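(* Let $\omega$ be a real number. If for every $\eta>0$ one can multiply $n$-by-$n$ matrices in $O(n^{\omega+\eta})$ arithmetic operations, then for every $\eta>0$ one can compute the QR decomposition of an $n$-by-$n$ matrix stably (and so solve linear systems and least squares problems stably) in $O(n^{\omega+\eta})$ arithmetic operations, without using extra precision.
   Context: Floating point arithmetic with machine epsilon $\varepsilon$ (a bound on the roundoff error) is used. "Stably" means normwise backward stably: the computed result is the exact (or, for orthogonal factors, exact up to a normwise error $O(\varepsilon)$) result for an input $\hat C$ with $\|\hat C-C\|=O(\varepsilon)\|C\|$, where $C$ is the actual input and $O(\varepsilon)$ may include a factor $n^c$ with $c$ a constant. For the QR decomposition of an $n$-by-$m$ matrix $A$ with $n\ge m$: there is an exactly orthogonal $Q$ that differs from the computed orthogonal factor by a matrix of norm $O(\varepsilon)$, such that $Q^T(A+\delta A)$ is exactly the computed upper triangular factor (padded with zero rows), with $\|\delta A\|=O(\varepsilon)\|A\|$. "Without extra precision" means that all operations are performed at machine precision $\varepsilon$. *)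

theory Defs
  imports Complex_Main "Jordan_Normal_Form.Matrix_Kernel"
begin

section \<open>Algorithms and their floating point execution\<close>

text \<open>
  An algorithm for inputs of one fixed format is an algebraic computation tree: arithmetic
  operations and square roots on real registers, branching on comparisons, and termination by
  listing the registers that hold the result.  Reading and writing registers is free, as usual when
  arithmetic operations are counted.
\<close>

datatype operation =
    Const real
  | Add nat nat
  | Sub nat nat
  | Mul nat nat
  | Div nat nat
  | Sqrt nat

datatype prog =
    Return "nat list"
  | Assign nat operation prog
  | IfLe nat nat prog prog

text \<open>The number of operations on the longest path; comparisons and constants count as operations.\<close>

primrec cost :: "prog \<Rightarrow> nat" where
  "cost (Return rs) = 0"
| "cost (Assign r f p) = Suc (cost p)"
| "cost (IfLe a b p q) = Suc (max (cost p) (cost q))"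

text \<open>\<open>None\<close> stands for an invalid operation, so division by zero is not the total division of HOL.\<close>

primrec exact_value :: "operation \<Rightarrow> (nat \<Rightarrow> real) \<Rightarrow> real option" where
  "exact_value (Const c) s = Some c"
| "exact_value (Add a b) s = Some (s a + s b)"
| "exact_value (Sub a b) s = Some (s a - s b)"
| "exact_value (Mul a b) s = Some (s a * s b)"
| "exact_value (Div a b) s = (if s b = 0 then None else Some (s a / s b))"
| "exact_value (Sqrt a) s = (if s a < 0 then None else Some (sqrt (s a)))"

text \<open>
  All outcomes that are possible in floating point arithmetic with machine epsilon \<open>\<epsilon>\<close>, where the
  computed value of every single operation is \<open>v * (1 + \<delta>)\<close> with \<open>v\<close> its exact value and
  \<open>\<bar>\<delta>\<bar> \<le> \<epsilon>\<close> arbitrary.  Real constants are subject to rounding as well; there is no overflow or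
  underflow.  For \<open>\<epsilon> = 0\<close> this is a singleton, the outcome in exact arithmetic.
\<close>

primrec outcomes :: "real \<Rightarrow> prog \<Rightarrow> (nat \<Rightarrow> real) \<Rightarrow> real list option set" where
  "outcomes \<epsilon> (Return rs) s = {Some (map s rs)}"
| "outcomes \<epsilon> (Assign r f p) s =
     (case exact_value f s of
        None \<Rightarrow> {None}
      | Some v \<Rightarrow> (\<Union>\<delta>\<in>{-\<epsilon>..\<epsilon>}. outcomes \<epsilon> p (s(r := v * (1 + \<delta>)))))"
| "outcomes \<epsilon> (IfLe a b p q) s = (if s a \<le> s b then outcomes \<epsilon> p s else outcomes \<epsilon> q s)"

definition load :: "real list \<Rightarrow> nat \<Rightarrow> real" where
  "load xs k = (if k < length xs then xs ! k else 0)"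

definition entries :: "real mat \<Rightarrow> real list" where
  "entries A = concat (mat_to_list A)"

definition multiplies :: "nat \<Rightarrow> prog \<Rightarrow> bool" where
  "multiplies n p \<longleftrightarrow>
     (\<forall>A\<in>carrier_mat n n. \<forall>B\<in>carrier_mat n n.
        outcomes 0 p (load (entries A @ entries B)) = {Some (entries (A * B))})"


section \<open>Normwise backward stability\<close>

text \<open>
  The Frobenius norm is within a factor \<open>n\<close> of the other usual matrix norms, which is immaterial
  for error bounds that are only specified up to a power of \<open>n\<close>.
\<close>

definition fnorm :: "real mat \<Rightarrow> real" where
  "fnorm A = sqrt (\<Sum>i<dim_row A. \<Sum>j<dim_col A. (A $$ (i, j))\<^sup>2)"

definition vnorm :: "real vec \<Rightarrow> real" where
  "vnorm v = sqrt (v \<bullet> v)"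

text \<open>\<open>orthogonal_mat\<close> of the library does not require columns of length one.\<close>

definition orthonormal_mat :: "real mat \<Rightarrow> bool" where
  "orthonormal_mat Q \<longleftrightarrow> square_mat Q \<and> transpose_mat Q * Q = 1\<^sub>m (dim_row Q)"

text \<open>
  In the following, \<open>\<beta>\<close> is the bound \<open>O(\<epsilon>)\<close> on the relative errors.
\<close>

definition stable_qr :: "nat \<Rightarrow> real \<Rightarrow> real \<Rightarrow> prog \<Rightarrow> bool" where
  "stable_qr n \<epsilon> \<beta> p \<longleftrightarrow>
     (\<forall>A\<in>carrier_mat n n. \<forall>res\<in>outcomes \<epsilon> p (load (entries A)).
        \<exists>Qc\<in>carrier_mat n n. \<exists>Rc\<in>carrier_mat n n.
          res = Some (entries Qc @ entries Rc) \<and> upper_triangular Rc \<and>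
          (\<exists>Q\<in>carrier_mat n n. \<exists>\<delta>A\<in>carrier_mat n n.
             orthonormal_mat Q \<and> fnorm (Qc - Q) \<le> \<beta> \<and>
             fnorm \<delta>A \<le> \<beta> * fnorm A \<and>
             transpose_mat Q * (A + \<delta>A) = Rc))"

text \<open>
  A result of a linear solver must always be the exact solution of a nearby system.  Such a solution
  need not exist if \<open>A\<close> is so close to a singular matrix that backward errors of the admitted
  size \<open>\<beta>\<close> can make it singular.  Only in that case may the algorithm break down; likewise for least
  squares problems and loss of full column rank.
\<close>

definition stable_solver :: "nat \<Rightarrow> real \<Rightarrow> real \<Rightarrow> prog \<Rightarrow> bool" where
  "stable_solver n \<epsilon> \<beta> p \<longleftrightarrow>
     (\<forall>A\<in>carrier_mat n n. \<forall>b\<in>carrier_vec n.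
        \<forall>res\<in>outcomes \<epsilon> p (load (entries A @ list_of_vec b)).
          (case res of
             None \<Rightarrow> (\<exists>E\<in>carrier_mat n n. fnorm E \<le> \<beta> * fnorm A \<and> \<not> invertible_mat (A + E))
           | Some xs \<Rightarrow>
               (\<exists>x\<in>carrier_vec n. xs = list_of_vec x \<and>
                 (\<exists>\<delta>A\<in>carrier_mat n n. \<exists>\<delta>b\<in>carrier_vec n.
                    fnorm \<delta>A \<le> \<beta> * fnorm A \<and> vnorm \<delta>b \<le> \<beta> * vnorm b \<and>
                    (A + \<delta>A) *\<^sub>v x = b + \<delta>b))))"

definition least_squares_solution :: "real mat \<Rightarrow> real vec \<Rightarrow> real vec \<Rightarrow> bool" where
  "least_squares_solution A b x \<longleftrightarrow>
     x \<in> carrier_vec (dim_col A) \<and>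
     (\<forall>y\<in>carrier_vec (dim_col A). vnorm (A *\<^sub>v x - b) \<le> vnorm (A *\<^sub>v y - b))"

definition full_column_rank :: "real mat \<Rightarrow> bool" where
  "full_column_rank A \<longleftrightarrow> mat_kernel A = {0\<^sub>v (dim_col A)}"

definition stable_least_squares :: "nat \<Rightarrow> nat \<Rightarrow> real \<Rightarrow> real \<Rightarrow> prog \<Rightarrow> bool" where
  "stable_least_squares n m \<epsilon> \<beta> p \<longleftrightarrow>
     (\<forall>A\<in>carrier_mat n m. \<forall>b\<in>carrier_vec n.
        \<forall>res\<in>outcomes \<epsilon> p (load (entries A @ list_of_vec b)).
          (case res of
             None \<Rightarrow> (\<exists>E\<in>carrier_mat n m. fnorm E \<le> \<beta> * fnorm A \<and> \<not> full_column_rank (A + E))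
           | Some xs \<Rightarrow>
               (\<exists>x\<in>carrier_vec m. xs = list_of_vec x \<and>
                 (\<exists>\<delta>A\<in>carrier_mat n m. \<exists>\<delta>b\<in>carrier_vec n.
                    fnorm \<delta>A \<le> \<beta> * fnorm A \<and> vnorm \<delta>b \<le> \<beta> * vnorm b \<and>
                    least_squares_solution (A + \<delta>A) (b + \<delta>b) x))))"

text \<open>
  The error bound \<open>O(\<epsilon>)\<close>, with a factor polynomial in \<open>n\<close>, is \<open>K * n ^ c * \<epsilon>\<close>; being an asymptotic
  statement for small \<open>\<epsilon>\<close>, it is required only where this quantity is at most one.  The algorithm
  itself does not depend on \<open>\<epsilon>\<close>.
\<close>

definition stable_for_small_eps ::
    "real \<Rightarrow> nat \<Rightarrow> nat \<Rightarrow> (real \<Rightarrow> real \<Rightarrow> prog \<Rightarrow> bool) \<Rightarrow> prog \<Rightarrow> bool" where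
  "stable_for_small_eps K c n S p \<longleftrightarrow>
     (\<forall>\<epsilon>>0. K * real n ^ c * \<epsilon> \<le> 1 \<longrightarrow> S \<epsilon> (K * real n ^ c * \<epsilon>) p)"

end

(*
  A program for n x n matrices with L operations computes, on an open set of inputs, along a single
  path, and there the second order Taylor terms of its results give a bilinear algorithm with at most
  2 L products (Strassen).  Hence the exponent is at least 2.  The algorithm for one large fixed n,
  applied recursively to blocks, is stable: each level of the recursion multiplies the error bound
  relative to the norms by a constant, whatever the coefficients are, so the bound is polynomial in n.

  The QR decomposition is computed by recursive halving as well.  To eliminate B in [R; B] with R
  upper triangular, four eliminations of half the size, whose explicitly formed orthogonal factors are
  applied to the other columns by fast multiplication, suffice; the base case is a Givens rotation.
  Each step is a small perturbation of a multiplication by an exactly orthogonal matrix, so the errors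
  only get multiplied by a constant per level again.

  Least squares problems follow by back substitution, which costs O(n^2) and is backward stable in
  the triangular matrix.  A zero on the diagonal shows that a nearby matrix is rank deficient.
*)

theory Submission
  imports Defs "HOL-Analysis.Convex" "HOL-Analysis.Function_Topology"
begin

section \<open>Finitely supported matrices\<close>

typedef fm = "{f :: nat \<Rightarrow> nat \<Rightarrow> real. \<exists>N. \<forall>i j. f i j \<noteq> 0 \<longrightarrow> i < N \<and> j < N}"
  morphisms entry Abs_fm
  by (rule exI[of _ "\<lambda>_ _. 0"]) simp

setup_lifting type_definition_fm

lemma fm_eqI: "(\<And>i j. entry A i j = entry B i j) \<Longrightarrow> A = B"
  by (simp add: entry_inject[symmetric] fun_eq_iff)

definition dims :: "nat \<Rightarrow> nat \<Rightarrow> fm \<Rightarrow> bool" where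
  "dims n m A \<longleftrightarrow> (\<forall>i j. entry A i j \<noteq> 0 \<longrightarrow> i < n \<and> j < m)"

lemma dims_exists: "\<exists>N. dims N N A"
  using entry[of A] by (auto simp: dims_def)

lemma dims_mono: "dims n m A \<Longrightarrow> n \<le> n' \<Longrightarrow> m \<le> m' \<Longrightarrow> dims n' m' A"
  by (force simp: dims_def)

lemma dims_exists_ge: "\<exists>N\<ge>k. dims N N A"
  using dims_exists dims_mono by (metis max.cobounded1 max.cobounded2)

lemma dims_entry0: "dims n m A \<Longrightarrow> n \<le> i \<or> m \<le> j \<Longrightarrow> entry A i j = 0"
  by (force simp: dims_def)

lemma dims_common: obtains N where "dims N N A" "dims N N B" "dims N N C"
proof -
  obtain a where a: "dims a a A" using dims_exists by blast
  obtain b where b: "b \<ge> a" "dims b b B" using dims_exists_ge by blast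
  obtain c where c: "c \<ge> b" "dims c c C" using dims_exists_ge by blast
  show thesis by (rule that[of c]) (use a b c dims_mono in \<open>meson order_trans\<close>)+
qed

definition mk :: "nat \<Rightarrow> nat \<Rightarrow> (nat \<times> nat \<Rightarrow> real) \<Rightarrow> fm" where
  "mk n m f = Abs_fm (\<lambda>i j. if i < n \<and> j < m then f (i, j) else 0)"

lemma entry_mk [simp]: "entry (mk n m f) i j = (if i < n \<and> j < m then f (i, j) else 0)"
proof -
  have "\<exists>N. \<forall>i j. (if i < n \<and> j < m then f (i, j) else 0) \<noteq> 0 \<longrightarrow> i < N \<and> j < N"
    by (rule exI[of _ "max n m"]) auto
  then show ?thesis unfolding mk_def by (subst Abs_fm_inverse) auto
qed

lemma dims_mk [simp]: "dims n m (mk n m f)"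
  by (simp add: dims_def)

lemma mk_cong: "(\<And>i j. i < n \<Longrightarrow> j < m \<Longrightarrow> f (i, j) = g (i, j)) \<Longrightarrow> mk n m f = mk n m g"
  by (rule fm_eqI) auto

instantiation fm :: "{minus, uminus, zero, plus, times}"
begin

lift_definition zero_fm :: fm is "\<lambda>_ _. 0" by simp

lift_definition plus_fm :: "fm \<Rightarrow> fm \<Rightarrow> fm" is "\<lambda>f g i j. f i j + g i j"
proof -
  fix f g :: "nat \<Rightarrow> nat \<Rightarrow> real"
  assume "\<exists>N. \<forall>i j. f i j \<noteq> 0 \<longrightarrow> i < N \<and> j < N" "\<exists>N. \<forall>i j. g i j \<noteq> 0 \<longrightarrow> i < N \<and> j < N"
  then obtain N M where NM: "\<forall>i j. f i j \<noteq> 0 \<longrightarrow> i < N \<and> j < N" "\<forall>i j. g i j \<noteq> 0 \<longrightarrow> i < M \<and> j < M"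
    by blast
  have "i < max N M \<and> j < max N M" if "f i j + g i j \<noteq> 0" for i j
  proof -
    from that have "f i j \<noteq> 0 \<or> g i j \<noteq> 0" by auto
    then show ?thesis using NM by (auto simp: less_max_iff_disj)
  qed
  then show "\<exists>N. \<forall>i j. f i j + g i j \<noteq> 0 \<longrightarrow> i < N \<and> j < N" by blast
qed

lift_definition uminus_fm :: "fm \<Rightarrow> fm" is "\<lambda>f i j. - f i j" by simp

definition "A - (B :: fm) = A + (- B)"

lift_definition times_fm :: "fm \<Rightarrow> fm \<Rightarrow> fm" is
  "\<lambda>f g i j. \<Sum>k | f i k \<noteq> 0. f i k * g k j"
proof -
  fix f g :: "nat \<Rightarrow> nat \<Rightarrow> real"
  assume "\<exists>N. \<forall>i j. f i j \<noteq> 0 \<longrightarrow> i < N \<and> j < N" "\<exists>N. \<forall>i j. g i j \<noteq> 0 \<longrightarrow> i < N \<and> j < N"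
  then obtain N M where N: "\<forall>i j. f i j \<noteq> 0 \<longrightarrow> i < N \<and> j < N"
    and M: "\<forall>i j. g i j \<noteq> 0 \<longrightarrow> i < M \<and> j < M" by blast
  have "i < max N M \<and> j < max N M" if "(\<Sum>k | f i k \<noteq> 0. f i k * g k j) \<noteq> 0" for i j
  proof -
    from that obtain k where "f i k * g k j \<noteq> 0" by (meson sum.neutral)
    then have "f i k \<noteq> 0" "g k j \<noteq> 0" by auto
    then have "i < N" "j < M" using N M by blast+
    then show ?thesis by (simp add: less_max_iff_disj)
  qed
  then show "\<exists>N. \<forall>i j. (\<Sum>k | f i k \<noteq> 0. f i k * g k j) \<noteq> 0 \<longrightarrow> i < N \<and> j < N" by blast
qed

instance ..

end

lemma entry_zero [simp]: "entry 0 i j = 0"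
  by transfer simp

lemma entry_add [simp]: "entry (A + B) i j = entry A i j + entry B i j"
  by transfer simp

lemma entry_uminus [simp]: "entry (- A) i j = - entry A i j"
  by transfer simp

lemma entry_diff [simp]: "entry (A - B) i j = entry A i j - entry B i j"
  by (simp add: minus_fm_def)

lemma entry_mult: "dims n m A \<Longrightarrow> entry (A * B) i j = (\<Sum>k<m. entry A i k * entry B k j)"
  unfolding times_fm.rep_eq
  by (rule sum.mono_neutral_left) (auto simp: dims_def)

lemma entry_mult': assumes "dims n m B" shows "entry (A * B) i j = (\<Sum>k<n. entry A i k * entry B k j)"
proof -
  obtain N where N: "N \<ge> n" "dims N N A" using dims_exists_ge by blast
  have "entry (A * B) i j = (\<Sum>k<N. entry A i k * entry B k j)" by (rule entry_mult[OF N(2)])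
  also have "\<dots> = (\<Sum>k<n. entry A i k * entry B k j)"
    by (rule sum.mono_neutral_right) (use N assms in \<open>auto simp: dims_entry0\<close>)
  finally show ?thesis .
qed

lemma dims_add: "dims n m A \<Longrightarrow> dims n m B \<Longrightarrow> dims n m (A + B)"
  unfolding dims_def by (metis add_0 entry_add)

lemma dims_diff: "dims n m A \<Longrightarrow> dims n m B \<Longrightarrow> dims n m (A - B)"
  unfolding dims_def by (metis diff_zero entry_diff)

lemma dims_mult: "dims n m A \<Longrightarrow> dims p q B \<Longrightarrow> dims n q (A * B)"
  unfolding dims_def by (metis (mono_tags, lifting) dims_def entry_mult mult_eq_0_iff sum.neutral)

instance fm :: ring
proof
  fix A B C :: fm
  show "A * B * C = A * (B * C)"
  proof (rule fm_eqI)
    fix i j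
    obtain N where N: "dims N N A" "dims N N B" by (rule dims_common)
    show "entry (A * B * C) i j = entry (A * (B * C)) i j"
      using N by (simp add: entry_mult[OF dims_mult[OF N]] entry_mult[OF N(1)] entry_mult[OF N(2)]
          sum_distrib_left sum_distrib_right mult.assoc) (rule sum.swap)
  qed
  show "(A + B) * C = A * C + B * C"
  proof (rule fm_eqI)
    fix i j
    obtain N where N: "dims N N A" "dims N N B" by (rule dims_common)
    show "entry ((A + B) * C) i j = entry (A * C + B * C) i j"
      by (simp add: entry_mult[OF dims_add[OF N]] entry_mult[OF N(1)] entry_mult[OF N(2)]
          distrib_right sum.distrib)
  qed
  show "A * (B + C) = A * B + A * C"
  proof (rule fm_eqI)
    fix i j
    obtain N where N: "dims N N A" by (rule dims_common)
    show "entry (A * (B + C)) i j = entry (A * B + A * C) i j"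
      by (simp add: entry_mult[OF N(1)] distrib_left sum.distrib)
  qed
qed (auto intro!: fm_eqI simp: minus_fm_def)

instantiation fm :: real_vector
begin

lift_definition scaleR_fm :: "real \<Rightarrow> fm \<Rightarrow> fm" is "\<lambda>c f i j. c * f i j"
  by (metis mult_zero_right)

lemma entry_scaleR [simp]: "entry (c *\<^sub>R A) i j = c * entry A i j"
  by transfer simp

instance
  by standard (auto intro!: fm_eqI simp: algebra_simps)

end

instantiation fm :: real_inner
begin

definition inner_fm :: "fm \<Rightarrow> fm \<Rightarrow> real" where
  "inner_fm A B = (\<Sum>(i, j) | entry A i j \<noteq> 0. entry A i j * entry B i j)"

definition norm_fm :: "fm \<Rightarrow> real" where "norm_fm A = sqrt (inner A A)"

definition sgn_fm :: "fm \<Rightarrow> fm" where "sgn_fm A = A /\<^sub>R norm A"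

definition dist_fm :: "fm \<Rightarrow> fm \<Rightarrow> real" where "dist_fm A B = norm (A - B)"

definition uniformity_fm :: "(fm \<times> fm) filter" where
  "uniformity_fm = (INF e\<in>{0 <..}. principal {(x, y). dist x y < e})"

definition open_fm :: "fm set \<Rightarrow> bool" where
  "open_fm U \<longleftrightarrow> (\<forall>x\<in>U. eventually (\<lambda>(x', y). x' = x \<longrightarrow> y \<in> U) uniformity)"

lemma inner_fm: assumes "dims n m A" shows "inner A B = (\<Sum>i<n. \<Sum>j<m. entry A i j * entry B i j)"
  unfolding inner_fm_def sum.cartesian_product
  by (rule sum.mono_neutral_left) (use assms in \<open>auto simp: dims_def\<close>)

instance
proof
  fix A B C :: fm and c d :: real
  obtain N where N: "dims N N A" "dims N N B" "dims N N C" by (rule dims_common)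
  have cA: "dims N N (c *\<^sub>R A)" using N(1) by (auto simp: dims_def)
  show "inner A B = inner B A" by (simp add: inner_fm[OF N(1)] inner_fm[OF N(2)] mult.commute)
  show "inner (A + B) C = inner A C + inner B C"
    by (simp add: inner_fm[OF dims_add[OF N(1,2)]] inner_fm[OF N(1)] inner_fm[OF N(2)]
        sum.distrib distrib_right)
  show "inner (c *\<^sub>R A) B = c * inner A B"
    by (simp add: inner_fm[OF cA] inner_fm[OF N(1)] sum_distrib_left mult.assoc)
  show "0 \<le> inner A A" by (auto simp: inner_fm[OF N(1)] intro!: sum_nonneg)
  show "(inner A A = 0) = (A = 0)"
  proof
    assume "inner A A = 0"
    then have "entry A i j * entry A i j = 0" if "i < N" "j < N" for i j
      using that by (simp add: inner_fm[OF N(1)] sum_nonneg_eq_0_iff sum_nonneg)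
    then show "A = 0"
      by (intro fm_eqI) (metis N(1) dims_entry0 entry_zero mult_eq_0_iff not_less)
  qed (simp add: inner_fm_def)
qed (auto intro!: fm_eqI simp: algebra_simps norm_fm_def sgn_fm_def dist_fm_def uniformity_fm_def open_fm_def)

end

lemma norm_fm_sq: "dims n m A \<Longrightarrow> (norm A)\<^sup>2 = (\<Sum>i<n. \<Sum>j<m. (entry A i j)\<^sup>2)"
  by (simp add: norm_fm_def inner_fm sum_nonneg power2_eq_square)

instance fm :: real_normed_algebra
proof
  fix A B :: fm and c :: real
  obtain N where N: "dims N N A" "dims N N B" by (rule dims_common)
  have cA: "dims N N (c *\<^sub>R A)" using N(1) unfolding dims_def by auto
  show "c *\<^sub>R A * B = c *\<^sub>R (A * B)"
    by (rule fm_eqI) (simp add: entry_mult[OF cA] entry_mult[OF N(1)] sum_distrib_left mult.assoc)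
  show "A * c *\<^sub>R B = c *\<^sub>R (A * B)"
    by (rule fm_eqI) (simp add: entry_mult[OF N(1)] sum_distrib_left mult.left_commute)
  have "(norm (A * B))\<^sup>2 = (\<Sum>i<N. \<Sum>j<N. (\<Sum>k<N. entry A i k * entry B k j)\<^sup>2)"
    by (simp add: norm_fm_sq[OF dims_mult[OF N]] entry_mult[OF N(1)])
  also have "\<dots> \<le> (\<Sum>i<N. \<Sum>j<N. (\<Sum>k<N. (entry A i k)\<^sup>2) * (\<Sum>k<N. (entry B k j)\<^sup>2))"
    by (intro sum_mono Cauchy_Schwarz_ineq_sum)
  also have "\<dots> = (\<Sum>i<N. \<Sum>k<N. (entry A i k)\<^sup>2) * (\<Sum>j<N. \<Sum>k<N. (entry B k j)\<^sup>2)"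
    by (simp add: sum_product)
  also have "(\<Sum>j<N. \<Sum>k<N. (entry B k j)\<^sup>2) = (norm B)\<^sup>2"
    unfolding norm_fm_sq[OF N(2)] by (rule sum.swap)
  also have "(\<Sum>i<N. \<Sum>k<N. (entry A i k)\<^sup>2) = (norm A)\<^sup>2"
    unfolding norm_fm_sq[OF N(1)] ..
  finally show "norm (A * B) \<le> norm A * norm B"
    by (metis norm_ge_zero mult_nonneg_nonneg power2_le_imp_le power_mult_distrib)
qed


lift_definition tp :: "fm \<Rightarrow> fm" is "\<lambda>f i j. f j i"
  by blast

lemma entry_tp [simp]: "entry (tp A) i j = entry A j i"
  by transfer simp

lemma dims_tp: "dims n m A \<Longrightarrow> dims m n (tp A)"
  by (auto simp: dims_def)

lemma tp_tp [simp]: "tp (tp A) = A"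
  by (rule fm_eqI) simp

lemma tp_add: "tp (A + B) = tp A + tp B" and tp_diff: "tp (A - B) = tp A - tp B"
  by (rule fm_eqI; simp)+

lemma tp_mult: "tp (A * B) = tp B * tp A"
proof (rule fm_eqI)
  fix i j
  obtain N where N: "dims N N A" "dims N N B" by (rule dims_common)
  show "entry (tp (A * B)) i j = entry (tp B * tp A) i j"
    by (simp add: entry_mult[OF N(1)] entry_mult[OF dims_tp[OF N(2)]] mult.commute)
qed

lemma inner_tp: "inner (tp A) (tp B) = inner A (B :: fm)"
proof -
  obtain N where N: "dims N N A" by (rule dims_common)
  show ?thesis unfolding inner_fm[OF N] inner_fm[OF dims_tp[OF N]] entry_tp by (rule sum.swap)
qed

lemma norm_tp [simp]: "norm (tp A) = norm (A :: fm)"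
  by (simp add: norm_fm_def inner_tp)

lemma inner_mult_left: "inner (A * B) C = inner B (tp A * C)" for A B C :: fm
proof -
  obtain N where N: "dims N N A" "dims N N B" "dims N N C" by (rule dims_common)
  have "inner (A * B) C = (\<Sum>i<N. \<Sum>j<N. \<Sum>k<N. entry A i k * entry B k j * entry C i j)"
    by (simp add: inner_fm[OF dims_mult[OF N(1,2)]] entry_mult[OF N(1)] sum_distrib_right)
  also have "\<dots> = (\<Sum>k<N. \<Sum>j<N. \<Sum>i<N. entry A i k * entry B k j * entry C i j)"
    by (subst sum.swap, subst (2) sum.swap, subst sum.swap) simp
  also have "\<dots> = inner B (tp A * C)"
    by (simp add: inner_fm[OF N(2)] entry_mult[OF dims_tp[OF N(1)]] sum_distrib_left ac_simps)
  finally show ?thesis .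
qed

definition idm :: "nat \<Rightarrow> fm" where "idm n = mk n n (\<lambda>(i, j). if i = j then 1 else 0)"

lemma entry_idm [simp]: "entry (idm n) i j = (if i = j \<and> i < n then 1 else 0)"
  by (auto simp: idm_def)

lemma dims_idm [simp]: "dims n n (idm n)"
  by (simp add: idm_def)

lemma tp_idm [simp]: "tp (idm n) = idm n"
  by (rule fm_eqI) auto

lemma entry_idm_mult: "entry (idm n * A) i j = (if i < n then entry A i j else 0)"
  by (auto simp: entry_mult[OF dims_idm] if_distrib[of "\<lambda>x. x * _"] cong: if_cong)

lemma entry_mult_idm: "entry (A * idm n) i j = (if j < n then entry A i j else 0)"
  by (auto simp: entry_mult'[OF dims_idm] if_distrib[of "(*) _"] cong: if_cong)

lemma idm_mult: "dims n m A \<Longrightarrow> idm n * A = A"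
  by (rule fm_eqI) (auto simp: entry_idm_mult dims_entry0)

lemma mult_idm: "dims n m A \<Longrightarrow> A * idm m = A"
  by (rule fm_eqI) (auto simp: entry_mult_idm dims_entry0)

lemma norm_le_entries:
  assumes "\<And>i j. \<bar>entry A i j\<bar> \<le> \<bar>entry B i j\<bar>"
  shows "norm A \<le> norm B"
proof -
  obtain N where N: "dims N N A" "dims N N B" by (rule dims_common)
  have "(norm A)\<^sup>2 \<le> (norm B)\<^sup>2"
    unfolding norm_fm_sq[OF N(1)] norm_fm_sq[OF N(2)]
    by (intro sum_mono) (use assms in \<open>simp add: abs_le_square_iff\<close>)
  then show ?thesis by (rule power2_le_imp_le) simp
qed

lift_definition absm :: "fm \<Rightarrow> fm" is "\<lambda>f i j. \<bar>f i j\<bar>"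
  by simp

lemma entry_absm [simp]: "entry (absm A) i j = \<bar>entry A i j\<bar>"
  by transfer simp

lemma entry_sum [simp]: "entry (sum f S) i j = (\<Sum>t\<in>S. entry (f t) i j)"
  by (induction S rule: infinite_finite_induct) auto

lemma norm_le_sum_entries:
  assumes "\<And>i j. \<bar>entry A i j\<bar> \<le> (\<Sum>t\<in>S. \<bar>entry (f t) i j\<bar>)"
  shows "norm A \<le> (\<Sum>t\<in>S. norm (f t))"
proof -
  have "norm A \<le> norm (\<Sum>t\<in>S. absm (f t))"
    by (rule norm_le_entries) (use assms in \<open>simp add: sum_nonneg\<close>)
  also have "\<dots> \<le> (\<Sum>t\<in>S. norm (absm (f t)))" by (rule norm_sum)
  also have "\<dots> \<le> (\<Sum>t\<in>S. norm (f t))" by (intro sum_mono norm_le_entries) simp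
  finally show ?thesis .
qed

lemma norm_le_card_entries:
  assumes "dims n m A" "\<And>i j. i < n \<Longrightarrow> j < m \<Longrightarrow> \<bar>entry A i j\<bar> \<le> c"
  shows "norm A \<le> real (n * m) * c"
proof -
  let ?e = "\<lambda>(a, b). mk n m (\<lambda>p. if p = (a, b) then c else 0)"
  have e: "norm (?e p) \<le> c" if mem: "p \<in> {..<n} \<times> {..<m}" for p
  proof -
    obtain a b where p: "p = (a, b)" "a < n" "b < m" using mem by blast
    then have "0 \<le> c" using assms(2)[of a b] by linarith
    have "(norm (?e p))\<^sup>2 = (\<Sum>i<n. \<Sum>j<m. if (i, j) = (a, b) then c\<^sup>2 else 0)"
      unfolding p by (simp add: norm_fm_sq[OF dims_mk] if_distrib[of "\<lambda>x. x\<^sup>2"] cong: if_cong)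
    also have "\<dots> = (\<Sum>q\<in>{..<n} \<times> {..<m}. if q = (a, b) then c\<^sup>2 else 0)"
      unfolding sum.cartesian_product by (rule sum.cong) (auto split: if_splits)
    also have "\<dots> = c\<^sup>2" using p by simp
    finally have "(norm (?e p))\<^sup>2 \<le> c\<^sup>2" by simp
    then show ?thesis by (rule power2_le_imp_le) fact
  qed
  have "norm A \<le> (\<Sum>p\<in>{..<n} \<times> {..<m}. norm (?e p))"
  proof (rule norm_le_sum_entries)
    fix i j
    show "\<bar>entry A i j\<bar> \<le> (\<Sum>p\<in>{..<n} \<times> {..<m}. \<bar>entry (?e p) i j\<bar>)"
    proof (cases "i < n \<and> j < m")
      case True
      then have "\<bar>entry A i j\<bar> \<le> \<bar>entry (?e (i, j)) i j\<bar>" using assms(2)[of i j] by simp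
      also have "\<dots> \<le> (\<Sum>p\<in>{..<n} \<times> {..<m}. \<bar>entry (?e p) i j\<bar>)"
        by (rule member_le_sum) (use True in auto)
      finally show ?thesis .
    next
      case False
      then have "entry A i j = 0" using assms(1) by (auto simp: dims_def)
      then show ?thesis by (simp add: sum_nonneg)
    qed
  qed
  also have "\<dots> \<le> (\<Sum>p\<in>{..<n} \<times> {..<m}. c)" by (rule sum_mono) (rule e)
  finally show ?thesis by simp
qed

definition orth :: "nat \<Rightarrow> fm \<Rightarrow> bool" where
  "orth n Q \<longleftrightarrow> dims n n Q \<and> tp Q * Q = idm n \<and> Q * tp Q = idm n"

lemma orth_idm: "orth n (idm n)"
  by (simp add: orth_def idm_mult[OF dims_idm])

lemma orth_tp: "orth n Q \<Longrightarrow> orth n (tp Q)"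
  by (auto simp: orth_def dims_tp)

lemma orth_mult:
  assumes "orth n P" "orth n Q" shows "orth n (P * Q)"
proof -
  have d: "dims n n P" "dims n n Q" using assms by (auto simp: orth_def)
  have "tp (P * Q) * (P * Q) = tp Q * ((tp P * P) * Q)" "P * Q * tp (P * Q) = P * ((Q * tp Q) * tp P)"
    by (simp_all only: tp_mult mult.assoc)
  then show ?thesis using assms
    by (auto simp: orth_def idm_mult[OF d(2)] idm_mult[OF dims_tp[OF d(1)]] intro: dims_mult)
qed

lemma norm_isometry:
  assumes "tp J * J = idm p" "dims p m X"
  shows "norm (J * X) = norm X"
proof -
  have "inner (J * X) (J * X) = inner X X"
    by (simp add: inner_mult_left mult.assoc[symmetric] assms idm_mult[OF assms(2)])
  then show ?thesis by (simp add: norm_fm_def)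
qed

lemma norm_orth_mult: "orth n Q \<Longrightarrow> dims n m X \<Longrightarrow> norm (Q * X) = norm X"
  by (rule norm_isometry) (auto simp: orth_def)

lemma norm_mult_orth:
  assumes "orth n Q" "dims m n X" shows "norm (X * Q) = norm X"
  using norm_orth_mult[OF orth_tp[OF assms(1)] dims_tp[OF assms(2)]] norm_tp tp_mult by metis

lemma norm_idm_le: "norm (idm n) \<le> real n"
proof -
  have "(norm (idm n))\<^sup>2 = (\<Sum>i<n. \<Sum>j<n. if j = i then 1 else 0)"
    unfolding norm_fm_sq[OF dims_idm] by (intro sum.cong) auto
  also have "\<dots> = real n" by simp
  also have "\<dots> \<le> (real n)\<^sup>2" by (cases n) (auto simp: power2_eq_square)
  finally show ?thesis by (rule power2_le_imp_le) simp
qed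

lemma norm_orth_le: "orth n Q \<Longrightarrow> norm Q \<le> real n"
  using norm_orth_mult[of n Q n "idm n"] norm_idm_le[of n] mult_idm[of n n Q] by (simp add: orth_def)

text \<open>
  \<open>Y\<close> is the result of transforming \<open>X\<close> backward stably by an orthogonal matrix, with computed factor \<open>Qh\<close>;
  the backward error is \<open>Q * Y - X\<close>.
\<close>

definition good :: "nat \<Rightarrow> real \<Rightarrow> fm \<Rightarrow> fm \<Rightarrow> fm \<Rightarrow> bool" where
  "good n \<delta> Qh X Y \<longleftrightarrow> (\<exists>Q. orth n Q \<and> norm (Qh - Q) \<le> \<delta> \<and> norm (X - Q * Y) \<le> \<delta> * norm X)"

lemma good_mono: "good n \<delta> Qh X Y \<Longrightarrow> \<delta> \<le> \<delta>' \<Longrightarrow> good n \<delta>' Qh X Y"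
  unfolding good_def by (meson mult_right_mono norm_ge_zero order_trans)

lemma good_norm_Qh: "good n \<delta> Qh X Y \<Longrightarrow> norm Qh \<le> real n + \<delta>"
  unfolding good_def using norm_orth_le norm_triangle_sub[of Qh] by (smt (verit))

lemma good_norm:
  assumes "good n \<delta> Qh X Y" "dims n m Y" shows "norm Y \<le> (1 + \<delta>) * norm X"
proof -
  obtain Q where Q: "orth n Q" "norm (X - Q * Y) \<le> \<delta> * norm X" using assms(1) by (auto simp: good_def)
  have "norm Y = norm (Q * Y)" using norm_orth_mult[OF Q(1) assms(2)] by simp
  also have "\<dots> \<le> norm X + norm (X - Q * Y)" using norm_triangle_sub[of "Q * Y" X] by (simp add: norm_minus_commute)
  finally show ?thesis using Q(2) by (simp add: algebra_simps)
qed

lemma good_trans: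
  assumes g1: "good n \<delta> Q1 X Y" and g2: "good n e Q2 Y Z"
    and d: "dims n n Q1" "dims n n Q2" "dims n m X" "dims n m Y" "dims n m Z"
    and Q: "norm (Qh - Q1 * Q2) \<le> e" and le: "0 \<le> \<delta>" "0 \<le> e" "\<delta> \<le> 1" "e \<le> 1"
  shows "good n (2 * \<delta> + 2 * e) Qh X Z"
proof -
  obtain P1 where P1: "orth n P1" "norm (Q1 - P1) \<le> \<delta>" "norm (X - P1 * Y) \<le> \<delta> * norm X"
    using g1 by (auto simp: good_def)
  obtain P2 where P2: "orth n P2" "norm (Q2 - P2) \<le> e" "norm (Y - P2 * Z) \<le> e * norm Y"
    using g2 by (auto simp: good_def)
  have dP: "dims n n P1" "dims n n P2" using P1 P2 by (auto simp: orth_def)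
  have "Qh - P1 * P2 = (Qh - Q1 * Q2) + ((Q1 - P1) * P2 + (Q1 - P1) * (Q2 - P2) + P1 * (Q2 - P2))"
    by (simp add: algebra_simps)
  then have "norm (Qh - P1 * P2) \<le> norm (Qh - Q1 * Q2)
      + (norm ((Q1 - P1) * P2) + norm ((Q1 - P1) * (Q2 - P2)) + norm (P1 * (Q2 - P2)))"
    by (metis add_mono norm_triangle_le norm_triangle_mono order_refl)
  also have "norm ((Q1 - P1) * P2) = norm (Q1 - P1)"
    by (rule norm_mult_orth[OF P2(1)]) (rule dims_diff[OF d(1) dP(1)])
  also have "norm (P1 * (Q2 - P2)) = norm (Q2 - P2)"
    by (rule norm_orth_mult[OF P1(1)]) (rule dims_diff[OF d(2) dP(2)])
  also have "norm ((Q1 - P1) * (Q2 - P2)) \<le> norm (Q1 - P1) * norm (Q2 - P2)"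
    by (rule norm_mult_ineq)
  also have "\<dots> \<le> \<delta> * 1"
    by (rule mult_mono) (use P1(2) P2(2) le in auto)
  finally have 1: "norm (Qh - P1 * P2) \<le> 2 * \<delta> + 2 * e" using P1 P2 Q by simp
  have "X - P1 * P2 * Z = (X - P1 * Y) + P1 * (Y - P2 * Z)" by (simp add: algebra_simps)
  then have "norm (X - P1 * P2 * Z) \<le> norm (X - P1 * Y) + norm (P1 * (Y - P2 * Z))"
    by (metis norm_triangle_ineq)
  also have "norm (P1 * (Y - P2 * Z)) = norm (Y - P2 * Z)"
    by (rule norm_orth_mult[OF P1(1)]) (rule dims_diff[OF d(4) dims_mult[OF dP(2) d(5)]])
  also have "norm (Y - P2 * Z) \<le> e * ((1 + \<delta>) * norm X)"
    using P2(3) good_norm[OF g1 d(4)] le(2) by (meson mult_left_mono order_trans)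
  also have "\<dots> \<le> 2 * e * norm X"
    using mult_right_mono[of "1 + \<delta>" 2 "e * norm X"] le by (simp add: algebra_simps)
  finally have "norm (X - P1 * P2 * Z) \<le> \<delta> * norm X + 2 * e * norm X" using P1(3) by simp
  also have "\<dots> \<le> (2 * \<delta> + 2 * e) * norm X" using le by (simp add: algebra_simps)
  finally show ?thesis using 1 orth_mult[OF P1(1) P2(1)] unfolding good_def by blast
qed

section \<open>Rounding-error specifications of programs\<close>

datatype cmd = Skip | Op nat operation | Seq cmd cmd | Cond nat nat cmd cmd

primrec compile :: "cmd \<Rightarrow> prog \<Rightarrow> prog" where
  "compile Skip p = p"
| "compile (Op r f) p = Assign r f p"
| "compile (Seq c d) p = compile c (compile d p)"
| "compile (Cond a b c d) p = IfLe a b (compile c p) (compile d p)"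

primrec ccost :: "cmd \<Rightarrow> nat" where
  "ccost Skip = 0"
| "ccost (Op r f) = 1"
| "ccost (Seq c d) = ccost c + ccost d"
| "ccost (Cond a b c d) = Suc (max (ccost c) (ccost d))"

primrec wp :: "real \<Rightarrow> cmd \<Rightarrow> ((nat \<Rightarrow> real) \<Rightarrow> bool) \<Rightarrow> (nat \<Rightarrow> real) \<Rightarrow> bool" where
  "wp \<epsilon> Skip Q s = Q s"
| "wp \<epsilon> (Op r f) Q s = (case exact_value f s of None \<Rightarrow> False
     | Some v \<Rightarrow> \<forall>\<delta>. \<bar>\<delta>\<bar> \<le> \<epsilon> \<longrightarrow> Q (s(r := v * (1 + \<delta>))))"
| "wp \<epsilon> (Seq c d) Q s = wp \<epsilon> c (wp \<epsilon> d Q) s"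
| "wp \<epsilon> (Cond a b c d) Q s = (if s a \<le> s b then wp \<epsilon> c Q s else wp \<epsilon> d Q s)"

lemma cost_compile: "cost (compile c p) \<le> ccost c + cost p"
proof (induction c arbitrary: p)
  case (Seq c d)
  show ?case using Seq(1)[of "compile d p"] Seq(2)[of p] by simp
next
  case (Cond a b c d)
  then show ?case by (simp add: le_max_iff_disj max_def) (meson add_le_mono1 nat_le_linear order_trans)
qed auto

lemma wp_mono: "wp \<epsilon> c Q s \<Longrightarrow> (\<And>s'. Q s' \<Longrightarrow> Q' s') \<Longrightarrow> wp \<epsilon> c Q' s"
proof (induction c arbitrary: Q Q' s)
  case (Seq c d)
  show ?case using Seq(3) by (auto intro: Seq(1) Seq(2) Seq(4))
next
  case (Cond a b c d)
  show ?case using Cond(3) by (auto intro: Cond(1) Cond(2) Cond(4) split: if_splits)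
qed (auto split: option.splits)

lemma outcomes_compile:
  assumes "wp \<epsilon> c (\<lambda>s'. \<forall>res\<in>outcomes \<epsilon> p s'. R res) s" "res \<in> outcomes \<epsilon> (compile c p) s"
  shows "R res"
  using assms
proof (induction c arbitrary: p s res)
  case (Op r f)
  from Op.prems(1) obtain v where v: "exact_value f s = Some v" by (cases "exact_value f s") simp_all
  then obtain \<delta> where d: "\<delta> \<in> {-\<epsilon>..\<epsilon>}" "res \<in> outcomes \<epsilon> p (s(r := v * (1 + \<delta>)))"
    using Op.prems(2) by (auto simp only: compile.simps outcomes.simps option.case UN_iff)
  have "\<bar>\<delta>\<bar> \<le> \<epsilon>" using d(1) unfolding atLeastAtMost_iff by linarith
  then have "\<forall>res\<in>outcomes \<epsilon> p (s(r := v * (1 + \<delta>))). R res"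
    using Op.prems(1) v by (simp only: wp.simps option.case) blast
  then show ?case using d(2) by (rule bspec)
next
  case (Seq c d)
  show ?case
  proof (rule Seq.IH(1))
    show "res \<in> outcomes \<epsilon> (compile c (compile d p)) s" using Seq.prems(2) by (simp only: compile.simps)
    show "wp \<epsilon> c (\<lambda>s'. \<forall>res\<in>outcomes \<epsilon> (compile d p) s'. R res) s"
    proof (rule wp_mono[OF Seq.prems(1)[unfolded wp.simps]], rule ballI)
      fix s' res
      assume "wp \<epsilon> d (\<lambda>s'. \<forall>res\<in>outcomes \<epsilon> p s'. R res) s'" "res \<in> outcomes \<epsilon> (compile d p) s'"
      then show "R res" by (rule Seq.IH(2))
    qed
  qed
next
  case (Cond a b c d)
  show ?case
  proof (cases "s a \<le> s b")
    case True
    show ?thesis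
      by (rule Cond.IH(1)[of p s]) (use Cond.prems True in \<open>simp_all only: wp.simps compile.simps outcomes.simps if_True\<close>)
  next
    case False
    show ?thesis
      by (rule Cond.IH(2)[of p s]) (use Cond.prems False in \<open>simp_all only: wp.simps compile.simps outcomes.simps if_False\<close>)
  qed
qed simp

text \<open>
  Inputs and outputs are families of registers over arbitrary index types, and the relation \<open>R\<close>
  specifies the computed values.  Registers are written only once, so inputs stay available.
  The restriction to \<open>\<epsilon> \<le> 1/2\<close> ensures that only zero is rounded to zero.
\<close>

definition computable :: "real \<Rightarrow> (real \<Rightarrow> ('i \<Rightarrow> real) \<Rightarrow> ('o \<Rightarrow> real) \<Rightarrow> bool) \<Rightarrow> bool" where
  "computable C R \<longleftrightarrow> (\<forall>k (X :: 'i \<Rightarrow> nat). (\<forall>i. X i < k) \<longrightarrow>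
     (\<exists>c (Z :: 'o \<Rightarrow> nat) k'. real (ccost c) \<le> C \<and> k \<le> k' \<and> (\<forall>j. Z j < k') \<and>
        (\<forall>\<epsilon> s. 0 \<le> \<epsilon> \<longrightarrow> \<epsilon> \<le> 1 / 2 \<longrightarrow>
           wp \<epsilon> c (\<lambda>s'. (\<forall>r<k. s' r = s r) \<and> R \<epsilon> (\<lambda>i. s (X i)) (\<lambda>j. s' (Z j))) s)))"

lemma computableI:
  assumes "\<And>k X. (\<And>i. X i < k) \<Longrightarrow>
    \<exists>c Z k'. real (ccost c) \<le> C \<and> k \<le> k' \<and> (\<forall>j. Z j < k') \<and>
        (\<forall>\<epsilon> s. 0 \<le> \<epsilon> \<longrightarrow> \<epsilon> \<le> 1 / 2 \<longrightarrow>
           wp \<epsilon> c (\<lambda>s'. (\<forall>r<k. s' r = s r) \<and> R \<epsilon> (\<lambda>i. s (X i)) (\<lambda>j. s' (Z j))) s)"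
  shows "computable C R"
  using assms unfolding computable_def by blast

lemma computableE:
  assumes "computable C R" "\<And>i. X i < k"
  obtains c Z k' where "real (ccost c) \<le> C" "k \<le> k'" "\<And>j. Z j < k'"
    "\<And>\<epsilon> s. 0 \<le> \<epsilon> \<Longrightarrow> \<epsilon> \<le> 1 / 2 \<Longrightarrow>
       wp \<epsilon> c (\<lambda>s'. (\<forall>r<k. s' r = s r) \<and> R \<epsilon> (\<lambda>i. s (X i)) (\<lambda>j. s' (Z j))) s"
proof -
  have "\<exists>c (Z :: 'b \<Rightarrow> nat) k'. real (ccost c) \<le> C \<and> k \<le> k' \<and> (\<forall>j. Z j < k') \<and>
        (\<forall>\<epsilon> s. 0 \<le> \<epsilon> \<longrightarrow> \<epsilon> \<le> 1 / 2 \<longrightarrow>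
           wp \<epsilon> c (\<lambda>s'. (\<forall>r<k. s' r = s r) \<and> R \<epsilon> (\<lambda>i. s (X i)) (\<lambda>j. s' (Z j))) s)"
    by (rule assms(1)[unfolded computable_def, rule_format]) (rule assms(2))
  then obtain c and Z :: "'b \<Rightarrow> nat" and k' where "real (ccost c) \<le> C" "k \<le> k'" "\<forall>j. Z j < k'"
    "\<forall>\<epsilon> s. 0 \<le> \<epsilon> \<longrightarrow> \<epsilon> \<le> 1 / 2 \<longrightarrow>
           wp \<epsilon> c (\<lambda>s'. (\<forall>r<k. s' r = s r) \<and> R \<epsilon> (\<lambda>i. s (X i)) (\<lambda>j. s' (Z j))) s"
    by (elim exE conjE)
  then show thesis by (intro that[of c k' Z]) simp_all
qed

lemma computable_mono:
  assumes "computable C R" "C \<le> C'"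
    and "\<And>\<epsilon> x z. 0 \<le> \<epsilon> \<Longrightarrow> \<epsilon> \<le> 1 / 2 \<Longrightarrow> R \<epsilon> x z \<Longrightarrow> R' \<epsilon> x z"
  shows "computable C' R'"
proof (rule computableI)
  fix k and X :: "'a \<Rightarrow> nat" assume X: "\<And>i. X i < k"
  obtain c Z k' where c: "real (ccost c) \<le> C" "k \<le> k'" "\<And>j. Z j < k'"
    "\<And>\<epsilon> s. 0 \<le> \<epsilon> \<Longrightarrow> \<epsilon> \<le> 1 / 2 \<Longrightarrow>
       wp \<epsilon> c (\<lambda>s'. (\<forall>r<k. s' r = s r) \<and> R \<epsilon> (\<lambda>i. s (X i)) (\<lambda>j. s' (Z j))) s"
    by (rule computableE[OF assms(1) X]) (rule that)
  show "\<exists>c Z k'. real (ccost c) \<le> C' \<and> k \<le> k' \<and> (\<forall>j. Z j < k') \<and>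
        (\<forall>\<epsilon> s. 0 \<le> \<epsilon> \<longrightarrow> \<epsilon> \<le> 1 / 2 \<longrightarrow>
           wp \<epsilon> c (\<lambda>s'. (\<forall>r<k. s' r = s r) \<and> R' \<epsilon> (\<lambda>i. s (X i)) (\<lambda>j. s' (Z j))) s)"
  proof (intro exI conjI allI impI)
    show "real (ccost c) \<le> C'" using c(1) assms(2) by simp
    show "k \<le> k'" "Z j < k'" for j by fact+
    fix \<epsilon> :: real and s assume e: "0 \<le> \<epsilon>" "\<epsilon> \<le> 1 / 2"
    show "wp \<epsilon> c (\<lambda>s'. (\<forall>r<k. s' r = s r) \<and> R' \<epsilon> (\<lambda>i. s (X i)) (\<lambda>j. s' (Z j))) s"
      by (rule wp_mono[OF c(4)[OF e]]) (blast intro: assms(3)[OF e])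
  qed
qed

lemma computable_seq:
  assumes "computable C R" "computable D S"
  shows "computable (C + D) (\<lambda>\<epsilon> x z. \<exists>y. R \<epsilon> x y \<and> S \<epsilon> y z)"
proof (rule computableI)
  fix k and X :: "'a \<Rightarrow> nat" assume X: "\<And>i. X i < k"
  obtain c Y k' where c: "real (ccost c) \<le> C" "k \<le> k'" "\<And>j. Y j < k'"
    "\<And>\<epsilon> s. 0 \<le> \<epsilon> \<Longrightarrow> \<epsilon> \<le> 1 / 2 \<Longrightarrow>
       wp \<epsilon> c (\<lambda>s'. (\<forall>r<k. s' r = s r) \<and> R \<epsilon> (\<lambda>i. s (X i)) (\<lambda>j. s' (Y j))) s"
    by (rule computableE[OF assms(1) X]) (rule that)
  obtain d Z k'' where d: "real (ccost d) \<le> D" "k' \<le> k''" "\<And>j. Z j < k''"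
    "\<And>\<epsilon> s. 0 \<le> \<epsilon> \<Longrightarrow> \<epsilon> \<le> 1 / 2 \<Longrightarrow>
       wp \<epsilon> d (\<lambda>s'. (\<forall>r<k'. s' r = s r) \<and> S \<epsilon> (\<lambda>i. s (Y i)) (\<lambda>j. s' (Z j))) s"
    by (rule computableE[OF assms(2) c(3)]) (rule that)
  show "\<exists>c Z k'. real (ccost c) \<le> C + D \<and> k \<le> k' \<and> (\<forall>j. Z j < k') \<and>
        (\<forall>\<epsilon> s. 0 \<le> \<epsilon> \<longrightarrow> \<epsilon> \<le> 1 / 2 \<longrightarrow>
           wp \<epsilon> c (\<lambda>s'. (\<forall>r<k. s' r = s r) \<and>
             (\<exists>y. R \<epsilon> (\<lambda>i. s (X i)) y \<and> S \<epsilon> y (\<lambda>j. s' (Z j)))) s)"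
  proof (intro exI conjI allI impI)
    show "real (ccost (Seq c d)) \<le> C + D" using c(1) d(1) by simp
    show "k \<le> k''" using c(2) d(2) by simp
    show "Z j < k''" for j by (rule d(3))
    fix \<epsilon> :: real and s assume e: "0 \<le> \<epsilon>" "\<epsilon> \<le> 1 / 2"
    show "wp \<epsilon> (Seq c d) (\<lambda>s'. (\<forall>r<k. s' r = s r) \<and>
             (\<exists>y. R \<epsilon> (\<lambda>i. s (X i)) y \<and> S \<epsilon> y (\<lambda>j. s' (Z j)))) s"
      unfolding wp.simps
    proof (rule wp_mono[OF c(4)[OF e]])
      fix s1 assume s1: "(\<forall>r<k. s1 r = s r) \<and> R \<epsilon> (\<lambda>i. s (X i)) (\<lambda>j. s1 (Y j))"
      show "wp \<epsilon> d (\<lambda>s'. (\<forall>r<k. s' r = s r) \<and>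
             (\<exists>y. R \<epsilon> (\<lambda>i. s (X i)) y \<and> S \<epsilon> y (\<lambda>j. s' (Z j)))) s1"
        by (rule wp_mono[OF d(4)[OF e]]) (use s1 c(2) in auto)
    qed
  qed
qed

text \<open>Calling a procedure on rearranged inputs; its results may be combined with the inputs.\<close>

lemma computable_call:
  fixes f :: "'i \<Rightarrow> 'j" and h :: "'o \<Rightarrow> 'j + 'p"
  assumes "computable C R"
  shows "computable C (\<lambda>\<epsilon> x z. \<exists>w. R \<epsilon> (\<lambda>i. x (f i)) w \<and> z = (\<lambda>a. case h a of Inl b \<Rightarrow> x b | Inr b \<Rightarrow> w b))"
proof (rule computableI)
  fix k and X :: "'j \<Rightarrow> nat" assume X: "\<And>i. X i < k"
  obtain c Y k' where c: "real (ccost c) \<le> C" "k \<le> k'" "\<And>j. Y j < k'"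
    "\<And>\<epsilon> s. 0 \<le> \<epsilon> \<Longrightarrow> \<epsilon> \<le> 1 / 2 \<Longrightarrow>
       wp \<epsilon> c (\<lambda>s'. (\<forall>r<k. s' r = s r) \<and> R \<epsilon> (\<lambda>i. s (X (f i))) (\<lambda>j. s' (Y j))) s"
    by (rule computableE[OF assms(1), where X = "\<lambda>i. X (f i)", OF X]) (rule that)
  show "\<exists>c Z k'. real (ccost c) \<le> C \<and> k \<le> k' \<and> (\<forall>j. Z j < k') \<and>
        (\<forall>\<epsilon> s. 0 \<le> \<epsilon> \<longrightarrow> \<epsilon> \<le> 1 / 2 \<longrightarrow>
           wp \<epsilon> c (\<lambda>s'. (\<forall>r<k. s' r = s r) \<and>
             (\<exists>w. R \<epsilon> (\<lambda>i. s (X (f i))) w \<and>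
                (\<lambda>j. s' (Z j)) = (\<lambda>a. case h a of Inl b \<Rightarrow> s (X b) | Inr b \<Rightarrow> w b))) s)"
  proof (intro exI conjI allI impI)
    show "real (ccost c) \<le> C" "k \<le> k'" by fact+
    show "(case h j of Inl b \<Rightarrow> X b | Inr b \<Rightarrow> Y b) < k'" for j
      using c(3) order_less_le_trans[OF X c(2)] by (auto split: sum.splits)
    fix \<epsilon> :: real and s assume e: "0 \<le> \<epsilon>" "\<epsilon> \<le> 1 / 2"
    show "wp \<epsilon> c (\<lambda>s'. (\<forall>r<k. s' r = s r) \<and>
             (\<exists>w. R \<epsilon> (\<lambda>i. s (X (f i))) w \<and>
                (\<lambda>j. s' (case h j of Inl b \<Rightarrow> X b | Inr b \<Rightarrow> Y b)) =
                (\<lambda>a. case h a of Inl b \<Rightarrow> s (X b) | Inr b \<Rightarrow> w b))) s"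
    proof (rule wp_mono[OF c(4)[OF e]])
      fix s' assume s': "(\<forall>r<k. s' r = s r) \<and> R \<epsilon> (\<lambda>i. s (X (f i))) (\<lambda>j. s' (Y j))"
      then show "(\<forall>r<k. s' r = s r) \<and>
             (\<exists>w. R \<epsilon> (\<lambda>i. s (X (f i))) w \<and>
                (\<lambda>j. s' (case h j of Inl b \<Rightarrow> X b | Inr b \<Rightarrow> Y b)) =
                (\<lambda>a. case h a of Inl b \<Rightarrow> s (X b) | Inr b \<Rightarrow> w b))"
        by (intro conjI exI[of _ "\<lambda>j. s' (Y j)"]) (use X in \<open>auto split: sum.splits\<close>)
    qed
  qed
qed

lemma computable_copy: "computable 0 (\<lambda>\<epsilon> x z. z = (\<lambda>a. x (f a)))"
proof (rule computableI)
  fix k and X :: "'a \<Rightarrow> nat" assume X: "\<And>i. X i < k"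
  show "\<exists>c Z k'. real (ccost c) \<le> 0 \<and> k \<le> k' \<and> (\<forall>j. Z j < k') \<and>
        (\<forall>\<epsilon> s. 0 \<le> \<epsilon> \<longrightarrow> \<epsilon> \<le> 1 / 2 \<longrightarrow>
           wp \<epsilon> c (\<lambda>s'. (\<forall>r<k. s' r = s r) \<and> (\<lambda>j. s' (Z j)) = (\<lambda>a. s (X (f a)))) s)"
    by (rule exI[of _ Skip], rule exI[of _ "\<lambda>a. X (f a)"], rule exI[of _ k]) (use X in auto)
qed

lemma computable_in: "computable C R \<Longrightarrow> computable C (\<lambda>\<epsilon> x z. R \<epsilon> (\<lambda>i. x (f i)) z)"
  by (drule computable_call[where f = f and h = Inr]) simp

lemma computable_out: "computable C R \<Longrightarrow> computable C (\<lambda>\<epsilon> x z. \<exists>w. R \<epsilon> x w \<and> z = (\<lambda>a. w (f a)))"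
  by (drule computable_call[where f = "\<lambda>x. x" and h = "\<lambda>a. Inr (f a)"]) simp

lemma computable_keep: "computable C R \<Longrightarrow>
  computable C (\<lambda>\<epsilon> x z. R \<epsilon> x (\<lambda>j. z (Inr j)) \<and> (\<lambda>i. z (Inl i)) = x)"
  by (drule computable_call[where f = "\<lambda>x. x" and h = "\<lambda>a. a"]) (erule computable_mono, auto)

lemma computable_family:
  assumes "finite J" "\<And>j. j \<in> J \<Longrightarrow> computable (C j) (R j)"
  shows "computable (\<Sum>j\<in>J. C j) (\<lambda>\<epsilon> x z. \<forall>j\<in>J. R j \<epsilon> x (\<lambda>a. z (j, a)))"
  using assms
proof (induction J rule: finite_induct)
  case empty
  show ?case
    by (rule computableI, rule exI[of _ Skip], rule exI[of _ "\<lambda>_. 0"]) (auto intro: le_SucI)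
next
  case (insert j J)
  let ?h = "\<lambda>(i, a). if i = j then Inr a else Inl (Inr (i, a))"
  have 1: "computable (sum C J) (\<lambda>\<epsilon> x z. (\<forall>j\<in>J. R j \<epsilon> x (\<lambda>a. z (Inr (j, a)))) \<and> (\<lambda>i. z (Inl i)) = x)"
    using computable_keep[OF insert.IH] insert.prems by auto
  have "computable (C j) (R j)" using insert.prems by auto
  from computable_seq[OF 1 computable_call[OF this, where f = Inl and h = ?h]]
  show ?case
  proof (rule computable_mono)
    show "sum C J + C j \<le> (\<Sum>j\<in>insert j J. C j)" using insert.hyps by simp
    fix \<epsilon> x z
    assume "\<exists>y. ((\<forall>j\<in>J. R j \<epsilon> x (\<lambda>a. y (Inr (j, a)))) \<and> (\<lambda>i. y (Inl i)) = x) \<and>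
       (\<exists>w. R j \<epsilon> (\<lambda>i. y (Inl i)) w \<and> z = (\<lambda>a. case ?h a of Inl b \<Rightarrow> y b | Inr b \<Rightarrow> w b))"
    then obtain y w where y: "\<forall>j\<in>J. R j \<epsilon> x (\<lambda>a. y (Inr (j, a)))"
      and x: "(\<lambda>i. y (Inl i)) = x" and w: "R j \<epsilon> (\<lambda>i. y (Inl i)) w"
      and z: "z = (\<lambda>a. case ?h a of Inl b \<Rightarrow> y b | Inr b \<Rightarrow> w b)" by (elim exE conjE)
    have "R i \<epsilon> x (\<lambda>a. z (i, a))" if "i \<in> insert j J" for i
    proof (cases "i = j")
      case True
      have "(\<lambda>a. z (j, a)) = w" by (simp add: z)
      then show ?thesis using w unfolding x True by simp
    next
      case False
      then have "(\<lambda>a. z (i, a)) = (\<lambda>a. y (Inr (i, a)))" by (simp add: z)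
      then show ?thesis using y that False by simp
    qed
    then show "\<forall>i\<in>insert j J. R i \<epsilon> x (\<lambda>a. z (i, a))" by (rule ballI)
  qed
qed

lemma computable_iter:
  assumes "\<And>t. t < (T :: nat) \<Longrightarrow> computable C (R t)"
  shows "computable (real T * C) (\<lambda>\<epsilon> x z. \<exists>f. f 0 = x \<and> f T = z \<and> (\<forall>t<T. R t \<epsilon> (f t) (f (Suc t))))"
  using assms
proof (induction T)
  case 0
  show ?case by (rule computable_mono[OF computable_copy[of "\<lambda>x. x"]]) (auto intro: exI[of _ "\<lambda>_. _"])
next
  case (Suc T)
  have "computable (real T * C) (\<lambda>\<epsilon> x z. \<exists>f. f 0 = x \<and> f T = z \<and> (\<forall>t<T. R t \<epsilon> (f t) (f (Suc t))))"
    "computable C (R T)" using Suc by auto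
  from computable_seq[OF this] show ?case
  proof (rule computable_mono)
    fix \<epsilon> x z
    assume "\<exists>y. (\<exists>f. f 0 = x \<and> f T = y \<and> (\<forall>t<T. R t \<epsilon> (f t) (f (Suc t)))) \<and> R T \<epsilon> y z"
    then obtain f where f: "f 0 = x" "\<forall>t<T. R t \<epsilon> (f t) (f (Suc t))" "R T \<epsilon> (f T) z" by blast
    then show "\<exists>f. f 0 = x \<and> f (Suc T) = z \<and> (\<forall>t<Suc T. R t \<epsilon> (f t) (f (Suc t)))"
      by (intro exI[of _ "f(Suc T := z)"]) (auto simp: less_Suc_eq)
  qed (simp add: algebra_simps)
qed

lemma computable_const: "computable 1 (\<lambda>\<epsilon> x z. \<exists>\<delta>. \<bar>\<delta>\<bar> \<le> \<epsilon> \<and> z = (\<lambda>_. c * (1 + \<delta>)))"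
proof (rule computableI)
  fix k and X :: "'a \<Rightarrow> nat" assume X: "\<And>i. X i < k"
  show "\<exists>C Z k'. real (ccost C) \<le> 1 \<and> k \<le> k' \<and> (\<forall>j. Z j < k') \<and>
        (\<forall>\<epsilon> s. 0 \<le> \<epsilon> \<longrightarrow> \<epsilon> \<le> 1 / 2 \<longrightarrow>
           wp \<epsilon> C (\<lambda>s'. (\<forall>r<k. s' r = s r) \<and>
             (\<exists>\<delta>. \<bar>\<delta>\<bar> \<le> \<epsilon> \<and> (\<lambda>j. s' (Z j)) = (\<lambda>_. c * (1 + \<delta>)))) s)"
    by (rule exI[of _ "Op k (Const c)"], rule exI[of _ "\<lambda>_. k"], rule exI[of _ "Suc k"]) auto
qed

lemma computable_sub: "computable 1 (\<lambda>\<epsilon> x z. \<exists>\<delta>. \<bar>\<delta>\<bar> \<le> \<epsilon> \<and> z = (\<lambda>_. (x a - x b) * (1 + \<delta>)))"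
proof (rule computableI)
  fix k and X :: "'a \<Rightarrow> nat" assume X: "\<And>i. X i < k"
  show "\<exists>c Z k'. real (ccost c) \<le> 1 \<and> k \<le> k' \<and> (\<forall>j. Z j < k') \<and>
        (\<forall>\<epsilon> s. 0 \<le> \<epsilon> \<longrightarrow> \<epsilon> \<le> 1 / 2 \<longrightarrow>
           wp \<epsilon> c (\<lambda>s'. (\<forall>r<k. s' r = s r) \<and>
             (\<exists>\<delta>. \<bar>\<delta>\<bar> \<le> \<epsilon> \<and> (\<lambda>j. s' (Z j)) = (\<lambda>_. (s (X a) - s (X b)) * (1 + \<delta>)))) s)"
    by (rule exI[of _ "Op k (Sub (X a) (X b))"], rule exI[of _ "\<lambda>_. k"], rule exI[of _ "Suc k"]) auto
qed

lemma computable_mult: "computable 1 (\<lambda>\<epsilon> x z. \<exists>\<delta>. \<bar>\<delta>\<bar> \<le> \<epsilon> \<and> z = (\<lambda>_. (x a * x b) * (1 + \<delta>)))"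
proof (rule computableI)
  fix k and X :: "'a \<Rightarrow> nat" assume X: "\<And>i. X i < k"
  show "\<exists>c Z k'. real (ccost c) \<le> 1 \<and> k \<le> k' \<and> (\<forall>j. Z j < k') \<and>
        (\<forall>\<epsilon> s. 0 \<le> \<epsilon> \<longrightarrow> \<epsilon> \<le> 1 / 2 \<longrightarrow>
           wp \<epsilon> c (\<lambda>s'. (\<forall>r<k. s' r = s r) \<and>
             (\<exists>\<delta>. \<bar>\<delta>\<bar> \<le> \<epsilon> \<and> (\<lambda>j. s' (Z j)) = (\<lambda>_. (s (X a) * s (X b)) * (1 + \<delta>)))) s)"
    by (rule exI[of _ "Op k (Mul (X a) (X b))"], rule exI[of _ "\<lambda>_. k"], rule exI[of _ "Suc k"]) auto
qed

lemma computable_safe_div: "computable 4 (\<lambda>\<epsilon> x z. \<exists>\<delta>. \<bar>\<delta>\<bar> \<le> \<epsilon> \<and>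
    z = (\<lambda>_. (if x b = 0 then d else x a / x b) * (1 + \<delta>)))"
proof (rule computableI)
  fix k and X :: "'a \<Rightarrow> nat" assume X: "\<And>i. X i < k"
  have ne: "X i \<noteq> k" "X i \<noteq> Suc k" for i using X[of i] by auto
  let ?c = "Seq (Op k (Mul (X b) (X b))) (Seq (Op (Suc k) (Const 0))
    (Cond k (Suc k) (Op k (Const d)) (Op k (Div (X a) (X b)))))"
  show "\<exists>c Z k'. real (ccost c) \<le> 4 \<and> k \<le> k' \<and> (\<forall>j. Z j < k') \<and>
        (\<forall>\<epsilon> s. 0 \<le> \<epsilon> \<longrightarrow> \<epsilon> \<le> 1 / 2 \<longrightarrow>
           wp \<epsilon> c (\<lambda>s'. (\<forall>r<k. s' r = s r) \<and>
             (\<exists>\<delta>. \<bar>\<delta>\<bar> \<le> \<epsilon> \<and> (\<lambda>j. s' (Z j)) =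
                (\<lambda>_. (if s (X b) = 0 then d else s (X a) / s (X b)) * (1 + \<delta>)))) s)"
  proof (rule exI[of _ ?c], rule exI[of _ "\<lambda>_. k"], rule exI[of _ "Suc (Suc k)"],
      intro conjI allI impI)
    fix \<epsilon> :: real and s assume e: "0 \<le> \<epsilon>" "\<epsilon> \<le> 1 / 2"
    have pos: "s (X b) * s (X b) * (1 + \<delta>) \<le> 0 \<longleftrightarrow> s (X b) = 0" if "\<bar>\<delta>\<bar> \<le> \<epsilon>" for \<delta>
    proof -
      have "1 + \<delta> > 0" using that e by linarith
      then have "s (X b) \<noteq> 0 \<Longrightarrow> s (X b) * s (X b) * (1 + \<delta>) > 0"
        by (metis mult_pos_pos not_square_less_zero linorder_neqE_linordered_idom mult_eq_0_iff)
      then show ?thesis by force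
    qed
    show "wp \<epsilon> ?c (\<lambda>s'. (\<forall>r<k. s' r = s r) \<and>
             (\<exists>\<delta>. \<bar>\<delta>\<bar> \<le> \<epsilon> \<and> (\<lambda>j. s' k) =
                (\<lambda>_. (if s (X b) = 0 then d else s (X a) / s (X b)) * (1 + \<delta>)))) s"
      using pos by (auto simp: ne)
  qed auto
qed

lemma computable_hyp: "computable 4 (\<lambda>\<epsilon> x z. \<exists>\<delta>1 \<delta>2 \<delta>3 \<delta>4. \<bar>\<delta>1\<bar> \<le> \<epsilon> \<and> \<bar>\<delta>2\<bar> \<le> \<epsilon> \<and> \<bar>\<delta>3\<bar> \<le> \<epsilon> \<and> \<bar>\<delta>4\<bar> \<le> \<epsilon> \<and>
    z = (\<lambda>_. sqrt (((x a)\<^sup>2 * (1 + \<delta>1) + (x b)\<^sup>2 * (1 + \<delta>2)) * (1 + \<delta>3)) * (1 + \<delta>4)))"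
proof (rule computableI)
  fix k and X :: "'a \<Rightarrow> nat" assume X: "\<And>i. X i < k"
  have ne: "X i \<noteq> k" "X i \<noteq> Suc k" for i using X[of i] by auto
  let ?c = "Seq (Op k (Mul (X a) (X a))) (Seq (Op (Suc k) (Mul (X b) (X b)))
    (Seq (Op k (Add k (Suc k))) (Op k (Sqrt k))))"
  show "\<exists>c Z k'. real (ccost c) \<le> 4 \<and> k \<le> k' \<and> (\<forall>j. Z j < k') \<and>
        (\<forall>\<epsilon> s. 0 \<le> \<epsilon> \<longrightarrow> \<epsilon> \<le> 1 / 2 \<longrightarrow>
           wp \<epsilon> c (\<lambda>s'. (\<forall>r<k. s' r = s r) \<and>
             (\<exists>\<delta>1 \<delta>2 \<delta>3 \<delta>4. \<bar>\<delta>1\<bar> \<le> \<epsilon> \<and> \<bar>\<delta>2\<bar> \<le> \<epsilon> \<and> \<bar>\<delta>3\<bar> \<le> \<epsilon> \<and> \<bar>\<delta>4\<bar> \<le> \<epsilon> \<and> (\<lambda>j. s' (Z j)) =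
                (\<lambda>_. sqrt (((s (X a))\<^sup>2 * (1 + \<delta>1) + (s (X b))\<^sup>2 * (1 + \<delta>2)) * (1 + \<delta>3)) * (1 + \<delta>4)))) s)"
  proof (rule exI[of _ ?c], rule exI[of _ "\<lambda>_. k"], rule exI[of _ "Suc (Suc k)"],
      intro conjI allI impI)
    fix \<epsilon> :: real and s assume e: "0 \<le> \<epsilon>" "\<epsilon> \<le> 1 / 2"
    have nn: "\<not> (s (X a) * s (X a) * (1 + \<delta>1) + s (X b) * s (X b) * (1 + \<delta>2)) * (1 + \<delta>3) < 0"
      if "\<bar>\<delta>1\<bar> \<le> \<epsilon>" "\<bar>\<delta>2\<bar> \<le> \<epsilon>" "\<bar>\<delta>3\<bar> \<le> \<epsilon>" for \<delta>1 \<delta>2 \<delta>3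
    proof -
      have "1 + \<delta>1 \<ge> 0" "1 + \<delta>2 \<ge> 0" "1 + \<delta>3 \<ge> 0" using that e by linarith+
      then show ?thesis by (simp add: not_less)
    qed
    show "wp \<epsilon> ?c (\<lambda>s'. (\<forall>r<k. s' r = s r) \<and>
             (\<exists>\<delta>1 \<delta>2 \<delta>3 \<delta>4. \<bar>\<delta>1\<bar> \<le> \<epsilon> \<and> \<bar>\<delta>2\<bar> \<le> \<epsilon> \<and> \<bar>\<delta>3\<bar> \<le> \<epsilon> \<and> \<bar>\<delta>4\<bar> \<le> \<epsilon> \<and> (\<lambda>j. s' k) =
                (\<lambda>_. sqrt (((s (X a))\<^sup>2 * (1 + \<delta>1) + (s (X b))\<^sup>2 * (1 + \<delta>2)) * (1 + \<delta>3)) * (1 + \<delta>4)))) s"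
      using nn by (auto simp: ne power2_eq_square)
  qed auto
qed

section \<open>The bilinear rank of matrix multiplication\<close>

lemma concat_map_upt:
  "concat (map (\<lambda>i. map (f i) [0..<m]) [0..<n]) = map (\<lambda>k. f (k div m) (k mod m)) [0..<n * m]"
proof (induction n)
  case (Suc n)
  have "[0..<n * m + m] = [0..<n * m] @ [n * m..<n * m + m]" by (rule upt_add_eq_append) simp
  then have "[0..<Suc n * m] = [0..<n * m] @ map (\<lambda>j. j + n * m) [0..<m]"
    by (simp add: map_add_upt add.commute)
  moreover have "map ((\<lambda>k. f (k div m) (k mod m)) \<circ> (\<lambda>j. j + n * m)) [0..<m] = map (f n) [0..<m]"
    by (rule map_cong) auto
  ultimately show ?case using Suc by simp
qed simp

lemma entries_eq: "A \<in> carrier_mat n m \<Longrightarrow> entries A = map (\<lambda>k. A $$ (k div m, k mod m)) [0..<n * m]"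
  using concat_map_upt[of "\<lambda>i j. A $$ (i, j)" m n] by (auto simp: entries_def mat_to_list_def)

lemma length_entries: "A \<in> carrier_mat n m \<Longrightarrow> length (entries A) = n * m"
  by (simp add: entries_eq)

lemma index_less: "i < n \<Longrightarrow> j < m \<Longrightarrow> i * m + j < n * (m :: nat)"
  by (metis add.commute add_less_cancel_right mult.commute mult_Suc order_less_le_trans
      mult_le_mono1 Suc_leI add.right_neutral nat_add_left_cancel_less)

lemma nth_entries:
  assumes "A \<in> carrier_mat n m" "i < n" "j < m" shows "entries A ! (i * m + j) = A $$ (i, j)"
  using index_less[OF assms(2,3)] assms(3) by (simp add: entries_eq[OF assms(1)])

text \<open>The straight line is used in place of the partial derivatives: \<open>l\<close> and \<open>q\<close> are the first two
  Taylor coefficients of \<open>F\<close> at \<open>a\<close>, as functions of the direction.\<close>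

definition jet :: "((nat \<Rightarrow> real) \<Rightarrow> real) \<Rightarrow> (nat \<Rightarrow> real) \<Rightarrow> real \<Rightarrow>
    ((nat \<Rightarrow> real) \<Rightarrow> real) \<Rightarrow> ((nat \<Rightarrow> real) \<Rightarrow> real) \<Rightarrow> bool" where
  "jet F a c l q \<longleftrightarrow> (\<forall>x. \<exists>e. (e \<longlongrightarrow> q x) (at_right 0) \<and>
     (\<forall>\<^sub>F t in at_right 0. F (\<lambda>i. a i + t * x i) = c + t * l x + t\<^sup>2 * e t))"

lemma jetI:
  assumes "\<And>x. \<exists>e. (e \<longlongrightarrow> q x) (at_right 0) \<and>
     (\<forall>\<^sub>F t in at_right 0. F (\<lambda>i. a i + t * x i) = c + t * l x + t\<^sup>2 * e t)"
  shows "jet F a c l q"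
  using assms by (simp add: jet_def)

lemma jetE:
  assumes "jet F a c l q"
  obtains e where "(e \<longlongrightarrow> q x) (at_right 0)"
    "\<forall>\<^sub>F t in at_right 0. F (\<lambda>i. a i + t * x i) = c + t * l x + t\<^sup>2 * e t"
  using assms unfolding jet_def by blast

lemma tendsto_t: "((\<lambda>t::real. t) \<longlongrightarrow> 0) (at_right 0)"
  by (rule tendsto_ident_at)

lemma eventually_pos: "\<forall>\<^sub>F t in at_right (0::real). 0 < t"
  by (simp add: eventually_at_right_less)

lemma jet_tendsto:
  assumes "jet F a c l q"
  shows "((\<lambda>t. F (\<lambda>i. a i + t * x i)) \<longlongrightarrow> c) (at_right 0)"
proof -
  obtain e where e: "(e \<longlongrightarrow> q x) (at_right 0)"
    "\<forall>\<^sub>F t in at_right 0. F (\<lambda>i. a i + t * x i) = c + t * l x + t\<^sup>2 * e t"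
    by (rule jetE[OF assms])
  have "((\<lambda>t. c + t * l x + t\<^sup>2 * e t) \<longlongrightarrow> c + 0 * l x + 0\<^sup>2 * q x) (at_right 0)"
    by (intro tendsto_intros tendsto_t e)
  then show ?thesis by (subst tendsto_cong[OF e(2)]) simp
qed

lemma jet_eventually_cong:
  assumes "jet F a c l q" "\<And>x. \<forall>\<^sub>F t in at_right 0. G (\<lambda>i. a i + t * x i) = F (\<lambda>i. a i + t * x i)"
  shows "jet G a c l q"
proof (rule jetI)
  fix x
  obtain e where e: "(e \<longlongrightarrow> q x) (at_right 0)"
    "\<forall>\<^sub>F t in at_right 0. F (\<lambda>i. a i + t * x i) = c + t * l x + t\<^sup>2 * e t"
    by (rule jetE[OF assms(1)])
  show "\<exists>e. (e \<longlongrightarrow> q x) (at_right 0) \<and>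
     (\<forall>\<^sub>F t in at_right 0. G (\<lambda>i. a i + t * x i) = c + t * l x + t\<^sup>2 * e t)"
    by (rule exI[of _ e], rule conjI, rule e, use e(2) assms(2)[of x] in eventually_elim) simp
qed

lemma jet_const: "jet (\<lambda>_. c) a c (\<lambda>_. 0) (\<lambda>_. 0)"
  by (rule jetI) (auto intro!: exI[of _ "\<lambda>_. 0"])

lemma jet_coordinate: "jet (\<lambda>s. s r) a (a r) (\<lambda>x. x r) (\<lambda>_. 0)"
  by (rule jetI) (auto intro!: exI[of _ "\<lambda>_. 0"])

lemma jet_add:
  assumes "jet F a c l q" "jet G a c' l' q'"
  shows "jet (\<lambda>s. F s + G s) a (c + c') (\<lambda>x. l x + l' x) (\<lambda>x. q x + q' x)"
proof (rule jetI)
  fix x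
  obtain e where e: "(e \<longlongrightarrow> q x) (at_right 0)"
    "\<forall>\<^sub>F t in at_right 0. F (\<lambda>i. a i + t * x i) = c + t * l x + t\<^sup>2 * e t"
    by (rule jetE[OF assms(1)])
  obtain e' where e': "(e' \<longlongrightarrow> q' x) (at_right 0)"
    "\<forall>\<^sub>F t in at_right 0. G (\<lambda>i. a i + t * x i) = c' + t * l' x + t\<^sup>2 * e' t"
    by (rule jetE[OF assms(2)])
  show "\<exists>e. (e \<longlongrightarrow> q x + q' x) (at_right 0) \<and>
     (\<forall>\<^sub>F t in at_right 0. F (\<lambda>i. a i + t * x i) + G (\<lambda>i. a i + t * x i)
       = c + c' + t * (l x + l' x) + t\<^sup>2 * e t)"
    by (rule exI[of _ "\<lambda>t. e t + e' t"], rule conjI, intro tendsto_intros e e',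
        use e(2) e'(2) in eventually_elim) (simp add: algebra_simps)
qed

lemma jet_mult:
  assumes "jet F a c l q" "jet G a c' l' q'"
  shows "jet (\<lambda>s. F s * G s) a (c * c') (\<lambda>x. c * l' x + c' * l x) (\<lambda>x. c * q' x + c' * q x + l x * l' x)"
proof (rule jetI)
  fix x
  obtain e where e: "(e \<longlongrightarrow> q x) (at_right 0)"
    "\<forall>\<^sub>F t in at_right 0. F (\<lambda>i. a i + t * x i) = c + t * l x + t\<^sup>2 * e t"
    by (rule jetE[OF assms(1)])
  obtain e' where e': "(e' \<longlongrightarrow> q' x) (at_right 0)"
    "\<forall>\<^sub>F t in at_right 0. G (\<lambda>i. a i + t * x i) = c' + t * l' x + t\<^sup>2 * e' t"
    by (rule jetE[OF assms(2)])
  let ?e = "\<lambda>t. c * e' t + c' * e t + l x * l' x + t * (l x * e' t + l' x * e t) + t\<^sup>2 * (e t * e' t)"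
  have lim: "(?e \<longlongrightarrow> c * q' x + c' * q x + l x * l' x + 0 * (l x * q' x + l' x * q x) + 0\<^sup>2 * (q x * q' x)) (at_right 0)"
    by (intro tendsto_intros tendsto_t e e')
  have "\<forall>\<^sub>F t in at_right 0. F (\<lambda>i. a i + t * x i) * G (\<lambda>i. a i + t * x i)
       = c * c' + t * (c * l' x + c' * l x) + t\<^sup>2 * ?e t"
    using e(2) e'(2) by eventually_elim (simp only:, simp add: power2_eq_square algebra_simps)
  then show "\<exists>e. (e \<longlongrightarrow> c * q' x + c' * q x + l x * l' x) (at_right 0) \<and>
     (\<forall>\<^sub>F t in at_right 0. F (\<lambda>i. a i + t * x i) * G (\<lambda>i. a i + t * x i)
       = c * c' + t * (c * l' x + c' * l x) + t\<^sup>2 * e t)"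
    using lim by (intro exI[of _ ?e]) simp
qed

lemma jet_scale: "jet F a c l q \<Longrightarrow> jet (\<lambda>s. k * F s) a (k * c) (\<lambda>x. k * l x) (\<lambda>x. k * q x)"
  using jet_mult[OF jet_const[of k], of F a c l q] by simp

lemma jet_diff:
  assumes "jet F a c l q" "jet G a c' l' q'"
  shows "jet (\<lambda>s. F s - G s) a (c - c') (\<lambda>x. l x - l' x) (\<lambda>x. q x - q' x)"
  using jet_add[OF assms(1) jet_scale[OF assms(2), of "-1"]] by simp

text \<open>If the product with \<open>G\<close> or the square of \<open>H\<close> is known, then \<open>H - (c + t * l)\<close> is a multiple of \<open>t^2\<close>.\<close>

lemma jet_divide:
  assumes "jet F a c l q" "jet G a c' l' q'" "c' \<noteq> 0"
  defines "h \<equiv> \<lambda>x. (l x - c / c' * l' x) / c'"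
  shows "jet (\<lambda>s. F s / G s) a (c / c') h (\<lambda>x. (q x - c / c' * q' x - h x * l' x) / c')"
proof (rule jetI)
  fix x
  obtain e where e: "(e \<longlongrightarrow> q x) (at_right 0)"
    "\<forall>\<^sub>F t in at_right 0. F (\<lambda>i. a i + t * x i) = c + t * l x + t\<^sup>2 * e t"
    by (rule jetE[OF assms(1)])
  obtain e' where e': "(e' \<longlongrightarrow> q' x) (at_right 0)"
    "\<forall>\<^sub>F t in at_right 0. G (\<lambda>i. a i + t * x i) = c' + t * l' x + t\<^sup>2 * e' t"
    by (rule jetE[OF assms(2)])
  have G: "((\<lambda>t. G (\<lambda>i. a i + t * x i)) \<longlongrightarrow> c') (at_right 0)" by (rule jet_tendsto[OF assms(2)])
  have ne: "\<forall>\<^sub>F t in at_right 0. G (\<lambda>i. a i + t * x i) \<noteq> 0"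
    by (rule tendsto_imp_eventually_ne[OF G assms(3)])
  let ?e = "\<lambda>t. (e t - c / c' * e' t - h x * l' x - t * (h x * e' t)) / G (\<lambda>i. a i + t * x i)"
  have lim: "(?e \<longlongrightarrow> (q x - c / c' * q' x - h x * l' x - 0 * (h x * q' x)) / c') (at_right 0)"
    by (intro tendsto_intros tendsto_t e e' G assms(3))
  have hx: "c' * h x = l x - c / c' * l' x" using assms(3) by (simp add: h_def)
  have "\<forall>\<^sub>F t in at_right 0. F (\<lambda>i. a i + t * x i) / G (\<lambda>i. a i + t * x i) = c / c' + t * h x + t\<^sup>2 * ?e t"
    using e(2) e'(2) ne
  proof eventually_elim
    case (elim t)
    let ?g = "c' + t * l' x + t\<^sup>2 * e' t"
    have g: "?g \<noteq> 0" using elim by simp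
    have "(c / c' + t * h x) * ?g + t\<^sup>2 * (e t - c / c' * e' t - h x * l' x - t * (h x * e' t))
        = c / c' * c' + t * (c / c' * l' x + c' * h x) + t\<^sup>2 * e t"
      by (simp add: power2_eq_square algebra_simps)
    also have "\<dots> = c + t * l x + t\<^sup>2 * e t" using assms(3) by (simp add: hx)
    finally have "c + t * l x + t\<^sup>2 * e t = (c / c' + t * h x) * ?g + t\<^sup>2 * (e t - c / c' * e' t - h x * l' x - t * (h x * e' t))" ..
    then show ?case using g unfolding elim(1,2) by (simp add: add_divide_distrib)
  qed
  then show "\<exists>e. (e \<longlongrightarrow> (q x - c / c' * q' x - h x * l' x) / c') (at_right 0) \<and>
     (\<forall>\<^sub>F t in at_right 0. F (\<lambda>i. a i + t * x i) / G (\<lambda>i. a i + t * x i) = c / c' + t * h x + t\<^sup>2 * e t)"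
    using lim by (intro exI[of _ ?e]) simp
qed

lemma jet_sqrt:
  assumes "jet F a c l q" "0 < c"
  defines "h \<equiv> \<lambda>x. l x / (2 * sqrt c)"
  shows "jet (\<lambda>s. sqrt (F s)) a (sqrt c) h (\<lambda>x. (q x - h x * h x) / (2 * sqrt c))"
proof (rule jetI)
  fix x
  obtain e where e: "(e \<longlongrightarrow> q x) (at_right 0)"
    "\<forall>\<^sub>F t in at_right 0. F (\<lambda>i. a i + t * x i) = c + t * l x + t\<^sup>2 * e t"
    by (rule jetE[OF assms(1)])
  let ?F = "\<lambda>t. F (\<lambda>i. a i + t * x i)"
  have F: "(?F \<longlongrightarrow> c) (at_right 0)" by (rule jet_tendsto[OF assms(1)])
  have pos: "\<forall>\<^sub>F t in at_right 0. 0 < ?F t" using order_tendstoD(1)[OF F assms(2)] .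
  let ?d = "\<lambda>t. sqrt (?F t) + (sqrt c + t * h x)"
  have d: "(?d \<longlongrightarrow> sqrt c + (sqrt c + 0 * h x)) (at_right 0)"
    by (intro tendsto_intros tendsto_t F)
  have c: "sqrt c > 0" using assms(2) by simp
  have dne: "\<forall>\<^sub>F t in at_right 0. ?d t \<noteq> 0"
    by (rule tendsto_imp_eventually_ne[OF d]) (use c in simp)
  let ?e = "\<lambda>t. (e t - h x * h x) / ?d t"
  have lim: "(?e \<longlongrightarrow> (q x - h x * h x) / (sqrt c + (sqrt c + 0 * h x))) (at_right 0)"
    by (rule tendsto_divide[OF tendsto_diff[OF e(1) tendsto_const] d]) (use c in simp)
  have lx: "l x = 2 * (sqrt c * h x)" using c by (simp add: h_def)
  have "\<forall>\<^sub>F t in at_right 0. sqrt (?F t) = sqrt c + t * h x + t\<^sup>2 * ?e t"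
    using e(2) pos dne
  proof eventually_elim
    case (elim t)
    let ?m = "sqrt c + t * h x"
    have "(sqrt (?F t) - ?m) * ?d t = ?F t - ?m * ?m"
      using elim(2) by (simp add: algebra_simps)
    also have "\<dots> = t\<^sup>2 * (e t - h x * h x)"
      unfolding elim(1) lx using assms(2) by (simp add: power2_eq_square algebra_simps)
    finally have "sqrt (?F t) - ?m = t\<^sup>2 * ?e t"
      using elim(3) by (simp add: field_simps)
    then show ?case by simp
  qed
  then show "\<exists>e. (e \<longlongrightarrow> (q x - h x * h x) / (2 * sqrt c)) (at_right 0) \<and>
     (\<forall>\<^sub>F t in at_right 0. sqrt (?F t) = sqrt c + t * h x + t\<^sup>2 * e t)"
    using lim by (intro exI[of _ ?e]) simp
qed

lemma jet_unique:
  assumes "jet F a c l q" "jet F a c' l' q'"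
  shows "q x = q' x"
proof -
  obtain e where e: "(e \<longlongrightarrow> q x) (at_right 0)"
    "\<forall>\<^sub>F t in at_right 0. F (\<lambda>i. a i + t * x i) = c + t * l x + t\<^sup>2 * e t"
    by (rule jetE[OF assms(1)])
  obtain e' where e': "(e' \<longlongrightarrow> q' x) (at_right 0)"
    "\<forall>\<^sub>F t in at_right 0. F (\<lambda>i. a i + t * x i) = c' + t * l' x + t\<^sup>2 * e' t"
    by (rule jetE[OF assms(2)])
  have nt: "at_right (0::real) \<noteq> bot" by simp
  have c: "c = c'"
    by (rule tendsto_unique[OF nt jet_tendsto[OF assms(1), of x] jet_tendsto[OF assms(2), of x]])
  have 1: "((\<lambda>t. l x + t * e t) \<longlongrightarrow> l x + 0 * q x) (at_right 0)"
    "((\<lambda>t. l' x + t * e' t) \<longlongrightarrow> l' x + 0 * q' x) (at_right 0)"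
    by (intro tendsto_intros tendsto_t e e')+
  have "\<forall>\<^sub>F t in at_right 0. l x + t * e t = l' x + t * e' t"
    using e(2) e'(2) eventually_pos
  proof eventually_elim
    case (elim t)
    then have "t * (l x + t * e t) = t * (l' x + t * e' t)"
      using c by (simp add: power2_eq_square algebra_simps)
    then show ?case using elim(3) by simp
  qed
  then have "((\<lambda>t. l' x + t * e' t) \<longlongrightarrow> l x + 0 * q x) (at_right 0)"
    using 1(1) by (simp add: tendsto_cong)
  then have l: "l x = l' x" using tendsto_unique[OF nt _ 1(2)] by fastforce
  have "\<forall>\<^sub>F t in at_right 0. e t = e' t"
    using e(2) e'(2) eventually_pos by eventually_elim (use c l in simp)
  then have "(e' \<longlongrightarrow> q x) (at_right 0)"
    using e(1) by (simp add: tendsto_cong)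
  then show ?thesis by (rule tendsto_unique[OF nt _ e'(1)])
qed

definition lin :: "((nat \<Rightarrow> real) \<Rightarrow> real) \<Rightarrow> bool" where
  "lin l \<longleftrightarrow> (\<forall>x y. l (\<lambda>i. x i + y i) = l x + l y)"

definition quadratic_rank :: "nat \<Rightarrow> (nat \<Rightarrow> (nat \<Rightarrow> real) \<Rightarrow> real) \<Rightarrow> (nat \<Rightarrow> real) \<Rightarrow> bool" where
  "quadratic_rank L F a \<longleftrightarrow> (\<exists>\<alpha> \<beta>. (\<forall>p. lin (\<alpha> p) \<and> lin (\<beta> p)) \<and>
     (\<forall>r. \<exists>c l w. lin l \<and> jet (F r) a c l (\<lambda>x. \<Sum>p<(L::nat). w p * \<alpha> p x * \<beta> p x)))"

lemma quadratic_rank_mono: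
  assumes "quadratic_rank L F a" "L \<le> M" shows "quadratic_rank M F a"
proof -
  obtain \<alpha> \<beta> where ab: "\<forall>p. lin (\<alpha> p) \<and> lin (\<beta> p)"
    "\<And>r. \<exists>c l w. lin l \<and> jet (F r) a c l (\<lambda>x. \<Sum>p<L. w p * \<alpha> p x * \<beta> p x)"
    using assms(1) unfolding quadratic_rank_def by blast
  have "\<exists>c l w. lin l \<and> jet (F r) a c l (\<lambda>x. \<Sum>p<M. w p * \<alpha> p x * \<beta> p x)" for r
  proof -
    obtain c l w where w: "lin l" "jet (F r) a c l (\<lambda>x. \<Sum>p<L. w p * \<alpha> p x * \<beta> p x)" using ab(2) by blast
    have "(\<Sum>p<M. (if p < L then w p else 0) * \<alpha> p x * \<beta> p x) = (\<Sum>p<L. w p * \<alpha> p x * \<beta> p x)" for x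
      by (rule sum.mono_neutral_cong_right) (use assms(2) in auto)
    then show ?thesis using w by (intro exI[of _ c] exI[of _ l] exI[of _ "\<lambda>p. if p < L then w p else 0"]) simp
  qed
  then show ?thesis using ab(1) unfolding quadratic_rank_def by blast
qed

lemma quadratic_rank_update:
  assumes ab: "\<And>p. lin (\<alpha> p)" "\<And>p. lin (\<beta> p)"
    and F: "\<And>r. \<exists>c l w. lin l \<and> jet (F r) a c l (\<lambda>x. \<Sum>p<L. w p * \<alpha> p x * \<beta> p x)"
    and G: "lin l" "lin \<alpha>'" "lin \<beta>'" "jet G a c l (\<lambda>x. (\<Sum>p<L. w p * \<alpha> p x * \<beta> p x) + \<alpha>' x * \<beta>' x)"
  shows "quadratic_rank (Suc L) (F(r := G)) a"
  unfolding quadratic_rank_def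
proof (rule exI[of _ "\<alpha>(L := \<alpha>')"], rule exI[of _ "\<beta>(L := \<beta>')"], intro conjI allI)
  fix p
  show "lin ((\<alpha>(L := \<alpha>')) p)" "lin ((\<beta>(L := \<beta>')) p)" using ab G by auto
next
  fix r'
  have sum: "(\<Sum>p<Suc L. (w(L := k)) p * (\<alpha>(L := \<alpha>')) p x * (\<beta>(L := \<beta>')) p x)
      = (\<Sum>p<L. w p * \<alpha> p x * \<beta> p x) + k * \<alpha>' x * \<beta>' x" for w x k
    by simp
  show "\<exists>c l w. lin l \<and> jet ((F(r := G)) r') a c l (\<lambda>x. \<Sum>p<Suc L. w p * (\<alpha>(L := \<alpha>')) p x * (\<beta>(L := \<beta>')) p x)"
  proof (cases "r' = r")
    case True
    have "jet ((F(r := G)) r') a c l (\<lambda>x. \<Sum>p<Suc L. (w(L := 1)) p * (\<alpha>(L := \<alpha>')) p x * (\<beta>(L := \<beta>')) p x)"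
      unfolding sum True using G(4) by simp
    then show ?thesis using G(1) by blast
  next
    case False
    obtain c l w where w: "lin l" "jet (F r') a c l (\<lambda>x. \<Sum>p<L. w p * \<alpha> p x * \<beta> p x)" using F by blast
    have "jet ((F(r := G)) r') a c l (\<lambda>x. \<Sum>p<Suc L. (w(L := 0)) p * (\<alpha>(L := \<alpha>')) p x * (\<beta>(L := \<beta>')) p x)"
      unfolding sum using w(2) False by simp
    then show ?thesis using w(1) by blast
  qed
qed

lemma eventually_line:
  assumes "open U" "a \<in> U"
  shows "\<forall>\<^sub>F t in at_right (0::real). (\<lambda>i. a i + t * x i) \<in> (U :: (nat \<Rightarrow> real) set)"
proof -
  have c: "continuous_on UNIV (\<lambda>t::real. (\<lambda>i. a i + t * x i))"
    by (rule continuous_on_coordinatewise_then_product) (intro continuous_intros)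
  have "((\<lambda>t. (\<lambda>i. a i + t * x i)) \<longlongrightarrow> (\<lambda>i. a i + 0 * x i)) (at_right 0)"
    using continuous_on_tendsto_compose[OF c tendsto_t] by simp
  then show ?thesis using topological_tendstoD[OF _ assms(1)] assms(2) by force
qed

lemma lin_zero: "lin (\<lambda>_. 0)" and lin_cmult: "lin l \<Longrightarrow> lin (\<lambda>x. k * l x)"
  and lin_add: "lin l \<Longrightarrow> lin l' \<Longrightarrow> lin (\<lambda>x. l x + l' x)"
  by (simp_all add: lin_def algebra_simps)

lemma lin_diff: "lin l \<Longrightarrow> lin l' \<Longrightarrow> lin (\<lambda>x. l x - l' x)" and lin_divide: "lin l \<Longrightarrow> lin (\<lambda>x. l x / k)"
  by (simp_all add: lin_def algebra_simps add_divide_distrib)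

lemma sum_products_comb:
  fixes w w' :: "nat \<Rightarrow> real"
  shows "(\<Sum>p<L. (k * w p + k' * w' p) * u p * v p) = k * (\<Sum>p<L. w p * u p * v p) + k' * (\<Sum>p<L. w' p * u p * v p)"
  by (simp add: sum_distrib_left distrib_right sum.distrib mult.assoc)

lemma operation_step:
  assumes U: "open U" "U \<noteq> {}" and F: "\<And>r. continuous_on U (F r)" "\<And>a. a \<in> U \<Longrightarrow> quadratic_rank L F a"
    and def: "\<And>a. a \<in> U \<Longrightarrow> exact_value f (\<lambda>r. F r a) \<noteq> None"
  shows "\<exists>V G. open V \<and> V \<noteq> {} \<and> V \<subseteq> U \<and> continuous_on V G \<and>
    (\<forall>a\<in>V. exact_value f (\<lambda>r. F r a) = Some (G a) \<and> quadratic_rank (Suc L) (F(r := G)) a)"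
proof -
  have upd: "quadratic_rank (Suc L) (F(r := G)) a"
    if a: "a \<in> U" and G: "\<And>\<alpha> \<beta>. (\<And>p. lin (\<alpha> p)) \<Longrightarrow> (\<And>p. lin (\<beta> p)) \<Longrightarrow>
        (\<And>r. \<exists>c l w. lin l \<and> jet (F r) a c l (\<lambda>x. \<Sum>p<L. w p * \<alpha> p x * \<beta> p x)) \<Longrightarrow>
        \<exists>c l w \<alpha>' \<beta>'. lin l \<and> lin \<alpha>' \<and> lin \<beta>' \<and> jet G a c l (\<lambda>x. (\<Sum>p<L. w p * \<alpha> p x * \<beta> p x) + \<alpha>' x * \<beta>' x)"
    for a G
  proof -
    obtain \<alpha> \<beta> where ab: "\<And>p. lin (\<alpha> p)" "\<And>p. lin (\<beta> p)"
      "\<And>r. \<exists>c l w. lin l \<and> jet (F r) a c l (\<lambda>x. \<Sum>p<L. w p * \<alpha> p x * \<beta> p x)"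
      using F(2)[OF a] unfolding quadratic_rank_def by blast
    obtain c l w \<alpha>' \<beta>' where "lin l" "lin \<alpha>'" "lin \<beta>'"
      "jet G a c l (\<lambda>x. (\<Sum>p<L. w p * \<alpha> p x * \<beta> p x) + \<alpha>' x * \<beta>' x)"
      using G[OF ab] by blast
    then show ?thesis by (rule quadratic_rank_update[OF ab])
  qed
  show ?thesis
  proof (cases f)
    case (Const k)
    have "quadratic_rank (Suc L) (F(r := \<lambda>_. k)) a" if "a \<in> U" for a
      by (rule upd[OF that], rule exI[of _ k], rule exI[of _ "\<lambda>_. 0"], rule exI[of _ "\<lambda>_. 0"],
          rule exI[of _ "\<lambda>_. 0"], rule exI[of _ "\<lambda>_. 0"]) (simp add: jet_const lin_zero)
    then show ?thesis
      by (intro exI[of _ U] exI[of _ "\<lambda>_. k"]) (use U Const in auto)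
  next
    case (Add i j)
    have "quadratic_rank (Suc L) (F(r := \<lambda>s. F i s + F j s)) a" if "a \<in> U" for a
    proof (rule upd[OF that])
      fix \<alpha> \<beta>
      assume F: "\<And>r. \<exists>c l w. lin l \<and> jet (F r) a c l (\<lambda>x. \<Sum>p<L. w p * \<alpha> p x * \<beta> p x)"
      obtain c l w where 1: "lin l" "jet (F i) a c l (\<lambda>x. \<Sum>p<L. w p * \<alpha> p x * \<beta> p x)" using F by blast
      obtain c' l' w' where 2: "lin l'" "jet (F j) a c' l' (\<lambda>x. \<Sum>p<L. w' p * \<alpha> p x * \<beta> p x)" using F by blast
      show "\<exists>c l w \<alpha>' \<beta>'. lin l \<and> lin \<alpha>' \<and> lin \<beta>' \<and>
          jet (\<lambda>s. F i s + F j s) a c l (\<lambda>x. (\<Sum>p<L. w p * \<alpha> p x * \<beta> p x) + \<alpha>' x * \<beta>' x)"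
        by (rule exI[of _ "c + c'"], rule exI[of _ "\<lambda>x. l x + l' x"], rule exI[of _ "\<lambda>p. 1 * w p + 1 * w' p"],
            rule exI[of _ "\<lambda>_. 0"], rule exI[of _ "\<lambda>_. 0"], unfold sum_products_comb)
          (use jet_add[OF 1(2) 2(2)] 1 2 in \<open>simp add: lin_zero lin_add\<close>)
    qed
    then show ?thesis
      by (intro exI[of _ U] exI[of _ "\<lambda>s. F i s + F j s"]) (use U Add F(1) in \<open>auto intro: continuous_intros\<close>)
  next
    case (Sub i j)
    have "quadratic_rank (Suc L) (F(r := \<lambda>s. F i s - F j s)) a" if "a \<in> U" for a
    proof (rule upd[OF that])
      fix \<alpha> \<beta>
      assume F: "\<And>r. \<exists>c l w. lin l \<and> jet (F r) a c l (\<lambda>x. \<Sum>p<L. w p * \<alpha> p x * \<beta> p x)"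
      obtain c l w where 1: "lin l" "jet (F i) a c l (\<lambda>x. \<Sum>p<L. w p * \<alpha> p x * \<beta> p x)" using F by blast
      obtain c' l' w' where 2: "lin l'" "jet (F j) a c' l' (\<lambda>x. \<Sum>p<L. w' p * \<alpha> p x * \<beta> p x)" using F by blast
      show "\<exists>c l w \<alpha>' \<beta>'. lin l \<and> lin \<alpha>' \<and> lin \<beta>' \<and>
          jet (\<lambda>s. F i s - F j s) a c l (\<lambda>x. (\<Sum>p<L. w p * \<alpha> p x * \<beta> p x) + \<alpha>' x * \<beta>' x)"
        by (rule exI[of _ "c - c'"], rule exI[of _ "\<lambda>x. l x - l' x"], rule exI[of _ "\<lambda>p. 1 * w p + (-1) * w' p"],
            rule exI[of _ "\<lambda>_. 0"], rule exI[of _ "\<lambda>_. 0"], unfold sum_products_comb)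
          (use jet_diff[OF 1(2) 2(2)] 1 2 in \<open>simp add: lin_zero lin_diff\<close>)
    qed
    then show ?thesis
      by (intro exI[of _ U] exI[of _ "\<lambda>s. F i s - F j s"]) (use U Sub F(1) in \<open>auto intro: continuous_intros\<close>)
  next
    case (Mul i j)
    have "quadratic_rank (Suc L) (F(r := \<lambda>s. F i s * F j s)) a" if "a \<in> U" for a
    proof (rule upd[OF that])
      fix \<alpha> \<beta>
      assume F: "\<And>r. \<exists>c l w. lin l \<and> jet (F r) a c l (\<lambda>x. \<Sum>p<L. w p * \<alpha> p x * \<beta> p x)"
      obtain c l w where 1: "lin l" "jet (F i) a c l (\<lambda>x. \<Sum>p<L. w p * \<alpha> p x * \<beta> p x)" using F by blast
      obtain c' l' w' where 2: "lin l'" "jet (F j) a c' l' (\<lambda>x. \<Sum>p<L. w' p * \<alpha> p x * \<beta> p x)" using F by blast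
      show "\<exists>c l w \<alpha>' \<beta>'. lin l \<and> lin \<alpha>' \<and> lin \<beta>' \<and>
          jet (\<lambda>s. F i s * F j s) a c l (\<lambda>x. (\<Sum>p<L. w p * \<alpha> p x * \<beta> p x) + \<alpha>' x * \<beta>' x)"
        by (rule exI[of _ "c * c'"], rule exI[of _ "\<lambda>x. c * l' x + c' * l x"], rule exI[of _ "\<lambda>p. c * w' p + c' * w p"],
            rule exI[of _ l], rule exI[of _ l'], unfold sum_products_comb)
          (use jet_mult[OF 1(2) 2(2)] 1 2 in \<open>simp add: lin_cmult lin_add\<close>)
    qed
    then show ?thesis
      by (intro exI[of _ U] exI[of _ "\<lambda>s. F i s * F j s"]) (use U Mul F(1) in \<open>auto intro: continuous_intros\<close>)
  next
    case (Div i j)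
    have nz: "F j a \<noteq> 0" if "a \<in> U" for a using def[OF that] Div by auto
    have "quadratic_rank (Suc L) (F(r := \<lambda>s. F i s / F j s)) a" if a: "a \<in> U" for a
    proof (rule upd[OF a])
      fix \<alpha> \<beta>
      assume F: "\<And>r. \<exists>c l w. lin l \<and> jet (F r) a c l (\<lambda>x. \<Sum>p<L. w p * \<alpha> p x * \<beta> p x)"
      obtain c l w where 1: "lin l" "jet (F i) a c l (\<lambda>x. \<Sum>p<L. w p * \<alpha> p x * \<beta> p x)" using F by blast
      obtain c' l' w' where 2: "lin l'" "jet (F j) a c' l' (\<lambda>x. \<Sum>p<L. w' p * \<alpha> p x * \<beta> p x)" using F by blast
      have "((\<lambda>t::real. F j a) \<longlongrightarrow> c') (at_right 0)" using jet_tendsto[OF 2(2), of "\<lambda>_. 0"] by simp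
      then have "c' = F j a" by (simp add: tendsto_const_iff)
      then have c': "c' \<noteq> 0" using nz[OF a] by simp
      let ?h = "\<lambda>x. (l x - c / c' * l' x) / c'"
      have h: "lin ?h" by (intro lin_divide lin_diff lin_cmult 1 2)
      have eq: "((\<Sum>p<L. w p * \<alpha> p x * \<beta> p x) - c / c' * (\<Sum>p<L. w' p * \<alpha> p x * \<beta> p x) - ?h x * l' x) / c'
         = (\<Sum>p<L. (1 / c' * w p + (- c / c' / c') * w' p) * \<alpha> p x * \<beta> p x) + (- 1 / c' * ?h x) * l' x" for x
        unfolding sum_products_comb using c' by (simp add: field_simps)
      show "\<exists>c l w \<alpha>' \<beta>'. lin l \<and> lin \<alpha>' \<and> lin \<beta>' \<and>
          jet (\<lambda>s. F i s / F j s) a c l (\<lambda>x. (\<Sum>p<L. w p * \<alpha> p x * \<beta> p x) + \<alpha>' x * \<beta>' x)"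
        by (rule exI[of _ "c / c'"], rule exI[of _ ?h], rule exI[of _ "\<lambda>p. 1 / c' * w p + (- c / c' / c') * w' p"],
            rule exI[of _ "\<lambda>x. - 1 / c' * ?h x"], rule exI[of _ l'])
          (intro conjI h lin_cmult 2(1) jet_divide[OF 1(2) 2(2) c', unfolded eq])
    qed
    then show ?thesis
      by (intro exI[of _ U] exI[of _ "\<lambda>s. F i s / F j s"]) (use U Div F(1) nz in \<open>auto intro!: continuous_intros\<close>)
  next
    case (Sqrt i)
    have nn: "F i a \<ge> 0" if "a \<in> U" for a using def[OF that] Sqrt by (auto split: if_splits)
    show ?thesis
    proof (cases "\<exists>a\<in>U. F i a > 0")
      case True
      define V where "V = {a \<in> U. F i a > 0}"
      have Veq: "V = F i -` {0<..} \<inter> U" by (auto simp: V_def)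
      have "open V" unfolding Veq
        by (rule F(1)[unfolded continuous_on_open_vimage[OF U(1)], rule_format]) simp
      moreover have "V \<noteq> {}" "V \<subseteq> U" using True by (auto simp: V_def)
      ultimately have V: "open V" "V \<noteq> {}" "V \<subseteq> U" .
      have "quadratic_rank (Suc L) (F(r := \<lambda>s. sqrt (F i s))) a" if a: "a \<in> V" for a
      proof (rule upd)
        show "a \<in> U" using V a by auto
        fix \<alpha> \<beta>
        assume F: "\<And>r. \<exists>c l w. lin l \<and> jet (F r) a c l (\<lambda>x. \<Sum>p<L. w p * \<alpha> p x * \<beta> p x)"
        obtain c l w where 1: "lin l" "jet (F i) a c l (\<lambda>x. \<Sum>p<L. w p * \<alpha> p x * \<beta> p x)" using F by blast
        have "((\<lambda>t::real. F i a) \<longlongrightarrow> c) (at_right 0)" using jet_tendsto[OF 1(2), of "\<lambda>_. 0"] by simp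
        then have "c = F i a" by (simp add: tendsto_const_iff)
        then have c: "c > 0" using a by (simp add: V_def)
        let ?h = "\<lambda>x. l x / (2 * sqrt c)"
        have h: "lin ?h" by (intro lin_divide 1)
        have eq: "((\<Sum>p<L. w p * \<alpha> p x * \<beta> p x) - ?h x * ?h x) / (2 * sqrt c)
           = (\<Sum>p<L. (1 / (2 * sqrt c) * w p + 0 * w p) * \<alpha> p x * \<beta> p x) + (- 1 / (2 * sqrt c) * ?h x) * ?h x" for x
          unfolding sum_products_comb by (simp add: diff_divide_distrib)
        show "\<exists>c l w \<alpha>' \<beta>'. lin l \<and> lin \<alpha>' \<and> lin \<beta>' \<and>
            jet (\<lambda>s. sqrt (F i s)) a c l (\<lambda>x. (\<Sum>p<L. w p * \<alpha> p x * \<beta> p x) + \<alpha>' x * \<beta>' x)"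
          by (rule exI[of _ "sqrt c"], rule exI[of _ ?h], rule exI[of _ "\<lambda>p. 1 / (2 * sqrt c) * w p + 0 * w p"],
              rule exI[of _ "\<lambda>x. - 1 / (2 * sqrt c) * ?h x"], rule exI[of _ ?h])
            (intro conjI h lin_cmult jet_sqrt[OF 1(2) c, unfolded eq])
      qed
      moreover have "continuous_on V (\<lambda>s. sqrt (F i s))"
        using continuous_on_subset[OF F(1) V(3)] by (intro continuous_intros)
      ultimately show ?thesis
        by (intro exI[of _ V] exI[of _ "\<lambda>s. sqrt (F i s)"]) (use V Sqrt nn in \<open>auto simp: not_less\<close>)
    next
      case False
      have "quadratic_rank (Suc L) (F(r := \<lambda>_. 0)) a" if "a \<in> U" for a
        by (rule upd[OF that], rule exI[of _ 0], rule exI[of _ "\<lambda>_. 0"], rule exI[of _ "\<lambda>_. 0"],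
            rule exI[of _ "\<lambda>_. 0"], rule exI[of _ "\<lambda>_. 0"]) (simp add: jet_const lin_zero)
      moreover have "F i a = 0" if "a \<in> U" for a using False nn[OF that] that by force
      ultimately show ?thesis
        by (intro exI[of _ U] exI[of _ "\<lambda>_. 0"]) (use U Sqrt in auto)
    qed
  qed
qed

lemma generic_path:
  assumes "open U" "U \<noteq> {}" "\<And>r. continuous_on U (F r)" "\<And>a. a \<in> U \<Longrightarrow> quadratic_rank L F a"
    and "\<And>a. a \<in> U \<Longrightarrow> None \<notin> outcomes 0 p (\<lambda>r. F r a)"
  shows "\<exists>V rs F'. open V \<and> V \<noteq> {} \<and> V \<subseteq> U \<and> (\<forall>a\<in>V. outcomes 0 p (\<lambda>r. F r a) = {Some (map (\<lambda>r. F' r a) rs)} \<and>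
      quadratic_rank (L + cost p) F' a)"
  using assms
proof (induction p arbitrary: U F L)
  case (Return rs)
  then show ?case by (intro exI[of _ U] exI[of _ rs] exI[of _ F]) auto
next
  case (Assign r f p)
  have "exact_value f (\<lambda>r. F r a) \<noteq> None" if "a \<in> U" for a
    using Assign.prems(5)[OF that] by (auto split: option.splits)
  from operation_step[OF Assign.prems(1-4) this, of r]
  obtain V G where V: "open V" "V \<noteq> {}" "V \<subseteq> U" "continuous_on V G"
    "\<And>a. a \<in> V \<Longrightarrow> exact_value f (\<lambda>r. F r a) = Some (G a)"
    "\<And>a. a \<in> V \<Longrightarrow> quadratic_rank (Suc L) (F(r := G)) a" by blast
  have out: "outcomes 0 (Assign r f p) (\<lambda>r. F r a) = outcomes 0 p (\<lambda>q. (F(r := G)) q a)" if "a \<in> V" for a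
  proof -
    have "(\<lambda>r. F r a)(r := G a) = (\<lambda>q. (F(r := G)) q a)" by auto
    then show ?thesis using V(5)[OF that] by simp
  qed
  have c: "continuous_on V ((F(r := G)) q)" for q
    using V(4) continuous_on_subset[OF Assign.prems(3) V(3)] by auto
  have "\<exists>W rs F'. open W \<and> W \<noteq> {} \<and> W \<subseteq> V \<and> (\<forall>a\<in>W. outcomes 0 p (\<lambda>q. (F(r := G)) q a) = {Some (map (\<lambda>r. F' r a) rs)} \<and>
      quadratic_rank (Suc L + cost p) F' a)"
    by (rule Assign.IH[OF V(1,2) c V(6)]) (use out Assign.prems(5) V(3) in auto)
  then obtain W rs F' where W: "open W" "W \<noteq> {}" "W \<subseteq> V"
    "\<And>a. a \<in> W \<Longrightarrow> outcomes 0 p (\<lambda>q. (F(r := G)) q a) = {Some (map (\<lambda>r. F' r a) rs)}"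
    "\<And>a. a \<in> W \<Longrightarrow> quadratic_rank (Suc L + cost p) F' a" by blast
  have "outcomes 0 (Assign r f p) (\<lambda>r. F r a) = {Some (map (\<lambda>r. F' r a) rs)}" if "a \<in> W" for a
    using out[of a] W(3) W(4)[OF that] that by blast
  moreover have "quadratic_rank (L + cost (Assign r f p)) F' a" if "a \<in> W" for a
    using W(5)[OF that] by simp
  ultimately show ?case
      by (intro exI[of _ W] exI[of _ rs] exI[of _ F'] conjI ballI W(1,2) order_trans[OF W(3) V(3)])
next
  case (IfLe i j p q)
  show ?case
  proof (cases "\<exists>a\<in>U. F j a < F i a")
    case True
    define V where "V = {a \<in> U. F j a < F i a}"
    have cont: "continuous_on U (\<lambda>a. F i a - F j a)" by (intro continuous_intros IfLe.prems)
    have Veq: "V = (\<lambda>a. F i a - F j a) -` {0<..} \<inter> U" by (auto simp: V_def)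
    have "open V" unfolding Veq
      by (rule cont[unfolded continuous_on_open_vimage[OF IfLe.prems(1)], rule_format]) simp
    moreover have "V \<noteq> {}" "V \<subseteq> U" using True by (auto simp: V_def)
    ultimately have V: "open V" "V \<noteq> {}" "V \<subseteq> U" .
    have out: "outcomes 0 (IfLe i j p q) (\<lambda>r. F r a) = outcomes 0 q (\<lambda>r. F r a)" if "a \<in> V" for a
      using that by (simp add: V_def)
    have "\<exists>W rs F'. open W \<and> W \<noteq> {} \<and> W \<subseteq> V \<and> (\<forall>a\<in>W. outcomes 0 q (\<lambda>r. F r a) = {Some (map (\<lambda>r. F' r a) rs)} \<and>
      quadratic_rank (L + cost q) F' a)"
    proof (rule IfLe.IH(2)[OF V(1,2)])
      show "continuous_on V (F r)" for r by (rule continuous_on_subset[OF IfLe.prems(3) V(3)])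
      show "quadratic_rank L F a" if "a \<in> V" for a using IfLe.prems(4) V(3) that by (simp add: subset_iff)
      show "None \<notin> outcomes 0 q (\<lambda>r. F r a)" if "a \<in> V" for a
        using IfLe.prems(5)[of a] out[OF that] V(3) that by (simp add: subset_iff del: outcomes.simps)
    qed
    then obtain W rs F' where W: "open W" "W \<noteq> {}" "W \<subseteq> V"
      "\<And>a. a \<in> W \<Longrightarrow> outcomes 0 q (\<lambda>r. F r a) = {Some (map (\<lambda>r. F' r a) rs)}"
      "\<And>a. a \<in> W \<Longrightarrow> quadratic_rank (L + cost q) F' a" by blast
    have "outcomes 0 (IfLe i j p q) (\<lambda>r. F r a) = {Some (map (\<lambda>r. F' r a) rs)}" if "a \<in> W" for a
      using out[of a] W(3) W(4)[OF that] that by blast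
    moreover have "quadratic_rank (L + cost (IfLe i j p q)) F' a" if "a \<in> W" for a
      by (rule quadratic_rank_mono[OF W(5)[OF that]]) simp
    ultimately show ?thesis
      by (intro exI[of _ W] exI[of _ rs] exI[of _ F'] conjI ballI W(1,2) order_trans[OF W(3) V(3)])
  next
    case False
    then have out: "outcomes 0 (IfLe i j p q) (\<lambda>r. F r a) = outcomes 0 p (\<lambda>r. F r a)" if "a \<in> U" for a
      using that by (simp add: not_less)
    have "\<exists>W rs F'. open W \<and> W \<noteq> {} \<and> W \<subseteq> U \<and> (\<forall>a\<in>W. outcomes 0 p (\<lambda>r. F r a) = {Some (map (\<lambda>r. F' r a) rs)} \<and>
      quadratic_rank (L + cost p) F' a)"
      by (rule IfLe.IH(1)[OF IfLe.prems(1-4)]) (use IfLe.prems(5) out in auto)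
    then obtain W rs F' where W: "open W" "W \<noteq> {}" "W \<subseteq> U"
      "\<And>a. a \<in> W \<Longrightarrow> outcomes 0 p (\<lambda>r. F r a) = {Some (map (\<lambda>r. F' r a) rs)}"
      "\<And>a. a \<in> W \<Longrightarrow> quadratic_rank (L + cost p) F' a" by blast
    have "outcomes 0 (IfLe i j p q) (\<lambda>r. F r a) = {Some (map (\<lambda>r. F' r a) rs)}" if "a \<in> W" for a
      using out[of a] W(3) W(4)[OF that] that by blast
    moreover have "quadratic_rank (L + cost (IfLe i j p q)) F' a" if "a \<in> W" for a
      by (rule quadratic_rank_mono[OF W(5)[OF that]]) simp
    ultimately show ?thesis
      by (intro exI[of _ W] exI[of _ rs] exI[of _ F'] conjI ballI W(1,2) W(3))
  qed
qed


lemma load_entries: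
  fixes a :: "nat \<Rightarrow> real" and n :: nat
  defines "A \<equiv> mat n n (\<lambda>(i, j). a (i * n + j))" and "B \<equiv> mat n n (\<lambda>(i, j). a (n * n + (i * n + j)))"
  shows "load (entries A @ entries B) = (\<lambda>r. if r < n * n + n * n then a r else 0)"
proof -
  have AB: "A \<in> carrier_mat n n" "B \<in> carrier_mat n n" by (simp_all add: A_def B_def)
  have divmod: "k div n < n" "k mod n < n" "k div n * n + k mod n = k" if "k < n * n" for k
    using that less_mult_imp_div_less[OF that] by (auto intro!: mod_less_divisor Nat.gr0I)
  have "entries A ! k = a k" "entries B ! k = a (n * n + k)" if "k < n * n" for k
    using divmod[OF that] that unfolding entries_eq[OF AB(1)] entries_eq[OF AB(2)] by (simp_all add: A_def B_def)
  then show ?thesis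
    by (auto simp: load_def fun_eq_iff nth_append length_entries[OF AB(1)] length_entries[OF AB(2)])
qed

lemma multiplies_quadratic_rank:
  assumes "multiplies n p"
  shows "\<exists>\<alpha> \<beta> w. (\<forall>p. lin (\<alpha> p) \<and> lin (\<beta> p)) \<and>
    (\<forall>i<n. \<forall>j<n. \<forall>x. (\<Sum>k<n. x (i * n + k) * x (n * n + (k * n + j))) = (\<Sum>q<cost p. w i j q * \<alpha> q x * \<beta> q x))"
proof -
  define N where "N = n * n + n * n"
  define F where "F r s = (if r < N then s r else (0::real))" for r and s :: "nat \<Rightarrow> real"
  define A where "A a = mat n n (\<lambda>(i, j). a (i * n + j))" for a :: "nat \<Rightarrow> real"
  define B where "B a = mat n n (\<lambda>(i, j). a (n * n + (i * n + j)))" for a :: "nat \<Rightarrow> real"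
  have AB: "A a \<in> carrier_mat n n" "B a \<in> carrier_mat n n" for a by (simp_all add: A_def B_def)
  have out: "outcomes 0 p (\<lambda>r. F r a) = {Some (entries (A a * B a))}" for a
    using assms[unfolded multiplies_def, rule_format, OF AB(1) AB(2), of a a] load_entries[of n a]
    by (simp add: A_def B_def F_def N_def)
  have Fr: "F r = (if r < N then (\<lambda>s. s r) else (\<lambda>_. 0))" for r by (auto simp: F_def)
  have cont: "continuous_on UNIV (F r)" for r
    unfolding Fr by (auto intro: continuous_intros)
  have rank: "quadratic_rank 0 F a" for a
    unfolding quadratic_rank_def
  proof (rule exI[of _ "\<lambda>_ _. 0"], rule exI[of _ "\<lambda>_ _. 0"], intro conjI allI lin_zero)
    fix r
    show "\<exists>c l w. lin l \<and> jet (F r) a c l (\<lambda>x. \<Sum>p<(0::nat). w p * 0 * 0)"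
    proof (cases "r < N")
      case True
      then have "jet (F r) a (a r) (\<lambda>x. x r) (\<lambda>_. 0)" unfolding Fr by (simp add: jet_coordinate)
      moreover have "lin (\<lambda>x. x r)" by (simp add: lin_def)
      ultimately show ?thesis by (auto intro!: exI[of _ "a r"] exI[of _ "\<lambda>x. x r"])
    next
      case False
      then have "jet (F r) a 0 (\<lambda>_. 0) (\<lambda>_. 0)" unfolding Fr by (simp add: jet_const)
      then show ?thesis using lin_zero by (auto intro!: exI[of _ 0] exI[of _ "\<lambda>_. 0"])
    qed
  qed
  have "\<exists>V rs F'. open V \<and> V \<noteq> {} \<and> V \<subseteq> UNIV \<and> (\<forall>a\<in>V. outcomes 0 p (\<lambda>r. F r a) = {Some (map (\<lambda>r. F' r a) rs)} \<and>
      quadratic_rank (0 + cost p) F' a)"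
    by (rule generic_path) (use cont rank out in auto)
  then obtain V rs F' where V: "open V" "V \<noteq> {}"
    and V': "\<And>a. a \<in> V \<Longrightarrow> outcomes 0 p (\<lambda>r. F r a) = {Some (map (\<lambda>r. F' r a) rs)}"
    "\<And>a. a \<in> V \<Longrightarrow> quadratic_rank (cost p) F' a" by (elim exE conjE) simp
  obtain a where a: "a \<in> V" using V(2) by blast
  obtain \<alpha> \<beta> where ab: "\<And>p. lin (\<alpha> p) \<and> lin (\<beta> p)"
    "\<And>r. \<exists>c l w. lin l \<and> jet (F' r) a c l (\<lambda>x. \<Sum>q<cost p. w q * \<alpha> q x * \<beta> q x)"
    using V'(2)[OF a] unfolding quadratic_rank_def by blast
  have "\<exists>w. \<forall>x. (\<Sum>k<n. x (i * n + k) * x (n * n + (k * n + j))) = (\<Sum>q<cost p. w q * \<alpha> q x * \<beta> q x)"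
    if ij: "i < n" "j < n" for i j
  proof -
    let ?S = "\<lambda>x y. \<Sum>k<n. x (i * n + k) * y (n * n + (k * n + j)) :: real"
    define r where "r = rs ! (i * n + j)"
    have Fr: "F' r b = ?S b b" if "b \<in> V" for b
    proof -
      have eq: "map (\<lambda>r. F' r b) rs = entries (A b * B b)" using V'(1)[OF that] out[of b] by simp
      have C: "A b * B b \<in> carrier_mat n n" by (rule mult_carrier_mat[OF AB])
      have len: "length rs = n * n" using eq length_entries[OF C] length_map by metis
      have "F' r b = map (\<lambda>r. F' r b) rs ! (i * n + j)"
        unfolding r_def using len index_less[OF ij] by simp
      also have "\<dots> = (A b * B b) $$ (i, j)" unfolding eq by (rule nth_entries[OF C ij])
      also have "\<dots> = ?S b b" using ij by (simp add: A_def B_def scalar_prod_def lessThan_atLeast0)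
      finally show ?thesis .
    qed
    have "jet (\<lambda>s. ?S s s) a (?S a a) (\<lambda>x. ?S a x + ?S x a) (\<lambda>x. ?S x x)"
    proof (rule jetI)
      fix x
      have "(a u + t * x u) * (a v + t * x v) = a u * a v + t * (a u * x v + x u * a v) + t\<^sup>2 * (x u * x v)"
        for u v and t :: real by (simp add: power2_eq_square algebra_simps)
      then have "?S (\<lambda>i. a i + t * x i) (\<lambda>i. a i + t * x i) = ?S a a + t * (?S a x + ?S x a) + t\<^sup>2 * ?S x x" for t
        by (simp add: sum.distrib sum_distrib_left distrib_left)
      then show "\<exists>e. (e \<longlongrightarrow> ?S x x) (at_right 0) \<and> (\<forall>\<^sub>F t in at_right 0.
          ?S (\<lambda>i. a i + t * x i) (\<lambda>i. a i + t * x i) = ?S a a + t * (?S a x + ?S x a) + t\<^sup>2 * e t)"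
        by (intro exI[of _ "\<lambda>_. ?S x x"]) simp
    qed
    then have j: "jet (F' r) a (?S a a) (\<lambda>x. ?S a x + ?S x a) (\<lambda>x. ?S x x)"
    proof (rule jet_eventually_cong)
      show "\<forall>\<^sub>F t in at_right 0. F' r (\<lambda>i. a i + t * x i) = ?S (\<lambda>i. a i + t * x i) (\<lambda>i. a i + t * x i)" for x
        using eventually_line[OF V(1) a, of x] by eventually_elim (rule Fr)
    qed
    obtain c l w where "jet (F' r) a c l (\<lambda>x. \<Sum>q<cost p. w q * \<alpha> q x * \<beta> q x)" using ab(2) by blast
    from jet_unique[OF j this] show ?thesis by blast
  qed
  note ex = this
  define w where "w i j = (SOME w. \<forall>x. (\<Sum>k<n. x (i * n + k) * x (n * n + (k * n + j))) =
    (\<Sum>q<cost p. w q * \<alpha> q x * \<beta> q x))" for i j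
  have "\<forall>x. (\<Sum>k<n. x (i * n + k) * x (n * n + (k * n + j))) = (\<Sum>q<cost p. w i j q * \<alpha> q x * \<beta> q x)"
    if "i < n" "j < n" for i j
    unfolding w_def by (rule someI_ex[OF ex[OF that]])
  then show ?thesis using ab(1) by - (rule exI[of _ \<alpha>], rule exI[of _ \<beta>], rule exI[of _ w], simp)
qed

lemma sum_lessThan_add: "(\<Sum>p<m + k. f p) = (\<Sum>p<m. f p) + (\<Sum>p<k. f (m + p))" for f :: "nat \<Rightarrow> real"
  by (induction k) auto

text \<open>Polarization turns a quadratic algorithm with \<open>L\<close> products into a bilinear one with \<open>2 L\<close> products.\<close>

lemma multiplies_bilinear_rank:
  assumes "multiplies n p"
  shows "\<exists>u v w :: nat \<Rightarrow> nat \<Rightarrow> nat \<Rightarrow> real. \<forall>a<n. \<forall>b<n. \<forall>c<n. \<forall>d<n. \<forall>e<n. \<forall>f<n.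
    (\<Sum>q<2 * cost p. w q a b * u q c d * v q e f) = (if a = c \<and> d = e \<and> f = b then 1 else 0)"
proof -
  obtain \<alpha> \<beta> w where ab: "\<And>q. lin (\<alpha> q)" "\<And>q. lin (\<beta> q)" and w: "\<And>i j x. i < n \<Longrightarrow> j < n \<Longrightarrow>
    (\<Sum>k<n. x (i * n + k) * x (n * n + (k * n + j))) = (\<Sum>q<cost p. w i j q * \<alpha> q x * \<beta> q x)"
    using multiplies_quadratic_rank[OF assms] by blast
  define L where "L = cost p"
  define X where "X c d i = (if i = c * n + d then 1 else 0 :: real)" for c d i
  define Y where "Y e f i = (if i = n * n + (e * n + f) then 1 else 0 :: real)" for e f i
  define u where "u q c d = (if q < L then \<alpha> q (X c d) else \<beta> (q - L) (X c d))" for q c d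
  define v where "v q e f = (if q < L then \<beta> q (Y e f) else \<alpha> (q - L) (Y e f))" for q e f
  define w' where "w' q a b = (if q < L then w a b q else w a b (q - L))" for q a b
  have inj: "i * n + j = k * n + l \<longleftrightarrow> i = k \<and> j = l" if "j < n" "l < n" for i j k l :: nat
  proof
    assume "i * n + j = k * n + l"
    then have "(i * n + j) div n = (k * n + l) div n" "(i * n + j) mod n = (k * n + l) mod n" by simp_all
    then show "i = k \<and> j = l" using that by simp
  qed simp
  have "(\<Sum>q<2 * cost p. w' q a b * u q c d * v q e f) = (if a = c \<and> d = e \<and> f = b then 1 else 0)"
    if lt: "a < n" "b < n" "c < n" "d < n" "e < n" "f < n" for a b c d e f
  proof -
    let ?x = "X c d" and ?y = "Y e f"
    have x0: "?x (n * n + k) = 0" for k using index_less[OF lt(3,4)] by (auto simp: X_def)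
    have y0: "?y (a * n + k) = 0" if "k < n" for k using index_less[OF lt(1) that] by (auto simp: Y_def)
    have x1: "?x (a * n + k) = (if a = c \<and> k = d then 1 else 0)" if "k < n" for k
      using inj[OF that lt(4)] by (simp add: X_def)
    have y1: "?y (n * n + (k * n + b)) = (if k = e \<and> b = f then 1 else 0)" for k
      using inj[OF lt(2,6)] by (simp add: Y_def)
    have lin_xy: "\<alpha> q (\<lambda>i. ?x i + ?y i) = \<alpha> q ?x + \<alpha> q ?y" "\<beta> q (\<lambda>i. ?x i + ?y i) = \<beta> q ?x + \<beta> q ?y" for q
      using ab by (simp_all only: lin_def)
    have polar: "(\<Sum>q<L. w a b q * \<alpha> q (\<lambda>i. ?x i + ?y i) * \<beta> q (\<lambda>i. ?x i + ?y i))
        = (\<Sum>q<L. w a b q * \<alpha> q ?x * \<beta> q ?x) + (\<Sum>q<L. w a b q * \<alpha> q ?y * \<beta> q ?y)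
          + (\<Sum>q<L. w a b q * (\<alpha> q ?x * \<beta> q ?y + \<alpha> q ?y * \<beta> q ?x))"
      unfolding lin_xy sum.distrib[symmetric]
      by (rule sum.cong[OF refl]) (simp add: distrib_left distrib_right mult.assoc)
    have "(\<Sum>q<L. w a b q * \<alpha> q ?x * \<beta> q ?x) = 0" "(\<Sum>q<L. w a b q * \<alpha> q ?y * \<beta> q ?y) = 0"
      unfolding L_def w[OF lt(1,2), symmetric] by (simp_all add: x0 y0)
    moreover have "(\<Sum>q<L. w a b q * \<alpha> q (\<lambda>i. ?x i + ?y i) * \<beta> q (\<lambda>i. ?x i + ?y i))
        = (\<Sum>k<n. if k = d then if a = c \<and> d = e \<and> f = b then 1 else 0 else 0)"
      unfolding L_def w[OF lt(1,2), symmetric] by (rule sum.cong) (auto simp: x0 y0 x1 y1)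
    ultimately have "(\<Sum>q<L. w a b q * (\<alpha> q ?x * \<beta> q ?y + \<alpha> q ?y * \<beta> q ?x)) = (if a = c \<and> d = e \<and> f = b then 1 else 0)"
      using lt(4) unfolding polar by simp
    moreover have "(\<Sum>q<L + L. w' q a b * u q c d * v q e f)
        = (\<Sum>q<L. w a b q * (\<alpha> q ?x * \<beta> q ?y + \<alpha> q ?y * \<beta> q ?x))"
      unfolding sum_lessThan_add sum.distrib[symmetric]
      by (rule sum.cong[OF refl]) (simp add: u_def v_def w'_def distrib_left mult.assoc mult.commute)
    ultimately show ?thesis by (simp add: L_def mult_2)
  qed
  then show ?thesis by blast
qed

lemma written_values:
  "Some ys \<in> outcomes 0 p s \<Longrightarrow> \<exists>W. finite W \<and> card W \<le> cost p \<and> set ys \<subseteq> range s \<union> W"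
proof (induction p arbitrary: s)
  case (Return rs)
  then show ?case by (intro exI[of _ "{}"]) auto
next
  case (Assign r f p)
  obtain v where v: "Some ys \<in> outcomes 0 p (s(r := v))"
    using Assign.prems by (auto split: option.splits)
  obtain W where W: "finite W" "card W \<le> cost p" "set ys \<subseteq> range (s(r := v)) \<union> W" using Assign.IH[OF v] by blast
  have "range (s(r := v)) \<subseteq> insert v (range s)" by auto
  then have "set ys \<subseteq> range s \<union> insert v W" using W(3) by blast
  moreover have "card (insert v W) \<le> cost (Assign r f p)" using W by (simp add: card_insert_if)
  ultimately show ?case using W(1) by blast
next
  case (IfLe i j p q)
  then have "Some ys \<in> outcomes 0 p s \<or> Some ys \<in> outcomes 0 q s" by (simp split: if_splits)
  then obtain W where "finite W" "card W \<le> cost p \<or> card W \<le> cost q" "set ys \<subseteq> range s \<union> W"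
    using IfLe.IH by blast
  then show ?case by (intro exI[of _ W]) auto
qed

lemma multiplies_cost:
  assumes "multiplies n p" "n \<ge> 2" shows "n * n \<le> cost p"
proof -
  define A where "A = mat n n (\<lambda>(i, k). if k = 0 then real (n * i) else if k = 1 then 1 / 4 else 0)"
  define B where "B = mat n n (\<lambda>(k, j). if k = 0 then 1 else if k = 1 then real (4 * j + 3) else 0)"
  have AB: "A \<in> carrier_mat n n" "B \<in> carrier_mat n n" by (simp_all add: A_def B_def)
  then have ABc: "A * B \<in> carrier_mat n n" by (rule mult_carrier_mat)
  have prod: "(A * B) $$ (i, j) = real (i * n + j) + 3 / 4" if "i < n" "j < n" for i j
  proof -
    have "(A * B) $$ (i, j) = (\<Sum>k<n. A $$ (i, k) * B $$ (k, j))"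
      using that AB by (simp add: A_def B_def scalar_prod_def lessThan_atLeast0)
    also have "\<dots> = (\<Sum>k\<in>{0, 1}. A $$ (i, k) * B $$ (k, j))"
      by (rule sum.mono_neutral_right) (use assms(2) that in \<open>auto simp: A_def B_def\<close>)
    also have "\<dots> = real (i * n + j) + 3 / 4"
      using assms(2) that by (simp add: A_def B_def algebra_simps)
    finally show ?thesis .
  qed
  have lt: "k div n < n" "k mod n < n" "k div n * n + k mod n = k" if "k < n * n" for k
    using that less_mult_imp_div_less[OF that] assms(2) by auto
  have E: "entries (A * B) = map (\<lambda>k. real k + 3 / 4) [0..<n * n]"
    unfolding entries_eq[OF ABc] by (rule map_cong[OF refl]) (simp only: lt prod set_upt atLeastLessThan_iff)
  have "Some (entries (A * B)) \<in> outcomes 0 p (load (entries A @ entries B))"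
    using assms(1) AB unfolding multiplies_def by blast
  then obtain W where W: "finite W" "card W \<le> cost p"
    "set (entries (A * B)) \<subseteq> range (load (entries A @ entries B)) \<union> W"
    using written_values by blast
  have Aval: "A $$ (i, j) \<in> \<int> \<union> {1 / 4}" if "i < n" "j < n" for i j
    using that unfolding A_def by (simp del: of_nat_mult)
  have Bval: "B $$ (i, j) \<in> \<int>" if "i < n" "j < n" for i j
    using that unfolding B_def by (simp del: of_nat_mult of_nat_add)
  have "set (entries A @ entries B) \<subseteq> \<int> \<union> {1 / 4}"
    unfolding entries_eq[OF AB(1)] entries_eq[OF AB(2)] set_append set_map
  proof (intro Un_least image_subsetI)
    fix k assume "k \<in> set [0..<n * n]"
    then have k: "k < n * n" by simp
    show "A $$ (k div n, k mod n) \<in> \<int> \<union> {1 / 4}" by (rule Aval[OF lt(1,2)[OF k]])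
    show "B $$ (k div n, k mod n) \<in> \<int> \<union> {1 / 4}" using Bval[OF lt(1,2)[OF k]] by blast
  qed
  then have "load (entries A @ entries B) k \<in> \<int> \<union> {1 / 4}" for k
    by (auto simp: load_def subset_iff simp del: set_append)
  then have R: "range (load (entries A @ entries B)) \<subseteq> \<int> \<union> {1 / 4}" by blast
  have notin: "real k + 3 / 4 \<notin> \<int> \<union> {1 / 4}" for k
  proof
    assume "real k + 3 / 4 \<in> \<int> \<union> {1 / 4}"
    then consider z where "real k + 3 / 4 = real_of_int z" | "real k + 3 / 4 = 1 / 4" by (auto elim: Ints_cases)
    then show False
    proof cases
      case 1
      then have "real_of_int (4 * int k + 3) = real_of_int (4 * z)" by simp
      then have "4 * int k + 3 = 4 * z" by (simp only: of_int_eq_iff)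
      then show False by presburger
    qed simp
  qed
  have "(\<lambda>k. real k + 3 / 4) ` {..<n * n} \<subseteq> W"
  proof (rule image_subsetI)
    fix k assume "k \<in> {..<n * n}"
    then have "real k + 3 / 4 \<in> set (entries (A * B))" unfolding E by simp
    then show "real k + 3 / 4 \<in> W" using W(3) R notin[of k] by blast
  qed
  then have "card ((\<lambda>k. real k + 3 / 4) ` {..<n * n}) \<le> card W" by (rule card_mono[OF W(1)])
  also have "card ((\<lambda>k. real k + 3 / 4) ` {..<n * n}) = n * n"
    by (subst card_image) (auto simp: inj_on_def)
  finally show ?thesis using W(2) by simp
qed

section \<open>Stable fast matrix multiplication\<close>

lemma rounding_product:
  assumes "\<bar>\<theta>\<bar> \<le> (1 + \<epsilon>) ^ m - 1" "\<bar>\<delta>\<bar> \<le> \<epsilon>"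
  shows "\<bar>(1 + \<theta>) * (1 + \<delta>) - 1\<bar> \<le> (1 + \<epsilon>) ^ Suc m - (1::real)"
proof -
  have "\<bar>(1 + \<theta>) * (1 + \<delta>) - 1\<bar> = \<bar>\<theta> * (1 + \<delta>) + \<delta>\<bar>" by (simp add: algebra_simps)
  also have "\<dots> \<le> \<bar>\<theta>\<bar> * \<bar>1 + \<delta>\<bar> + \<bar>\<delta>\<bar>" by (metis abs_mult abs_triangle_ineq)
  also have "\<dots> \<le> ((1 + \<epsilon>) ^ m - 1) * (1 + \<epsilon>) + \<epsilon>"
    by (intro add_mono mult_mono) (use assms in auto)
  finally show ?thesis by (simp add: algebra_simps)
qed

lemma rounding_mono:
  assumes "m \<le> k" "0 \<le> \<epsilon>" shows "(1 + \<epsilon>) ^ m - (1::real) \<le> (1 + \<epsilon>) ^ k - 1"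
  using power_increasing[OF assms(1), of "1 + \<epsilon>"] assms(2) by simp

lemma rounding_le:
  assumes "0 \<le> \<epsilon>" "\<epsilon> \<le> (1::real)" shows "(1 + \<epsilon>) ^ m - 1 \<le> 2 ^ m * \<epsilon>"
proof -
  have "(1 + \<epsilon>) ^ m - 1 \<le> (2 ^ m - 1) * \<epsilon>"
  proof (induction m)
    case (Suc m)
    have "(1 + \<epsilon>) ^ Suc m - 1 = ((1 + \<epsilon>) ^ m - 1) * (1 + \<epsilon>) + \<epsilon>" by (simp add: algebra_simps)
    also have "\<dots> \<le> (2 ^ m - 1) * \<epsilon> * (1 + \<epsilon>) + \<epsilon>" using Suc assms by (intro add_mono mult_right_mono) auto
    also have "\<dots> \<le> (2 ^ m - 1) * \<epsilon> * 2 + \<epsilon>" using assms by (intro add_mono mult_left_mono) auto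
    finally show ?case by (simp add: algebra_simps)
  qed simp
  then show ?thesis using assms by (simp add: algebra_simps)
qed

lemma computable_dot:
  "computable (2 * real T) (\<lambda>\<epsilon> x z. \<exists>\<theta>0 \<theta>. \<bar>\<theta>0\<bar> \<le> (1 + \<epsilon>) ^ Suc T - 1 \<and>
     (\<forall>t. \<bar>\<theta> t\<bar> \<le> (1 + \<epsilon>) ^ Suc T - 1) \<and>
     z = (\<lambda>_ :: unit. x (0 :: nat, 0 :: nat) * (1 + \<theta>0) - (\<Sum>t<T. x (1, t) * x (2, t) * (1 + \<theta> t))))"
proof (induction T)
  case 0
  show ?case
    by (rule computable_mono[OF computable_copy[of "\<lambda>_. (0, 0)"]]) (auto intro!: exI[of _ 0] exI[of _ "\<lambda>_. 0"])
next
  case (Suc T)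
  have m: "computable 1 (\<lambda>\<epsilon> y z. \<exists>\<delta>. \<bar>\<delta>\<bar> \<le> \<epsilon> \<and> z = (\<lambda>_::unit. y (Inl (1 :: nat, T)) * y (Inl (2, T)) * (1 + \<delta>)))"
    by (rule computable_mult)
  have s: "computable 1 (\<lambda>\<epsilon> y z. \<exists>\<delta>. \<bar>\<delta>\<bar> \<le> \<epsilon> \<and> z = (\<lambda>_::unit. (y (Inl (Inr ())) - y (Inr ())) * (1 + \<delta>)))"
    by (rule computable_sub)
  show ?case
  proof (rule computable_mono[OF computable_seq[OF computable_keep[OF Suc.IH] computable_seq[OF computable_keep[OF m] s]]])
    fix \<epsilon> :: real and x :: "nat \<times> nat \<Rightarrow> real" and z :: "unit \<Rightarrow> real"
    assume e: "0 \<le> \<epsilon>" "\<epsilon> \<le> 1 / 2"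
    assume "\<exists>y. ((\<exists>\<theta>0 \<theta>. \<bar>\<theta>0\<bar> \<le> (1 + \<epsilon>) ^ Suc T - 1 \<and>
        (\<forall>t. \<bar>\<theta> t\<bar> \<le> (1 + \<epsilon>) ^ Suc T - 1) \<and>
        (\<lambda>j. y (Inr j)) = (\<lambda>_. x (0, 0) * (1 + \<theta>0) - (\<Sum>t<T. x (1, t) * x (2, t) * (1 + \<theta> t)))) \<and>
        (\<lambda>i. y (Inl i)) = x) \<and>
      (\<exists>ya. ((\<exists>\<delta>. \<bar>\<delta>\<bar> \<le> \<epsilon> \<and> (\<lambda>j. ya (Inr j)) = (\<lambda>_. y (Inl (1, T)) * y (Inl (2, T)) * (1 + \<delta>))) \<and>
         (\<lambda>i. ya (Inl i)) = y) \<and>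
         (\<exists>\<delta>. \<bar>\<delta>\<bar> \<le> \<epsilon> \<and> z = (\<lambda>_. (ya (Inl (Inr ())) - ya (Inr ())) * (1 + \<delta>))))"
    then obtain y ya \<theta>0 \<theta> \<delta> \<delta>'
      where acc: "(\<lambda>j. y (Inr j)) = (\<lambda>_. x (0, 0) * (1 + \<theta>0) - (\<Sum>t<T. x (1, t) * x (2, t) * (1 + \<theta> t)))"
      and x: "(\<lambda>i. y (Inl i)) = x"
      and p: "(\<lambda>j. ya (Inr j)) = (\<lambda>_. y (Inl (1, T)) * y (Inl (2, T)) * (1 + \<delta>))"
      and y: "(\<lambda>i. ya (Inl i)) = y"
      and z: "z = (\<lambda>_. (ya (Inl (Inr ())) - ya (Inr ())) * (1 + \<delta>'))"
      and \<theta>: "\<bar>\<theta>0\<bar> \<le> (1 + \<epsilon>) ^ Suc T - 1" "\<forall>t. \<bar>\<theta> t\<bar> \<le> (1 + \<epsilon>) ^ Suc T - 1"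
      and \<delta>: "\<bar>\<delta>\<bar> \<le> \<epsilon>" "\<bar>\<delta>'\<bar> \<le> \<epsilon>" by (elim exE conjE) (rule that; assumption)
    let ?k0 = "(1 + \<theta>0) * (1 + \<delta>') - 1"
    let ?\<theta> = "\<lambda>t. if t < T then (1 + \<theta> t) * (1 + \<delta>') - 1 else (1 + \<delta>) * (1 + \<delta>') - 1"
    have 1: "\<bar>?k0\<bar> \<le> (1 + \<epsilon>) ^ Suc (Suc T) - 1" by (rule rounding_product[OF \<theta>(1) \<delta>(2)])
    have 2: "\<bar>?\<theta> t\<bar> \<le> (1 + \<epsilon>) ^ Suc (Suc T) - 1" for t
    proof (cases "t < T")
      case True
      then show ?thesis using rounding_product[OF spec[OF \<theta>(2), of t] \<delta>(2)] by simp
    next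
      case False
      have "\<bar>\<delta>\<bar> \<le> (1 + \<epsilon>) ^ Suc T - 1"
        using \<delta>(1) rounding_mono[of 1 "Suc T" \<epsilon>] e(1) by simp
      then show ?thesis using rounding_product[of \<delta> \<epsilon> "Suc T" \<delta>'] \<delta>(2) False by simp
    qed
    have ya: "ya (Inl (Inr ())) = y (Inr ())" "ya (Inr ()) = x (1, T) * x (2, T) * (1 + \<delta>)"
      using fun_cong[OF y] fun_cong[OF p] fun_cong[OF x] by simp_all
    have "(ya (Inl (Inr ())) - ya (Inr ())) * (1 + \<delta>')
        = x (0, 0) * (1 + \<theta>0) * (1 + \<delta>') - (\<Sum>t<T. x (1, t) * x (2, t) * (1 + \<theta> t)) * (1 + \<delta>')
          - x (1, T) * x (2, T) * ((1 + \<delta>) * (1 + \<delta>'))"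
      unfolding ya fun_cong[OF acc] by (simp add: left_diff_distrib mult.assoc)
    also have "\<dots> = x (0, 0) * (1 + ?k0) - (\<Sum>t<Suc T. x (1, t) * x (2, t) * (1 + ?\<theta> t))"
      by (simp add: sum_distrib_right mult.assoc)
    finally have "z = (\<lambda>_. x (0, 0) * (1 + ?k0) - (\<Sum>t<Suc T. x (1, t) * x (2, t) * (1 + ?\<theta> t)))"
      unfolding z by (rule ext)
    then show "\<exists>\<theta>0 \<theta>. \<bar>\<theta>0\<bar> \<le> (1 + \<epsilon>) ^ Suc (Suc T) - 1 \<and>
     (\<forall>t. \<bar>\<theta> t\<bar> \<le> (1 + \<epsilon>) ^ Suc (Suc T) - 1) \<and>
     z = (\<lambda>_. x (0, 0) * (1 + \<theta>0) - (\<Sum>t<Suc T. x (1, t) * x (2, t) * (1 + \<theta> t)))"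
      using 1 2 by (intro exI[of _ ?k0] exI[of _ ?\<theta>]) blast
  qed simp
qed

text \<open>A linear combination with constant coefficients, which are themselves rounded.\<close>

lemma computable_lincomb:
  "computable (3 * real T + 1) (\<lambda>\<epsilon> x z. \<exists>\<theta>. (\<forall>t. \<bar>\<theta> t\<bar> \<le> 2 ^ (T + 2) * \<epsilon>) \<and>
     z = (\<lambda>_ :: unit. \<Sum>t<T. u t * x t * (1 + \<theta> t)))"
proof -
  define c where "c t = (if t < T then - u t else 0)" for t
  have 1: "computable (\<Sum>t\<in>{..T}. 1) (\<lambda>\<epsilon> x z. \<forall>t\<in>{..T}. \<exists>\<delta>. \<bar>\<delta>\<bar> \<le> \<epsilon> \<and> (\<lambda>a. z (t, a)) = (\<lambda>_::unit. c t * (1 + \<delta>)))"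
    by (rule computable_family) (auto intro: computable_const)
  let ?f = "\<lambda>(i, t). if i = (0::nat) then Inr (T, ()) else if i = 1 then Inr (t, ()) else Inl t"
  show ?thesis
  proof (rule computable_mono[OF computable_seq[OF computable_keep[OF 1] computable_in[OF computable_dot[of T], of ?f]]])
    fix \<epsilon> :: real and x :: "nat \<Rightarrow> real" and z :: "unit \<Rightarrow> real"
    assume e: "0 \<le> \<epsilon>" "\<epsilon> \<le> 1 / 2"
    assume "\<exists>y. ((\<forall>t\<in>{..T}. \<exists>\<delta>. \<bar>\<delta>\<bar> \<le> \<epsilon> \<and> (\<lambda>a. y (Inr (t, a))) = (\<lambda>_. c t * (1 + \<delta>))) \<and> (\<lambda>i. y (Inl i)) = x) \<and>
      (\<exists>\<theta>0 \<theta>. \<bar>\<theta>0\<bar> \<le> (1 + \<epsilon>) ^ Suc T - 1 \<and> (\<forall>t. \<bar>\<theta> t\<bar> \<le> (1 + \<epsilon>) ^ Suc T - 1) \<and>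
       z = (\<lambda>_. y (?f (0, 0)) * (1 + \<theta>0) - (\<Sum>t<T. y (?f (1, t)) * y (?f (2, t)) * (1 + \<theta> t))))"
    then obtain y \<theta>0 \<theta> where z: "z = (\<lambda>_. y (?f (0, 0)) * (1 + \<theta>0) - (\<Sum>t<T. y (?f (1, t)) * y (?f (2, t)) * (1 + \<theta> t)))"
      and y: "\<forall>t\<in>{..T}. \<exists>\<delta>. \<bar>\<delta>\<bar> \<le> \<epsilon> \<and> (\<lambda>a. y (Inr (t, a))) = (\<lambda>_. c t * (1 + \<delta>))"
      and x: "(\<lambda>i. y (Inl i)) = x" and \<theta>: "\<forall>t. \<bar>\<theta> t\<bar> \<le> (1 + \<epsilon>) ^ Suc T - 1"
      by (elim exE conjE) (rule that; assumption)
    have "\<exists>\<delta>. \<bar>\<delta>\<bar> \<le> \<epsilon> \<and> y (Inr (t, ())) = c t * (1 + \<delta>)" if "t \<le> T" for t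
    proof -
      from y that obtain \<delta> where "\<bar>\<delta>\<bar> \<le> \<epsilon>" "(\<lambda>a. y (Inr (t, a))) = (\<lambda>_. c t * (1 + \<delta>))" by auto
      then show ?thesis using fun_cong[of "\<lambda>a. y (Inr (t, a))" "\<lambda>_. c t * (1 + \<delta>)" "()"] by (intro exI[of _ \<delta>]) simp
    qed
    then obtain \<delta> where \<delta>: "\<And>t. t \<le> T \<Longrightarrow> \<bar>\<delta> t\<bar> \<le> \<epsilon> \<and> y (Inr (t, ())) = c t * (1 + \<delta> t)" by metis
    have x': "y (Inl t) = x t" for t using fun_cong[OF x] by simp
    let ?\<theta> = "\<lambda>t. if t < T then (1 + \<theta> t) * (1 + \<delta> t) - 1 else 0"
    have t: "\<bar>?\<theta> t\<bar> \<le> (1 + \<epsilon>) ^ Suc (Suc T) - 1" for t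
    proof (cases "t < T")
      case True
      then show ?thesis using rounding_product[OF spec[OF \<theta>, of t], of "\<delta> t"] \<delta>[of t] by simp
    next
      case False
      then show ?thesis using rounding_mono[of 0 "Suc (Suc T)" \<epsilon>] e(1) by simp
    qed
    have b: "\<bar>?\<theta> t\<bar> \<le> 2 ^ (T + 2) * \<epsilon>" for t
      using order_trans[OF t[of t] rounding_le[of \<epsilon> "Suc (Suc T)"]] e by simp
    have "y (?f (0, 0)) = 0" using \<delta>[of T] by (simp add: c_def)
    moreover have "y (?f (1, t)) * y (?f (2, t)) * (1 + \<theta> t) = - (u t * x t * (1 + ?\<theta> t))" if "t < T" for t
      using \<delta>[of t] that by (simp add: c_def x')
    ultimately have "z = (\<lambda>_. \<Sum>t<T. u t * x t * (1 + ?\<theta> t))"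
      unfolding z by (simp add: sum_negf)
    then show "\<exists>\<theta>. (\<forall>t. \<bar>\<theta> t\<bar> \<le> 2 ^ (T + 2) * \<epsilon>) \<and> z = (\<lambda>_. \<Sum>t<T. u t * x t * (1 + \<theta> t))"
      using b by (intro exI[of _ ?\<theta>]) blast
  qed simp
qed

definition mm_kernel :: "nat \<Rightarrow> real \<Rightarrow> real \<Rightarrow> bool" where
  "mm_kernel n C \<mu> \<longleftrightarrow> computable C (\<lambda>\<epsilon> x z.
     norm (mk n n z - mk n n (\<lambda>p. x (False, p)) * mk n n (\<lambda>p. x (True, p)))
       \<le> \<mu> * \<epsilon> * (norm (mk n n (\<lambda>p. x (False, p))) * norm (mk n n (\<lambda>p. x (True, p)))))"

lemma norm_mk_1: "norm (mk (Suc 0) (Suc 0) f) = \<bar>f (0, 0)\<bar>"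
proof -
  have "(norm (mk (Suc 0) (Suc 0) f))\<^sup>2 = \<bar>f (0, 0)\<bar>\<^sup>2" by (simp add: norm_fm_sq[OF dims_mk])
  then show ?thesis by (simp only: power2_eq_iff_nonneg norm_ge_zero abs_ge_zero)
qed

lemma mm_kernel_1: "mm_kernel 1 1 1"
  unfolding mm_kernel_def
proof (rule computable_mono[OF computable_mult[of "(False, 0, 0)" "(True, 0, 0)"]])
  fix \<epsilon> :: real and x :: "bool \<times> nat \<times> nat \<Rightarrow> real" and z :: "nat \<times> nat \<Rightarrow> real"
  assume "\<exists>\<delta>. \<bar>\<delta>\<bar> \<le> \<epsilon> \<and> z = (\<lambda>_. x (False, 0, 0) * x (True, 0, 0) * (1 + \<delta>))"
  then obtain \<delta> where \<delta>: "\<bar>\<delta>\<bar> \<le> \<epsilon>" "z = (\<lambda>_. x (False, 0, 0) * x (True, 0, 0) * (1 + \<delta>))" by blast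
  have "mk 1 1 z - mk 1 1 (\<lambda>p. x (False, p)) * mk 1 1 (\<lambda>p. x (True, p)) = mk 1 1 (\<lambda>_. \<delta> * (x (False, 0, 0) * x (True, 0, 0)))"
    by (rule fm_eqI) (simp add: entry_mult[OF dims_mk] \<delta>(2) algebra_simps)
  then show "norm (mk 1 1 z - mk 1 1 (\<lambda>p. x (False, p)) * mk 1 1 (\<lambda>p. x (True, p)))
       \<le> 1 * \<epsilon> * (norm (mk 1 1 (\<lambda>p. x (False, p))) * norm (mk 1 1 (\<lambda>p. x (True, p))))"
    using \<delta>(1) by (simp add: norm_mk_1 abs_mult mult_right_mono)
qed simp

lemma mm_rect:
  fixes f g :: "nat \<times> nat \<Rightarrow> 'i"
  assumes mm: "mm_kernel N C \<mu>" and le: "p \<le> N" "q \<le> N" "r \<le> N"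
  shows "computable (C + 1) (\<lambda>\<epsilon> x z.
    norm (mk p r z - mk p q (\<lambda>a. x (f a)) * mk q r (\<lambda>a. x (g a)))
       \<le> \<mu> * \<epsilon> * (norm (mk p q (\<lambda>a. x (f a))) * norm (mk q r (\<lambda>a. x (g a)))))"
proof -
  have c: "computable 1 (\<lambda>\<epsilon> (x :: 'i \<Rightarrow> real) z. \<exists>\<delta>. \<bar>\<delta>\<bar> \<le> \<epsilon> \<and> z = (\<lambda>_::unit. 0 * (1 + \<delta>)))"
    by (rule computable_const)
  let ?h = "\<lambda>(b, i, j). if b then (if i < q \<and> j < r then Inl (g (i, j)) else Inr ())
     else (if i < p \<and> j < q then Inl (f (i, j)) else Inr ())"
  show ?thesis
  proof (rule computable_mono[OF computable_seq[OF computable_keep[OF c] computable_in[OF mm[unfolded mm_kernel_def], of ?h]]])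
    fix \<epsilon> :: real and x :: "'i \<Rightarrow> real" and z :: "nat \<times> nat \<Rightarrow> real"
    assume "\<exists>y. ((\<exists>\<delta>. \<bar>\<delta>\<bar> \<le> \<epsilon> \<and> (\<lambda>j. y (Inr j)) = (\<lambda>_. 0 * (1 + \<delta>))) \<and> (\<lambda>i. y (Inl i)) = x) \<and>
       norm (mk N N z - mk N N (\<lambda>p. y (?h (False, p))) * mk N N (\<lambda>p. y (?h (True, p))))
       \<le> \<mu> * \<epsilon> * (norm (mk N N (\<lambda>p. y (?h (False, p)))) * norm (mk N N (\<lambda>p. y (?h (True, p)))))"
    then obtain y where y0: "\<exists>\<delta>. \<bar>\<delta>\<bar> \<le> \<epsilon> \<and> (\<lambda>j. y (Inr j)) = (\<lambda>_::unit. 0 * (1 + \<delta>))" and x: "(\<lambda>i. y (Inl i)) = x"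
      and n: "norm (mk N N z - mk N N (\<lambda>p. y (?h (False, p))) * mk N N (\<lambda>p. y (?h (True, p))))
       \<le> \<mu> * \<epsilon> * (norm (mk N N (\<lambda>p. y (?h (False, p)))) * norm (mk N N (\<lambda>p. y (?h (True, p)))))" by blast
    have y: "y (Inr ()) = 0" "y (Inl i) = x i" for i
      using y0 fun_cong[OF x] by (auto simp: fun_eq_iff)
    have A: "mk N N (\<lambda>p. y (?h (False, p))) = mk p q (\<lambda>a. x (f a))"
      by (rule fm_eqI) (use le y in auto)
    have B: "mk N N (\<lambda>p. y (?h (True, p))) = mk q r (\<lambda>a. x (g a))"
      by (rule fm_eqI) (use le y in auto)
    let ?P = "mk p q (\<lambda>a. x (f a)) * mk q r (\<lambda>a. x (g a))"
    have P: "dims p r ?P" by (rule dims_mult[OF dims_mk dims_mk])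
    have "norm (mk p r z - ?P) \<le> norm (mk N N z - ?P)"
    proof (rule norm_le_entries)
      fix i j
      show "\<bar>entry (mk p r z - ?P) i j\<bar> \<le> \<bar>entry (mk N N z - ?P) i j\<bar>"
        using le dims_entry0[OF P, of i j] by (cases "i < p \<and> j < r") auto
    qed
    then show "norm (mk p r z - ?P) \<le> \<mu> * \<epsilon> * (norm (mk p q (\<lambda>a. x (f a))) * norm (mk q r (\<lambda>a. x (g a))))"
      using n unfolding A B by simp
  qed simp
qed

lemma mm_kernel_mono: "mm_kernel N C \<mu> \<Longrightarrow> n \<le> N \<Longrightarrow> mm_kernel n (C + 1) \<mu>"
  unfolding mm_kernel_def[of n] by (rule mm_rect)

lemma mm_kernel_mono_bounds:
  assumes "mm_kernel n C \<mu>" "C \<le> C'" "\<mu> \<le> \<mu>'" shows "mm_kernel n C' \<mu>'"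
  unfolding mm_kernel_def
  by (rule computable_mono[OF assms(1)[unfolded mm_kernel_def] assms(2)])
    (meson assms(3) mult_nonneg_nonneg mult_right_mono norm_ge_zero order_trans)

lemma sum_div_mod:
  fixes f :: "nat \<Rightarrow> nat \<Rightarrow> 'a :: comm_monoid_add"
  shows "(\<Sum>k<n * m. f (k div m) (k mod m)) = (\<Sum>i<n. \<Sum>j<m. f i j)"
proof (induction n)
  case (Suc n)
  have add: "(\<Sum>k<l + m. g k) = (\<Sum>k<l. g k) + (\<Sum>k<m. g (l + k))" for g :: "nat \<Rightarrow> 'a" and l
    by (induction m) (auto simp: add.assoc)
  have "(\<Sum>k<n * m + m. f (k div m) (k mod m)) = (\<Sum>k<n * m. f (k div m) (k mod m)) + (\<Sum>j<m. f n j)"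
    unfolding add by (intro arg_cong2[of _ _ _ _ "(+)"] sum.cong refl) auto
  then show ?case using Suc by (simp add: add.commute)
qed simp

lemma norm_gather_le:
  assumes "inj_on f {..<p}" "inj_on g {..<q}"
  shows "norm (mk p q (\<lambda>(i, j). entry X (f i) (g j))) \<le> norm X"
proof -
  obtain N where N: "dims N N X" by (rule dims_common)
  define M where "M = N + (\<Sum>i<p. f i + 1) + (\<Sum>j<q. g j + 1)"
  have M: "dims M M X" by (rule dims_mono[OF N]) (simp_all add: M_def)
  have f: "f ` {..<p} \<subseteq> {..<M}" "g ` {..<q} \<subseteq> {..<M}"
  proof -
    have "f i + 1 \<le> (\<Sum>i<p. f i + 1)" if "i < p" for i
      by (rule member_le_sum[of i _ "\<lambda>i. f i + 1"]) (use that in auto)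
    then show "f ` {..<p} \<subseteq> {..<M}" by (fastforce simp: M_def)
    have "g i + 1 \<le> (\<Sum>i<q. g i + 1)" if "i < q" for i
      by (rule member_le_sum[of i _ "\<lambda>i. g i + 1"]) (use that in auto)
    then show "g ` {..<q} \<subseteq> {..<M}" by (fastforce simp: M_def)
  qed
  have "(norm (mk p q (\<lambda>(i, j). entry X (f i) (g j))))\<^sup>2 = (\<Sum>i<p. \<Sum>j<q. (entry X (f i) (g j))\<^sup>2)"
    by (simp add: norm_fm_sq[OF dims_mk])
  also have "\<dots> = (\<Sum>i\<in>f ` {..<p}. \<Sum>j\<in>g ` {..<q}. (entry X i j)\<^sup>2)"
    by (simp add: sum.reindex[OF assms(1)] sum.reindex[OF assms(2)] o_def)
  also have "\<dots> \<le> (\<Sum>i<M. \<Sum>j\<in>g ` {..<q}. (entry X i j)\<^sup>2)"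
    by (rule sum_mono2) (use f in \<open>auto intro: sum_nonneg\<close>)
  also have "\<dots> \<le> (\<Sum>i<M. \<Sum>j<M. (entry X i j)\<^sup>2)"
    by (intro sum_mono sum_mono2) (use f in auto)
  also have "\<dots> = (norm X)\<^sup>2" by (rule norm_fm_sq[OF M, symmetric])
  finally show ?thesis by (rule power2_le_imp_le) simp
qed

definition blk :: "nat \<Rightarrow> fm \<Rightarrow> nat \<Rightarrow> nat \<Rightarrow> fm" where
  "blk m X a b = mk m m (\<lambda>(i, j). entry X (a * m + i) (b * m + j))"

lemma norm_blk_le: "norm (blk m X a b) \<le> norm X"
  unfolding blk_def by (rule norm_gather_le) (auto simp: inj_on_def)

lemma entry_blk: "entry (blk m X a b) i j = (if i < m \<and> j < m then entry X (a * m + i) (b * m + j) else 0)"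
  by (simp add: blk_def)

lemma blk_mult:
  assumes "dims l (n * m) X"
  shows "blk m (X * Y) a b = (\<Sum>c<n. blk m X a c * blk m Y c b)"
proof (rule fm_eqI)
  fix i j
  show "entry (blk m (X * Y) a b) i j = entry (\<Sum>c<n. blk m X a c * blk m Y c b) i j"
  proof (cases "i < m \<and> j < m")
    case True
    have "(\<Sum>k<n * m. entry X (a * m + i) k * entry Y k (b * m + j))
       = (\<Sum>k<n * m. entry X (a * m + i) (k div m * m + k mod m) * entry Y (k div m * m + k mod m) (b * m + j))" by simp
    also have "\<dots> = (\<Sum>c<n. \<Sum>k<m. entry X (a * m + i) (c * m + k) * entry Y (c * m + k) (b * m + j))"
      by (rule sum_div_mod[of "\<lambda>c k. entry X (a * m + i) (c * m + k) * entry Y (c * m + k) (b * m + j)"])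
    finally show ?thesis using True
      by (simp add: entry_blk entry_mult[OF assms] entry_mult[of m m] blk_def[of m X] blk_def[of m Y])
  next
    case False
    have "dims m m (blk m X a c * blk m Y c b)" for c
      unfolding blk_def by (rule dims_mult[OF dims_mk dims_mk])
    then show ?thesis using False dims_entry0[of m m] by (auto simp: entry_blk not_less)
  qed
qed

lemma norm_le_blocks:
  assumes "dims (n * m) (n * m) Z" "\<And>a b. a < n \<Longrightarrow> b < n \<Longrightarrow> norm (blk m Z a b) \<le> \<beta>" "0 \<le> \<beta>"
  shows "norm Z \<le> real n * \<beta>"
proof -
  have "(norm Z)\<^sup>2 = (\<Sum>k<n * m. \<Sum>l<n * m. (entry Z (k div m * m + k mod m) (l div m * m + l mod m))\<^sup>2)"
    by (simp add: norm_fm_sq[OF assms(1)])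
  also have "\<dots> = (\<Sum>k<n * m. \<Sum>b<n. \<Sum>j<m. (entry Z (k div m * m + k mod m) (b * m + j))\<^sup>2)"
    by (intro sum.cong refl sum_div_mod[of "\<lambda>b j. (entry Z _ (b * m + j))\<^sup>2"])
  also have "\<dots> = (\<Sum>a<n. \<Sum>i<m. \<Sum>b<n. \<Sum>j<m. (entry Z (a * m + i) (b * m + j))\<^sup>2)"
    by (rule sum_div_mod[of "\<lambda>a i. \<Sum>b<n. \<Sum>j<m. (entry Z (a * m + i) (b * m + j))\<^sup>2"])
  also have "\<dots> = (\<Sum>a<n. \<Sum>b<n. (norm (blk m Z a b))\<^sup>2)"
    by (rule sum.cong[OF refl], subst sum.swap) (simp add: norm_fm_sq[OF dims_mk] blk_def)
  also have "\<dots> \<le> (\<Sum>a<n. \<Sum>b<n. \<beta>\<^sup>2)"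
    by (intro sum_mono power_mono assms(2)) auto
  also have "\<dots> = (real n * \<beta>)\<^sup>2" by (simp add: power_mult_distrib power2_eq_square)
  finally show ?thesis by (rule power2_le_imp_le) (use assms(3) in simp)
qed

definition bilinear_mm :: "nat \<Rightarrow> nat \<Rightarrow> (nat \<Rightarrow> nat \<Rightarrow> nat \<Rightarrow> real) \<Rightarrow> (nat \<Rightarrow> nat \<Rightarrow> nat \<Rightarrow> real) \<Rightarrow>
    (nat \<Rightarrow> nat \<Rightarrow> nat \<Rightarrow> real) \<Rightarrow> bool" where
  "bilinear_mm n r u v w \<longleftrightarrow> (\<forall>a<n. \<forall>b<n. \<forall>c<n. \<forall>d<n. \<forall>e<n. \<forall>f<n.
    (\<Sum>q<r. w q a b * u q c d * v q e f) = (if a = c \<and> d = e \<and> f = b then 1 else 0))"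

lemma bilinear_mm_apply:
  fixes X Y :: "nat \<Rightarrow> nat \<Rightarrow> 'a :: real_algebra"
  assumes "bilinear_mm n r u v w" "a < n" "b < n"
  shows "(\<Sum>q<r. w q a b *\<^sub>R ((\<Sum>c<n. \<Sum>d<n. u q c d *\<^sub>R X c d) * (\<Sum>e<n. \<Sum>f<n. v q e f *\<^sub>R Y e f)))
    = (\<Sum>k<n. X a k * Y k b)"
proof -
  let ?P = "{..<n} \<times> {..<n}"
  have pairs: "(\<Sum>c<n. \<Sum>d<n. f c d *\<^sub>R Z c d) = (\<Sum>s\<in>?P. f (fst s) (snd s) *\<^sub>R Z (fst s) (snd s))"
    for f and Z :: "nat \<Rightarrow> nat \<Rightarrow> 'a" by (simp add: sum.cartesian_product split_def)
  have "(\<Sum>q<r. w q a b *\<^sub>R ((\<Sum>c<n. \<Sum>d<n. u q c d *\<^sub>R X c d) * (\<Sum>e<n. \<Sum>f<n. v q e f *\<^sub>R Y e f)))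
    = (\<Sum>q<r. \<Sum>s\<in>?P. \<Sum>t\<in>?P. (w q a b * u q (fst s) (snd s) * v q (fst t) (snd t)) *\<^sub>R (X (fst s) (snd s) * Y (fst t) (snd t)))"
    unfolding pairs sum_product by (simp add: scaleR_sum_right ac_simps)
  also have "\<dots> = (\<Sum>s\<in>?P. \<Sum>t\<in>?P. \<Sum>q<r. (w q a b * u q (fst s) (snd s) * v q (fst t) (snd t)) *\<^sub>R (X (fst s) (snd s) * Y (fst t) (snd t)))"
    by (subst sum.swap, rule sum.cong[OF refl], rule sum.swap)
  also have "\<dots> = (\<Sum>s\<in>?P. \<Sum>t\<in>?P. (if a = fst s \<and> snd s = fst t \<and> snd t = b then 1 else 0) *\<^sub>R (X (fst s) (snd s) * Y (fst t) (snd t)))"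
    by (intro sum.cong refl) (use assms in \<open>auto simp: scaleR_left.sum[symmetric] bilinear_mm_def\<close>)
  also have "\<dots> = (\<Sum>c<n. \<Sum>d<n. \<Sum>e<n. \<Sum>f<n. if f = b then if e = d then if c = a then X c d * Y e f else 0 else 0 else 0)"
    unfolding sum.cartesian_product' by (intro sum.cong refl) auto
  also have "\<dots> = (\<Sum>c<n. if c = a then (\<Sum>d<n. X c d * Y d b) else 0)"
    using assms(3) by (intro sum.cong refl) auto
  also have "\<dots> = (\<Sum>k<n. X a k * Y k b)" using assms(2) by simp
  finally show ?thesis .
qed


lemma bilinear_mm_step:
  assumes bil: "bilinear_mm n r u v w" and n: "n \<ge> 1"
  defines "K \<equiv> 2 * real r * (3 * real (n * n) + 1) + real (n * n) * (3 * real r + 1)"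
  shows "\<exists>D\<ge>1. \<forall>m C \<mu>. mm_kernel m C \<mu> \<longrightarrow> 0 \<le> \<mu> \<longrightarrow>
    mm_kernel (n * m) (real r * C + K * real (m * m)) (D * (\<mu> + 1))"
proof -
  define T where "T = n * n"
  define U where "U = 1 + (\<Sum>q<r. \<Sum>c<n. \<Sum>d<n. \<bar>u q c d\<bar> + \<bar>v q c d\<bar> + \<bar>w q c d\<bar>)"
  have U1: "U \<ge> 1" unfolding U_def by (simp add: sum_nonneg)
  have U: "\<bar>u q c d\<bar> \<le> U" "\<bar>v q c d\<bar> \<le> U" "\<bar>w q c d\<bar> \<le> U" if lt: "q < r" "c < n" "d < n" for q c d
  proof -
    let ?s = "\<lambda>q c d. \<bar>u q c d\<bar> + \<bar>v q c d\<bar> + \<bar>w q c d\<bar>"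
    have "?s q c d \<le> (\<Sum>d<n. ?s q c d)" by (rule member_le_sum[of d _ "?s q c"]) (use lt in auto)
    also have "\<dots> \<le> (\<Sum>c<n. \<Sum>d<n. ?s q c d)"
      by (rule member_le_sum[of c _ "\<lambda>c. \<Sum>d<n. ?s q c d"]) (use lt in \<open>auto intro!: sum_nonneg add_nonneg_nonneg\<close>)
    also have "\<dots> \<le> (\<Sum>q<r. \<Sum>c<n. \<Sum>d<n. ?s q c d)"
      by (rule member_le_sum[of q _ "\<lambda>q. \<Sum>c<n. \<Sum>d<n. ?s q c d"]) (use lt in \<open>auto intro!: sum_nonneg add_nonneg_nonneg\<close>)
    finally have "?s q c d \<le> U" by (simp add: U_def)
    then show "\<bar>u q c d\<bar> \<le> U" "\<bar>v q c d\<bar> \<le> U" "\<bar>w q c d\<bar> \<le> U" by linarith+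
  qed
  define \<gamma> :: real where "\<gamma> = 2 ^ (T + 2) + 2 ^ (r + 2)"
  have \<gamma>: "\<gamma> \<ge> 0" "2 ^ (T + 2) \<le> \<gamma>" "2 ^ (r + 2) \<le> \<gamma>" by (simp_all add: \<gamma>_def)
  define k where "k = real T * U * (1 + \<gamma>)"
  have "1 * 1 \<le> n * n" using n by (intro mult_le_mono)
  then have T1: "real T \<ge> 1" unfolding T_def by linarith
  have k: "k \<ge> 0" "real T * U \<le> k" "real T * U * \<gamma> \<le> k" using T1 U1 \<gamma>(1)
    by (auto simp: k_def algebra_simps)
  define D where "D = 1 + 5 * real n * (real r * U * (1 + \<gamma>) * k\<^sup>2)"
  have "D \<ge> 1" using U1 \<gamma>(1) by (simp add: D_def)
  moreover have "mm_kernel (n * m) (real r * C + K * real (m * m)) (D * (\<mu> + 1))"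
    if mm: "mm_kernel m C \<mu>" and \<mu>: "0 \<le> \<mu>" for m C \<mu>
  proof -
    define coef where "coef b q t = (if b then v q (t div n) (t mod n) else u q (t div n) (t mod n))" for b q t
    define J where "J = (UNIV :: bool set) \<times> {..<r} \<times> {..<m} \<times> {..<m}"
    define R1 where "R1 = (\<lambda>(b, q, i, j) (\<epsilon> :: real) (x :: bool \<times> nat \<times> nat \<Rightarrow> real) z.
      \<exists>\<theta>. (\<forall>t. \<bar>\<theta> t\<bar> \<le> 2 ^ (T + 2) * \<epsilon>) \<and>
     z = (\<lambda>_ :: unit. \<Sum>t<T. coef b q t * x (b, t div n * m + i, t mod n * m + j) * (1 + \<theta> t)))"
    have 1: "computable (\<Sum>p\<in>J. 3 * real T + 1) (\<lambda>\<epsilon> x z. \<forall>p\<in>J. R1 p \<epsilon> x (\<lambda>a. z (p, a)))"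
    proof (rule computable_family)
      show "finite J" by (simp add: J_def)
      fix p assume "p \<in> J"
      obtain b q i j where p: "p = (b, q, i, j)" by (cases p) auto
      show "computable (3 * real T + 1) (R1 p)"
        unfolding p R1_def prod.case
        by (rule computable_in[OF computable_lincomb[of T "coef b q"], of "\<lambda>t. (b, t div n * m + i, t mod n * m + j)"])
    qed
    define R2 where "R2 q \<epsilon> y z \<longleftrightarrow>
       norm (mk m m z - mk m m (\<lambda>p. y ((False, q, p), ())) * mk m m (\<lambda>p. y ((True, q, p), ())))
       \<le> \<mu> * \<epsilon> * (norm (mk m m (\<lambda>p. y ((False, q, p), ()))) * norm (mk m m (\<lambda>p. y ((True, q, p), ()))))"
      for q \<epsilon> and y :: "(bool \<times> nat \<times> nat \<times> nat) \<times> unit \<Rightarrow> real" and z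
    have 2: "computable (\<Sum>q\<in>{..<r}. C) (\<lambda>\<epsilon> y z. \<forall>q\<in>{..<r}. R2 q \<epsilon> y (\<lambda>a. z (q, a)))"
    proof (rule computable_family)
      fix q
      show "computable C (R2 q)" unfolding R2_def
        using computable_in[OF mm[unfolded mm_kernel_def], of "\<lambda>(b, p). ((b, q, p), ())"] by simp
    qed simp
    define R3 where "R3 = (\<lambda>(i, j) (\<epsilon> :: real) (y :: nat \<times> nat \<times> nat \<Rightarrow> real) z.
      \<exists>\<theta>. (\<forall>q. \<bar>\<theta> q\<bar> \<le> 2 ^ (r + 2) * \<epsilon>) \<and>
     z = (\<lambda>_ :: unit. \<Sum>q<r. w q (i div m) (j div m) * y (q, i mod m, j mod m) * (1 + \<theta> q)))"
    have 3: "computable (\<Sum>p\<in>{..<n * m} \<times> {..<n * m}. 3 * real r + 1)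
      (\<lambda>\<epsilon> y z. \<forall>p\<in>{..<n * m} \<times> {..<n * m}. R3 p \<epsilon> y (\<lambda>a. z (p, a)))"
    proof (rule computable_family)
      fix p :: "nat \<times> nat"
      obtain i j where p: "p = (i, j)" by (cases p) auto
      show "computable (3 * real r + 1) (R3 p)"
        unfolding p R3_def prod.case
        by (rule computable_in[OF computable_lincomb[of r "\<lambda>q. w q (i div m) (j div m)"], of "\<lambda>q. (q, i mod m, j mod m)"])
    qed simp
    have cost: "(\<Sum>p\<in>J. 3 * real T + 1) + ((\<Sum>q\<in>{..<r}. C) + (\<Sum>p\<in>{..<n * m} \<times> {..<n * m}. 3 * real r + 1))
        = real r * C + K * real (m * m)"
      by (simp add: J_def K_def T_def card_cartesian_product algebra_simps)
    show ?thesis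
      unfolding mm_kernel_def
    proof (rule computable_mono[OF computable_seq[OF 1 computable_seq[OF 2
            computable_out[OF 3, of "\<lambda>p. (p, ())"]]]])
      show "(\<Sum>p\<in>J. 3 * real T + 1) + ((\<Sum>q\<in>{..<r}. C) + (\<Sum>p\<in>{..<n * m} \<times> {..<n * m}. 3 * real r + 1))
        \<le> real r * C + K * real (m * m)" unfolding cost by simp
      fix \<epsilon> :: real and x :: "bool \<times> nat \<times> nat \<Rightarrow> real" and z :: "nat \<times> nat \<Rightarrow> real"
      assume e: "0 \<le> \<epsilon>" "\<epsilon> \<le> 1 / 2"
      assume "\<exists>y. (\<forall>p\<in>J. R1 p \<epsilon> x (\<lambda>a. y (p, a))) \<and> (\<exists>y'. (\<forall>q\<in>{..<r}. R2 q \<epsilon> y (\<lambda>a. y' (q, a))) \<and>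
        (\<exists>z'. (\<forall>p\<in>{..<n * m} \<times> {..<n * m}. R3 p \<epsilon> y' (\<lambda>a. z' (p, a))) \<and> z = (\<lambda>a. z' (a, ()))))"
      then obtain y y' z' where z: "z = (\<lambda>a. z' (a, ()))"
        and all: "\<forall>p\<in>J. R1 p \<epsilon> x (\<lambda>a. y (p, a))" "\<forall>q\<in>{..<r}. R2 q \<epsilon> y (\<lambda>a. y' (q, a))"
          "\<forall>p\<in>{..<n * m} \<times> {..<n * m}. R3 p \<epsilon> y' (\<lambda>a. z' (p, a))"
        by (elim exE conjE) (rule that; assumption)
      note y = bspec[OF all(1)] and y' = bspec[OF all(2), unfolded lessThan_iff] and z' = bspec[OF all(3)]
      define X where "X b = mk (n * m) (n * m) (\<lambda>p. x (b, p))" for b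
      define S where "S b q = mk m m (\<lambda>p. y ((b, q, p), ()))" for b q
      define M where "M q = mk m m (\<lambda>p. y' (q, p))" for q
      define cf where "cf b q c d = (if b then v q c d else u q c d)" for b q c d
      define E where "E b q = (\<Sum>c<n. \<Sum>d<n. cf b q c d *\<^sub>R blk m (X b) c d)" for b q
      have cf: "\<bar>cf b q c d\<bar> \<le> U" if "q < r" "c < n" "d < n" for b q c d
        using U[OF that] by (simp add: cf_def)
      have Esum: "E b q = (\<Sum>t<T. coef b q t *\<^sub>R blk m (X b) (t div n) (t mod n))" for b q
        unfolding E_def T_def coef_def cf_def
        by (rule sum_div_mod[of "\<lambda>c d. (if b then v q c d else u q c d) *\<^sub>R blk m (X b) c d", symmetric])
      have lt: "t div n < n" "t mod n < n" if "t < T" for t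
        using that n by (auto simp: T_def less_mult_imp_div_less)
      have idx: "a * m + i < n * m" if "a < n" "i < m" for a i
      proof -
        have "a * m + i < (a + 1) * m" using that(2) by simp
        also have "\<dots> \<le> n * m" using that(1) by (intro mult_le_mono1) simp
        finally show ?thesis .
      qed
      have En: "norm (E b q) \<le> k * norm (X b)" if q: "q < r" for b q
      proof -
        have "norm (E b q) \<le> (\<Sum>t<T. norm (coef b q t *\<^sub>R blk m (X b) (t div n) (t mod n)))"
          unfolding Esum by (rule norm_sum)
        also have "\<dots> \<le> (\<Sum>t<T. U * norm (X b))"
        proof (rule sum_mono)
          fix t assume "t \<in> {..<T}"
          then have tT: "t < T" by simp
          have "\<bar>coef b q t\<bar> \<le> U" using cf[OF q lt(1)[OF tT] lt(2)[OF tT], of b] by (simp add: cf_def coef_def)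
          then show "norm (coef b q t *\<^sub>R blk m (X b) (t div n) (t mod n)) \<le> U * norm (X b)"
            using norm_blk_le[of m "X b" "t div n" "t mod n"] by (simp add: mult_mono)
        qed
        also have "\<dots> = real T * U * norm (X b)" by simp
        also have "\<dots> \<le> k * norm (X b)" by (intro mult_right_mono k) simp
        finally show ?thesis .
      qed
      have SE: "norm (S b q - E b q) \<le> k * \<epsilon> * norm (X b)" if q: "q < r" for b q
      proof -
        have "norm (S b q - E b q) \<le> (\<Sum>t<T. norm ((\<gamma> * \<epsilon> * U) *\<^sub>R blk m (X b) (t div n) (t mod n)))"
        proof (rule norm_le_sum_entries)
          fix i j
          show "\<bar>entry (S b q - E b q) i j\<bar> \<le> (\<Sum>t<T. \<bar>entry ((\<gamma> * \<epsilon> * U) *\<^sub>R blk m (X b) (t div n) (t mod n)) i j\<bar>)"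
          proof (cases "i < m \<and> j < m")
            case True
            then have "(b, q, i, j) \<in> J" using q by (simp add: J_def)
            from y[OF this] obtain \<theta> where \<theta>: "\<And>t. \<bar>\<theta> t\<bar> \<le> 2 ^ (T + 2) * \<epsilon>"
              "(\<lambda>a. y ((b, q, i, j), a)) = (\<lambda>_. \<Sum>t<T. coef b q t * x (b, t div n * m + i, t mod n * m + j) * (1 + \<theta> t))"
              unfolding R1_def prod.case by blast
            let ?b = "\<lambda>t. entry (blk m (X b) (t div n) (t mod n)) i j"
            have xb: "x (b, t div n * m + i, t mod n * m + j) = ?b t" if "t < T" for t
              using idx lt[OF that] True by (simp add: entry_blk X_def)
            have "y ((b, q, i, j), ()) = (\<Sum>t<T. coef b q t * x (b, t div n * m + i, t mod n * m + j) * (1 + \<theta> t))"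
              using fun_cong[OF \<theta>(2)] by simp
            also have "\<dots> = (\<Sum>t<T. coef b q t * ?b t * (1 + \<theta> t))"
              by (rule sum.cong) (simp_all add: xb)
            finally have "entry (S b q) i j = (\<Sum>t<T. coef b q t * ?b t * (1 + \<theta> t))" using True by (simp add: S_def)
            moreover have "entry (E b q) i j = (\<Sum>t<T. coef b q t * ?b t)"
              by (simp only: Esum entry_sum entry_scaleR)
            ultimately have "entry (S b q - E b q) i j = (\<Sum>t<T. coef b q t * ?b t * \<theta> t)"
              by (simp only: entry_diff sum_subtractf[symmetric] distrib_left mult_1_right add_diff_cancel_left')
            also have "\<bar>\<dots>\<bar> \<le> (\<Sum>t<T. \<bar>coef b q t * ?b t * \<theta> t\<bar>)" by (rule sum_abs)
            also have "\<dots> \<le> (\<Sum>t<T. \<bar>entry ((\<gamma> * \<epsilon> * U) *\<^sub>R blk m (X b) (t div n) (t mod n)) i j\<bar>)"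
            proof (rule sum_mono)
              fix t assume "t \<in> {..<T}"
              then have tT: "t < T" by simp
              have "\<bar>coef b q t\<bar> \<le> U" using cf[OF q lt(1)[OF tT] lt(2)[OF tT], of b] by (simp add: cf_def coef_def)
              moreover have "\<bar>\<theta> t\<bar> \<le> \<gamma> * \<epsilon>" using \<theta>(1)[of t] mult_right_mono[OF \<gamma>(2) e(1)] by linarith
              ultimately have "\<bar>coef b q t\<bar> * \<bar>\<theta> t\<bar> \<le> U * (\<gamma> * \<epsilon>)" using U1 by (intro mult_mono) auto
              then have "(\<bar>coef b q t\<bar> * \<bar>\<theta> t\<bar>) * \<bar>?b t\<bar> \<le> (U * (\<gamma> * \<epsilon>)) * \<bar>?b t\<bar>" by (rule mult_right_mono) simp
              moreover have "\<bar>U\<bar> = U" "\<bar>\<epsilon>\<bar> = \<epsilon>" "\<bar>\<gamma>\<bar> = \<gamma>" using \<gamma>(1) e(1) U1 by simp_all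
              ultimately show "\<bar>coef b q t * ?b t * \<theta> t\<bar> \<le> \<bar>entry ((\<gamma> * \<epsilon> * U) *\<^sub>R blk m (X b) (t div n) (t mod n)) i j\<bar>"
                by (simp add: abs_mult ac_simps)
            qed
            finally show ?thesis .
          next
            case False
            then have "entry (S b q) i j = 0" "entry (E b q) i j = 0"
              by (auto simp: S_def Esum entry_blk)
            then show ?thesis by (simp add: sum_nonneg)
          qed
        qed
        also have "\<dots> \<le> (\<Sum>t<T. \<gamma> * \<epsilon> * U * norm (X b))"
          using \<gamma>(1) e(1) U1 norm_blk_le[of m "X b"] by (intro sum_mono) (simp add: mult_left_mono)
        also have "\<dots> = real T * U * \<gamma> * (\<epsilon> * norm (X b))" by simp
        also have "\<dots> \<le> k * (\<epsilon> * norm (X b))" by (intro mult_right_mono k) (use e in simp)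
        finally show ?thesis by simp
      qed
      define N where "N = norm (X False) * norm (X True)"
      have N0: "N \<ge> 0" by (simp add: N_def)
      have Sn: "norm (S b q) \<le> 2 * k * norm (X b)" if q: "q < r" for b q
      proof -
        have "norm (S b q) \<le> norm (E b q) + norm (S b q - E b q)"
          by (rule norm_triangle_sub)
        also have "\<dots> \<le> k * norm (X b) + k * norm (X b)"
        proof (rule add_mono[OF En[OF q] order_trans[OF SE[OF q]]])
          show "k * \<epsilon> * norm (X b) \<le> k * norm (X b)"
            using e k(1) mult_left_le[of \<epsilon> k] by (intro mult_right_mono) auto
        qed
        finally show ?thesis by simp
      qed
      have ME: "norm (M q - E False q * E True q) \<le> 4 * (\<mu> + 1) * k\<^sup>2 * \<epsilon> * N" if q: "q < r" for q
      proof -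
        have "norm (M q - S False q * S True q) \<le> \<mu> * \<epsilon> * (norm (S False q) * norm (S True q))"
          using y'[OF q] by (simp add: R2_def M_def S_def)
        also have "\<dots> \<le> \<mu> * \<epsilon> * ((2 * k * norm (X False)) * (2 * k * norm (X True)))"
          using \<mu> e k(1) by (intro mult_left_mono mult_mono Sn[OF q]) auto
        also have "\<dots> = 4 * \<mu> * k\<^sup>2 * \<epsilon> * N" by (simp add: N_def power2_eq_square)
        finally have 1: "norm (M q - S False q * S True q) \<le> 4 * \<mu> * k\<^sup>2 * \<epsilon> * N" .
        have "S False q * S True q - E False q * E True q
          = (S False q - E False q) * S True q + E False q * (S True q - E True q)" by (simp add: algebra_simps)
        then have "norm (S False q * S True q - E False q * E True q)
          \<le> norm (S False q - E False q) * norm (S True q) + norm (E False q) * norm (S True q - E True q)"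
          by (metis norm_triangle_le add_mono norm_mult_ineq)
        also have "\<dots> \<le> (k * \<epsilon> * norm (X False)) * (2 * k * norm (X True)) + (k * norm (X False)) * (k * \<epsilon> * norm (X True))"
          using e k(1) by (intro add_mono mult_mono SE[OF q] Sn[OF q] En[OF q]) auto
        also have "\<dots> = 3 * k\<^sup>2 * \<epsilon> * N" by (simp add: N_def power2_eq_square)
        finally have 2: "norm (S False q * S True q - E False q * E True q) \<le> 3 * k\<^sup>2 * \<epsilon> * N" .
        have "norm (M q - E False q * E True q)
          \<le> norm (M q - S False q * S True q) + norm (S False q * S True q - E False q * E True q)"
          using norm_triangle_ineq[of "M q - S False q * S True q" "S False q * S True q - E False q * E True q"] by simp
        also have "\<dots> \<le> 4 * \<mu> * k\<^sup>2 * \<epsilon> * N + 4 * k\<^sup>2 * \<epsilon> * N"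
          using 1 2 e N0 by (intro add_mono) (auto intro: order_trans mult_right_mono)
        finally show ?thesis by (simp add: algebra_simps)
      qed
      have Mn: "norm (M q) \<le> 5 * (\<mu> + 1) * k\<^sup>2 * N" if q: "q < r" for q
      proof -
        have "norm (M q) \<le> norm (E False q * E True q) + norm (M q - E False q * E True q)"
          by (rule norm_triangle_sub)
        also have "\<dots> \<le> (k * norm (X False)) * (k * norm (X True)) + 4 * (\<mu> + 1) * k\<^sup>2 * \<epsilon> * N"
          by (intro add_mono ME[OF q] order_trans[OF norm_mult_ineq] mult_mono En[OF q]) (use k(1) in auto)
        also have "\<dots> = k\<^sup>2 * N + 4 * (\<mu> + 1) * k\<^sup>2 * N * \<epsilon>" by (simp add: N_def power2_eq_square)
        also have "\<dots> \<le> (\<mu> + 1) * (k\<^sup>2 * N) + 4 * (\<mu> + 1) * k\<^sup>2 * N * 1"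
          using \<mu> e N0 by (intro add_mono mult_left_mono) (auto simp: algebra_simps)
        finally show ?thesis by (simp add: algebra_simps)
      qed
      let ?Z = "mk (n * m) (n * m) z"
      have dX: "dims (n * m) (n * m) (X b)" for b by (simp add: X_def)
      define \<beta> where "\<beta> = 5 * real r * U * (1 + \<gamma>) * (\<mu> + 1) * k\<^sup>2 * \<epsilon> * N"
      have "norm (blk m (?Z - X False * X True) a b) \<le> \<beta>" if ab: "a < n" "b < n" for a b
      proof -
        let ?W = "\<Sum>q<r. w q a b *\<^sub>R M q"
        have "norm (blk m ?Z a b - ?W) \<le> (\<Sum>q<r. norm ((\<gamma> * \<epsilon> * U) *\<^sub>R M q))"
        proof (rule norm_le_sum_entries)
          fix i j
          show "\<bar>entry (blk m ?Z a b - ?W) i j\<bar> \<le> (\<Sum>q<r. \<bar>entry ((\<gamma> * \<epsilon> * U) *\<^sub>R M q) i j\<bar>)"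
          proof (cases "i < m \<and> j < m")
            case True
            then have "(a * m + i, b * m + j) \<in> {..<n * m} \<times> {..<n * m}" using idx ab by simp
            from z'[OF this] obtain \<theta> where \<theta>: "\<And>q. \<bar>\<theta> q\<bar> \<le> 2 ^ (r + 2) * \<epsilon>"
              "(\<lambda>p. z' ((a * m + i, b * m + j), p)) = (\<lambda>_. \<Sum>q<r. w q ((a * m + i) div m) ((b * m + j) div m) *
                 y' (q, (a * m + i) mod m, (b * m + j) mod m) * (1 + \<theta> q))"
              unfolding R3_def prod.case by blast
            have "z (a * m + i, b * m + j) = (\<Sum>q<r. w q a b * y' (q, i, j) * (1 + \<theta> q))"
              using fun_cong[OF \<theta>(2), of "()"] True by (simp add: z)
            then have "entry (blk m ?Z a b - ?W) i j = (\<Sum>q<r. w q a b * y' (q, i, j) * \<theta> q)"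
              using True idx ab by (simp add: entry_blk M_def sum_subtractf[symmetric] distrib_left)
            also have "\<bar>\<dots>\<bar> \<le> (\<Sum>q<r. \<bar>w q a b * y' (q, i, j) * \<theta> q\<bar>)" by (rule sum_abs)
            also have "\<dots> \<le> (\<Sum>q<r. \<bar>entry ((\<gamma> * \<epsilon> * U) *\<^sub>R M q) i j\<bar>)"
            proof (rule sum_mono)
              fix q assume "q \<in> {..<r}"
              then have "\<bar>w q a b\<bar> \<le> U" using U(3) ab by simp
              moreover have "\<bar>\<theta> q\<bar> \<le> \<gamma> * \<epsilon>" using \<theta>(1)[of q] mult_right_mono[OF \<gamma>(3) e(1)] by linarith
              ultimately have "\<bar>w q a b\<bar> * \<bar>\<theta> q\<bar> \<le> U * (\<gamma> * \<epsilon>)" using U1 by (intro mult_mono) auto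
              then have "(\<bar>w q a b\<bar> * \<bar>\<theta> q\<bar>) * \<bar>y' (q, i, j)\<bar> \<le> (U * (\<gamma> * \<epsilon>)) * \<bar>y' (q, i, j)\<bar>"
                by (rule mult_right_mono) simp
              moreover have "\<bar>U\<bar> = U" "\<bar>\<epsilon>\<bar> = \<epsilon>" "\<bar>\<gamma>\<bar> = \<gamma>" using \<gamma>(1) e(1) U1 by simp_all
              ultimately show "\<bar>w q a b * y' (q, i, j) * \<theta> q\<bar> \<le> \<bar>entry ((\<gamma> * \<epsilon> * U) *\<^sub>R M q) i j\<bar>"
                using True by (simp add: abs_mult ac_simps M_def)
            qed
            finally show ?thesis .
          next
            case False
            then have "entry (blk m ?Z a b) i j = 0" "entry ?W i j = 0"
              by (auto simp: M_def entry_blk)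
            then show ?thesis by (simp add: sum_nonneg)
          qed
        qed
        also have "\<dots> \<le> (\<Sum>q<r. \<gamma> * \<epsilon> * U * (5 * (\<mu> + 1) * k\<^sup>2 * N))"
        proof (rule sum_mono)
          fix q assume "q \<in> {..<r}"
          then have "norm (M q) \<le> 5 * (\<mu> + 1) * k\<^sup>2 * N" using Mn by simp
          then have "(\<gamma> * \<epsilon> * U) * norm (M q) \<le> (\<gamma> * \<epsilon> * U) * (5 * (\<mu> + 1) * k\<^sup>2 * N)"
            using \<gamma>(1) e(1) U1 by (intro mult_left_mono) auto
          moreover have "\<bar>\<gamma> * \<epsilon> * U\<bar> = \<gamma> * \<epsilon> * U" using \<gamma>(1) e(1) U1 by simp
          ultimately show "norm ((\<gamma> * \<epsilon> * U) *\<^sub>R M q) \<le> \<gamma> * \<epsilon> * U * (5 * (\<mu> + 1) * k\<^sup>2 * N)" by simp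
        qed
        also have "\<dots> = real r * (\<gamma> * \<epsilon> * U * (5 * (\<mu> + 1) * k\<^sup>2 * N))" by simp
        finally have 1: "norm (blk m ?Z a b - ?W) \<le> real r * (\<gamma> * \<epsilon> * U * (5 * (\<mu> + 1) * k\<^sup>2 * N))" .
        have "blk m (X False * X True) a b = (\<Sum>c<n. blk m (X False) a c * blk m (X True) c b)"
          by (rule blk_mult[OF dX])
        also have "\<dots> = (\<Sum>q<r. w q a b *\<^sub>R (E False q * E True q))"
          unfolding E_def cf_def by (simp add: bilinear_mm_apply[OF bil ab])
        finally have "?W - blk m (X False * X True) a b = (\<Sum>q<r. w q a b *\<^sub>R (M q - E False q * E True q))"
          by (simp add: sum_subtractf scaleR_diff_right)
        then have "norm (?W - blk m (X False * X True) a b) \<le> (\<Sum>q<r. norm (w q a b *\<^sub>R (M q - E False q * E True q)))"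
          by (simp only:) (rule norm_sum)
        also have "\<dots> \<le> (\<Sum>q<r. U * (4 * (\<mu> + 1) * k\<^sup>2 * \<epsilon> * N))"
          unfolding norm_scaleR
          by (intro sum_mono mult_mono U(3) ME) (use ab U1 in auto)
        also have "\<dots> \<le> real r * (U * (5 * (\<mu> + 1) * k\<^sup>2 * \<epsilon> * N))"
          using U1 \<mu> e N0 by (simp add: mult_left_mono mult_right_mono)
        finally have 2: "norm (?W - blk m (X False * X True) a b) \<le> real r * (U * (5 * (\<mu> + 1) * k\<^sup>2 * \<epsilon> * N))" .
        have "blk m (?Z - X False * X True) a b = (blk m ?Z a b - ?W) + (?W - blk m (X False * X True) a b)"
          by (rule fm_eqI) (simp add: entry_blk)
        then have "norm (blk m (?Z - X False * X True) a b)
          \<le> norm (blk m ?Z a b - ?W) + norm (?W - blk m (X False * X True) a b)"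
          by (simp only:) (rule norm_triangle_ineq)
        also have "\<dots> \<le> \<beta>" using 1 2 by (simp add: \<beta>_def algebra_simps)
        finally show ?thesis .
      qed
      then have "norm (?Z - X False * X True) \<le> real n * \<beta>"
        by (rule norm_le_blocks[rotated]) (auto simp: \<beta>_def intro!: dims_diff dims_mult[OF dX dX] mult_nonneg_nonneg, use U1 \<gamma>(1) \<mu> e N0 in auto)
      also have "\<dots> \<le> D * (\<mu> + 1) * \<epsilon> * N"
        using \<mu> e N0 by (simp add: \<beta>_def D_def algebra_simps)
      finally show "norm (mk (n * m) (n * m) z - mk (n * m) (n * m) (\<lambda>p. x (False, p)) * mk (n * m) (n * m) (\<lambda>p. x (True, p)))
       \<le> D * (\<mu> + 1) * \<epsilon> * (norm (mk (n * m) (n * m) (\<lambda>p. x (False, p))) * norm (mk (n * m) (n * m) (\<lambda>p. x (True, p))))"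
        by (simp add: N_def X_def)
    qed
  qed
  ultimately show ?thesis by blast
qed


lemma mm_kernel_powers:
  assumes bil: "bilinear_mm n r u v w" and n: "n \<ge> 1" and x: "real r < x" "real (n * n) \<le> x"
  shows "\<exists>C D. C \<ge> 1 \<and> D \<ge> 1 \<and> (\<forall>k. mm_kernel (n ^ k) (C * x ^ k) (D ^ k))"
proof -
  define K where "K = 2 * real r * (3 * real (n * n) + 1) + real (n * n) * (3 * real r + 1)"
  obtain D where D: "D \<ge> 1" and step: "\<And>m C \<mu>. mm_kernel m C \<mu> \<Longrightarrow> 0 \<le> \<mu> \<Longrightarrow>
    mm_kernel (n * m) (real r * C + K * real (m * m)) (D * (\<mu> + 1))"
    using bilinear_mm_step[OF bil n] unfolding K_def by blast
  have K: "K \<ge> 0" by (simp add: K_def)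
  define C where "C = 1 + K / (x - real r)"
  have C: "C \<ge> 1" using K x by (simp add: C_def)
  have "C * (x - real r) = (x - real r) + K" using x by (simp add: C_def field_simps)
  then have Cx: "real r * C + K \<le> C * x" using x by (simp add: algebra_simps)
  have x0: "x \<ge> 0" using x by linarith
  have "mm_kernel (n ^ k) (C * x ^ k) ((2 * D) ^ k)" for k
  proof (induction k)
    case 0
    show ?case using mm_kernel_mono_bounds[OF mm_kernel_1, of C 1] C by simp
  next
    case (Suc k)
    have "real r * (C * x ^ k) + K * real (n ^ k * n ^ k) \<le> real r * (C * x ^ k) + K * x ^ k"
      using power_mono[OF x(2), of k] K by (intro add_left_mono mult_left_mono) (simp_all add: power_mult_distrib)
    also have "\<dots> = (real r * C + K) * x ^ k" by (simp add: algebra_simps)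
    also have "\<dots> \<le> C * x * x ^ k" using Cx x0 by (intro mult_right_mono) auto
    finally have c: "real r * (C * x ^ k) + K * real (n ^ k * n ^ k) \<le> C * x ^ Suc k" by (simp add: mult.assoc)
    have "1 \<le> (2 * D) ^ k" using D by (intro one_le_power) simp
    then have "D * ((2 * D) ^ k + 1) \<le> D * (2 * (2 * D) ^ k)" using D by (intro mult_left_mono) linarith+
    then have d: "D * ((2 * D) ^ k + 1) \<le> (2 * D) ^ Suc k" by (simp add: ac_simps)
    show ?case
      using mm_kernel_mono_bounds[OF step[OF Suc.IH] c d] D by simp
  qed
  then show ?thesis using C D by (intro exI[of _ C] exI[of _ "2 * D"]) auto
qed

section \<open>Recursive QR decomposition\<close>

definition sel :: "nat \<Rightarrow> nat \<Rightarrow> (nat \<Rightarrow> nat) \<Rightarrow> fm" where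
  "sel N p \<rho> = mk N p (\<lambda>(i, a). if i = \<rho> a then 1 else 0)"

lemma dims_sel: "dims N p (sel N p \<rho>)"
  by (simp add: sel_def)

lemma entry_tp_sel_mult:
  assumes "\<And>a. a < p \<Longrightarrow> \<rho> a < N"
  shows "entry (tp (sel N p \<rho>) * X) a j = (if a < p then entry X (\<rho> a) j else 0)"
proof -
  have "entry (tp (sel N p \<rho>) * X) a j = (\<Sum>i<N. if i = \<rho> a \<and> a < p then entry X (\<rho> a) j else 0)"
    unfolding entry_mult[OF dims_tp[OF dims_sel]] by (rule sum.cong) (auto simp: sel_def)
  then show ?thesis using assms by (cases "a < p") simp_all
qed

lemma entry_mult_sel:
  assumes "\<And>a. a < p \<Longrightarrow> \<rho> a < N"
  shows "entry (X * sel N p \<rho>) i a = (if a < p then entry X i (\<rho> a) else 0)"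
proof -
  have "entry (X * sel N p \<rho>) i a = (\<Sum>k<N. if k = \<rho> a \<and> a < p then entry X i (\<rho> a) else 0)"
    unfolding entry_mult'[OF dims_sel] by (rule sum.cong) (auto simp: sel_def)
  then show ?thesis using assms by (cases "a < p") simp_all
qed

lemma entry_sel_mult:
  assumes "inj_on \<rho> {..<p}" "b < p" "\<rho> b < N"
  shows "entry (sel N p \<rho> * Y) (\<rho> b) j = entry Y b j"
proof -
  have "entry (sel N p \<rho> * Y) (\<rho> b) j = (\<Sum>a<p. if a = b then entry Y b j else 0)"
    unfolding entry_mult[OF dims_sel]
    by (rule sum.cong) (use assms in \<open>auto simp: sel_def dest: inj_onD\<close>)
  then show ?thesis using assms(2) by simp
qed

lemma entry_sel_mult_0:
  assumes "i \<notin> \<rho> ` {..<p}" shows "entry (sel N p \<rho> * Y) i j = 0"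
  unfolding entry_mult[OF dims_sel] by (rule sum.neutral) (use assms in \<open>auto simp: sel_def\<close>)

lemma sel_isometry:
  assumes "inj_on \<rho> {..<p}" "\<And>a. a < p \<Longrightarrow> \<rho> a < N"
  shows "tp (sel N p \<rho>) * sel N p \<rho> = idm p"
proof (rule fm_eqI)
  fix a j
  have "entry (tp (sel N p \<rho>) * sel N p \<rho>) a j = (if a < p then entry (sel N p \<rho>) (\<rho> a) j else 0)"
    using assms(2) by (rule entry_tp_sel_mult)
  then show "entry (tp (sel N p \<rho>) * sel N p \<rho>) a j = entry (idm p) a j"
    using assms by (auto simp: sel_def dest: inj_onD)
qed

lemma entry_sel_proj:
  assumes "inj_on \<rho> {..<p}" "\<And>a. a < p \<Longrightarrow> \<rho> a < N"
  shows "entry (sel N p \<rho> * (tp (sel N p \<rho>) * X)) i j = (if i \<in> \<rho> ` {..<p} then entry X i j else 0)"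
proof (cases "i \<in> \<rho> ` {..<p}")
  case True
  then obtain b where "b < p" "i = \<rho> b" by auto
  then show ?thesis using entry_sel_mult[OF assms(1) _ assms(2)] entry_tp_sel_mult[OF assms(2)] by auto
next
  case False
  then show ?thesis by (simp add: entry_sel_mult_0)
qed

definition colsub :: "nat \<Rightarrow> fm \<Rightarrow> nat \<Rightarrow> nat \<Rightarrow> fm" where
  "colsub n X c0 c = mk n c (\<lambda>(i, j). entry X i (c0 + j))"

lemma dims_colsub: "dims n c (colsub n X c0 c)"
  by (simp add: colsub_def)

lemma entry_colsub: "entry (colsub n X c0 c) i j = (if i < n \<and> j < c then entry X i (c0 + j) else 0)"
  by (simp add: colsub_def)

lemma norm_colsub_le: "norm (colsub n X c0 c) \<le> norm X"
  unfolding colsub_def by (rule norm_gather_le[of "\<lambda>i. i" n]) (auto simp: inj_on_def)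

lemma colsub_mult: "dims p n A \<Longrightarrow> colsub p (A * X) c0 c = A * colsub n X c0 c"
  by (rule fm_eqI) (auto simp: entry_colsub entry_mult dims_entry0)

lemma colsub_diff: "colsub n (X - Y) c0 c = colsub n X c0 c - colsub n Y c0 c"
  by (rule fm_eqI) (simp add: entry_colsub)

lemma norm_le_colsub:
  assumes "dims n (c0 + c + c1) W"
  shows "norm W \<le> norm (colsub n W 0 c0) + norm (colsub n W c0 c) + norm (colsub n W (c0 + c) c1)"
proof -
  have add: "(\<Sum>j<k + l. g j) = (\<Sum>j<k. g j) + (\<Sum>j<l. g (k + j))" for g :: "nat \<Rightarrow> real" and k l
    by (induction l) (auto simp: add.assoc)
  let ?a = "norm (colsub n W 0 c0)" and ?b = "norm (colsub n W c0 c)" and ?c = "norm (colsub n W (c0 + c) c1)"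
  have "(norm W)\<^sup>2 = ?a\<^sup>2 + ?b\<^sup>2 + ?c\<^sup>2"
    by (simp add: norm_fm_sq[OF assms] norm_fm_sq[OF dims_colsub] add sum.distrib entry_colsub)
  also have "\<dots> \<le> (?a + ?b + ?c)\<^sup>2" by (simp add: power2_sum)
  finally show ?thesis by (rule power2_le_imp_le) simp
qed

lemma norm_mult_tp_isometry:
  assumes "tp J * J = idm p" "dims m p X" shows "norm (X * tp J) = norm X"
  using norm_isometry[OF assms(1) dims_tp[OF assms(2)]] norm_tp[of "J * tp X"] by (simp add: tp_mult)

text \<open>A transformation of some of the rows, which acts by \<open>Q\<close> on these and by the identity on the others.\<close>

lemma orth_embed:
  assumes J: "dims N p J" "tp J * J = idm p" and Q: "orth p Q"
  shows "orth N (idm N - J * tp J + J * Q * tp J)"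
proof -
  have embed: "(idm N - J * tp J + J * A * tp J) * (idm N - J * tp J + J * B * tp J) = idm N"
    if "dims p p A" "dims p p B" "A * B = idm p" for A B
  proof -
    have I: "idm N * J = J" "tp J * idm N = tp J" by (rule idm_mult[OF J(1)], rule mult_idm[OF dims_tp[OF J(1)]])
    have II: "idm N * idm N = idm N" by (rule idm_mult[OF dims_idm])
    have Ip: "J * idm p = J" "A * idm p = A" "B * idm p = B" "idm p * tp J = tp J" "idm p * B = B"
      by (rule mult_idm[OF J(1)], rule mult_idm[OF that(1)], rule mult_idm[OF that(2)],
          rule idm_mult[OF dims_tp[OF J(1)]], rule idm_mult[OF that(2)])
    have I': "idm N * (J * Z) = J * Z" for Z by (simp add: mult.assoc[symmetric] I)
    have JJ: "tp J * (J * Z) = idm p * Z" for Z by (simp add: mult.assoc[symmetric] J(2))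
    have AB: "A * (B * Z) = idm p * Z" for Z by (simp add: mult.assoc[symmetric] that(3))
    have Ip': "idm p * (B * Z) = B * Z" for Z by (simp add: mult.assoc[symmetric] Ip)
    show ?thesis
      by (simp add: distrib_left distrib_right left_diff_distrib right_diff_distrib mult.assoc
          I I' II JJ AB Ip Ip')
  qed
  have Qd: "dims p p Q" "dims p p (tp Q)" using Q dims_tp by (auto simp: orth_def)
  have t: "tp (idm N - J * tp J + J * Q * tp J) = idm N - J * tp J + J * tp Q * tp J"
    by (simp add: tp_add tp_diff tp_mult mult.assoc)
  have "dims N N (idm N - J * tp J + J * Q * tp J)"
    by (intro dims_add dims_diff dims_idm dims_mult[OF J(1) dims_tp[OF J(1)]]
        dims_mult[OF dims_mult[OF J(1) Qd(1)] dims_tp[OF J(1)]])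
  then show ?thesis unfolding orth_def t using embed Qd Q by (simp add: orth_def)
qed

lemma good_embed:
  assumes J: "dims N p J" "tp J * J = idm p" and X: "dims N M X" "dims N M Y" and M: "M = c0 + c + c1"
    and Qh: "dims p p Qh" and le: "norm (tp J * X) \<le> norm X"
    and pivot: "good p d Qh (colsub p (tp J * X) c0 c) (colsub p (tp J * Y) c0 c)"
    and left: "colsub p (tp J * X) 0 c0 = 0" "colsub p (tp J * Y) 0 c0 = 0"
    and right: "norm (colsub p (tp J * Y) (c0 + c) c1 - tp Qh * colsub p (tp J * X) (c0 + c) c1) \<le> e * norm X"
    and rest: "Y - J * (tp J * Y) = X - J * (tp J * X)" and "0 \<le> d" "0 \<le> e"
  shows "good N (2 * d + e) (idm N - J * tp J + J * Qh * tp J) X Y"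
proof -
  let ?XJ = "tp J * X" and ?YJ = "tp J * Y"
  obtain Q where Q: "orth p Q" "norm (Qh - Q) \<le> d"
    "norm (colsub p ?XJ c0 c - Q * colsub p ?YJ c0 c) \<le> d * norm (colsub p ?XJ c0 c)"
    using pivot by (auto simp: good_def)
  have Qd: "dims p p Q" using Q by (simp add: orth_def)
  define G where "G = idm N - J * tp J + J * Q * tp J"
  have G: "orth N G" unfolding G_def by (rule orth_embed[OF J Q(1)])
  have dQ: "dims p p (Qh - Q)" by (rule dims_diff[OF Qh Qd])
  have "idm N - J * tp J + J * Qh * tp J - G = J * ((Qh - Q) * tp J)" by (simp add: G_def algebra_simps)
  then have 1: "norm (idm N - J * tp J + J * Qh * tp J - G) \<le> 2 * d + e"
    using norm_isometry[OF J(2) dims_mult[OF dQ dims_tp[OF J(1)]]] norm_mult_tp_isometry[OF J(2) dQ] Q(2) assms(13,14)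
    by simp
  have GX: "tp G * X - Y = J * (tp Q * ?XJ - ?YJ)"
  proof -
    have "tp G * X = X - J * (tp J * X) + J * (tp Q * (tp J * X))"
      using idm_mult[OF X(1)] by (simp add: G_def tp_add tp_diff tp_mult mult.assoc distrib_right left_diff_distrib)
    also have "\<dots> = Y - J * (tp J * Y) + J * (tp Q * (tp J * X))" using rest by simp
    finally show ?thesis by (simp add: right_diff_distrib)
  qed
  have dX: "dims p M ?XJ" "dims p M ?YJ" by (rule dims_mult[OF dims_tp[OF J(1)] X(1)], rule dims_mult[OF dims_tp[OF J(1)] X(2)])
  have tQ: "dims p p (tp Q)" "orth p (tp Q)" using Q(1) orth_tp dims_tp by (auto simp: orth_def)
  have dW: "dims p M (tp Q * ?XJ - ?YJ)" by (rule dims_diff[OF dims_mult[OF tQ(1) dX(1)] dX(2)])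
  have G': "G * (tp G * X - Y) = X - G * Y"
  proof -
    have "G * (tp G * X) = idm N * X" using G by (simp add: orth_def mult.assoc[symmetric])
    then show ?thesis using idm_mult[OF X(1)] by (simp add: right_diff_distrib)
  qed
  have dtG: "dims N N (tp G)" using G dims_tp by (auto simp: orth_def)
  have "norm (X - G * Y) = norm (tp G * X - Y)"
    using norm_orth_mult[OF G dims_diff[OF dims_mult[OF dtG X(1)] X(2)]] G' by simp
  also have "\<dots> = norm (tp Q * ?XJ - ?YJ)" unfolding GX by (rule norm_isometry[OF J(2) dW])
  also have "\<dots> \<le> norm (colsub p (tp Q * ?XJ - ?YJ) 0 c0) + norm (colsub p (tp Q * ?XJ - ?YJ) c0 c)
      + norm (colsub p (tp Q * ?XJ - ?YJ) (c0 + c) c1)"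
    by (rule norm_le_colsub) (use dW M in simp)
  also have "colsub p (tp Q * ?XJ - ?YJ) 0 c0 = 0"
    by (simp add: colsub_diff colsub_mult[OF tQ(1)] left)
  also have "norm (colsub p (tp Q * ?XJ - ?YJ) c0 c) \<le> d * norm X"
  proof -
    let ?Xp = "colsub p ?XJ c0 c" and ?Yp = "colsub p ?YJ c0 c"
    have "tp Q * (?Xp - Q * ?Yp) = tp Q * ?Xp - idm p * ?Yp"
      using Q(1) by (simp add: orth_def right_diff_distrib mult.assoc[symmetric])
    then have "colsub p (tp Q * ?XJ - ?YJ) c0 c = tp Q * (?Xp - Q * ?Yp)"
      by (simp add: colsub_diff colsub_mult[OF tQ(1)] idm_mult[OF dims_colsub])
    then have "norm (colsub p (tp Q * ?XJ - ?YJ) c0 c) = norm (?Xp - Q * ?Yp)"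
      using norm_orth_mult[OF tQ(2) dims_diff[OF dims_colsub dims_mult[OF Qd dims_colsub]]] by simp
    also have "\<dots> \<le> d * norm ?Xp" by (rule Q(3))
    also have "\<dots> \<le> d * norm X"
      using order_trans[OF norm_colsub_le le] assms(13) by (intro mult_left_mono) auto
    finally show ?thesis .
  qed
  also have "norm (colsub p (tp Q * ?XJ - ?YJ) (c0 + c) c1) \<le> (d + e) * norm X"
  proof -
    let ?Xr = "colsub p ?XJ (c0 + c) c1" and ?Yr = "colsub p ?YJ (c0 + c) c1"
    have "colsub p (tp Q * ?XJ - ?YJ) (c0 + c) c1 = - (tp (Qh - Q) * ?Xr) - (?Yr - tp Qh * ?Xr)"
      by (simp add: colsub_diff colsub_mult[OF tQ(1)] tp_diff left_diff_distrib)
    then have "norm (colsub p (tp Q * ?XJ - ?YJ) (c0 + c) c1) \<le> norm (tp (Qh - Q) * ?Xr) + norm (?Yr - tp Qh * ?Xr)"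
      using norm_triangle_ineq4[of "- (tp (Qh - Q) * ?Xr)" "?Yr - tp Qh * ?Xr"] by simp
    also have "norm (tp (Qh - Q) * ?Xr) \<le> norm (tp (Qh - Q)) * norm ?Xr" by (rule norm_mult_ineq)
    also have "\<dots> \<le> d * norm X"
      using order_trans[OF norm_colsub_le le] assms(13) Q(2) unfolding norm_tp by (intro mult_mono) auto
    finally show ?thesis using right by (simp add: distrib_right)
  qed
  finally have "norm (X - G * Y) \<le> (2 * d + e) * norm X" by (simp add: distrib_right)
  then show ?thesis using 1 G unfolding good_def by blast
qed

text \<open>A procedure for the QR decomposition of \<open>p \<times> c\<close> matrices whose first \<open>r\<close> rows are upper triangular.\<close>

definition qr_kernel :: "nat \<Rightarrow> nat \<Rightarrow> nat \<Rightarrow> real \<Rightarrow> real \<Rightarrow> bool" where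
  "qr_kernel p c r C d \<longleftrightarrow> computable C (\<lambda>\<epsilon> x z. d * \<epsilon> \<le> 1 \<longrightarrow>
     (\<forall>i j. j < i \<and> i < r \<and> j < c \<longrightarrow> x (i, j) = 0) \<longrightarrow>
     good p (d * \<epsilon>) (mk p p (\<lambda>a. z (False, a))) (mk p c x) (mk p c (\<lambda>a. z (True, a))) \<and>
     (\<forall>i j. j < i \<and> i < p \<and> j < c \<longrightarrow> z (True, i, j) = 0))"

lemma qr_kernel_mono:
  assumes "qr_kernel p c r C d" "C \<le> C'" "d \<le> d'" shows "qr_kernel p c r C' d'"
  unfolding qr_kernel_def
proof (rule computable_mono[OF assms(1)[unfolded qr_kernel_def] assms(2)], intro impI)
  fix \<epsilon> :: real and x :: "nat \<times> nat \<Rightarrow> real" and z :: "bool \<times> nat \<times> nat \<Rightarrow> real"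
  assume e: "0 \<le> \<epsilon>" and R: "d * \<epsilon> \<le> 1 \<longrightarrow> (\<forall>i j. j < i \<and> i < r \<and> j < c \<longrightarrow> x (i, j) = 0) \<longrightarrow>
     good p (d * \<epsilon>) (mk p p (\<lambda>a. z (False, a))) (mk p c x) (mk p c (\<lambda>a. z (True, a))) \<and>
     (\<forall>i j. j < i \<and> i < p \<and> j < c \<longrightarrow> z (True, i, j) = 0)"
    and d: "d' * \<epsilon> \<le> 1" and u: "\<forall>i j. j < i \<and> i < r \<and> j < c \<longrightarrow> x (i, j) = 0"
  have le: "d * \<epsilon> \<le> d' * \<epsilon>" using e assms(3) by (rule mult_right_mono[rotated])
  then have "d * \<epsilon> \<le> 1" using d by linarith
  then show "good p (d' * \<epsilon>) (mk p p (\<lambda>a. z (False, a))) (mk p c x) (mk p c (\<lambda>a. z (True, a))) \<and>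
     (\<forall>i j. j < i \<and> i < p \<and> j < c \<longrightarrow> z (True, i, j) = 0)"
    using R u good_mono[OF _ le] by blast
qed

definition intervals :: "nat \<Rightarrow> nat \<Rightarrow> nat \<Rightarrow> nat \<Rightarrow> nat" where
  "intervals s l t a = (if a < l then s + a else t + (a - l))"

lemma intervals_inj: "s + l \<le> t \<Longrightarrow> inj_on (intervals s l t) A"
  by (auto simp: inj_on_def intervals_def split: if_splits)

lemma intervals_less: "s + l \<le> t \<Longrightarrow> t + l' \<le> N \<Longrightarrow> a < l + l' \<Longrightarrow> intervals s l t a < N"
  by (auto simp: intervals_def)

lemma intervals_image: "i \<in> intervals s l t ` {..<l + l'} \<longleftrightarrow> s \<le> i \<and> i < s + l \<or> t \<le> i \<and> i < t + l'"
proof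
  assume "s \<le> i \<and> i < s + l \<or> t \<le> i \<and> i < t + l'"
  then show "i \<in> intervals s l t ` {..<l + l'}"
  proof
    assume "s \<le> i \<and> i < s + l"
    then show ?thesis by (intro image_eqI[of _ _ "i - s"]) (auto simp: intervals_def)
  next
    assume "t \<le> i \<and> i < t + l'"
    then show ?thesis by (intro image_eqI[of _ _ "l + (i - t)"]) (auto simp: intervals_def)
  qed
qed (auto simp: intervals_def split: if_splits)

text \<open>One step of a block algorithm.  The state consists of the accumulated orthogonal factor (\<open>False\<close>) and
  the transformed matrix (\<open>True\<close>); the rows \<open>[s, s+l)\<close> and \<open>[t, t+l')\<close> are transformed such that the
  columns \<open>[c0, c0+c)\<close> become upper triangular there.\<close>

definition step_rel :: "nat \<Rightarrow> nat \<Rightarrow> nat \<Rightarrow> nat \<Rightarrow> nat \<Rightarrow> nat \<Rightarrow> nat \<Rightarrow> nat \<Rightarrow> nat \<Rightarrow> real \<Rightarrow> real \<Rightarrow>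
    (bool \<times> nat \<times> nat \<Rightarrow> real) \<Rightarrow> (bool \<times> nat \<times> nat \<Rightarrow> real) \<Rightarrow> bool" where
  "step_rel N M s l t l' c0 c r E \<epsilon> x z \<longleftrightarrow> E * \<epsilon> \<le> 1 \<longrightarrow>
     (\<forall>i j. j < i \<and> i < r \<and> j < c \<longrightarrow> x (True, s + i, c0 + j) = 0) \<longrightarrow>
     (\<forall>i j. (s \<le> i \<and> i < s + l \<or> t \<le> i \<and> i < t + l') \<and> j < c0 \<longrightarrow> x (True, i, j) = 0) \<longrightarrow>
     (\<forall>\<delta> X0. dims N M X0 \<and> 0 \<le> \<delta> \<and> \<delta> \<le> 1 \<and> good N \<delta> (mk N N (\<lambda>a. x (False, a))) X0 (mk N M (\<lambda>a. x (True, a))) \<longrightarrow>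
        good N (2 * \<delta> + 2 * (E * \<epsilon>)) (mk N N (\<lambda>a. z (False, a))) X0 (mk N M (\<lambda>a. z (True, a)))) \<and>
     (\<forall>i j. \<not> (s \<le> i \<and> i < s + l \<or> t \<le> i \<and> i < t + l') \<or> j < c0 \<longrightarrow> z (True, i, j) = x (True, i, j)) \<and>
     (\<forall>a j. a < l \<and> j < c \<and> j < a \<longrightarrow> z (True, s + a, c0 + j) = 0) \<and>
     (\<forall>b j. b < l' \<and> j < c \<and> j < l + b \<longrightarrow> z (True, t + b, c0 + j) = 0)"

lemma computable_step:
  assumes qr: "qr_kernel (l + l') c r C d" and mm: "mm_kernel S Cm \<mu>"
    and N: "s + l \<le> t" "t + l' \<le> N" "c0 + c \<le> M" "N \<le> S" "M \<le> S" "1 \<le> S" and rl: "r \<le> l"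
    and pos: "0 \<le> d" "0 \<le> \<mu>"
  shows "computable (C + 2 * (Cm + 1)) (step_rel N M s l t l' c0 c r (3 * d + 4 * (real S)\<^sup>2 * \<mu>))"
proof -
  define p where "p = l + l'"
  define \<rho> where "\<rho> = intervals s l t"
  define c1 where "c1 = M - (c0 + c)"
  define E where "E = 3 * d + 4 * (real S)\<^sup>2 * \<mu>"
  define iv where "iv = the_inv_into {..<p} \<rho>"
  have inj: "inj_on \<rho> {..<p}" unfolding \<rho>_def by (rule intervals_inj[OF N(1)])
  have lt: "a < p \<Longrightarrow> \<rho> a < N" for a unfolding \<rho>_def p_def by (rule intervals_less[OF N(1,2)])
  have iv: "a < p \<Longrightarrow> iv (\<rho> a) = a" for a unfolding iv_def by (rule the_inv_into_f_f[OF inj]) simp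
  have img: "i \<in> \<rho> ` {..<p} \<longleftrightarrow> s \<le> i \<and> i < s + l \<or> t \<le> i \<and> i < t + l'" for i
    unfolding \<rho>_def p_def by (rule intervals_image)
  have M: "M = c0 + c + c1" using N(3) by (simp add: c1_def)
  have pS: "p \<le> S" "c1 \<le> S" "p \<le> N" using N by (auto simp: p_def c1_def)
  have 1: "computable C (\<lambda>\<epsilon> x z. d * \<epsilon> \<le> 1 \<longrightarrow>
     (\<forall>i j. j < i \<and> i < r \<and> j < c \<longrightarrow> x (True, \<rho> i, c0 + j) = 0) \<longrightarrow>
     good p (d * \<epsilon>) (mk p p (\<lambda>a. z (False, a))) (mk p c (\<lambda>a. x (case a of (i, j) \<Rightarrow> (True, \<rho> i, c0 + j))))
       (mk p c (\<lambda>a. z (True, a))) \<and>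
     (\<forall>i j. j < i \<and> i < p \<and> j < c \<longrightarrow> z (True, i, j) = 0))"
    using computable_in[OF qr[unfolded qr_kernel_def], of "\<lambda>(i, j). (True, \<rho> i, c0 + j)"] by (simp add: p_def)
  note 2 = mm_rect[OF mm pS(1) pS(1) pS(2), of "\<lambda>(i, j). Inr (False, j, i)" "\<lambda>(i, j). Inl (True, \<rho> i, c0 + c + j)"]
  note 3 = mm_rect[OF mm N(4) pS(1) pS(1), of "\<lambda>(i, j). Inl (Inl (False, i, \<rho> j))" "\<lambda>(i, j). Inl (Inr (False, i, j))"]
  define h where "h = (\<lambda>(b, i, j).
     if b then (if i \<in> \<rho> ` {..<p} \<and> c0 \<le> j then
         (if j < c0 + c then Inl (Inl (Inr (True, iv i, j - c0))) else Inl (Inr (iv i, j - (c0 + c))))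
       else Inl (Inl (Inl (True, i, j))))
     else (if j \<in> \<rho> ` {..<p} then Inr (i, iv j) else Inl (Inl (Inl (False, i, j)))))"
  note comp = computable_seq[OF computable_keep[OF 1] computable_seq[OF computable_keep[OF 2]
      computable_seq[OF computable_keep[OF 3] computable_copy[of h]]]]
  show ?thesis
    unfolding E_def[symmetric]
  proof (rule computable_mono[OF comp])
    show "C + (Cm + 1 + (Cm + 1 + 0)) \<le> C + 2 * (Cm + 1)" by simp
    fix \<epsilon> :: real and x z :: "bool \<times> nat \<times> nat \<Rightarrow> real"
    assume e: "0 \<le> \<epsilon>" "\<epsilon> \<le> 1 / 2"
    assume "\<exists>y1. ((d * \<epsilon> \<le> 1 \<longrightarrow> (\<forall>i j. j < i \<and> i < r \<and> j < c \<longrightarrow> x (True, \<rho> i, c0 + j) = 0) \<longrightarrow>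
         good p (d * \<epsilon>) (mk p p (\<lambda>a. y1 (Inr (False, a)))) (mk p c (\<lambda>a. x (case a of (i, j) \<Rightarrow> (True, \<rho> i, c0 + j))))
           (mk p c (\<lambda>a. y1 (Inr (True, a)))) \<and>
         (\<forall>i j. j < i \<and> i < p \<and> j < c \<longrightarrow> y1 (Inr (True, i, j)) = 0)) \<and> (\<lambda>i. y1 (Inl i)) = x) \<and>
      (\<exists>y2. (norm (mk p c1 (\<lambda>j. y2 (Inr j)) - mk p p (\<lambda>a. y1 (case a of (i, j) \<Rightarrow> Inr (False, j, i))) *
             mk p c1 (\<lambda>a. y1 (case a of (i, j) \<Rightarrow> Inl (True, \<rho> i, c0 + c + j))))
          \<le> \<mu> * \<epsilon> * (norm (mk p p (\<lambda>a. y1 (case a of (i, j) \<Rightarrow> Inr (False, j, i)))) *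
             norm (mk p c1 (\<lambda>a. y1 (case a of (i, j) \<Rightarrow> Inl (True, \<rho> i, c0 + c + j))))) \<and> (\<lambda>i. y2 (Inl i)) = y1) \<and>
      (\<exists>y3. (norm (mk N p (\<lambda>j. y3 (Inr j)) - mk N p (\<lambda>a. y2 (case a of (i, j) \<Rightarrow> Inl (Inl (False, i, \<rho> j)))) *
             mk p p (\<lambda>a. y2 (case a of (i, j) \<Rightarrow> Inl (Inr (False, i, j)))))
          \<le> \<mu> * \<epsilon> * (norm (mk N p (\<lambda>a. y2 (case a of (i, j) \<Rightarrow> Inl (Inl (False, i, \<rho> j))))) *
             norm (mk p p (\<lambda>a. y2 (case a of (i, j) \<Rightarrow> Inl (Inr (False, i, j)))))) \<and> (\<lambda>i. y3 (Inl i)) = y2) \<and>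
         z = (\<lambda>a. y3 (h a))))"
    then obtain y1 y2 y3 where
      k1: "d * \<epsilon> \<le> 1 \<longrightarrow> (\<forall>i j. j < i \<and> i < r \<and> j < c \<longrightarrow> x (True, \<rho> i, c0 + j) = 0) \<longrightarrow>
         good p (d * \<epsilon>) (mk p p (\<lambda>a. y1 (Inr (False, a)))) (mk p c (\<lambda>a. x (case a of (i, j) \<Rightarrow> (True, \<rho> i, c0 + j))))
           (mk p c (\<lambda>a. y1 (Inr (True, a)))) \<and>
         (\<forall>i j. j < i \<and> i < p \<and> j < c \<longrightarrow> y1 (Inr (True, i, j)) = 0)"
      and y1: "(\<lambda>i. y1 (Inl i)) = x"
      and k2: "norm (mk p c1 (\<lambda>j. y2 (Inr j)) - mk p p (\<lambda>a. y1 (case a of (i, j) \<Rightarrow> Inr (False, j, i))) *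
             mk p c1 (\<lambda>a. y1 (case a of (i, j) \<Rightarrow> Inl (True, \<rho> i, c0 + c + j))))
          \<le> \<mu> * \<epsilon> * (norm (mk p p (\<lambda>a. y1 (case a of (i, j) \<Rightarrow> Inr (False, j, i)))) *
             norm (mk p c1 (\<lambda>a. y1 (case a of (i, j) \<Rightarrow> Inl (True, \<rho> i, c0 + c + j)))))"
      and y2: "(\<lambda>i. y2 (Inl i)) = y1"
      and k3: "norm (mk N p (\<lambda>j. y3 (Inr j)) - mk N p (\<lambda>a. y2 (case a of (i, j) \<Rightarrow> Inl (Inl (False, i, \<rho> j)))) *
             mk p p (\<lambda>a. y2 (case a of (i, j) \<Rightarrow> Inl (Inr (False, i, j)))))
          \<le> \<mu> * \<epsilon> * (norm (mk N p (\<lambda>a. y2 (case a of (i, j) \<Rightarrow> Inl (Inl (False, i, \<rho> j))))) *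
             norm (mk p p (\<lambda>a. y2 (case a of (i, j) \<Rightarrow> Inl (Inr (False, i, j))))))"
      and y3: "(\<lambda>i. y3 (Inl i)) = y2" and z: "z = (\<lambda>a. y3 (h a))"
      by (elim exE conjE) (rule that; assumption)
    have y1': "y1 (Inl a) = x a" for a using fun_cong[OF y1] .
    have y2': "y2 (Inl a) = y1 a" for a using fun_cong[OF y2] .
    have y3': "y3 (Inl a) = y2 a" for a using fun_cong[OF y3] .
    show "step_rel N M s l t l' c0 c r E \<epsilon> x z"
      unfolding step_rel_def
    proof (rule impI, rule impI, rule impI)
      assume E1: "E * \<epsilon> \<le> 1"
        and up: "\<forall>i j. j < i \<and> i < r \<and> j < c \<longrightarrow> x (True, s + i, c0 + j) = 0"
        and le0: "\<forall>i j. (s \<le> i \<and> i < s + l \<or> t \<le> i \<and> i < t + l') \<and> j < c0 \<longrightarrow> x (True, i, j) = 0"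
      define Qh where "Qh = mk p p (\<lambda>a. y1 (Inr (False, a)))"
      define X where "X = mk N M (\<lambda>a. x (True, a))"
      define Y where "Y = mk N M (\<lambda>a. z (True, a))"
      define A where "A = mk N N (\<lambda>a. x (False, a))"
      define A' where "A' = mk N N (\<lambda>a. z (False, a))"
      define J where "J = sel N p \<rho>"
      have J: "dims N p J" "tp J * J = idm p" unfolding J_def by (rule dims_sel, rule sel_isometry[OF inj], erule lt)
      have dE: "d * \<epsilon> \<le> E * \<epsilon>" using pos e by (intro mult_right_mono) (auto simp: E_def)
      then have d1: "d * \<epsilon> \<le> 1" using E1 by simp
      have up': "\<forall>i j. j < i \<and> i < r \<and> j < c \<longrightarrow> x (True, \<rho> i, c0 + j) = 0"
        using up rl by (simp add: \<rho>_def intervals_def)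
      have pv: "good p (d * \<epsilon>) Qh (mk p c (\<lambda>a. x (case a of (i, j) \<Rightarrow> (True, \<rho> i, c0 + j))))
           (mk p c (\<lambda>a. y1 (Inr (True, a))))"
        and zero: "\<And>i j. j < i \<Longrightarrow> i < p \<Longrightarrow> j < c \<Longrightarrow> y1 (Inr (True, i, j)) = 0"
        using k1 d1 up' by (simp_all add: Qh_def)
      have z1: "z (True, \<rho> a, c0 + j) = y1 (Inr (True, a, j))" if "a < p" "j < c" for a j
        using that iv by (simp add: z h_def y3' y2')
      have z2: "z (True, \<rho> a, c0 + c + j) = y2 (Inr (a, j))" if "a < p" for a j
        using that iv by (simp add: z h_def y3')
      have z3: "z (True, i, j) = x (True, i, j)" if "i \<notin> \<rho> ` {..<p} \<or> j < c0" for i j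
        using that by (auto simp: z h_def y3' y2' y1')
      have z4: "z (False, i, \<rho> a) = y3 (Inr (i, a))" if "a < p" for i a
        using that iv by (simp add: z h_def)
      have z5: "z (False, i, j) = x (False, i, j)" if "j \<notin> \<rho> ` {..<p}" for i j
        using that by (simp add: z h_def y3' y2' y1')
      have JX: "entry (tp J * X) a j = (if a < p \<and> j < M then x (True, \<rho> a, j) else 0)" for a j
        using lt by (simp add: J_def entry_tp_sel_mult X_def)
      have JY: "entry (tp J * Y) a j = (if a < p \<and> j < M then z (True, \<rho> a, j) else 0)" for a j
        using lt by (simp add: J_def entry_tp_sel_mult Y_def)
      have nJX: "norm (tp J * X) \<le> norm X"
      proof -
        have "tp J * X = mk p M (\<lambda>(a, j). entry X (\<rho> a) j)"
          by (rule fm_eqI) (simp add: JX, simp add: X_def lt)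
        then show ?thesis using norm_gather_le[OF inj, of "\<lambda>j. j" M X] by simp
      qed
      have Qhn: "norm Qh \<le> 2 * real S"
      proof -
        have "norm Qh \<le> real p + d * \<epsilon>" by (rule good_norm_Qh[OF pv])
        also have "\<dots> \<le> real S + real S" using d1 pS(1) N(6) by (intro add_mono) auto
        finally show ?thesis by simp
      qed
      have \<mu>e: "0 \<le> \<mu> * \<epsilon>" using pos e by simp
      have S1: "real S \<ge> 1" using N(6) by simp
      have gE: "good N (2 * (d * \<epsilon>) + 2 * real S * \<mu> * \<epsilon>) (idm N - J * tp J + J * Qh * tp J) X Y"
      proof (rule good_embed[OF J _ _ M _ nJX])
        show "dims N M X" "dims N M Y" "dims p p Qh" by (simp_all add: X_def Y_def Qh_def)
        have "colsub p (tp J * X) c0 c = mk p c (\<lambda>a. x (case a of (i, j) \<Rightarrow> (True, \<rho> i, c0 + j)))"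
          by (rule fm_eqI) (use M in \<open>simp add: entry_colsub JX\<close>)
        moreover have "colsub p (tp J * Y) c0 c = mk p c (\<lambda>a. y1 (Inr (True, a)))"
          by (rule fm_eqI) (use M in \<open>simp add: entry_colsub JY z1\<close>)
        ultimately show "good p (d * \<epsilon>) Qh (colsub p (tp J * X) c0 c) (colsub p (tp J * Y) c0 c)"
          using pv by simp
        have x0: "x (True, \<rho> a, j) = 0" if "a < p" "j < c0" for a j
          using le0 img[of "\<rho> a"] that by auto
        show "colsub p (tp J * X) 0 c0 = 0"
          by (rule fm_eqI) (simp add: entry_colsub JX x0)
        show "colsub p (tp J * Y) 0 c0 = 0"
          by (rule fm_eqI) (simp add: entry_colsub JY x0 z3)
        let ?Xr = "colsub p (tp J * X) (c0 + c) c1" and ?Yr = "colsub p (tp J * Y) (c0 + c) c1"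
        have Xr: "?Xr = mk p c1 (\<lambda>a. y1 (case a of (i, j) \<Rightarrow> Inl (True, \<rho> i, c0 + c + j)))"
          by (rule fm_eqI) (use M in \<open>simp add: entry_colsub JX y1'\<close>)
        have Yr: "?Yr = mk p c1 (\<lambda>j. y2 (Inr j))"
          by (rule fm_eqI) (use M in \<open>simp add: entry_colsub JY z2\<close>)
        have tQ: "tp Qh = mk p p (\<lambda>a. y1 (case a of (i, j) \<Rightarrow> Inr (False, j, i)))"
          by (rule fm_eqI) (simp add: Qh_def)
        have "norm (?Yr - tp Qh * ?Xr) \<le> \<mu> * \<epsilon> * (norm (tp Qh) * norm ?Xr)"
          unfolding Xr Yr tQ by (rule k2)
        also have "\<dots> \<le> \<mu> * \<epsilon> * (2 * real S * norm X)"
          unfolding norm_tp using \<mu>e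
          by (intro mult_left_mono mult_mono Qhn order_trans[OF norm_colsub_le nJX]) auto
        finally show "norm (?Yr - tp Qh * ?Xr) \<le> 2 * real S * \<mu> * \<epsilon> * norm X" by (simp add: ac_simps)
        show "Y - J * (tp J * Y) = X - J * (tp J * X)"
          unfolding J_def using lt by (intro fm_eqI) (simp add: entry_sel_proj[OF inj] X_def Y_def z3)
        show "0 \<le> d * \<epsilon>" "0 \<le> 2 * real S * \<mu> * \<epsilon>" using pos e by simp_all
      qed
      have dQg: "dims N N (idm N - J * tp J + J * Qh * tp J)"
        unfolding Qh_def
        by (intro dims_add dims_diff dims_idm dims_mult[OF J(1) dims_tp[OF J(1)]]
            dims_mult[OF dims_mult[OF J(1) dims_mk] dims_tp[OF J(1)]])
      have eS: "2 * (d * \<epsilon>) + 2 * real S * \<mu> * \<epsilon> \<le> E * \<epsilon>"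
      proof -
        have "2 * real S \<le> 4 * (real S)\<^sup>2" using S1 by (simp add: power2_eq_square)
        then have "2 * real S * (\<mu> * \<epsilon>) \<le> 4 * (real S)\<^sup>2 * (\<mu> * \<epsilon>)" using \<mu>e by (rule mult_right_mono)
        moreover have "0 \<le> d * \<epsilon>" using pos e by simp
        ultimately show ?thesis by (simp add: E_def algebra_simps)
      qed
      have main: "good N (2 * \<delta> + 2 * (E * \<epsilon>)) A' X0 Y"
        if X0: "dims N M X0" and \<delta>: "0 \<le> \<delta>" "\<delta> \<le> 1" and g: "good N \<delta> A X0 X" for \<delta> X0
      proof (rule good_trans[OF g good_mono[OF gE eS]])
        show "dims N N A" "dims N M X0" "dims N M X" "dims N M Y" by (simp_all add: A_def X0 X_def Y_def)
        show "dims N N (idm N - J * tp J + J * Qh * tp J)" by (rule dQg)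
        define F where "F = mk N p (\<lambda>j. y3 (Inr j))"
        have AJ: "A * J = mk N p (\<lambda>a. y2 (case a of (i, j) \<Rightarrow> Inl (Inl (False, i, \<rho> j))))"
          unfolding J_def using lt by (intro fm_eqI) (simp add: entry_mult_sel A_def y2' y1')
        have dF: "dims N p (F - A * J * Qh)" unfolding F_def A_def Qh_def
          by (rule dims_diff[OF dims_mk dims_mult[OF dims_mult[OF dims_mk J(1)] dims_mk]])
        have nAJ: "norm (A * J) \<le> norm A"
        proof -
          have "A * J = mk N p (\<lambda>(i, j). entry A i (\<rho> j))"
            unfolding AJ by (rule fm_eqI) (simp add: A_def lt y2' y1')
          then show ?thesis using norm_gather_le[OF _ inj, of "\<lambda>j. j" N A] by simp
        qed
        have "A' = A - A * J * tp J + F * tp J"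
        proof (rule fm_eqI)
          fix i j
          have t: "tp (tp J) * tp B = tp (B * tp J)" for B by (simp add: tp_mult)
          have e1: "entry (B * tp J) i j = entry (J * tp B) j i" for B
            using entry_tp[of "B * tp J" j i] by (simp add: tp_mult)
          show "entry A' i j = entry (A - A * J * tp J + F * tp J) i j"
          proof (cases "j \<in> \<rho> ` {..<p}")
            case True
            then obtain b where b: "b < p" "j = \<rho> b" by auto
            have "entry (J * tp B) j i = entry (tp B) b i" for B
              unfolding J_def b(2) by (rule entry_sel_mult[OF inj b(1) lt[OF b(1)]])
            then have "entry (A - A * J * tp J + F * tp J) i j = entry A i j - entry (A * J) i b + entry F i b"
              by (simp add: e1)
            also have "entry (A * J) i b = entry A i j"
              using b lt by (simp add: J_def entry_mult_sel)
            finally show ?thesis using b lt by (simp add: A'_def F_def z4)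
          next
            case False
            then have "entry (A - A * J * tp J + F * tp J) i j = entry A i j"
              by (simp add: e1) (simp add: J_def entry_sel_mult_0)
            then show ?thesis using False by (simp add: A'_def A_def z5)
          qed
        qed
        moreover have "idm N * Z = Z \<Longrightarrow> A * (idm N - Z + J * Qh * tp J) = A - A * Z + A * J * Qh * tp J" for Z
          using mult_idm[of N N A] by (simp add: A_def distrib_left right_diff_distrib mult.assoc)
        ultimately have "A' - A * (idm N - J * tp J + J * Qh * tp J) = (F - A * J * Qh) * tp J"
          using mult_idm[of N N A] by (simp add: A_def distrib_left right_diff_distrib left_diff_distrib mult.assoc)
        then have "norm (A' - A * (idm N - J * tp J + J * Qh * tp J)) = norm (F - A * J * Qh)"
          using norm_mult_tp_isometry[OF J(2) dF] by simp
        also have "\<dots> \<le> \<mu> * \<epsilon> * (norm (A * J) * norm Qh)"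
          using k3 unfolding AJ F_def Qh_def by (simp add: y2' cong: mk_cong)
        also have "\<dots> \<le> \<mu> * \<epsilon> * (2 * real S * (2 * real S))"
        proof (intro mult_left_mono mult_mono Qhn \<mu>e)
          have "norm A \<le> real N + \<delta>" by (rule good_norm_Qh[OF g])
          also have "\<dots> \<le> real S + real S" using \<delta>(2) N(4,6) by (intro add_mono) auto
          finally show "norm (A * J) \<le> 2 * real S" using nAJ by simp
        qed auto
        also have "\<dots> = 4 * (real S)\<^sup>2 * \<mu> * \<epsilon>" by (simp add: power2_eq_square)
        also have "\<dots> \<le> E * \<epsilon>" using pos e by (intro mult_right_mono) (auto simp: E_def)
        finally show "norm (A' - A * (idm N - J * tp J + J * Qh * tp J)) \<le> E * \<epsilon>" .
        show "0 \<le> \<delta>" "\<delta> \<le> 1" "E * \<epsilon> \<le> 1" by fact+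
        show "0 \<le> E * \<epsilon>" using pos e by (simp add: E_def)
      qed
      show "(\<forall>\<delta> X0. dims N M X0 \<and> 0 \<le> \<delta> \<and> \<delta> \<le> 1 \<and> good N \<delta> (mk N N (\<lambda>a. x (False, a))) X0 (mk N M (\<lambda>a. x (True, a))) \<longrightarrow>
        good N (2 * \<delta> + 2 * (E * \<epsilon>)) (mk N N (\<lambda>a. z (False, a))) X0 (mk N M (\<lambda>a. z (True, a)))) \<and>
       (\<forall>i j. \<not> (s \<le> i \<and> i < s + l \<or> t \<le> i \<and> i < t + l') \<or> j < c0 \<longrightarrow> z (True, i, j) = x (True, i, j)) \<and>
       (\<forall>a j. a < l \<and> j < c \<and> j < a \<longrightarrow> z (True, s + a, c0 + j) = 0) \<and>
       (\<forall>b j. b < l' \<and> j < c \<and> j < l + b \<longrightarrow> z (True, t + b, c0 + j) = 0)"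
      proof (intro conjI allI impI)
        fix \<delta> X0
        assume "dims N M X0 \<and> 0 \<le> \<delta> \<and> \<delta> \<le> 1 \<and> good N \<delta> (mk N N (\<lambda>a. x (False, a))) X0 (mk N M (\<lambda>a. x (True, a)))"
        then show "good N (2 * \<delta> + 2 * (E * \<epsilon>)) (mk N N (\<lambda>a. z (False, a))) X0 (mk N M (\<lambda>a. z (True, a)))"
          using main by (simp add: A_def A'_def X_def Y_def)
      next
        fix i j assume "\<not> (s \<le> i \<and> i < s + l \<or> t \<le> i \<and> i < t + l') \<or> j < c0"
        then show "z (True, i, j) = x (True, i, j)" using z3 img by blast
      next
        fix a j assume a: "a < l \<and> j < c \<and> j < a"
        then have "z (True, \<rho> a, c0 + j) = 0" using z1[of a j] zero[of j a] by (simp add: p_def)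
        then show "z (True, s + a, c0 + j) = 0" using a by (simp add: \<rho>_def intervals_def)
      next
        fix b j assume b: "b < l' \<and> j < c \<and> j < l + b"
        then have "z (True, \<rho> (l + b), c0 + j) = 0" using z1[of "l + b" j] zero[of j "l + b"] by (simp add: p_def)
        then show "z (True, t + b, c0 + j) = 0" by (simp add: \<rho>_def intervals_def)
      qed
    qed
  qed
qed


lemma computable_initial:
  "computable 2 (\<lambda>\<epsilon> x z. \<exists>\<delta>. \<bar>\<delta>\<bar> \<le> \<epsilon> \<and>
     z = (\<lambda>(b, i :: nat, j). if b then x (i, j) else if i = j then 1 + \<delta> else 0))"
proof -
  have c: "computable 1 (\<lambda>\<epsilon> (x :: nat \<times> nat \<Rightarrow> real) z. \<exists>\<delta>. \<bar>\<delta>\<bar> \<le> \<epsilon> \<and> z = (\<lambda>_::unit. k * (1 + \<delta>)))" for k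
    by (rule computable_const)
  have c': "computable 1 (\<lambda>\<epsilon> (x :: (nat \<times> nat) + unit \<Rightarrow> real) z. \<exists>\<delta>. \<bar>\<delta>\<bar> \<le> \<epsilon> \<and> z = (\<lambda>_::unit. 0 * (1 + \<delta>)))"
    by (rule computable_const)
  let ?h = "\<lambda>(b, i, j). if b then Inl (Inl (i, j)) else if i = j then Inl (Inr ()) else Inr ()"
  show ?thesis
  proof (rule computable_mono[OF computable_seq[OF computable_keep[OF c[of 1]]
          computable_seq[OF computable_keep[OF c'] computable_copy[of ?h]]]])
    fix \<epsilon> :: real and x :: "nat \<times> nat \<Rightarrow> real" and z :: "bool \<times> nat \<times> nat \<Rightarrow> real"
    assume "\<exists>y. ((\<exists>\<delta>. \<bar>\<delta>\<bar> \<le> \<epsilon> \<and> (\<lambda>j. y (Inr j)) = (\<lambda>_. 1 * (1 + \<delta>))) \<and> (\<lambda>i. y (Inl i)) = x) \<and>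
      (\<exists>y'. ((\<exists>\<delta>. \<bar>\<delta>\<bar> \<le> \<epsilon> \<and> (\<lambda>j. y' (Inr j)) = (\<lambda>_. 0 * (1 + \<delta>))) \<and> (\<lambda>i. y' (Inl i)) = y) \<and> z = (\<lambda>a. y' (?h a)))"
    then obtain y y' \<delta> \<delta>' where z: "z = (\<lambda>a. y' (?h a))" and y: "(\<lambda>j. y (Inr j)) = (\<lambda>_. 1 * (1 + \<delta>))" "(\<lambda>i. y (Inl i)) = x"
      and y': "(\<lambda>j. y' (Inr j)) = (\<lambda>_. 0 * (1 + \<delta>'))" "(\<lambda>i. y' (Inl i)) = y" and \<delta>: "\<bar>\<delta>\<bar> \<le> \<epsilon>"
      by (elim exE conjE) (rule that, assumption+)
    have "z = (\<lambda>(b, i, j). if b then x (i, j) else if i = j then 1 + \<delta> else 0)"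
      using fun_cong[OF y(1)] fun_cong[OF y(2)] fun_cong[OF y'(1)] fun_cong[OF y'(2)]
      by (auto simp: z fun_eq_iff)
    then show "\<exists>\<delta>. \<bar>\<delta>\<bar> \<le> \<epsilon> \<and> z = (\<lambda>(b, i, j). if b then x (i, j) else if i = j then 1 + \<delta> else 0)"
      using \<delta> by blast
  qed simp
qed

lemma good_initial:
  assumes "\<bar>\<delta>\<bar> \<le> \<epsilon>"
  shows "good p (real p * \<epsilon>) (mk p p (\<lambda>(i, j). if i = j then 1 + \<delta> else 0)) (mk p c x) (mk p c x)"
proof -
  have "mk p p (\<lambda>(i, j). if i = j then 1 + \<delta> else 0) - idm p = \<delta> *\<^sub>R idm p"
    by (rule fm_eqI) simp
  then have "norm (mk p p (\<lambda>(i, j). if i = j then 1 + \<delta> else 0) - idm p) \<le> \<epsilon> * real p"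
    using assms norm_idm_le[of p] by (simp add: mult_mono)
  then show ?thesis using assms orth_idm[of p] idm_mult[OF dims_mk, of p c x]
    unfolding good_def by (intro exI[of _ "idm p"]) (simp add: mult.commute)
qed

lemma qr_kernel_identity:
  assumes "\<And>i j. j < i \<Longrightarrow> i < p \<Longrightarrow> j < c \<Longrightarrow> i < r"
  shows "qr_kernel p c r 2 (real p)"
  unfolding qr_kernel_def
proof (rule computable_mono[OF computable_initial order_refl], intro impI)
  fix \<epsilon> :: real and x :: "nat \<times> nat \<Rightarrow> real" and z :: "bool \<times> nat \<times> nat \<Rightarrow> real"
  assume "\<exists>\<delta>. \<bar>\<delta>\<bar> \<le> \<epsilon> \<and> z = (\<lambda>(b, i, j). if b then x (i, j) else if i = j then 1 + \<delta> else 0)"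
  then obtain \<delta> where \<delta>: "\<bar>\<delta>\<bar> \<le> \<epsilon>" and z: "z = (\<lambda>(b, i, j). if b then x (i, j) else if i = j then 1 + \<delta> else 0)"
    by blast
  assume up: "\<forall>i j. j < i \<and> i < r \<and> j < c \<longrightarrow> x (i, j) = 0"
  have "mk p p (\<lambda>a. z (False, a)) = mk p p (\<lambda>(i, j). if i = j then 1 + \<delta> else 0)"
    "mk p c (\<lambda>a. z (True, a)) = mk p c x" by (rule mk_cong, simp add: z)+
  then show "good p (real p * \<epsilon>) (mk p p (\<lambda>a. z (False, a))) (mk p c x) (mk p c (\<lambda>a. z (True, a))) \<and>
     (\<forall>i j. j < i \<and> i < p \<and> j < c \<longrightarrow> z (True, i, j) = 0)"
    using good_initial[OF \<delta>, of p c x] up assms by (auto simp: z)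
qed

lemma computable_put:
  fixes R :: "real \<Rightarrow> ('i \<Rightarrow> real) \<Rightarrow> (unit \<Rightarrow> real) \<Rightarrow> bool"
  assumes "computable C R"
  shows "computable C (\<lambda>\<epsilon> x z. \<exists>w. R \<epsilon> x (\<lambda>_. w) \<and> z = x(k := w))"
proof (rule computable_mono[OF computable_call[OF assms, of "\<lambda>i. i" "\<lambda>i. if i = k then Inr () else Inl i"]])
  fix \<epsilon> and x z :: "'i \<Rightarrow> real"
  assume "\<exists>w. R \<epsilon> x w \<and> z = (\<lambda>a. case if a = k then Inr () else Inl a of Inl b \<Rightarrow> x b | Inr b \<Rightarrow> w b)"
  then obtain w where w: "R \<epsilon> x w" "z = (\<lambda>a. case if a = k then Inr () else Inl a of Inl b \<Rightarrow> x b | Inr b \<Rightarrow> w b)" by blast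
  have "w = (\<lambda>_. w ())" by (rule ext) simp
  then have "R \<epsilon> x (\<lambda>_. w ())" using w(1) by simp
  moreover have "z = x(k := w ())" by (rule ext) (simp add: w(2))
  ultimately show "\<exists>w. R \<epsilon> x (\<lambda>_. w) \<and> z = x(k := w)" by blast
qed simp

lemma hypot_rounding:
  fixes a b \<epsilon> :: real
  assumes e: "0 \<le> \<epsilon>" "\<epsilon> \<le> 1 / 40" and \<delta>: "\<bar>\<delta>1\<bar> \<le> \<epsilon>" "\<bar>\<delta>2\<bar> \<le> \<epsilon>" "\<bar>\<delta>3\<bar> \<le> \<epsilon>" "\<bar>\<delta>4\<bar> \<le> \<epsilon>"
  defines "h \<equiv> sqrt ((a\<^sup>2 * (1 + \<delta>1) + b\<^sup>2 * (1 + \<delta>2)) * (1 + \<delta>3)) * (1 + \<delta>4)"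
    and "h0 \<equiv> sqrt (a\<^sup>2 + b\<^sup>2)"
  shows "\<bar>h - h0\<bar> \<le> 3 * \<epsilon> * h0"
proof -
  define t where "t = (a\<^sup>2 * (1 + \<delta>1) + b\<^sup>2 * (1 + \<delta>2)) * (1 + \<delta>3)"
  have h0: "h0 \<ge> 0" "h0\<^sup>2 = a\<^sup>2 + b\<^sup>2" by (simp_all add: h0_def)
  have s: "h0\<^sup>2 * (1 - \<epsilon>) \<le> a\<^sup>2 * (1 + \<delta>1) + b\<^sup>2 * (1 + \<delta>2)" "a\<^sup>2 * (1 + \<delta>1) + b\<^sup>2 * (1 + \<delta>2) \<le> h0\<^sup>2 * (1 + \<epsilon>)"
    unfolding h0(2) distrib_right using \<delta> by (auto intro!: add_mono mult_left_mono)
  have "(h0\<^sup>2 * (1 - \<epsilon>)) * (1 - \<epsilon>) \<le> t" "t \<le> (h0\<^sup>2 * (1 + \<epsilon>)) * (1 + \<epsilon>)"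
    unfolding t_def using s \<delta> e by (auto intro!: mult_mono order_trans[OF _ s(1)])
  then have "((1 - \<epsilon>) * h0)\<^sup>2 \<le> t" "t \<le> ((1 + \<epsilon>) * h0)\<^sup>2" by (simp_all add: power2_eq_square ac_simps)
  then have t: "(1 - \<epsilon>) * h0 \<le> sqrt t" "sqrt t \<le> (1 + \<epsilon>) * h0"
    using e h0(1) real_sqrt_le_mono real_sqrt_abs by (auto intro: real_le_rsqrt real_le_lsqrt)
  have h: "((1 - \<epsilon>) * h0) * (1 - \<epsilon>) \<le> h" "h \<le> ((1 + \<epsilon>) * h0) * (1 + \<epsilon>)"
    unfolding h_def t_def[symmetric] using t \<delta> e h0(1) by (auto intro!: mult_mono order_trans[OF _ t(1)])
  have sq: "(1 + \<epsilon>) * (1 + \<epsilon>) \<le> 1 + 3 * \<epsilon>" "1 - 3 * \<epsilon> \<le> (1 - \<epsilon>) * (1 - \<epsilon>)"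
    using mult_left_le[of \<epsilon> \<epsilon>] e by (simp_all add: distrib_left distrib_right left_diff_distrib right_diff_distrib)
  have "h \<le> (1 + \<epsilon>) * (1 + \<epsilon>) * h0" using h(2) by (simp only: ac_simps)
  also have "\<dots> \<le> (1 + 3 * \<epsilon>) * h0" by (rule mult_right_mono[OF sq(1) h0(1)])
  finally have u: "h \<le> h0 + 3 * \<epsilon> * h0" by (simp add: distrib_right)
  have "(1 - 3 * \<epsilon>) * h0 \<le> (1 - \<epsilon>) * (1 - \<epsilon>) * h0" by (rule mult_right_mono[OF sq(2) h0(1)])
  also have "\<dots> \<le> h" using h(1) by (simp only: ac_simps)
  finally have "h0 - 3 * \<epsilon> * h0 \<le> h" by (simp add: left_diff_distrib)
  then show ?thesis using u by (simp add: abs_le_iff)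
qed

lemma quotient_rounding:
  fixes a h h0 \<epsilon> :: real
  assumes e: "0 \<le> \<epsilon>" "\<epsilon> \<le> 1 / 40" and \<delta>: "\<bar>\<delta>\<bar> \<le> \<epsilon>" and h: "0 < h0" "\<bar>h - h0\<bar> \<le> 3 * \<epsilon> * h0" and a: "\<bar>a\<bar> \<le> h0"
  shows "\<bar>a / h * (1 + \<delta>) - a / h0\<bar> \<le> 8 * \<epsilon>"
proof -
  have "3 * \<epsilon> * h0 \<le> 3 / 40 * h0" using e h(1) by (intro mult_right_mono) auto
  then have h1: "h \<ge> 37 / 40 * h0" using h(2) by (simp add: abs_le_iff)
  then have hp: "h > 0" using h(1) by linarith
  have "\<bar>h0 * (1 + \<delta>) - h\<bar> \<le> \<bar>h0 - h\<bar> + \<bar>h0 * \<delta>\<bar>" by (simp add: algebra_simps)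
  also have "\<dots> \<le> 3 * \<epsilon> * h0 + h0 * \<epsilon>"
    using h \<delta> by (intro add_mono) (auto simp: abs_mult abs_minus_commute)
  also have "\<dots> = 4 * \<epsilon> * h0" by simp
  finally have 1: "\<bar>h0 * (1 + \<delta>) - h\<bar> \<le> 4 * \<epsilon> * h0" .
  have "a / h * (1 + \<delta>) - a / h0 = a / h0 * ((h0 * (1 + \<delta>) - h) / h)"
    using hp h(1) by (simp add: field_simps)
  then have "\<bar>a / h * (1 + \<delta>) - a / h0\<bar> = \<bar>a\<bar> / h0 * (\<bar>h0 * (1 + \<delta>) - h\<bar> / h)"
    using hp h(1) by (simp add: abs_mult)
  also have "\<dots> \<le> 1 * (4 * \<epsilon> * h0 / (37 / 40 * h0))"
    using a h(1) h1 hp 1 by (intro mult_mono frac_le) auto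
  also have "\<dots> = 160 / 37 * \<epsilon>" using h(1) by simp
  also have "\<dots> \<le> 8 * \<epsilon>" using e(1) by simp
  finally show ?thesis .
qed

definition rotation :: "real \<Rightarrow> real \<Rightarrow> fm" where
  "rotation c s = mk 2 2 (\<lambda>(i, j). if i = j then c else if i = 0 then - s else s)"

lemma orth_rotation:
  assumes "c\<^sup>2 + s\<^sup>2 = 1" shows "orth 2 (rotation c s)"
proof -
  have d: "dims 2 2 (rotation c s)" by (simp add: rotation_def)
  have "entry (tp (rotation c s) * rotation c s) i j = entry (idm 2) i j"
    "entry (rotation c s * tp (rotation c s)) i j = entry (idm 2) i j" for i j
    unfolding entry_mult[OF d] entry_mult[OF dims_tp[OF d]] using assms
    by (auto simp: rotation_def numeral_2_eq_2 less_Suc_eq power2_eq_square algebra_simps)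
  then have "tp (rotation c s) * rotation c s = idm 2" "rotation c s * tp (rotation c s) = idm 2"
    by (auto intro: fm_eqI)
  then show ?thesis using d by (simp add: orth_def)
qed

lemma qr_kernel_givens: "qr_kernel 2 1 1 14 40"
proof -
  note c1 = computable_put[OF computable_hyp[of "0 :: nat" 1], of 2]
  note c2 = computable_put[OF computable_safe_div[of "2 :: nat" 0 1], of 3]
  note c3 = computable_put[OF computable_safe_div[of "2 :: nat" 1 0], of 4]
  note c4 = computable_put[OF computable_const[of 0], of 5]
  note c5 = computable_put[OF computable_sub[of "5 :: nat" 3], of 6]
  let ?f = "\<lambda>i :: nat. (i, 0 :: nat)"
  let ?h = "\<lambda>(b, i, j). if b then (if i = 0 then 2 else 5) else if i = j then 4 else if i = (0::nat) then 6 else (3 :: nat)"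
  note prog = computable_seq[OF computable_copy[of ?f] computable_seq[OF c1 computable_seq[OF c2 computable_seq[OF c3
    computable_seq[OF c4 computable_seq[OF c5 computable_copy[of ?h]]]]]]]
  show ?thesis
    unfolding qr_kernel_def
  proof (rule computable_mono[OF prog], goal_cases)
    case (2 \<epsilon> x z)
    show ?case
    proof (intro impI)
      assume d: "40 * \<epsilon> \<le> 1"
      have e: "0 \<le> \<epsilon>" "\<epsilon> \<le> 1 / 40" using 2(1) d by auto
      define a where "a = x (0, 0)"
      define b where "b = x (1, 0)"
      from 2(3) obtain y y1 y2 y3 y4 y5 h c s u n \<delta>1 \<delta>2 \<delta>3 \<delta>4 \<delta>5 \<delta>6 \<delta>7 \<delta>8 where
        y: "y = (\<lambda>t. x (?f t))" "y1 = y(2 := h)" "y2 = y1(3 := s)" "y3 = y2(4 := c)" "y4 = y3(5 := u)" "y5 = y4(6 := n)"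
        and v: "(\<lambda>_ :: unit. h) = (\<lambda>_. sqrt (((y 0)\<^sup>2 * (1 + \<delta>1) + (y 1)\<^sup>2 * (1 + \<delta>2)) * (1 + \<delta>3)) * (1 + \<delta>4))"
          "(\<lambda>_ :: unit. s) = (\<lambda>_. (if y1 2 = 0 then 0 else y1 1 / y1 2) * (1 + \<delta>6))"
          "(\<lambda>_ :: unit. c) = (\<lambda>_. (if y2 2 = 0 then 1 else y2 0 / y2 2) * (1 + \<delta>5))"
          "(\<lambda>_ :: unit. u) = (\<lambda>_. 0 * (1 + \<delta>7))"
          "(\<lambda>_ :: unit. n) = (\<lambda>_. (y4 5 - y4 3) * (1 + \<delta>8))"
        and z: "z = (\<lambda>t. y5 (?h t))"
        and \<delta>: "\<bar>\<delta>1\<bar> \<le> \<epsilon>" "\<bar>\<delta>2\<bar> \<le> \<epsilon>" "\<bar>\<delta>3\<bar> \<le> \<epsilon>" "\<bar>\<delta>4\<bar> \<le> \<epsilon>" "\<bar>\<delta>5\<bar> \<le> \<epsilon>" "\<bar>\<delta>6\<bar> \<le> \<epsilon>" "\<bar>\<delta>8\<bar> \<le> \<epsilon>"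
        by (elim exE conjE) (rule that, assumption+)
      note v' = fun_cong[OF v(1)] fun_cong[OF v(2)] fun_cong[OF v(3)]
        fun_cong[OF v(4)] fun_cong[OF v(5)]
      have h: "h = sqrt ((a\<^sup>2 * (1 + \<delta>1) + b\<^sup>2 * (1 + \<delta>2)) * (1 + \<delta>3)) * (1 + \<delta>4)"
        using v'(1) by (simp add: y(1) a_def b_def)
      have s: "s = (if h = 0 then 0 else b / h) * (1 + \<delta>6)" using v'(2) by (simp add: y(1,2) b_def)
      have c: "c = (if h = 0 then 1 else a / h) * (1 + \<delta>5)" using v'(3) by (simp add: y(1-3) a_def)
      have u: "u = 0" using v'(4) by simp
      have n: "n = - s * (1 + \<delta>8)" using v'(5) by (simp add: y(2-5) u)
      define h0 where "h0 = sqrt (a\<^sup>2 + b\<^sup>2)"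
      have hh: "\<bar>h - h0\<bar> \<le> 3 * \<epsilon> * h0" unfolding h h0_def by (rule hypot_rounding[OF e \<delta>(1-4)])
      let ?X = "mk 2 1 x" and ?Y = "mk 2 1 (\<lambda>a. z (True, a))" and ?Q = "mk 2 2 (\<lambda>a. z (False, a))"
      have zv: "z (True, 0, 0) = h" "z (True, Suc 0, 0) = 0" "z (False, 0, 0) = c" "z (False, Suc 0, Suc 0) = c"
        "z (False, Suc 0, 0) = s" "z (False, 0, Suc 0) = - s * (1 + \<delta>8)" using n by (simp_all add: z y u)
      have X: "norm ?X = h0"
      proof -
        have two: "{..<2} = {0, 1 :: nat}" by auto
        have "(norm ?X)\<^sup>2 = h0\<^sup>2"
          by (simp add: norm_fm_sq[OF dims_mk] two h0_def a_def b_def)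
        then show ?thesis by (rule power2_eq_imp_eq) (simp_all add: h0_def)
      qed
      have "\<exists>c0 s0. c0\<^sup>2 + s0\<^sup>2 = 1 \<and> a = c0 * h0 \<and> b = s0 * h0 \<and> \<bar>c - c0\<bar> \<le> 8 * \<epsilon> \<and> \<bar>s - s0\<bar> \<le> 8 * \<epsilon>"
      proof (cases "h0 = 0")
        case True
        then have ab: "a = 0" "b = 0" by (simp_all add: h0_def sum_power2_eq_zero_iff)
        then have "h = 0" using hh True by simp
        then have "c = 1 + \<delta>5" "s = 0" by (simp_all add: c s)
        then show ?thesis using ab True \<delta>(5) e by - (rule exI[of _ 1], rule exI[of _ 0], auto)
      next
        case False
        then have h0: "h0 > 0" by (simp add: h0_def less_le)
        have "3 * \<epsilon> * h0 \<le> 3 / 40 * h0" using e h0 by (intro mult_right_mono) auto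
        then have "h \<noteq> 0" using hh h0 by (auto simp: abs_le_iff)
        then have cs: "c = a / h * (1 + \<delta>5)" "s = b / h * (1 + \<delta>6)" by (simp_all add: c s)
        have ab: "\<bar>a\<bar> \<le> h0" "\<bar>b\<bar> \<le> h0" unfolding h0_def by (simp_all add: real_le_rsqrt)
        have "(a / h0)\<^sup>2 + (b / h0)\<^sup>2 = (a\<^sup>2 + b\<^sup>2) / h0\<^sup>2" by (simp add: power_divide add_divide_distrib)
        also have "a\<^sup>2 + b\<^sup>2 = h0\<^sup>2" by (simp add: h0_def)
        also have "h0\<^sup>2 / h0\<^sup>2 = 1" using h0 by simp
        finally show ?thesis
          using quotient_rounding[OF e \<delta>(5) h0 hh ab(1)] quotient_rounding[OF e \<delta>(6) h0 hh ab(2)] h0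
          unfolding cs by (intro exI[of _ "a / h0"] exI[of _ "b / h0"]) simp
      qed
      then obtain c0 s0 where cs: "c0\<^sup>2 + s0\<^sup>2 = 1" "a = c0 * h0" "b = s0 * h0" "\<bar>c - c0\<bar> \<le> 8 * \<epsilon>" "\<bar>s - s0\<bar> \<le> 8 * \<epsilon>"
        by blast
      have "c0\<^sup>2 \<le> 1" "s0\<^sup>2 \<le> 1" using cs(1) zero_le_power2[of c0] zero_le_power2[of s0] by linarith+
      then have c0: "\<bar>c0\<bar> \<le> 1" "\<bar>s0\<bar> \<le> 1" by (simp_all only: abs_square_le_1)
      have "\<bar>s * \<delta>8\<bar> \<le> (1 + 8 * \<epsilon>) * \<epsilon>" unfolding abs_mult
        using cs(5) c0(2) \<delta>(7) e by (intro mult_mono) auto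
      also have "\<dots> \<le> 2 * \<epsilon>" using e by (intro mult_right_mono) auto
      finally have ns: "\<bar>- s * (1 + \<delta>8) + s0\<bar> \<le> 10 * \<epsilon>" using cs(5) by (simp add: algebra_simps abs_le_iff)
      have "norm (?Q - rotation c0 s0) \<le> real (2 * 2) * (10 * \<epsilon>)"
      proof (rule norm_le_card_entries)
        show "dims 2 2 (?Q - rotation c0 s0)" unfolding rotation_def by (rule dims_diff[OF dims_mk dims_mk])
        fix i j :: nat assume "i < 2" "j < 2"
        then show "\<bar>entry (?Q - rotation c0 s0) i j\<bar> \<le> 10 * \<epsilon>"
          using cs(4,5) ns e by (auto simp: rotation_def numeral_2_eq_2 less_Suc_eq zv)
      qed
      moreover have "norm (?X - rotation c0 s0 * ?Y) \<le> real (2 * 1) * (3 * \<epsilon> * h0)"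
      proof (rule norm_le_card_entries)
        show "dims 2 1 (?X - rotation c0 s0 * ?Y)"
          unfolding rotation_def by (rule dims_diff[OF dims_mk dims_mult[OF dims_mk dims_mk]])
        fix i j :: nat assume ij: "i < 2" "j < 1"
        have "entry (?X - rotation c0 s0 * ?Y) i j = (if i = 0 then c0 else s0) * (h0 - h)"
          using ij cs(2,3) by (auto simp: rotation_def entry_mult[OF dims_mk] numeral_2_eq_2 less_Suc_eq zv a_def b_def algebra_simps)
        also have "\<bar>\<dots>\<bar> \<le> 1 * (3 * \<epsilon> * h0)"
          unfolding abs_mult using c0 hh by (intro mult_mono) (auto simp: abs_minus_commute)
        finally show "\<bar>entry (?X - rotation c0 s0 * ?Y) i j\<bar> \<le> 3 * \<epsilon> * h0" by simp
      qed
      moreover have "0 \<le> \<epsilon> * h0" using e by (simp add: h0_def)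
      ultimately have "good 2 (40 * \<epsilon>) ?Q ?X ?Y"
        unfolding good_def X using orth_rotation[OF cs(1)] by (intro exI[of _ "rotation c0 s0"]) simp
      then show "good 2 (40 * \<epsilon>) ?Q ?X ?Y \<and> (\<forall>i j. j < i \<and> i < 2 \<and> j < 1 \<longrightarrow> z (True, i, j) = 0)"
        by (auto simp: less_Suc_eq numeral_2_eq_2 zv)
    qed
  qed simp
qed


lemma step_relD:
  assumes "step_rel N M s l t l' c0 c r E \<epsilon> x z" "E * \<epsilon> \<le> 1"
    and "\<And>i j. j < i \<Longrightarrow> i < r \<Longrightarrow> j < c \<Longrightarrow> x (True, s + i, c0 + j) = 0"
    and "\<And>i j. s \<le> i \<and> i < s + l \<or> t \<le> i \<and> i < t + l' \<Longrightarrow> j < c0 \<Longrightarrow> x (True, i, j) = 0"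
  shows "\<And>\<delta> X0. dims N M X0 \<Longrightarrow> 0 \<le> \<delta> \<Longrightarrow> \<delta> \<le> 1 \<Longrightarrow>
        good N \<delta> (mk N N (\<lambda>a. x (False, a))) X0 (mk N M (\<lambda>a. x (True, a))) \<Longrightarrow>
        good N (2 * \<delta> + 2 * (E * \<epsilon>)) (mk N N (\<lambda>a. z (False, a))) X0 (mk N M (\<lambda>a. z (True, a)))"
    and "\<And>i j. \<not> (s \<le> i \<and> i < s + l \<or> t \<le> i \<and> i < t + l') \<or> j < c0 \<Longrightarrow> z (True, i, j) = x (True, i, j)"
    and "\<And>a j. a < l \<Longrightarrow> j < c \<Longrightarrow> j < a \<Longrightarrow> z (True, s + a, c0 + j) = 0"
    and "\<And>b j. b < l' \<Longrightarrow> j < c \<Longrightarrow> j < l + b \<Longrightarrow> z (True, t + b, c0 + j) = 0"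
proof -
  have u: "\<forall>i j. j < i \<and> i < r \<and> j < c \<longrightarrow> x (True, s + i, c0 + j) = 0" using assms(3) by blast
  have v: "\<forall>i j. (s \<le> i \<and> i < s + l \<or> t \<le> i \<and> i < t + l') \<and> j < c0 \<longrightarrow> x (True, i, j) = 0"
    using assms(4) by blast
  have R: "(\<forall>\<delta> X0. dims N M X0 \<and> 0 \<le> \<delta> \<and> \<delta> \<le> 1 \<and> good N \<delta> (mk N N (\<lambda>a. x (False, a))) X0 (mk N M (\<lambda>a. x (True, a))) \<longrightarrow>
        good N (2 * \<delta> + 2 * (E * \<epsilon>)) (mk N N (\<lambda>a. z (False, a))) X0 (mk N M (\<lambda>a. z (True, a)))) \<and>
     (\<forall>i j. \<not> (s \<le> i \<and> i < s + l \<or> t \<le> i \<and> i < t + l') \<or> j < c0 \<longrightarrow> z (True, i, j) = x (True, i, j)) \<and>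
     (\<forall>a j. a < l \<and> j < c \<and> j < a \<longrightarrow> z (True, s + a, c0 + j) = 0) \<and>
     (\<forall>b j. b < l' \<and> j < c \<and> j < l + b \<longrightarrow> z (True, t + b, c0 + j) = 0)"
    by (rule mp[OF mp[OF mp[OF assms(1)[unfolded step_rel_def] assms(2)] u] v])
  note R1 = R[THEN conjunct1] and R2 = R[THEN conjunct2, THEN conjunct1]
    and R3 = R[THEN conjunct2, THEN conjunct2, THEN conjunct1] and R4 = R[THEN conjunct2, THEN conjunct2, THEN conjunct2]
  show "\<And>\<delta> X0. dims N M X0 \<Longrightarrow> 0 \<le> \<delta> \<Longrightarrow> \<delta> \<le> 1 \<Longrightarrow>
        good N \<delta> (mk N N (\<lambda>a. x (False, a))) X0 (mk N M (\<lambda>a. x (True, a))) \<Longrightarrow>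
        good N (2 * \<delta> + 2 * (E * \<epsilon>)) (mk N N (\<lambda>a. z (False, a))) X0 (mk N M (\<lambda>a. z (True, a)))"
    by (rule R1[rule_format]) simp
  show "\<And>i j. \<not> (s \<le> i \<and> i < s + l \<or> t \<le> i \<and> i < t + l') \<or> j < c0 \<Longrightarrow> z (True, i, j) = x (True, i, j)"
    by (rule R2[rule_format])
  show "\<And>a j. a < l \<Longrightarrow> j < c \<Longrightarrow> j < a \<Longrightarrow> z (True, s + a, c0 + j) = 0"
    by (rule R3[rule_format]) simp
  show "\<And>b j. b < l' \<Longrightarrow> j < c \<Longrightarrow> j < l + b \<Longrightarrow> z (True, t + b, c0 + j) = 0"
    by (rule R4[rule_format]) simp
qed

lemma initial_good:
  assumes "\<bar>\<delta>\<bar> \<le> \<epsilon>" "z = (\<lambda>(b, i, j). if b then x (i, j) else if i = j then 1 + \<delta> else 0)"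
  shows "good N (real N * \<epsilon>) (mk N N (\<lambda>a. z (False, a))) (mk N M x) (mk N M (\<lambda>a. z (True, a)))"
proof -
  have "mk N N (\<lambda>a. z (False, a)) = mk N N (\<lambda>(i, j). if i = j then 1 + \<delta> else 0)"
    "mk N M (\<lambda>a. z (True, a)) = mk N M x" by (rule mk_cong, simp add: assms(2))+
  then show ?thesis using good_initial[OF assms(1), of N M x] by simp
qed

lemma error_chain:
  fixes u v :: real
  assumes "0 \<le> u" "0 \<le> v" "16 * u + 30 * v \<le> 1"
  shows "0 \<le> u" "u \<le> 1" "0 \<le> 2 * u + 2 * v" "2 * u + 2 * v \<le> 1"
    "0 \<le> 2 * (2 * u + 2 * v) + 2 * v" "2 * (2 * u + 2 * v) + 2 * v \<le> 1"
    "0 \<le> 2 * (2 * (2 * u + 2 * v) + 2 * v) + 2 * v" "2 * (2 * (2 * u + 2 * v) + 2 * v) + 2 * v \<le> 1"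
  using assms by auto

text \<open>Elimination of \<open>B\<close> in \<open>[R; B]\<close> with \<open>R\<close> upper triangular.  Splitting both into halves, the four half-size
  eliminations treat the pairs \<open>(R11, B11)\<close>, \<open>(R11, B21)\<close>, \<open>(R22, B12)\<close>, \<open>(R22, B22)\<close>.\<close>

lemma qr_kernel_eliminate:
  assumes G: "\<And>p q. p \<le> m \<Longrightarrow> q \<le> m \<Longrightarrow> qr_kernel (p + q) p p C d"
    and mm: "mm_kernel S Cm \<mu>" and pq: "p \<le> 2 * m" "q \<le> 2 * m" "p + q \<le> S" and S: "1 \<le> S"
    and pos: "0 \<le> d" "0 \<le> \<mu>"
  shows "qr_kernel (p + q) p p (4 * (C + 2 * (Cm + 1)) + 2) (16 * real S + 30 * (3 * d + 4 * (real S)\<^sup>2 * \<mu>))"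
proof -
  define p1 where "p1 = min p m"
  define p2 where "p2 = p - p1"
  define q1 where "q1 = min q m"
  define q2 where "q2 = q - q1"
  define N where "N = p + q"
  define E where "E = 3 * d + 4 * (real S)\<^sup>2 * \<mu>"
  have sz: "p1 \<le> m" "p2 \<le> m" "q1 \<le> m" "q2 \<le> m" "p = p1 + p2" "q = q1 + q2"
    using pq by (auto simp: p1_def p2_def q1_def q2_def)
  have E0: "E \<ge> 0" using pos by (simp add: E_def)
  have s1: "computable (C + 2 * (Cm + 1)) (step_rel N p 0 p1 p q1 0 p1 p1 E)"
    unfolding E_def by (rule computable_step[OF G[OF sz(1,3)] mm]) (use sz S pq pos in \<open>auto simp: N_def\<close>)
  have s2: "computable (C + 2 * (Cm + 1)) (step_rel N p 0 p1 (p + q1) q2 0 p1 p1 E)"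
    unfolding E_def by (rule computable_step[OF G[OF sz(1,4)] mm]) (use sz S pq pos in \<open>auto simp: N_def\<close>)
  have s3: "computable (C + 2 * (Cm + 1)) (step_rel N p p1 p2 p q1 p1 p2 p2 E)"
    unfolding E_def by (rule computable_step[OF G[OF sz(2,3)] mm]) (use sz S pq pos in \<open>auto simp: N_def\<close>)
  have s4: "computable (C + 2 * (Cm + 1)) (step_rel N p p1 p2 (p + q1) q2 p1 p2 p2 E)"
    unfolding E_def by (rule computable_step[OF G[OF sz(2,4)] mm]) (use sz S pq pos in \<open>auto simp: N_def\<close>)
  show ?thesis
    unfolding qr_kernel_def E_def[symmetric] N_def[symmetric]
  proof (rule computable_mono[OF computable_seq[OF computable_initial computable_seq[OF s1 computable_seq[OF s2 computable_seq[OF s3 s4]]]]],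
      goal_cases)
    case (2 \<epsilon> x z4)
    show ?case
    proof (intro impI)
      assume D: "(16 * real S + 30 * E) * \<epsilon> \<le> 1" and up: "\<forall>i j. j < i \<and> i < p \<and> j < p \<longrightarrow> x (i, j) = 0"
      from 2(3) obtain z0 z1 z2 z3 where i0: "\<exists>\<delta>. \<bar>\<delta>\<bar> \<le> \<epsilon> \<and> z0 = (\<lambda>(b, i, j). if b then x (i, j) else if i = j then 1 + \<delta> else 0)"
        and r: "step_rel N p 0 p1 p q1 0 p1 p1 E \<epsilon> z0 z1" "step_rel N p 0 p1 (p + q1) q2 0 p1 p1 E \<epsilon> z1 z2"
          "step_rel N p p1 p2 p q1 p1 p2 p2 E \<epsilon> z2 z3" "step_rel N p p1 p2 (p + q1) q2 p1 p2 p2 E \<epsilon> z3 z4" by blast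
      from i0 obtain \<delta> where \<delta>: "\<bar>\<delta>\<bar> \<le> \<epsilon>" "z0 = (\<lambda>(b, i, j). if b then x (i, j) else if i = j then 1 + \<delta> else 0)" by blast
      have z0: "z0 (True, i, j) = x (i, j)" for i j by (simp add: \<delta>(2))
      have e: "0 \<le> \<epsilon>" by (rule 2(1))
      have Ee: "0 \<le> E * \<epsilon>" "0 \<le> real S * \<epsilon>" "real N * \<epsilon> \<le> real S * \<epsilon>"
        using E0 e pq(3) by (auto simp: N_def intro!: mult_right_mono)
      have D': "16 * (real S * \<epsilon>) + 30 * (E * \<epsilon>) \<le> 1" using D by (simp add: algebra_simps)
      have E1: "E * \<epsilon> \<le> 1" using D' Ee by linarith
      have up': "x (i, j) = 0" if "j < i" "i < p" "j < p" for i j using up that by blast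
      have a1: "z0 (True, 0 + i, 0 + j) = 0" if "j < i" "i < p1" "j < p1" for i j
        using up'[of j i] that sz by (simp add: z0)
      note R1 = step_relD[OF r(1) E1 a1, simplified]
      have a2: "z1 (True, 0 + i, 0 + j) = 0" if "j < i" "i < p1" "j < p1" for i j
        using R1(3)[of i j] that by simp
      note R2 = step_relD[OF r(2) E1 a2, simplified]
      have un2: "z2 (True, i, j) = x (i, j)" if "p1 \<le> i" "i < p" for i j
        using R1(2)[of i j] R2(2)[of i j] that by (simp add: z0)
      have low2: "z2 (True, i, j) = 0" if "p \<le> i" "i < p + q" "j < p1" for i j
      proof (cases "i < p + q1")
        case True
        then have "z1 (True, p + (i - p), j) = 0" using that by (intro R1(4)) auto
        then show ?thesis using R2(2)[of i j] True that sz by simp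
      next
        case False
        then have "z2 (True, p + q1 + (i - (p + q1)), j) = 0" using that sz by (intro R2(4)) auto
        then show ?thesis using False by simp
      qed
      have a3: "z2 (True, p1 + i, p1 + j) = 0" if "j < i" "i < p2" "j < p2" for i j
        using un2[of "p1 + i"] up'[of "p1 + j" "p1 + i"] that sz by simp
      have b3: "z2 (True, i, j) = 0" if "p1 \<le> i \<and> i < p1 + p2 \<or> p \<le> i \<and> i < p + q1" "j < p1" for i j
        using that un2[of i j] up'[of j i] low2[of i j] sz by auto
      note R3 = step_relD[OF r(3) E1 a3 b3, simplified]
      have a4: "z3 (True, p1 + i, p1 + j) = 0" if "j < i" "i < p2" "j < p2" for i j
        using R3(3) that by blast
      have b4: "z3 (True, i, j) = 0" if "p1 \<le> i \<and> i < p1 + p2 \<or> p + q1 \<le> i \<and> i < p + q1 + q2" "j < p1" for i j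
        using that R3(2)[of i j] un2[of i j] up'[of j i] low2[of i j] sz by auto
      note R4 = step_relD[OF r(4) E1 a4 b4, simplified]
      have "good N (real N * \<epsilon>) (mk N N (\<lambda>a. z0 (False, a))) (mk N p x) (mk N p (\<lambda>a. z0 (True, a)))"
        by (rule initial_good[OF \<delta>])
      then have g0: "good N (real S * \<epsilon>) (mk N N (\<lambda>a. z0 (False, a))) (mk N p x) (mk N p (\<lambda>a. z0 (True, a)))"
        by (rule good_mono[OF _ Ee(3)])
      have g1: "good N (2 * (real S * \<epsilon>) + 2 * (E * \<epsilon>)) (mk N N (\<lambda>a. z1 (False, a))) (mk N p x) (mk N p (\<lambda>a. z1 (True, a)))"
        by (rule R1(1)[OF dims_mk _ _ g0]) (rule error_chain[OF Ee(2,1) D'])+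
      have g2: "good N (2 * (2 * (real S * \<epsilon>) + 2 * (E * \<epsilon>)) + 2 * (E * \<epsilon>)) (mk N N (\<lambda>a. z2 (False, a))) (mk N p x) (mk N p (\<lambda>a. z2 (True, a)))"
        by (rule R2(1)[OF dims_mk _ _ g1]) (rule error_chain[OF Ee(2,1) D'])+
      have g3: "good N (2 * (2 * (2 * (real S * \<epsilon>) + 2 * (E * \<epsilon>)) + 2 * (E * \<epsilon>)) + 2 * (E * \<epsilon>)) (mk N N (\<lambda>a. z3 (False, a))) (mk N p x) (mk N p (\<lambda>a. z3 (True, a)))"
        by (rule R3(1)[OF dims_mk _ _ g2]) (rule error_chain[OF Ee(2,1) D'])+
      have g4: "good N (2 * (2 * (2 * (2 * (real S * \<epsilon>) + 2 * (E * \<epsilon>)) + 2 * (E * \<epsilon>)) + 2 * (E * \<epsilon>)) + 2 * (E * \<epsilon>)) (mk N N (\<lambda>a. z4 (False, a))) (mk N p x) (mk N p (\<lambda>a. z4 (True, a)))"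
        by (rule R4(1)[OF dims_mk _ _ g3]) (rule error_chain[OF Ee(2,1) D'])+
      have "good N ((16 * real S + 30 * E) * \<epsilon>) (mk N N (\<lambda>a. z4 (False, a))) (mk N p x) (mk N p (\<lambda>a. z4 (True, a)))"
        by (rule good_mono[OF g4]) (simp add: algebra_simps)
      moreover have "z4 (True, i, j) = 0" if ij: "j < i" "i < N" "j < p" for i j
      proof (cases "j < p1")
        case True
        have "z4 (True, i, j) = z2 (True, i, j)" using R4(2)[of i j] R3(2)[of i j] True by simp
        also have "\<dots> = 0"
        proof (cases "i < p1")
          case True
          then show ?thesis using R2(3)[of i j] ij by simp
        next
          case False
          then show ?thesis using un2[of i j] up'[of j i] low2[of i j] ij True by (cases "i < p") (auto simp: N_def)
        qed
        finally show ?thesis .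
      next
        case False
        then obtain k where j: "j = p1 + k" "k < p2" using ij sz by (metis add_less_cancel_left le_Suc_ex not_less)
        consider (1) "i < p" | (2) "p \<le> i" "i < p + q1" | (3) "p + q1 \<le> i" by linarith
        then show ?thesis
        proof cases
          case 1
          then show ?thesis using R4(3)[of "i - p1" k] ij j sz by simp
        next
          case 2
          have "z3 (True, p + (i - p), p1 + k) = 0" using 2 j by (intro R3(4)) auto
          then show ?thesis using R4(2)[of i j] 2 j sz by simp
        next
          case 3
          have "z4 (True, p + q1 + (i - (p + q1)), p1 + k) = 0" using 3 ij j sz by (intro R4(4)) (auto simp: N_def)
          then show ?thesis using 3 j by simp
        qed
      qed
      ultimately show "good N ((16 * real S + 30 * E) * \<epsilon>) (mk N N (\<lambda>a. z4 (False, a))) (mk N p x) (mk N p (\<lambda>a. z4 (True, a))) \<and>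
        (\<forall>i j. j < i \<and> i < N \<and> j < p \<longrightarrow> z4 (True, i, j) = 0)" by blast
    qed
  qed simp
qed

lemma qr_kernel_square:
  assumes F: "\<And>n. n \<le> m \<Longrightarrow> qr_kernel n n 0 C1 d" and G: "\<And>p q. p \<le> m \<Longrightarrow> q \<le> m \<Longrightarrow> qr_kernel (p + q) p p C2 d"
    and mm: "mm_kernel S Cm \<mu>" and n: "n \<le> 2 * m" "n \<le> S" and S: "1 \<le> S"
    and pos: "0 \<le> d" "0 \<le> \<mu>"
  shows "qr_kernel n n 0 (2 * C1 + C2 + 6 * (Cm + 1) + 2) (16 * real S + 30 * (3 * d + 4 * (real S)\<^sup>2 * \<mu>))"
proof -
  define n1 where "n1 = min n m"
  define n2 where "n2 = n - n1"
  define E where "E = 3 * d + 4 * (real S)\<^sup>2 * \<mu>"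
  have sz: "n1 \<le> m" "n2 \<le> m" "n = n1 + n2" using n by (auto simp: n1_def n2_def)
  have E0: "E \<ge> 0" using pos by (simp add: E_def)
  have "qr_kernel (n1 + 0) n1 0 C1 d" "qr_kernel (n2 + 0) n2 0 C1 d" using F sz by simp_all
  note FF = this
  have s1: "computable (C1 + 2 * (Cm + 1)) (step_rel n n 0 n1 n 0 0 n1 0 E)"
    unfolding E_def by (rule computable_step[OF FF(1) mm]) (use sz S n pos in auto)
  have s2: "computable (C2 + 2 * (Cm + 1)) (step_rel n n 0 n1 n1 n2 0 n1 n1 E)"
    unfolding E_def by (rule computable_step[OF G[OF sz(1,2)] mm]) (use sz S n pos in auto)
  have s3: "computable (C1 + 2 * (Cm + 1)) (step_rel n n n1 n2 n 0 n1 n2 0 E)"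
    unfolding E_def by (rule computable_step[OF FF(2) mm]) (use sz S n pos in auto)
  show ?thesis
    unfolding qr_kernel_def E_def[symmetric]
  proof (rule computable_mono[OF computable_seq[OF computable_initial computable_seq[OF s1 computable_seq[OF s2 s3]]]],
      goal_cases)
    case (2 \<epsilon> x z3)
    show ?case
    proof (intro impI)
      assume D: "(16 * real S + 30 * E) * \<epsilon> \<le> 1"
      from 2(3) obtain z0 z1 z2 where i0: "\<exists>\<delta>. \<bar>\<delta>\<bar> \<le> \<epsilon> \<and> z0 = (\<lambda>(b, i, j). if b then x (i, j) else if i = j then 1 + \<delta> else 0)"
        and r: "step_rel n n 0 n1 n 0 0 n1 0 E \<epsilon> z0 z1" "step_rel n n 0 n1 n1 n2 0 n1 n1 E \<epsilon> z1 z2"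
          "step_rel n n n1 n2 n 0 n1 n2 0 E \<epsilon> z2 z3" by blast
      from i0 obtain \<delta> where \<delta>: "\<bar>\<delta>\<bar> \<le> \<epsilon>" "z0 = (\<lambda>(b, i, j). if b then x (i, j) else if i = j then 1 + \<delta> else 0)" by blast
      have e: "0 \<le> \<epsilon>" by (rule 2(1))
      have Ee: "0 \<le> E * \<epsilon>" "0 \<le> real S * \<epsilon>" "real n * \<epsilon> \<le> real S * \<epsilon>"
        using E0 e n(2) by (auto intro!: mult_right_mono)
      have D': "16 * (real S * \<epsilon>) + 30 * (E * \<epsilon>) \<le> 1" using D by (simp add: algebra_simps)
      have E1: "E * \<epsilon> \<le> 1" using D' Ee by linarith
      note R1 = step_relD[OF r(1) E1, simplified]
      have a2: "z1 (True, 0 + i, 0 + j) = 0" if "j < i" "i < n1" "j < n1" for i j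
        using R1(3)[of i j] that by simp
      note R2 = step_relD[OF r(2) E1 a2, simplified]
      have low2: "z2 (True, i, j) = 0" if "n1 \<le> i" "i < n" "j < n1" for i j
      proof -
        have "z2 (True, n1 + (i - n1), j) = 0" using that sz by (intro R2(4)) auto
        then show ?thesis using that by simp
      qed
      have b3: "z2 (True, i, j) = 0" if "n1 \<le> i \<and> i < n1 + n2 \<or> n \<le> i \<and> i < n + 0" "j < n1" for i j
        using that low2[of i j] sz by auto
      have a3: "z2 (True, n1 + i, n1 + j) = 0" if "j < i" "i < 0" "j < n2" for i j using that by simp
      note R3 = step_relD[OF r(3) E1 a3 b3, simplified]
      have "good n (real n * \<epsilon>) (mk n n (\<lambda>a. z0 (False, a))) (mk n n x) (mk n n (\<lambda>a. z0 (True, a)))"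
        by (rule initial_good[OF \<delta>])
      then have g0: "good n (real S * \<epsilon>) (mk n n (\<lambda>a. z0 (False, a))) (mk n n x) (mk n n (\<lambda>a. z0 (True, a)))"
        by (rule good_mono[OF _ Ee(3)])
      have g1: "good n (2 * (real S * \<epsilon>) + 2 * (E * \<epsilon>)) (mk n n (\<lambda>a. z1 (False, a))) (mk n n x) (mk n n (\<lambda>a. z1 (True, a)))"
        by (rule R1(1)[OF dims_mk _ _ g0]) (rule error_chain[OF Ee(2,1) D'])+
      have g2: "good n (2 * (2 * (real S * \<epsilon>) + 2 * (E * \<epsilon>)) + 2 * (E * \<epsilon>)) (mk n n (\<lambda>a. z2 (False, a))) (mk n n x) (mk n n (\<lambda>a. z2 (True, a)))"
        by (rule R2(1)[OF dims_mk _ _ g1]) (rule error_chain[OF Ee(2,1) D'])+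
      have g3: "good n (2 * (2 * (2 * (real S * \<epsilon>) + 2 * (E * \<epsilon>)) + 2 * (E * \<epsilon>)) + 2 * (E * \<epsilon>)) (mk n n (\<lambda>a. z3 (False, a))) (mk n n x) (mk n n (\<lambda>a. z3 (True, a)))"
        by (rule R3(1)[OF dims_mk _ _ g2]) (rule error_chain[OF Ee(2,1) D'])+
      have "good n ((16 * real S + 30 * E) * \<epsilon>) (mk n n (\<lambda>a. z3 (False, a))) (mk n n x) (mk n n (\<lambda>a. z3 (True, a)))"
        by (rule good_mono[OF g3]) (use Ee in \<open>simp add: algebra_simps\<close>)
      moreover have "z3 (True, i, j) = 0" if ij: "j < i" "i < n" "j < n" for i j
      proof (cases "j < n1")
        case True
        have "z3 (True, i, j) = z2 (True, i, j)" using R3(2)[of i j] True by simp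
        also have "\<dots> = 0" using R2(3)[of i j] low2[of i j] ij True by (cases "i < n1") auto
        finally show ?thesis .
      next
        case False
        then show ?thesis using R3(3)[of "i - n1" "j - n1"] ij sz by simp
      qed
      ultimately show "good n ((16 * real S + 30 * E) * \<epsilon>) (mk n n (\<lambda>a. z3 (False, a))) (mk n n x) (mk n n (\<lambda>a. z3 (True, a))) \<and>
        (\<forall>i j. j < i \<and> i < n \<and> j < n \<longrightarrow> z3 (True, i, j) = 0)" by blast
    qed
  qed simp
qed


lemma qr_kernel_levels:
  assumes mm: "\<And>k. mm_kernel (2 ^ k) (A * y ^ k) (B * L ^ k)"
    and A: "0 \<le> A" and B: "0 \<le> B" and L: "1 \<le> L" and y: "4 < y"
  shows "\<exists>C K \<Lambda>. 0 \<le> C \<and> 1 \<le> K \<and> 1 \<le> \<Lambda> \<and> (\<forall>k n. n \<le> 2 ^ k \<longrightarrow> qr_kernel n n 0 (C * y ^ k) (K * \<Lambda> ^ k))"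
proof -
  define C where "C = 14 + (8 * A * y\<^sup>2 + 10) / (y - 4)"
  define K where "K = 40 + B * L\<^sup>2"
  define \<Lambda> where "\<Lambda> = 2074 + 4 * L"
  have C: "C \<ge> 14" using A y by (simp add: C_def)
  have K: "K \<ge> 40" using B by (simp add: K_def)
  have \<Lambda>: "\<Lambda> \<ge> 1" using L by (simp add: \<Lambda>_def)
  have "C * (y - 4) = 14 * (y - 4) + (8 * A * y\<^sup>2 + 10)" using y by (simp add: C_def field_simps)
  then have Cy: "4 * C + 8 * A * y\<^sup>2 + 10 \<le> C * y" using y by (simp add: right_diff_distrib)
  have y1: "1 \<le> y ^ k" for k using y by (intro one_le_power) simp
  have cost: "4 * (C * y ^ k + 2 * (A * y ^ (k + 2) + 1)) + 2 \<le> C * y ^ Suc k"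
    "2 * (C * y ^ k) + C * y ^ k + 6 * (A * y ^ (k + 2) + 1) + 2 \<le> C * y ^ Suc k" for k
  proof -
    have "4 * (C * y ^ k + 2 * (A * y ^ (k + 2) + 1)) + 2 = (4 * C + 8 * A * y\<^sup>2) * y ^ k + 10"
      by (simp add: power_add power2_eq_square algebra_simps)
    also have "\<dots> \<le> (4 * C + 8 * A * y\<^sup>2 + 10) * y ^ k" using y1[of k] by (simp add: distrib_right)
    also have "\<dots> \<le> (C * y) * y ^ k" using Cy y1[of k] by (intro mult_right_mono) auto
    finally show 1: "4 * (C * y ^ k + 2 * (A * y ^ (k + 2) + 1)) + 2 \<le> C * y ^ Suc k" by (simp add: mult.assoc)
    have lin: "0 \<le> u \<Longrightarrow> 0 \<le> v \<Longrightarrow> 4 * (u + 2 * (v + 1)) + 2 \<le> w \<Longrightarrow> 2 * u + u + 6 * (v + 1) + 2 \<le> w"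
      for u v w :: real by simp
    have "0 \<le> C * y ^ k" "0 \<le> A * y ^ (k + 2)" using C A y by auto
    then show "2 * (C * y ^ k) + C * y ^ k + 6 * (A * y ^ (k + 2) + 1) + 2 \<le> C * y ^ Suc k"
      using 1 lin by blast
  qed
  have err: "16 * real (2 ^ (k + 2)) + 30 * (3 * (K * \<Lambda> ^ k) + 4 * (real (2 ^ (k + 2)))\<^sup>2 * (B * L ^ (k + 2))) \<le> K * \<Lambda> ^ Suc k" for k
  proof -
    have p2: "(2::real) ^ k \<le> \<Lambda> ^ k" using L by (intro power_mono) (auto simp: \<Lambda>_def)
    have p4: "(4 * L) ^ k \<le> \<Lambda> ^ k" using L by (intro power_mono) (auto simp: \<Lambda>_def)
    have "(2::real) ^ k \<le> K * \<Lambda> ^ k"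
      using mult_mono[of 1 K "2 ^ k" "\<Lambda> ^ k"] K p2 by simp
    moreover have "B * L\<^sup>2 * (4 * L) ^ k \<le> K * \<Lambda> ^ k"
      using p4 B L by (intro mult_mono) (auto simp: K_def)
    moreover have sq: "(real (2 ^ (k + 2)))\<^sup>2 = 16 * 4 ^ k"
      by (simp add: power_add power_mult_distrib power_mult[symmetric] mult.commute[of k 2] power_mult)
    have "16 * real (2 ^ (k + 2)) + 30 * (3 * (K * \<Lambda> ^ k) + 4 * (real (2 ^ (k + 2)))\<^sup>2 * (B * L ^ (k + 2)))
      = 64 * 2 ^ k + 90 * (K * \<Lambda> ^ k) + 1920 * (B * L\<^sup>2 * (4 * L) ^ k)"
      unfolding sq by (simp add: power_add power_mult_distrib power2_eq_square)
    ultimately have "16 * real (2 ^ (k + 2)) + 30 * (3 * (K * \<Lambda> ^ k) + 4 * (real (2 ^ (k + 2)))\<^sup>2 * (B * L ^ (k + 2)))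
      \<le> 2074 * (K * \<Lambda> ^ k)" by linarith
    also have "\<dots> \<le> \<Lambda> * (K * \<Lambda> ^ k)" using K \<Lambda> L by (intro mult_right_mono) (auto simp: \<Lambda>_def)
    finally show ?thesis by (simp add: ac_simps)
  qed
  have d0: "0 \<le> K * \<Lambda> ^ k" "0 \<le> B * L ^ k" for k using K \<Lambda> B L by auto
  have G: "\<forall>p\<le>2 ^ k. \<forall>q\<le>2 ^ k. qr_kernel (p + q) p p (C * y ^ k) (K * \<Lambda> ^ k)" for k
  proof (induction k)
    case 0
    have "qr_kernel (p + q) p p C K" if "p \<le> 1" "q \<le> 1" for p q
    proof (cases "p = 1 \<and> q = 1")
      case True
      then have "p = 1" "q = 1" by simp_all
      then show ?thesis using qr_kernel_mono[OF qr_kernel_givens C K] by (simp only: one_add_one)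
    next
      case False
      have "qr_kernel (p + q) p p 2 (real (p + q))"
        by (rule qr_kernel_identity) (use False that in auto)
      then show ?thesis by (rule qr_kernel_mono) (use C K that in auto)
    qed
    then show ?case by simp
  next
    case (Suc k)
    show ?case
    proof (intro allI impI)
      fix p q :: nat assume pq: "p \<le> 2 ^ Suc k" "q \<le> 2 ^ Suc k"
      have "qr_kernel (p + q) p p (4 * (C * y ^ k + 2 * (A * y ^ (k + 2) + 1)) + 2)
        (16 * real (2 ^ (k + 2)) + 30 * (3 * (K * \<Lambda> ^ k) + 4 * (real (2 ^ (k + 2)))\<^sup>2 * (B * L ^ (k + 2))))"
        by (rule qr_kernel_eliminate[OF _ mm[of "k + 2"], of "2 ^ k"]) (use Suc pq d0(1)[of k] d0(2)[of "k + 2"] in auto)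
      then show "qr_kernel (p + q) p p (C * y ^ Suc k) (K * \<Lambda> ^ Suc k)"
        by (rule qr_kernel_mono[OF _ cost(1) err])
    qed
  qed
  have F: "\<forall>n\<le>2 ^ k. qr_kernel n n 0 (C * y ^ k) (K * \<Lambda> ^ k)" for k
  proof (induction k)
    case 0
    have "qr_kernel n n 0 C K" if "n \<le> 1" for n
    proof -
      have "qr_kernel n n 0 2 (real n)" by (rule qr_kernel_identity) (use that in auto)
      then show ?thesis by (rule qr_kernel_mono) (use C K that in auto)
    qed
    then show ?case by simp
  next
    case (Suc k)
    show ?case
    proof (intro allI impI)
      fix n :: nat assume n: "n \<le> 2 ^ Suc k"
      have "qr_kernel n n 0 (2 * (C * y ^ k) + C * y ^ k + 6 * (A * y ^ (k + 2) + 1) + 2)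
        (16 * real (2 ^ (k + 2)) + 30 * (3 * (K * \<Lambda> ^ k) + 4 * (real (2 ^ (k + 2)))\<^sup>2 * (B * L ^ (k + 2))))"
        by (rule qr_kernel_square[OF _ _ mm[of "k + 2"], of "2 ^ k"]) (use Suc G n d0(1)[of k] d0(2)[of "k + 2"] in auto)
      then show "qr_kernel n n 0 (C * y ^ Suc k) (K * \<Lambda> ^ Suc k)"
        by (rule qr_kernel_mono[OF _ cost(2) err])
    qed
  qed
  show ?thesis using C K \<Lambda> F by - (rule exI[of _ C], rule exI[of _ K], rule exI[of _ \<Lambda>], auto)
qed

section \<open>Kernels of the given exponent\<close>

lemma power_unbounded:
  fixes x B :: real
  assumes "1 < x" shows "\<exists>k\<ge>1. B < x ^ k"
proof -
  obtain k where "B < x ^ k" using real_arch_pow[OF assms] by blast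
  also have "x ^ k \<le> x ^ Suc k" using assms by (intro power_increasing) auto
  finally show ?thesis by (intro exI[of _ "Suc k"]) simp
qed

lemma two_powr: "real (2 ^ k) powr s = (2 powr s) ^ k"
  by (simp add: powr_realpow[symmetric] powr_powr mult.commute)

lemma multiplication_exponent_ge_2:
  assumes "\<forall>n\<ge>1. multiplies n (P n) \<and> real (cost (P n)) \<le> C * real n powr s"
  shows "2 \<le> s"
proof (rule ccontr)
  assume "\<not> 2 \<le> s"
  then have x: "1 < (2::real) powr (2 - s)" by simp
  obtain k where k: "k \<ge> 1" "C < (2 powr (2 - s)) ^ k" using power_unbounded[OF x] by blast
  let ?n = "2 ^ k :: nat"
  have n: "?n \<ge> 2" using k(1) self_le_power[of "2 :: nat" k] by simp
  have "real ?n powr 2 = real (?n * ?n)" by (simp add: powr_numeral power2_eq_square)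
  also have "\<dots> \<le> real (cost (P ?n))" using multiplies_cost[of ?n "P ?n"] assms n by (simp del: of_nat_mult of_nat_power)
  also have "\<dots> \<le> C * real ?n powr s" using assms[rule_format, of ?n] by simp
  finally have "real ?n powr 2 / real ?n powr s \<le> C" by (simp add: divide_le_eq)
  then have "real ?n powr (2 - s) \<le> C" by (simp add: powr_diff)
  then show False using k(2) unfolding two_powr by simp
qed

lemma mm_kernel_fast:
  assumes fast: "\<forall>\<eta>>0. \<exists>P C. \<forall>n\<ge>1. multiplies n (P n) \<and> real (cost (P n)) \<le> C * real n powr (\<omega> + \<eta>)"
    and \<eta>: "0 < \<eta>"
  shows "2 < \<omega> + \<eta>" and "\<exists>A B L. 0 \<le> A \<and> 0 \<le> B \<and> 1 \<le> L \<and> (\<forall>k. mm_kernel (2 ^ k) (A * (2 powr (\<omega> + \<eta>)) ^ k) (B * L ^ k))"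
proof -
  define \<tau> where "\<tau> = \<omega> + \<eta>"
  obtain P C where P: "\<forall>n\<ge>1. multiplies n (P n) \<and> real (cost (P n)) \<le> C * real n powr (\<omega> + \<eta> / 2)"
    using fast \<eta> half_gt_zero by blast
  have "2 \<le> \<omega> + \<eta> / 2" by (rule multiplication_exponent_ge_2[OF P])
  then show \<tau>2: "2 < \<omega> + \<eta>" using \<eta> by linarith
  obtain t where t: "t \<ge> 1" "2 * C < (2 powr (\<eta> / 2)) ^ t"
    using power_unbounded[of "2 powr (\<eta> / 2)" "2 * C"] \<eta> by auto
  define n where "n = (2 ^ t :: nat)"
  have n1: "n \<ge> 1" by (simp add: n_def)
  define r where "r = 2 * cost (P n)"
  define x where "x = real n powr \<tau>"
  have "real r \<le> 2 * C * real n powr (\<omega> + \<eta> / 2)" using P n1 by (simp add: r_def)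
  also have "\<dots> < (real n powr (\<eta> / 2)) * real n powr (\<omega> + \<eta> / 2)"
    unfolding n_def two_powr using t(2) by (intro mult_strict_right_mono) simp_all
  also have "\<dots> = x" by (simp add: x_def \<tau>_def powr_add[symmetric] add.commute)
  finally have rx: "real r < x" .
  have "real (n * n) = real n powr 2" by (simp add: n_def powr_numeral power2_eq_square)
  also have "\<dots> \<le> x" unfolding x_def using \<tau>2 n1 by (intro powr_mono) (auto simp: \<tau>_def)
  finally have nx: "real (n * n) \<le> x" .
  obtain u v w where "bilinear_mm n r u v w"
    using multiplies_bilinear_rank[of n "P n"] P n1 unfolding bilinear_mm_def r_def by blast
  from mm_kernel_powers[OF this n1 rx nx]
  obtain C' D where CD: "C' \<ge> 1" "D \<ge> 1" "\<And>k. mm_kernel (n ^ k) (C' * x ^ k) (D ^ k)" by blast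
  define y where "y = (2::real) powr \<tau>"
  have y1: "y \<ge> 1" unfolding y_def using \<tau>2 by (intro ge_one_powr_ge_zero) (auto simp: \<tau>_def)
  have xy: "x = y ^ t" unfolding x_def n_def two_powr y_def ..
  have "mm_kernel (2 ^ k) ((C' * y ^ t + 1) * y ^ k) (D * D ^ k)" for k
  proof -
    define k' where "k' = k div t + 1"
    have "k = t * (k div t) + k mod t" by simp
    moreover have "k mod t < t" using t(1) by simp
    moreover have "t * k' = t * (k div t) + t" by (simp add: k'_def)
    ultimately have k': "k \<le> t * k'" "t * k' \<le> k + t" by linarith+
    have k'': "k' \<le> k + 1" by (simp add: k'_def)
    have "n ^ k' = 2 ^ (t * k')" by (simp add: n_def power_mult)
    then have "(2 :: nat) ^ k \<le> n ^ k'" using k'(1) by simp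
    from mm_kernel_mono[OF CD(3) this]
    show ?thesis
    proof (rule mm_kernel_mono_bounds)
      have "x ^ k' = y ^ (t * k')" by (simp add: xy power_mult)
      also have "\<dots> \<le> y ^ (k + t)" using k'(2) y1 by (intro power_increasing)
      finally have "C' * x ^ k' \<le> C' * y ^ (k + t)" using CD(1) by (intro mult_left_mono) auto
      moreover have "1 \<le> y ^ k" using y1 by (rule one_le_power)
      ultimately show "C' * x ^ k' + 1 \<le> (C' * y ^ t + 1) * y ^ k" by (simp add: power_add algebra_simps)
      show "D ^ k' \<le> D * D ^ k" using power_increasing[OF k'' CD(2)] by simp
    qed
  qed
  moreover have "0 \<le> C' * y ^ t + 1" using CD(1) y1 by simp
  moreover have "0 \<le> D" using CD(2) by simp
  ultimately show "\<exists>A B L. 0 \<le> A \<and> 0 \<le> B \<and> 1 \<le> L \<and> (\<forall>k. mm_kernel (2 ^ k) (A * (2 powr (\<omega> + \<eta>)) ^ k) (B * L ^ k))"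
    using CD(2) unfolding y_def \<tau>_def by blast
qed

lemma power_of_2_between: "1 \<le> n \<Longrightarrow> \<exists>k. n \<le> 2 ^ k \<and> 2 ^ k \<le> 2 * (n :: nat)"
proof (induction n rule: nat_induct_at_least)
  case base
  show ?case by (rule exI[of _ 0]) simp
next
  case (Suc n)
  then obtain k where k: "n \<le> 2 ^ k" "2 ^ k \<le> 2 * n" by blast
  show ?case
  proof (cases "Suc n \<le> 2 ^ k")
    case True
    then show ?thesis using k by (intro exI[of _ k]) simp
  next
    case False
    then have "2 ^ k = n" using k by simp
    then show ?thesis using Suc(1) by (intro exI[of _ "Suc k"]) simp
  qed
qed

lemma power_of_2_bound:
  assumes "1 \<le> (\<Lambda> :: real)"
  shows "\<exists>l. \<forall>k n. 2 ^ k \<le> 2 * n \<longrightarrow> \<Lambda> ^ k \<le> 2 ^ l * real n ^ l"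
proof -
  obtain l where l: "\<Lambda> < 2 ^ l" using real_arch_pow[of 2] by auto
  have "\<Lambda> ^ k \<le> 2 ^ l * real n ^ l" if n: "2 ^ k \<le> 2 * n" for k n
  proof -
    have "\<Lambda> ^ k \<le> (2 ^ l) ^ k" using l assms by (intro power_mono) auto
    also have "\<dots> = real (2 ^ k) ^ l" by (simp add: power_mult[symmetric] mult.commute)
    also have "\<dots> \<le> real (2 * n) ^ l" using n by (intro power_mono) (simp_all only: of_nat_le_iff of_nat_0_le_iff)
    finally show ?thesis by (simp add: power_mult_distrib)
  qed
  then show ?thesis by blast
qed

lemma fast_kernels:
  assumes fast: "\<forall>\<eta>>0. \<exists>P C. \<forall>n\<ge>1. multiplies n (P n) \<and> real (cost (P n)) \<le> C * real n powr (\<omega> + \<eta>)"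
    and \<eta>: "0 < \<eta>"
  shows "\<exists>C K c. 0 \<le> C \<and> 1 \<le> K \<and> (\<forall>n\<ge>1. qr_kernel n n 0 (C * real n powr (\<omega> + \<eta>)) (K * real n ^ c) \<and>
    mm_kernel n (C * real n powr (\<omega> + \<eta>)) (K * real n ^ c))"
proof -
  define \<tau> where "\<tau> = \<omega> + \<eta>"
  define y where "y = (2::real) powr \<tau>"
  have \<tau>: "2 < \<tau>" unfolding \<tau>_def by (rule mm_kernel_fast(1)[OF fast \<eta>])
  have "(2::real) powr 2 < y" unfolding y_def using \<tau> by (intro powr_less_mono) auto
  then have y: "4 < y" by (simp add: powr_numeral)
  obtain A B L where A: "0 \<le> A" "0 \<le> B" "1 \<le> L" and mm: "\<And>k. mm_kernel (2 ^ k) (A * y ^ k) (B * L ^ k)"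
    using mm_kernel_fast(2)[OF fast \<eta>] unfolding y_def \<tau>_def by blast
  obtain C K \<Lambda> where C: "0 \<le> C" "1 \<le> K" "1 \<le> \<Lambda>" and qr: "\<And>k n. n \<le> 2 ^ k \<Longrightarrow> qr_kernel n n 0 (C * y ^ k) (K * \<Lambda> ^ k)"
    using qr_kernel_levels[OF mm A y] by blast
  define M where "M = max L \<Lambda>"
  have M: "1 \<le> M" "L \<le> M" "\<Lambda> \<le> M" using A C by (auto simp: M_def)
  obtain l where l: "\<And>k n. 2 ^ k \<le> 2 * n \<Longrightarrow> M ^ k \<le> 2 ^ l * real n ^ l"
    using power_of_2_bound[OF M(1)] by blast
  define C' where "C' = (A + C) * y + 1"
  define K' where "K' = (B + K) * 2 ^ l"
  have "qr_kernel n n 0 (C' * real n powr \<tau>) (K' * real n ^ l) \<and> mm_kernel n (C' * real n powr \<tau>) (K' * real n ^ l)"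
    if n: "n \<ge> 1" for n
  proof -
    obtain k where k: "n \<le> 2 ^ k" "2 ^ k \<le> 2 * n" using power_of_2_between[OF n] by blast
    have "y ^ k = real (2 ^ k) powr \<tau>" unfolding y_def two_powr ..
    also have "real (2 ^ k) \<le> real (2 * n)" using k(2) by (simp only: of_nat_le_iff)
    then have "real (2 ^ k) powr \<tau> \<le> real (2 * n) powr \<tau>" using \<tau> by (intro powr_mono2) auto
    also have "\<dots> = y * real n powr \<tau>" by (simp add: powr_mult y_def)
    finally have yk: "y ^ k \<le> y * real n powr \<tau>" .
    have n1: "1 \<le> real n powr \<tau>" using n \<tau> by (intro ge_one_powr_ge_zero) auto
    have c: "E * y ^ k + 1 \<le> C' * real n powr \<tau>" if "0 \<le> E" "E \<le> A + C" for E
    proof -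
      have "E * y ^ k \<le> (A + C) * (y * real n powr \<tau>)" using that yk y by (intro mult_mono) auto
      then show ?thesis using n1 by (simp add: C'_def algebra_simps)
    qed
    have e: "E * X ^ k \<le> K' * real n ^ l" if "0 \<le> E" "E \<le> B + K" "1 \<le> X" "X \<le> M" for E X
    proof -
      have "X ^ k \<le> M ^ k" using that by (intro power_mono) auto
      then have "E * X ^ k \<le> (B + K) * (2 ^ l * real n ^ l)"
        using that l[OF k(2)] by (intro mult_mono) auto
      then show ?thesis by (simp add: K'_def)
    qed
    have "qr_kernel n n 0 (C' * real n powr \<tau>) (K' * real n ^ l)"
      by (rule qr_kernel_mono[OF qr[OF k(1)]]) (use c[of C] e[of K \<Lambda>] A C M in auto)
    moreover have "mm_kernel n (C' * real n powr \<tau>) (K' * real n ^ l)"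
      by (rule mm_kernel_mono_bounds[OF mm_kernel_mono[OF mm k(1)]]) (use c[of A] e[of B L] A C M in auto)
    ultimately show ?thesis ..
  qed
  moreover have "0 \<le> C'" using A C y by (simp add: C'_def)
  moreover have "1 \<le> K'" using A C mult_mono[of 1 "B + K" 1 "2 ^ l"] by (simp add: K'_def)
  ultimately show ?thesis unfolding \<tau>_def by blast
qed

section \<open>Back substitution\<close>

lemma rounding_linear:
  assumes "0 \<le> \<epsilon>" "real k * \<epsilon> \<le> 1" shows "(1 + \<epsilon>) ^ k - 1 \<le> 2 * real k * \<epsilon>"
proof -
  have "(1 + \<epsilon>) ^ k \<le> exp \<epsilon> ^ k" using assms(1) exp_ge_add_one_self[of \<epsilon>] by (intro power_mono) auto
  also have "\<dots> = exp (real k * \<epsilon>)" by (simp add: exp_of_nat_mult)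
  also have "\<dots> \<le> 1 + real k * \<epsilon> + (real k * \<epsilon>)\<^sup>2" using assms by (intro exp_bound) auto
  also have "(real k * \<epsilon>)\<^sup>2 \<le> real k * \<epsilon>"
    using assms mult_left_le[of "real k * \<epsilon>" "real k * \<epsilon>"] by (simp add: power2_eq_square)
  finally show ?thesis by linarith
qed

text \<open>Variables: \<open>0\<close> is the triangular matrix, \<open>1\<close> the right-hand side, \<open>2\<close> the solution.\<close>

definition backsub_rel :: "nat \<Rightarrow> nat \<Rightarrow> real \<Rightarrow> (nat \<times> nat \<times> nat \<Rightarrow> real) \<Rightarrow> (nat \<times> nat \<times> nat \<Rightarrow> real) \<Rightarrow> bool" where
  "backsub_rel m i \<epsilon> x z \<longleftrightarrow> (\<exists>w \<delta> \<theta>0 \<theta>. z = x((2, i, 0) := w) \<and> \<bar>\<delta>\<bar> \<le> \<epsilon> \<and>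
     \<bar>\<theta>0\<bar> \<le> (1 + \<epsilon>) ^ m - 1 \<and> (\<forall>j. \<bar>\<theta> j\<bar> \<le> (1 + \<epsilon>) ^ m - 1) \<and>
     (x (0, i, i) \<noteq> 0 \<longrightarrow> w = (x (1, i, 0) * (1 + \<theta>0)
       - (\<Sum>j\<in>{i<..<m}. x (0, i, j) * x (2, j, 0) * (1 + \<theta> j))) / x (0, i, i) * (1 + \<delta>)))"

lemma computable_backsub_row:
  assumes i: "i < m" shows "computable (2 * real m + 4) (backsub_rel m i)"
proof -
  define T where "T = m - Suc i"
  let ?f = "\<lambda>(a, t). if a = (0 :: nat) then (1, i, 0) else if a = 1 then (0, i, Suc i + t) else (2 :: nat, Suc i + t, 0)"
  note 1 = computable_in[OF computable_dot[of T], of ?f]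
  have 2: "computable 4 (\<lambda>\<epsilon> y z. \<exists>\<delta>. \<bar>\<delta>\<bar> \<le> \<epsilon> \<and> z = (\<lambda>_ :: unit.
      (if y (Inl (0, i, i)) = 0 then 0 else y (Inr ()) / y (Inl (0 :: nat, i, i))) * (1 + \<delta>)))"
    by (rule computable_safe_div)
  note 3 = computable_put[OF computable_seq[OF computable_keep[OF 1] 2], of "(2, i, 0)"]
  show ?thesis
  proof (rule computable_mono[OF 3])
    show "2 * real T + 4 \<le> 2 * real m + 4" by (simp add: T_def)
    fix \<epsilon> :: real and x z :: "nat \<times> nat \<times> nat \<Rightarrow> real"
    assume e: "0 \<le> \<epsilon>" "\<epsilon> \<le> 1 / 2"
    assume "\<exists>w. (\<exists>y. ((\<exists>\<theta>0 \<theta>. \<bar>\<theta>0\<bar> \<le> (1 + \<epsilon>) ^ Suc T - 1 \<and> (\<forall>t. \<bar>\<theta> t\<bar> \<le> (1 + \<epsilon>) ^ Suc T - 1) \<and>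
       (\<lambda>j. y (Inr j)) = (\<lambda>_. x (?f (0, 0)) * (1 + \<theta>0) - (\<Sum>t<T. x (?f (1, t)) * x (?f (2, t)) * (1 + \<theta> t)))) \<and>
       (\<lambda>i. y (Inl i)) = x) \<and>
       (\<exists>\<delta>. \<bar>\<delta>\<bar> \<le> \<epsilon> \<and> (\<lambda>_ :: unit. w) = (\<lambda>_. (if y (Inl (0, i, i)) = 0 then 0 else y (Inr ()) / y (Inl (0, i, i))) * (1 + \<delta>)))) \<and>
       z = x((2, i, 0) := w)"
    then obtain w y \<theta>0 \<theta> \<delta> where z: "z = x((2, i, 0) := w)"
      and acc: "(\<lambda>j. y (Inr j)) = (\<lambda>_. x (?f (0, 0)) * (1 + \<theta>0) - (\<Sum>t<T. x (?f (1, t)) * x (?f (2, t)) * (1 + \<theta> t)))"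
      and x: "(\<lambda>i. y (Inl i)) = x"
      and w: "(\<lambda>_ :: unit. w) = (\<lambda>_. (if y (Inl (0, i, i)) = 0 then 0 else y (Inr ()) / y (Inl (0, i, i))) * (1 + \<delta>))"
      and b: "\<bar>\<theta>0\<bar> \<le> (1 + \<epsilon>) ^ Suc T - 1" "\<forall>t. \<bar>\<theta> t\<bar> \<le> (1 + \<epsilon>) ^ Suc T - 1" "\<bar>\<delta>\<bar> \<le> \<epsilon>"
      by (elim exE conjE) (rule that, assumption+)
    have le: "(1 + \<epsilon>) ^ Suc T - 1 \<le> (1 + \<epsilon>) ^ m - 1"
      by (rule rounding_mono) (use i e in \<open>auto simp: T_def\<close>)
    have w': "w = (if y (Inl (0, i, i)) = 0 then 0 else y (Inr ()) / y (Inl (0, i, i))) * (1 + \<delta>)"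
      using fun_cong[OF w] by simp
    have x': "y (Inl a) = x a" for a using fun_cong[OF x] .
    have S: "(\<Sum>t<T. x (0, i, Suc i + t) * x (2, Suc i + t, 0) * (1 + \<theta> t))
       = (\<Sum>j\<in>{i<..<m}. x (0, i, j) * x (2, j, 0) * (1 + \<theta> (j - Suc i)))"
      by (rule sum.reindex_bij_witness[of _ "\<lambda>j. j - Suc i" "\<lambda>t. Suc i + t"]) (auto simp: T_def)
    have acc': "y (Inr ()) = x (1, i, 0) * (1 + \<theta>0) - (\<Sum>t<T. x (0, i, Suc i + t) * x (2, Suc i + t, 0) * (1 + \<theta> t))"
      using fun_cong[OF acc] by simp
    show "backsub_rel m i \<epsilon> x z"
      unfolding backsub_rel_def
    proof (intro exI conjI)
      show "z = x((2, i, 0) := w)" by (rule z)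
      show "\<bar>\<delta>\<bar> \<le> \<epsilon>" "\<bar>\<theta>0\<bar> \<le> (1 + \<epsilon>) ^ m - 1" using b le by auto
      show "\<forall>j. \<bar>\<theta> (j - Suc i)\<bar> \<le> (1 + \<epsilon>) ^ m - 1" using b(2) le order_trans by blast
      show "x (0, i, i) \<noteq> 0 \<longrightarrow> w = (x (1, i, 0) * (1 + \<theta>0)
       - (\<Sum>j\<in>{i<..<m}. x (0, i, j) * x (2, j, 0) * (1 + \<theta> (j - Suc i)))) / x (0, i, i) * (1 + \<delta>)"
        using w' unfolding acc' S x' by simp
    qed
  qed
qed

lemma computable_backsub:
  "computable (real m * (2 * real m + 4)) (\<lambda>\<epsilon> x z. real m * \<epsilon> \<le> 1 \<longrightarrow>
     (\<forall>i<m. x (0 :: nat, i, i) \<noteq> 0) \<longrightarrow>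
     (\<exists>D e. (\<forall>i j. \<bar>D i j\<bar> \<le> (2 * real m + 2) * \<epsilon> * \<bar>x (0, i, j)\<bar>) \<and> (\<forall>i. \<bar>e i\<bar> \<le> (2 * real m + 2) * \<epsilon> * \<bar>x (1, i, 0)\<bar>) \<and>
       (\<forall>i<m. (\<Sum>j\<in>{i..<m}. (x (0, i, j) + D i j) * z (2 :: nat, j, 0 :: nat)) = x (1, i, 0) + e i)))"
proof -
  have it: "computable (real m * (2 * real m + 4)) (\<lambda>\<epsilon> x z. \<exists>f. f 0 = x \<and> f m = z \<and>
      (\<forall>t<m. backsub_rel m (m - Suc t) \<epsilon> (f t) (f (Suc t))))"
    by (rule computable_iter) (rule computable_backsub_row, simp)
  show ?thesis
  proof (rule computable_mono[OF it order_refl], intro impI)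
    fix \<epsilon> :: real and x z :: "nat \<times> nat \<times> nat \<Rightarrow> real"
    assume e: "0 \<le> \<epsilon>" "\<epsilon> \<le> 1 / 2" and me: "real m * \<epsilon> \<le> 1" and nz: "\<forall>i<m. x (0, i, i) \<noteq> 0"
    assume "\<exists>f. f 0 = x \<and> f m = z \<and> (\<forall>t<m. backsub_rel m (m - Suc t) \<epsilon> (f t) (f (Suc t)))"
    then obtain f where f: "f 0 = x" "f m = z" "\<And>t. t < m \<Longrightarrow> backsub_rel m (m - Suc t) \<epsilon> (f t) (f (Suc t))" by blast
    have upd: "f (Suc t) p = f t p" if "t < m" "p \<noteq> (2, m - Suc t, 0)" for t p
      using f(3)[OF that(1)] that(2) unfolding backsub_rel_def by fastforce
    have keep: "f t (k, i, j) = x (k, i, j)" if "t \<le> m" "k \<noteq> 2" for t k i j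
      using that(1)
    proof (induction t)
      case (Suc t)
      then show ?case using upd[of t "(k, i, j)"] that(2) by simp
    qed (simp add: f)
    have fin: "f t (2, j, 0) = z (2, j, 0)" if "m - Suc j < t" "t \<le> m" "j < m" for t j
      using that(2,1)
    proof (induction t rule: inc_induct)
      case base
      show ?case by (simp add: f)
    next
      case (step t)
      have "f (Suc t) (2, j, 0) = f t (2, j, 0)" using step that by (intro upd) auto
      then show ?case using step by simp
    qed
    define g where "g = (2 * real m + 2) * \<epsilon>"
    have th: "(1 + \<epsilon>) ^ m - 1 \<le> g" using rounding_linear[OF e(1) me] e(1) by (simp add: g_def algebra_simps)
    have row: "\<exists>\<theta>0 D. \<bar>\<theta>0\<bar> \<le> g \<and> (\<forall>j. \<bar>D j\<bar> \<le> g) \<and>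
      (\<Sum>j\<in>{i..<m}. x (0, i, j) * (1 + D j) * z (2, j, 0)) = x (1, i, 0) * (1 + \<theta>0)" if i: "i < m" for i
    proof -
      define t where "t = m - Suc i"
      have t: "t < m" "m - Suc t = i" using i by (auto simp: t_def)
      obtain w \<delta> \<theta>0 \<theta> where w: "f (Suc t) = (f t)((2, i, 0) := w)" "\<bar>\<delta>\<bar> \<le> \<epsilon>" "\<bar>\<theta>0\<bar> \<le> (1 + \<epsilon>) ^ m - 1" "\<forall>j. \<bar>\<theta> j\<bar> \<le> (1 + \<epsilon>) ^ m - 1"
        "f t (0, i, i) \<noteq> 0 \<longrightarrow> w = (f t (1, i, 0) * (1 + \<theta>0)
           - (\<Sum>j\<in>{i<..<m}. f t (0, i, j) * f t (2, j, 0) * (1 + \<theta> j))) / f t (0, i, i) * (1 + \<delta>)"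
        using f(3)[OF t(1)] unfolding t(2) backsub_rel_def by blast
      have zi: "z (2, i, 0) = w" using fin[of i "Suc t"] w(1) t i by (simp add: t_def)
      have S: "(\<Sum>j\<in>{i<..<m}. f t (0, i, j) * f t (2, j, 0) * (1 + \<theta> j)) = (\<Sum>j\<in>{i<..<m}. x (0, i, j) * z (2, j, 0) * (1 + \<theta> j))"
      proof (rule sum.cong[OF refl])
        fix j assume j: "j \<in> {i<..<m}"
        then have "f t (2, j, 0) = z (2, j, 0)" using t by (intro fin) (auto simp: t_def)
        then show "f t (0, i, j) * f t (2, j, 0) * (1 + \<theta> j) = x (0, i, j) * z (2, j, 0) * (1 + \<theta> j)"
          using keep[of t 0 i j] t by simp
      qed
      have d1: "1 + \<delta> > 0" "1 / 2 \<le> 1 + \<delta>" using w(2) e by auto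
      have "w = (x (1, i, 0) * (1 + \<theta>0) - (\<Sum>j\<in>{i<..<m}. x (0, i, j) * z (2, j, 0) * (1 + \<theta> j))) / x (0, i, i) * (1 + \<delta>)"
        using w(5) nz i keep[of t 0 i i] keep[of t 1 i 0] t unfolding S by simp
      then have main: "x (0, i, i) * (1 / (1 + \<delta>)) * w = x (1, i, 0) * (1 + \<theta>0) - (\<Sum>j\<in>{i<..<m}. x (0, i, j) * z (2, j, 0) * (1 + \<theta> j))"
        using nz i d1 by (simp add: field_simps)
      define D where "D j = (if j = i then 1 / (1 + \<delta>) - 1 else \<theta> j)" for j
      have "1 / (1 + \<delta>) - 1 = - \<delta> / (1 + \<delta>)" using d1 by (simp add: field_simps)
      then have "\<bar>1 / (1 + \<delta>) - 1\<bar> = \<bar>\<delta>\<bar> / (1 + \<delta>)" using d1 by simp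
      also have "\<dots> \<le> \<epsilon> / (1 / 2)" using w(2) d1 by (intro frac_le) auto
      also have "\<dots> \<le> g" using e(1) by (simp add: g_def distrib_right)
      finally have Dg: "\<bar>D j\<bar> \<le> g" for j using w(4) th order_trans by (auto simp: D_def)
      have "{i..<m} = insert i {i<..<m}" using i by auto
      then have "(\<Sum>j\<in>{i..<m}. x (0, i, j) * (1 + D j) * z (2, j, 0))
         = x (0, i, i) * (1 + D i) * w + (\<Sum>j\<in>{i<..<m}. x (0, i, j) * (1 + D j) * z (2, j, 0))" by (simp add: zi)
      also have "(\<Sum>j\<in>{i<..<m}. x (0, i, j) * (1 + D j) * z (2, j, 0)) = (\<Sum>j\<in>{i<..<m}. x (0, i, j) * z (2, j, 0) * (1 + \<theta> j))"
        by (rule sum.cong) (auto simp: D_def)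
      also have "x (0, i, i) * (1 + D i) * w = x (0, i, i) * (1 / (1 + \<delta>)) * w" by (simp add: D_def)
      finally have "(\<Sum>j\<in>{i..<m}. x (0, i, j) * (1 + D j) * z (2, j, 0)) = x (1, i, 0) * (1 + \<theta>0)"
        unfolding main by simp
      moreover have "\<bar>\<theta>0\<bar> \<le> g" using w(3) th by simp
      ultimately show ?thesis using Dg by (intro exI[of _ \<theta>0] exI[of _ D]) simp
    qed
    then have "\<forall>i. \<exists>\<theta>0 D. i < m \<longrightarrow> \<bar>\<theta>0\<bar> \<le> g \<and> (\<forall>j. \<bar>D j\<bar> \<le> g) \<and>
      (\<Sum>j\<in>{i..<m}. x (0, i, j) * (1 + D j) * z (2, j, 0)) = x (1, i, 0) * (1 + \<theta>0)" by blast
    from choice[OF this] obtain \<theta>0 where 1: "\<forall>i. \<exists>D. i < m \<longrightarrow> \<bar>\<theta>0 i\<bar> \<le> g \<and> (\<forall>j. \<bar>D j\<bar> \<le> g) \<and>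
      (\<Sum>j\<in>{i..<m}. x (0, i, j) * (1 + D j) * z (2, j, 0)) = x (1, i, 0) * (1 + \<theta>0 i)" ..
    from choice[OF 1] obtain D where 2: "\<forall>i. i < m \<longrightarrow> \<bar>\<theta>0 i\<bar> \<le> g \<and> (\<forall>j. \<bar>D i j\<bar> \<le> g) \<and>
      (\<Sum>j\<in>{i..<m}. x (0, i, j) * (1 + D i j) * z (2, j, 0)) = x (1, i, 0) * (1 + \<theta>0 i)" ..
    have \<theta>: "\<bar>\<theta>0 i\<bar> \<le> g \<and> (\<forall>j. \<bar>D i j\<bar> \<le> g) \<and>
      (\<Sum>j\<in>{i..<m}. x (0, i, j) * (1 + D i j) * z (2, j, 0)) = x (1, i, 0) * (1 + \<theta>0 i)" if "i < m" for i
      by (rule mp[OF spec[OF 2] that])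
    have g0: "0 \<le> g" using e by (simp add: g_def)
    show "\<exists>D e. (\<forall>i j. \<bar>D i j\<bar> \<le> (2 * real m + 2) * \<epsilon> * \<bar>x (0, i, j)\<bar>) \<and> (\<forall>i. \<bar>e i\<bar> \<le> (2 * real m + 2) * \<epsilon> * \<bar>x (1, i, 0)\<bar>) \<and>
       (\<forall>i<m. (\<Sum>j\<in>{i..<m}. (x (0, i, j) + D i j) * z (2, j, 0)) = x (1, i, 0) + e i)"
      unfolding g_def[symmetric]
    proof (rule exI[of _ "\<lambda>i j. if i < m then x (0, i, j) * D i j else 0"],
        rule exI[of _ "\<lambda>i. if i < m then x (1, i, 0) * \<theta>0 i else 0"], intro conjI allI impI)
      fix i j
      show "\<bar>if i < m then x (0, i, j) * D i j else 0\<bar> \<le> g * \<bar>x (0, i, j)\<bar>"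
      proof (cases "i < m")
        case True
        have "\<bar>D i j\<bar> * \<bar>x (0, i, j)\<bar> \<le> g * \<bar>x (0, i, j)\<bar>" using \<theta>[OF True] by (intro mult_right_mono) auto
        then show ?thesis using True by (simp add: abs_mult mult.commute)
      qed (simp add: g0)
      show "\<bar>if i < m then x (1, i, 0) * \<theta>0 i else 0\<bar> \<le> g * \<bar>x (1, i, 0)\<bar>"
      proof (cases "i < m")
        case True
        have "\<bar>\<theta>0 i\<bar> * \<bar>x (1, i, 0)\<bar> \<le> g * \<bar>x (1, i, 0)\<bar>" using \<theta>[OF True] by (intro mult_right_mono) auto
        then show ?thesis using True by (simp add: abs_mult mult.commute)
      qed (simp add: g0)
    next
      fix i assume i: "i < m"
      show "(\<Sum>j\<in>{i..<m}. (x (0, i, j) + (if i < m then x (0, i, j) * D i j else 0)) * z (2, j, 0))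
        = x (1, i, 0) + (if i < m then x (1, i, 0) * \<theta>0 i else 0)"
        using \<theta>[OF i] i by (simp add: distrib_left)
    qed
  qed
qed


section \<open>Least squares\<close>

definition ls_rel :: "nat \<Rightarrow> nat \<Rightarrow> real \<Rightarrow> (bool \<times> nat \<times> nat \<Rightarrow> real) \<Rightarrow> (bool \<times> nat \<Rightarrow> real) \<Rightarrow> bool" where
  "ls_rel n m \<beta> x z \<longleftrightarrow> (let A = mk n m (\<lambda>a. x (False, a)); b = mk n 1 (\<lambda>a. x (True, a)) in
     \<exists>Q Y. orth n Q \<and> dims n m Y \<and> (\<forall>i j. j < i \<longrightarrow> entry Y i j = 0) \<and> norm (A - Q * Y) \<le> \<beta> * norm A \<and>
       (\<forall>j<m. z (True, j) = entry Y j j) \<and>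
       ((\<forall>j<m. z (True, j) \<noteq> 0) \<longrightarrow> (\<exists>Y' y. dims n m Y' \<and> dims n 1 y \<and> (\<forall>i j. j < i \<longrightarrow> entry Y' i j = 0) \<and>
          norm (A - Q * Y') \<le> \<beta> * norm A \<and> norm (b - Q * y) \<le> \<beta> * norm b \<and>
          (\<forall>i<m. entry (Y' * mk m 1 (\<lambda>(j, _). z (False, j))) i 0 = entry y i 0))))"

text \<open>Zero columns appended to \<open>A\<close> reduce the QR decomposition of an \<open>n \<times> m\<close> matrix to the square case.\<close>

lemma computable_ls:
  assumes qr: "qr_kernel n n 0 C1 d" and mm: "mm_kernel n C2 \<mu>" and nm: "1 \<le> m" "m \<le> n"
    and d: "0 \<le> d" and \<mu>: "0 \<le> \<mu>"
  defines "K \<equiv> 3 * d + 10 * real n * \<mu> + 20 * real n"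
  shows "computable (C1 + (C2 + 1) + real m * (2 * real m + 4) + 1) (\<lambda>\<epsilon> x z. K * \<epsilon> \<le> 1 \<longrightarrow> ls_rel n m (K * \<epsilon>) x z)"
proof -
  have 0: "computable 1 (\<lambda>\<epsilon> (x :: bool \<times> nat \<times> nat \<Rightarrow> real) z. \<exists>\<delta>. \<bar>\<delta>\<bar> \<le> \<epsilon> \<and> z = (\<lambda>_::unit. 0 * (1 + \<delta>)))"
    by (rule computable_const)
  note 1 = computable_in[OF qr[unfolded qr_kernel_def], of "\<lambda>(i, j). if j < m then Inl (False, i, j) else Inr ()"]
  have n1: "1 \<le> n" using nm by simp
  note 2 = mm_rect[OF mm order_refl order_refl n1, of "\<lambda>(i, j). Inr (False, j, i)" "\<lambda>(i, j). Inl (Inl (True, i, j))"]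
  note 3 = computable_in[OF computable_backsub[of m],
      of "\<lambda>(k, i, j). if k = 0 then Inl (Inr (True, i, j)) else if k = 1 then Inr (i, j) else Inl (Inr (True, i, j))"]
  let ?h = "\<lambda>(b, j). if b then Inl (Inl (Inr (True, j, j))) else Inr (2 :: nat, j, 0 :: nat)"
  show ?thesis
  proof (rule computable_mono[OF computable_seq[OF computable_keep[OF 0] computable_seq[OF computable_keep[OF 1] computable_seq[OF computable_keep[OF 2] computable_seq[OF computable_keep[OF 3]
    computable_copy[of ?h]]]]]], goal_cases)
    case 1
    show ?case by simp
  next
    case (2 \<epsilon> x z)
    note e = 2(1,2) and ex = 2(3)
    show ?case
    proof (rule impI)
      assume K1: "K * \<epsilon> \<le> 1"
      from ex obtain y0 y1 y2 y3 \<delta>0 where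
        z: "z = (\<lambda>a. y3 (?h a))" and y0: "(\<lambda>i. y0 (Inl i)) = x" "(\<lambda>j. y0 (Inr j)) = (\<lambda>_. 0 * (1 + \<delta>0))"
        and y1: "(\<lambda>i. y1 (Inl i)) = y0" and y2: "(\<lambda>i. y2 (Inl i)) = y1" and y3: "(\<lambda>i. y3 (Inl i)) = y2"
        and kq: "d * \<epsilon> \<le> 1 \<longrightarrow> (\<forall>i j. j < i \<and> i < 0 \<and> j < n \<longrightarrow> y0 (case (i, j) of (i, j) \<Rightarrow> if j < m then Inl (False, i, j) else Inr ()) = 0) \<longrightarrow>
           good n (d * \<epsilon>) (mk n n (\<lambda>a. y1 (Inr (False, a)))) (mk n n (\<lambda>i. y0 (case i of (i, j) \<Rightarrow> if j < m then Inl (False, i, j) else Inr ())))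
             (mk n n (\<lambda>a. y1 (Inr (True, a)))) \<and>
           (\<forall>i j. j < i \<and> i < n \<and> j < n \<longrightarrow> y1 (Inr (True, i, j)) = 0)"
        and km: "norm (mk n 1 (\<lambda>j. y2 (Inr j)) - mk n n (\<lambda>a. y1 (case a of (i, j) \<Rightarrow> Inr (False, j, i))) *
             mk n 1 (\<lambda>a. y1 (case a of (i, j) \<Rightarrow> Inl (Inl (True, i, j)))))
          \<le> \<mu> * \<epsilon> * (norm (mk n n (\<lambda>a. y1 (case a of (i, j) \<Rightarrow> Inr (False, j, i)))) *
             norm (mk n 1 (\<lambda>a. y1 (case a of (i, j) \<Rightarrow> Inl (Inl (True, i, j))))))"
        and kb: "real m * \<epsilon> \<le> 1 \<longrightarrow>
           (\<forall>i<m. y2 (case (0, i, i) of (k, i, j) \<Rightarrow> if k = (0::nat) then Inl (Inr (True, i, j)) else if k = 1 then Inr (i, j) else Inl (Inr (True, i, j))) \<noteq> 0) \<longrightarrow>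
           (\<exists>D e. (\<forall>i j. \<bar>D i j\<bar> \<le> (2 * real m + 2) * \<epsilon> * \<bar>y2 (case (0, i, j) of (k, i, j) \<Rightarrow> if k = (0::nat) then Inl (Inr (True, i, j)) else if k = 1 then Inr (i, j) else Inl (Inr (True, i, j)))\<bar>) \<and>
             (\<forall>i. \<bar>e i\<bar> \<le> (2 * real m + 2) * \<epsilon> * \<bar>y2 (case (1, i, 0) of (k, i, j) \<Rightarrow> if k = (0::nat) then Inl (Inr (True, i, j)) else if k = 1 then Inr (i, j) else Inl (Inr (True, i, j)))\<bar>) \<and>
             (\<forall>i<m. (\<Sum>j\<in>{i..<m}. (y2 (case (0, i, j) of (k, i, j) \<Rightarrow> if k = (0::nat) then Inl (Inr (True, i, j)) else if k = 1 then Inr (i, j) else Inl (Inr (True, i, j))) + D i j) * y3 (Inr (2 :: nat, j, 0 :: nat)))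
                = y2 (case (1, i, 0) of (k, i, j) \<Rightarrow> if k = (0::nat) then Inl (Inr (True, i, j)) else if k = 1 then Inr (i, j) else Inl (Inr (True, i, j))) + e i))"
        by (elim exE conjE) (rule that, assumption+)
      define A where "A = mk n m (\<lambda>a. x (False, a))"
      define b where "b = mk n 1 (\<lambda>a. x (True, a))"
      define Qh where "Qh = mk n n (\<lambda>a. y1 (Inr (False, a)))"
      define R where "R = (\<lambda>i j. y1 (Inr (True, i, j)))"
      define v where "v = (\<lambda>i. y2 (Inr (i, 0 :: nat)))"
      define w where "w = (\<lambda>j. y3 (Inr (2 :: nat, j, 0 :: nat)))"
      have y0': "y0 (Inl a) = x a" "y0 (Inr u) = 0" for a u using fun_cong[OF y0(1)] fun_cong[OF y0(2), of u] by simp_all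
      have y1': "y1 (Inl a) = y0 a" for a using fun_cong[OF y1] .
      have y2': "y2 (Inl a) = y1 a" for a using fun_cong[OF y2] .
      have y3': "y3 (Inl a) = y2 a" for a using fun_cong[OF y3] .
      have X: "mk n n (\<lambda>i. y0 (case i of (i, j) \<Rightarrow> if j < m then Inl (False, i, j) else Inr ())) = A"
        unfolding A_def by (rule fm_eqI) (use nm in \<open>auto simp: y0'\<close>)
      have pos: "0 \<le> d * \<epsilon>" "0 \<le> real n * (\<mu> * \<epsilon>)" "0 \<le> real n * \<epsilon>" using d \<mu> e by auto
      have Ke: "K * \<epsilon> = 3 * (d * \<epsilon>) + 10 * (real n * (\<mu> * \<epsilon>)) + 20 * (real n * \<epsilon>)"
        by (simp add: K_def distrib_right mult.assoc)
      have d1: "d * \<epsilon> \<le> 1" "real n * (\<mu> * \<epsilon>) \<le> 1 / 10" "real n * \<epsilon> \<le> 1 / 20" using K1 pos unfolding Ke by linarith+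
      have "real m * \<epsilon> \<le> real n * \<epsilon>" using nm e by (intro mult_right_mono) auto
      then have m1: "real m * \<epsilon> \<le> 1" using d1 by linarith
      have g: "good n (d * \<epsilon>) Qh A (mk n n (\<lambda>a. y1 (Inr (True, a))))" and low: "\<And>i j. j < i \<Longrightarrow> i < n \<Longrightarrow> j < n \<Longrightarrow> R i j = 0"
        using kq d1(1) unfolding X Qh_def R_def by simp_all
      define Yn where "Yn = mk n n (\<lambda>a. y1 (Inr (True, a)))"
      define Y where "Y = colsub n Yn 0 m"
      have Y: "entry Y i j = (if i < n \<and> j < m then R i j else 0)" for i j
        using nm by (simp add: Y_def entry_colsub Yn_def R_def)
      have dY: "dims n m Y" by (simp add: Y_def dims_colsub)
      have upY: "entry Y i j = 0" if "j < i" for i j using low that nm by (simp add: Y)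
      obtain Q where Q: "orth n Q" "norm (Qh - Q) \<le> d * \<epsilon>" "norm (A - Q * Yn) \<le> d * \<epsilon> * norm A"
        using g unfolding good_def Yn_def by blast
      have dQ: "dims n n Q" "dims n n (tp Q)" "orth n (tp Q)" using Q(1) orth_tp dims_tp by (auto simp: orth_def)
      have dA: "dims n m A" "dims n 1 b" by (simp_all add: A_def b_def)
      have AY: "norm (A - Q * Y) \<le> d * \<epsilon> * norm A"
      proof -
        have "A = colsub n A 0 m" by (rule fm_eqI) (use dims_entry0[OF dA(1)] in \<open>auto simp: entry_colsub\<close>)
        then have "A - Q * Y = colsub n (A - Q * Yn) 0 m"
          unfolding Y_def colsub_diff colsub_mult[OF dQ(1)] by simp
        then have "norm (A - Q * Y) \<le> norm (A - Q * Yn)" by (simp add: norm_colsub_le)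
        then show ?thesis using Q(3) by simp
      qed
      have "d * \<epsilon> \<le> K * \<epsilon>" unfolding Ke using pos by linarith
      then have le1: "d * \<epsilon> * norm A \<le> K * \<epsilon> * norm A" by (rule mult_right_mono) simp
      have AK: "norm (A - Q * Y) \<le> K * \<epsilon> * norm A" using AY le1 by linarith
      have zT: "z (True, j) = entry Y j j" if "j < m" for j
        using that nm by (simp add: z y3' y2' Y R_def)
      have zF: "z (False, j) = w j" for j by (simp add: z w_def)
      have "\<exists>Y' y. dims n m Y' \<and> dims n 1 y \<and> (\<forall>i j. j < i \<longrightarrow> entry Y' i j = 0) \<and>
          norm (A - Q * Y') \<le> K * \<epsilon> * norm A \<and> norm (b - Q * y) \<le> K * \<epsilon> * norm b \<and>
          (\<forall>i<m. entry (Y' * mk m 1 (\<lambda>(j, _). z (False, j))) i 0 = entry y i 0)"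
        if nz: "\<forall>j<m. z (True, j) \<noteq> 0"
      proof -
        define \<gamma> where "\<gamma> = (2 * real m + 2) * \<epsilon>"
        have \<gamma>: "0 \<le> \<gamma>" "\<gamma> \<le> 4 * (real n * \<epsilon>)"
        proof -
          have "2 * real m + 2 \<le> 4 * real n" using nm by linarith
          then have "(2 * real m + 2) * \<epsilon> \<le> 4 * real n * \<epsilon>" using e by (intro mult_right_mono) auto
          then show "0 \<le> \<gamma>" "\<gamma> \<le> 4 * (real n * \<epsilon>)" using e by (simp_all add: \<gamma>_def)
        qed
        have nz': "\<forall>i<m. R i i \<noteq> 0" using nz zT nm by (simp add: Y)
        have RR: "y1 (Inr (True, i, j)) = R i j" and vv0: "y2 (Inr (i, 0)) = v i" and ww: "y3 (Inr (2, j, 0)) = w j" for i j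
          by (simp_all add: R_def v_def w_def)
        have "\<exists>D f. (\<forall>i j. \<bar>D i j\<bar> \<le> \<gamma> * \<bar>R i j\<bar>) \<and> (\<forall>i. \<bar>f i\<bar> \<le> \<gamma> * \<bar>v i\<bar>) \<and>
            (\<forall>i<m. (\<Sum>j\<in>{i..<m}. (R i j + D i j) * w j) = v i + f i)"
          using kb m1 nz' by (simp add: y2' RR vv0 ww \<gamma>_def)
        then obtain D f where D: "\<And>i j. \<bar>D i j\<bar> \<le> \<gamma> * \<bar>R i j\<bar>" and f: "\<And>i. \<bar>f i\<bar> \<le> \<gamma> * \<bar>v i\<bar>"
          and eq: "\<And>i. i < m \<Longrightarrow> (\<Sum>j\<in>{i..<m}. (R i j + D i j) * w j) = v i + f i" by blast
        define DD where "DD = mk n m (\<lambda>(i, j). if i \<le> j \<and> i < m then D i j else 0)"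
        define Y' where "Y' = Y + DD"
        define vv where "vv = mk n 1 (\<lambda>(i, _). v i)"
        define ff where "ff = mk n 1 (\<lambda>(i, _). if i < m then f i else 0)"
        define y where "y = vv + ff"
        have dYy: "dims n m Y'" "dims n 1 y" "dims n m DD" "dims n 1 vv"
          unfolding Y'_def y_def DD_def vv_def ff_def by (intro dims_add dY dims_mk)+
        have up': "entry Y' i j = 0" if "j < i" for i j using upY[OF that] that by (simp add: Y'_def DD_def)
        have nDD: "norm DD \<le> \<gamma> * norm Y"
        proof -
          have "norm DD \<le> norm (\<gamma> *\<^sub>R Y)"
          proof (rule norm_le_entries)
            fix i j
            show "\<bar>entry DD i j\<bar> \<le> \<bar>entry (\<gamma> *\<^sub>R Y) i j\<bar>"
              using D[of i j] \<gamma>(1) by (simp add: DD_def Y abs_mult)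
          qed
          then show ?thesis using \<gamma>(1) by simp
        qed
        have nff: "norm ff \<le> \<gamma> * norm vv"
        proof -
          have "norm ff \<le> norm (\<gamma> *\<^sub>R vv)"
          proof (rule norm_le_entries)
            fix i j
            show "\<bar>entry ff i j\<bar> \<le> \<bar>entry (\<gamma> *\<^sub>R vv) i j\<bar>"
              using f[of i] \<gamma>(1) by (simp add: ff_def vv_def abs_mult)
          qed
          then show ?thesis using \<gamma>(1) by simp
        qed
        have nY: "norm Y \<le> 2 * norm A"
        proof -
          have "norm Y = norm (Q * Y)" using norm_orth_mult[OF Q(1) dY] by simp
          also have "\<dots> \<le> norm A + norm (A - Q * Y)" using norm_triangle_sub[of "Q * Y" A] by (simp add: norm_minus_commute)
          also have "\<dots> \<le> norm A + 1 * norm A" using AY mult_right_mono[OF d1(1) norm_ge_zero[of A]] by linarith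
          finally show ?thesis by simp
        qed
        have le3: "d * \<epsilon> + 8 * (real n * \<epsilon>) \<le> K * \<epsilon>" unfolding Ke using pos by linarith
        have "norm (A - Q * Y') \<le> norm (A - Q * Y) + norm (Q * DD)"
          using norm_triangle_ineq4[of "A - Q * Y" "Q * DD"] by (simp add: Y'_def distrib_left diff_diff_eq)
        also have "norm (Q * DD) = norm DD" by (rule norm_orth_mult[OF Q(1) dYy(3)])
        also have "norm DD \<le> 4 * (real n * \<epsilon>) * (2 * norm A)"
          by (rule order_trans[OF nDD mult_mono[OF \<gamma>(2) nY]]) (use pos in simp_all)
        finally have "norm (A - Q * Y') \<le> (d * \<epsilon> + 8 * (real n * \<epsilon>)) * norm A" using AY by (simp add: distrib_right)
        also have "\<dots> \<le> K * \<epsilon> * norm A" by (rule mult_right_mono[OF le3]) simp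
        finally have r1: "norm (A - Q * Y') \<le> K * \<epsilon> * norm A" .
        have tQ: "mk n n (\<lambda>a. y1 (case a of (i, j) \<Rightarrow> Inr (False, j, i))) = tp Qh"
          by (rule fm_eqI) (simp add: Qh_def)
        have bb: "mk n 1 (\<lambda>a. y1 (case a of (i, j) \<Rightarrow> Inl (Inl (True, i, j)))) = b"
          by (rule fm_eqI) (simp add: b_def y1' y0')
        have vv: "mk n 1 (\<lambda>j. y2 (Inr j)) = vv"
          by (rule fm_eqI) (simp add: vv_def v_def)
        have nQh: "norm Qh \<le> 2 * real n"
        proof -
          have "norm Qh \<le> real n + d * \<epsilon>" by (rule good_norm_Qh[OF g])
          then show ?thesis using d1(1) n1 by linarith
        qed
        have "norm (vv - tp Qh * b) \<le> \<mu> * \<epsilon> * (norm Qh * norm b)" using km unfolding tQ bb vv by simp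
        also have "\<dots> \<le> \<mu> * \<epsilon> * (2 * real n * norm b)"
          using nQh \<mu> e by (intro mult_left_mono mult_right_mono) auto
        finally have v1: "norm (vv - tp Qh * b) \<le> 2 * (real n * (\<mu> * \<epsilon>)) * norm b" by (simp add: ac_simps)
        have "norm (tp (Qh - Q) * b) \<le> norm (Qh - Q) * norm b" using norm_mult_ineq[of "tp (Qh - Q)" b] by simp
        also have "\<dots> \<le> d * \<epsilon> * norm b" by (rule mult_right_mono[OF Q(2)]) simp
        finally have v2: "norm (tp (Qh - Q) * b) \<le> d * \<epsilon> * norm b" .
        define s where "s = d * \<epsilon> + 2 * (real n * (\<mu> * \<epsilon>))"
        have le2: "s + 12 * (real n * \<epsilon>) \<le> K * \<epsilon>" unfolding Ke s_def using pos by linarith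
        have "vv - tp Q * b = (vv - tp Qh * b) + tp (Qh - Q) * b" by (simp add: tp_diff left_diff_distrib)
        then have "norm (vv - tp Q * b) \<le> norm (vv - tp Qh * b) + norm (tp (Qh - Q) * b)" by (metis norm_triangle_ineq)
        also have "\<dots> \<le> s * norm b" using v1 v2 by (simp add: s_def distrib_right)
        finally have v3: "norm (vv - tp Q * b) \<le> s * norm b" .
        have s2: "s \<le> 2" using d1 pos by (simp add: s_def)
        have "norm (tp Q * b) = norm b" by (rule norm_orth_mult[OF dQ(3) dA(2)])
        then have "norm vv \<le> norm b + norm (vv - tp Q * b)" using norm_triangle_sub[of vv "tp Q * b"] by simp
        then have nv: "norm vv \<le> 3 * norm b" using v3 mult_right_mono[OF s2 norm_ge_zero[of b]] by linarith
        have QQ: "Q * (tp Q * b - y) = b - Q * y"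
          using Q(1) idm_mult[OF dA(2)] by (simp add: right_diff_distrib orth_def mult.assoc[symmetric])
        have "norm (b - Q * y) = norm (tp Q * b - y)"
          using norm_orth_mult[OF Q(1) dims_diff[OF dims_mult[OF dQ(2) dA(2)] dYy(2)]] QQ by simp
        also have "\<dots> \<le> norm (vv - tp Q * b) + norm ff"
          using norm_triangle_ineq[of "vv - tp Q * b" ff] by (simp add: y_def norm_minus_commute[of "tp Q * b"] algebra_simps)
        also have "norm ff \<le> 4 * (real n * \<epsilon>) * (3 * norm b)"
          by (rule order_trans[OF nff mult_mono[OF \<gamma>(2) nv]]) (use pos in simp_all)
        finally have "norm (b - Q * y) \<le> (s + 12 * (real n * \<epsilon>)) * norm b" using v3 by (simp add: distrib_right)
        also have "\<dots> \<le> K * \<epsilon> * norm b" by (rule mult_right_mono[OF le2]) simp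
        finally have r2: "norm (b - Q * y) \<le> K * \<epsilon> * norm b" .
        have "entry (Y' * mk m 1 (\<lambda>(j, _). z (False, j))) i 0 = entry y i 0" if i: "i < m" for i
        proof -
          have "entry (Y' * mk m 1 (\<lambda>(j, _). z (False, j))) i 0 = (\<Sum>j<m. entry Y' i j * w j)"
            unfolding entry_mult[OF dYy(1)] by (rule sum.cong) (simp_all add: zF)
          also have "\<dots> = (\<Sum>j\<in>{i..<m}. entry Y' i j * w j)"
            by (rule sum.mono_neutral_right) (auto simp: up')
          also have "\<dots> = (\<Sum>j\<in>{i..<m}. (R i j + D i j) * w j)"
            by (rule sum.cong) (use i nm in \<open>auto simp: Y'_def Y DD_def\<close>)
          also have "\<dots> = v i + f i" by (rule eq[OF i])
          also have "\<dots> = entry y i 0" using i nm by (simp add: y_def vv_def ff_def)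
          finally show ?thesis .
        qed
        then show ?thesis using dYy up' r1 r2 by blast
      qed
      then show "ls_rel n m (K * \<epsilon>) x z"
        unfolding ls_rel_def Let_def A_def[symmetric] b_def[symmetric]
        using Q(1) dY upY AK zT by blast
    qed
  qed
qed

section \<open>Programs for concrete matrices\<close>

lemma computable_program:
  assumes "computable C R" "\<And>i. X i < k"
  obtains c Z k' where "\<And>j. Z j < k'" "real (ccost c) \<le> C"
    "\<And>\<epsilon> s p res. 0 \<le> \<epsilon> \<Longrightarrow> \<epsilon> \<le> 1 / 2 \<Longrightarrow> res \<in> outcomes \<epsilon> (compile c p) s \<Longrightarrow>
      \<exists>s'. R \<epsilon> (\<lambda>i. s (X i)) (\<lambda>j. s' (Z j)) \<and> res \<in> outcomes \<epsilon> p s'"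
proof -
  obtain c Z k' where c: "real (ccost c) \<le> C" "k \<le> k'" "\<And>j. Z j < k'"
    "\<And>\<epsilon> s. 0 \<le> \<epsilon> \<Longrightarrow> \<epsilon> \<le> 1 / 2 \<Longrightarrow>
       wp \<epsilon> c (\<lambda>s'. (\<forall>r<k. s' r = s r) \<and> R \<epsilon> (\<lambda>i. s (X i)) (\<lambda>j. s' (Z j))) s"
    by (rule computableE[OF assms]) (rule that)
  show thesis
  proof (rule that[of Z k' c])
    fix \<epsilon> :: real and s p res
    assume e: "0 \<le> \<epsilon>" "\<epsilon> \<le> 1 / 2" and res: "res \<in> outcomes \<epsilon> (compile c p) s"
    show "\<exists>s'. R \<epsilon> (\<lambda>i. s (X i)) (\<lambda>j. s' (Z j)) \<and> res \<in> outcomes \<epsilon> p s'"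
    proof (rule outcomes_compile[OF _ res], rule wp_mono[OF c(4)[OF e]], rule ballI)
      fix s' res'
      assume "(\<forall>r<k. s' r = s r) \<and> R \<epsilon> (\<lambda>i. s (X i)) (\<lambda>j. s' (Z j))" "res' \<in> outcomes \<epsilon> p s'"
      then show "\<exists>s'. R \<epsilon> (\<lambda>i. s (X i)) (\<lambda>j. s' (Z j)) \<and> res' \<in> outcomes \<epsilon> p s'" by blast
    qed
  qed (rule c)+
qed

definition to_mat :: "nat \<Rightarrow> nat \<Rightarrow> fm \<Rightarrow> real mat" where
  "to_mat n m F = mat n m (\<lambda>(i, j). entry F i j)"

lemma to_mat_carrier [simp]: "to_mat n m F \<in> carrier_mat n m"
  by (simp add: to_mat_def)

lemma to_mat_index [simp]: "i < n \<Longrightarrow> j < m \<Longrightarrow> to_mat n m F $$ (i, j) = entry F i j"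
  by (simp add: to_mat_def)

lemma dim_to_mat [simp]: "dim_row (to_mat n m F) = n" "dim_col (to_mat n m F) = m"
  by (simp_all add: to_mat_def)

lemma to_mat_mk: "A \<in> carrier_mat n m \<Longrightarrow> to_mat n m (mk n m (\<lambda>p. A $$ p)) = A"
  by (rule eq_matI) auto

lemma fnorm_to_mat: "dims n m F \<Longrightarrow> fnorm (to_mat n m F) = norm F"
  by (simp add: fnorm_def norm_fm_sq[symmetric])

lemma fnorm_mk: "A \<in> carrier_mat n m \<Longrightarrow> fnorm A = norm (mk n m (\<lambda>p. A $$ p))"
  using fnorm_to_mat[OF dims_mk, of n m "\<lambda>p. A $$ p"] by (simp add: to_mat_mk)

lemma to_mat_add: "to_mat n m F + to_mat n m G = to_mat n m (F + G)"
  and to_mat_diff: "to_mat n m F - to_mat n m G = to_mat n m (F - G)"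
  by (rule eq_matI; simp)+

lemma to_mat_tp: "transpose_mat (to_mat n m F) = to_mat m n (tp F)"
  by (rule eq_matI) auto

lemma to_mat_idm: "to_mat n n (idm n) = 1\<^sub>m n"
  by (rule eq_matI) auto

lemma to_mat_mult: "dims n k F \<Longrightarrow> to_mat n k F * to_mat k m G = to_mat n m (F * G)"
  by (rule eq_matI) (simp_all add: scalar_prod_def entry_mult lessThan_atLeast0)

lemma vnorm_mk: "v \<in> carrier_vec n \<Longrightarrow> vnorm v = norm (mk n 1 (\<lambda>(i, _). v $ i))"
proof -
  assume v: "v \<in> carrier_vec n"
  have "(norm (mk n 1 (\<lambda>(i, _). v $ i)))\<^sup>2 = (\<Sum>i<n. (v $ i)\<^sup>2)" by (simp add: norm_fm_sq[OF dims_mk])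
  also have "\<dots> = scalar_prod v v" using v by (simp add: scalar_prod_def power2_eq_square lessThan_atLeast0)
  finally show "vnorm v = norm (mk n 1 (\<lambda>(i, _). v $ i))" unfolding vnorm_def by (metis norm_ge_zero real_sqrt_unique)
qed

definition to_vec :: "nat \<Rightarrow> fm \<Rightarrow> real vec" where
  "to_vec n F = vec n (\<lambda>i. entry F i 0)"

lemma to_vec_carrier [simp]: "to_vec n F \<in> carrier_vec n"
  by (simp add: to_vec_def)

lemma to_vec_mk: "v \<in> carrier_vec n \<Longrightarrow> to_vec n (mk n 1 (\<lambda>(i, _). v $ i)) = v"
  by (rule eq_vecI) (auto simp: to_vec_def)

lemma to_vec_index [simp]: "i < n \<Longrightarrow> to_vec n F $ i = entry F i 0"
  by (simp add: to_vec_def)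

lemma dim_to_vec [simp]: "dim_vec (to_vec n F) = n"
  by (simp add: to_vec_def)

lemma vnorm_to_vec: assumes "dims n 1 F" shows "vnorm (to_vec n F) = norm F"
proof -
  have "mk n 1 (\<lambda>(i, _). to_vec n F $ i) = F"
    by (rule fm_eqI) (use assms in \<open>auto simp: dims_entry0 less_Suc_eq_0_disj\<close>)
  then show ?thesis using vnorm_mk[OF to_vec_carrier, of n F] by simp
qed

lemma to_mat_mult_vec: "dims n m F \<Longrightarrow> to_mat n m F *\<^sub>v to_vec m G = to_vec n (F * G)"
  by (rule eq_vecI) (simp_all add: scalar_prod_def entry_mult lessThan_atLeast0)

lemma to_vec_diff: "to_vec n F - to_vec n G = to_vec n (F - G)"
  and to_vec_add: "to_vec n F + to_vec n G = to_vec n (F + G)"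
  by (rule eq_vecI; simp)+

lemma orthonormal_to_mat: "orth n Q \<Longrightarrow> orthonormal_mat (to_mat n n Q)"
  by (simp add: orthonormal_mat_def orth_def to_mat_tp to_mat_mult[OF dims_tp] to_mat_idm)

lemma orth_mult_tp:
  assumes "orth n Q" "dims n m X" shows "Q * (tp Q * X) = X" "tp Q * (Q * X) = X"
  using assms idm_mult[OF assms(2)] by (simp_all add: orth_def mult.assoc[symmetric])

lemma qr_program:
  assumes qr: "qr_kernel n n 0 C d"
  shows "\<exists>p. real (cost p) \<le> C \<and> (\<forall>\<epsilon>. 0 \<le> \<epsilon> \<longrightarrow> \<epsilon> \<le> 1 / 2 \<longrightarrow> d * \<epsilon> \<le> 1 \<longrightarrow> stable_qr n \<epsilon> (d * \<epsilon>) p)"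
proof -
  define X where "X = (\<lambda>(i, j). if i < n \<and> j < n then i * n + j else n * n)"
  have X: "X a < n * n + 1" for a
    using index_less by (cases a) (auto simp: X_def less_Suc_eq)
  obtain c and Z :: "bool \<times> nat \<times> nat \<Rightarrow> nat" where c: "real (ccost c) \<le> C"
    "\<And>\<epsilon> s p res. 0 \<le> \<epsilon> \<Longrightarrow> \<epsilon> \<le> 1 / 2 \<Longrightarrow> res \<in> outcomes \<epsilon> (compile c p) s \<Longrightarrow>
      (\<exists>s'. (d * \<epsilon> \<le> 1 \<longrightarrow> (\<forall>i j. j < i \<and> i < 0 \<and> j < n \<longrightarrow> s (X (i, j)) = 0) \<longrightarrow>
        good n (d * \<epsilon>) (mk n n (\<lambda>a. s' (Z (False, a)))) (mk n n (\<lambda>a. s (X a))) (mk n n (\<lambda>a. s' (Z (True, a)))) \<and>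
        (\<forall>i j. j < i \<and> i < n \<and> j < n \<longrightarrow> s' (Z (True, i, j)) = 0)) \<and> res \<in> outcomes \<epsilon> p s')"
    by (rule computable_program[where X = X, OF qr[unfolded qr_kernel_def] X]) (rule that)
  define rs where "rs b = map (\<lambda>k. Z (b, k div n, k mod n)) [0..<n * n]" for b
  define p where "p = compile c (Return (rs False @ rs True))"
  have "stable_qr n \<epsilon> (d * \<epsilon>) p" if e: "0 \<le> \<epsilon>" "\<epsilon> \<le> 1 / 2" and d: "d * \<epsilon> \<le> 1" for \<epsilon>
    unfolding stable_qr_def
  proof (intro ballI)
    fix A res
    assume A: "A \<in> carrier_mat n n" and res: "res \<in> outcomes \<epsilon> p (load (entries A))"
    define s where "s = load (entries A)"
    obtain s' where s': "d * \<epsilon> \<le> 1 \<longrightarrow> (\<forall>i j. j < i \<and> i < 0 \<and> j < n \<longrightarrow> s (X (i, j)) = 0) \<longrightarrow>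
        good n (d * \<epsilon>) (mk n n (\<lambda>a. s' (Z (False, a)))) (mk n n (\<lambda>a. s (X a))) (mk n n (\<lambda>a. s' (Z (True, a)))) \<and>
        (\<forall>i j. j < i \<and> i < n \<and> j < n \<longrightarrow> s' (Z (True, i, j)) = 0)"
      and r: "res \<in> outcomes \<epsilon> (Return (rs False @ rs True)) s'"
      using c(2)[OF e res[unfolded p_def]] unfolding s_def by blast
    define Qh where "Qh = mk n n (\<lambda>a. s' (Z (False, a)))"
    define Y where "Y = mk n n (\<lambda>a. s' (Z (True, a)))"
    define F where "F = mk n n (\<lambda>p. A $$ p)"
    have "mk n n (\<lambda>a. s (X a)) = F"
      unfolding F_def
    proof (rule mk_cong)
      fix i j assume ij: "i < n" "j < n"
      then show "s (X (i, j)) = A $$ (i, j)"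
        using index_less[OF ij] by (simp add: s_def X_def load_def length_entries[OF A] nth_entries[OF A])
    qed
    then have g: "good n (d * \<epsilon>) Qh F Y" and up: "\<And>i j. j < i \<Longrightarrow> i < n \<Longrightarrow> j < n \<Longrightarrow> s' (Z (True, i, j)) = 0"
      using s' d by (simp_all add: Qh_def Y_def)
    obtain Q where Q: "orth n Q" "norm (Qh - Q) \<le> d * \<epsilon>" "norm (F - Q * Y) \<le> d * \<epsilon> * norm F"
      using g by (auto simp: good_def)
    have dm: "dims n n Qh" "dims n n Y" "dims n n F" "dims n n Q" "dims n n (Q * Y)"
      using Q(1) dims_mult[of n n Q n n Y] by (simp_all add: Qh_def Y_def F_def orth_def)
    have AF: "A = to_mat n n F" by (simp add: F_def to_mat_mk[OF A])
    have divmod: "k div n < n" "k mod n < n" if "k < n * n" for k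
      using that less_mult_imp_div_less[OF that] by (auto intro!: mod_less_divisor Nat.gr0I)
    have ent: "entries (to_mat n n (mk n n (\<lambda>a. s' (Z (b, a))))) = map s' (rs b)" for b
      unfolding entries_eq[OF to_mat_carrier] rs_def map_map using divmod by (intro map_cong) auto
    have res': "res = Some (entries (to_mat n n Qh) @ entries (to_mat n n Y))"
      using r by (simp add: ent Qh_def Y_def)
    show "\<exists>Qc\<in>carrier_mat n n. \<exists>Rc\<in>carrier_mat n n.
          res = Some (entries Qc @ entries Rc) \<and> upper_triangular Rc \<and>
          (\<exists>Q\<in>carrier_mat n n. \<exists>\<delta>A\<in>carrier_mat n n.
             orthonormal_mat Q \<and> fnorm (Qc - Q) \<le> d * \<epsilon> \<and>
             fnorm \<delta>A \<le> d * \<epsilon> * fnorm A \<and> transpose_mat Q * (A + \<delta>A) = Rc)"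
    proof (intro bexI conjI)
      show "res = Some (entries (to_mat n n Qh) @ entries (to_mat n n Y))" by (rule res')
      show "upper_triangular (to_mat n n Y)" using up by (auto simp: Y_def upper_triangular_def)
      show "orthonormal_mat (to_mat n n Q)" by (rule orthonormal_to_mat[OF Q(1)])
      show "fnorm (to_mat n n Qh - to_mat n n Q) \<le> d * \<epsilon>"
        using Q(2) by (simp add: to_mat_diff fnorm_to_mat dims_diff dm)
      show "fnorm (to_mat n n (Q * Y - F)) \<le> d * \<epsilon> * fnorm A"
        using Q(3) by (simp add: AF fnorm_to_mat dims_diff dm norm_minus_commute)
      show "transpose_mat (to_mat n n Q) * (A + to_mat n n (Q * Y - F)) = to_mat n n Y"
        by (simp add: AF to_mat_add to_mat_tp to_mat_mult[OF dims_tp[OF dm(4)]] orth_mult_tp(2)[OF Q(1) dm(2)])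
    qed simp_all
  qed
  moreover have "real (cost p) \<le> C" using c(1) cost_compile[of c "Return (rs False @ rs True)"] by (simp add: p_def)
  ultimately show ?thesis by blast
qed

text \<open>Dividing each register by itself makes the program fail exactly if one of them is zero.\<close>

definition test_nonzero :: "nat \<Rightarrow> nat list \<Rightarrow> prog \<Rightarrow> prog" where
  "test_nonzero k zs p = foldr (\<lambda>z. Assign k (Div z z)) zs p"

lemma cost_test_nonzero: "cost (test_nonzero k zs p) = length zs + cost p"
  by (induction zs) (auto simp: test_nonzero_def)

lemma outcomes_test_nonzero:
  assumes "res \<in> outcomes \<epsilon> (test_nonzero k zs p) s" "\<forall>z\<in>set zs. z < k"
  shows "(res = None \<and> (\<exists>z\<in>set zs. s z = 0)) \<or>
    ((\<forall>z\<in>set zs. s z \<noteq> 0) \<and> (\<exists>s'. (\<forall>r<k. s' r = s r) \<and> res \<in> outcomes \<epsilon> p s'))"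
  using assms
proof (induction zs arbitrary: s)
  case Nil
  then show ?case by (auto simp: test_nonzero_def)
next
  case (Cons z zs)
  show ?case
  proof (cases "s z = 0")
    case True
    then show ?thesis using Cons.prems by (simp add: test_nonzero_def)
  next
    case False
    then obtain v where v: "res \<in> outcomes \<epsilon> (test_nonzero k zs p) (s(k := v))"
      using Cons.prems by (auto simp: test_nonzero_def)
    have eq: "(s(k := v)) y = s y" if "y \<in> set zs" for y using Cons.prems(2) that by auto
    have "\<forall>z\<in>set zs. z < k" using Cons.prems(2) by simp
    from Cons.IH[OF v this] show ?thesis
    proof
      assume "res = None \<and> (\<exists>z\<in>set zs. (s(k := v)) z = 0)"
      then show ?thesis using eq by auto
    next
      assume h: "(\<forall>z\<in>set zs. (s(k := v)) z \<noteq> 0) \<and> (\<exists>s'. (\<forall>r<k. s' r = (s(k := v)) r) \<and> res \<in> outcomes \<epsilon> p s')"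
      then obtain s' where "\<forall>r<k. s' r = (s(k := v)) r" "res \<in> outcomes \<epsilon> p s'" by blast
      moreover have "\<forall>z\<in>set zs. s z \<noteq> 0" using h eq by auto
      ultimately show ?thesis using False by auto
    qed
  qed
qed

lemma upper_triangular_kernel:
  assumes Y: "dims n m Y" "\<And>i j. j < i \<Longrightarrow> entry Y i j = 0" and j: "j < m" "entry Y j j = 0"
  shows "\<exists>v\<in>carrier_vec m. v \<noteq> 0\<^sub>v m \<and> to_mat n m Y *\<^sub>v v = 0\<^sub>v n"
proof -
  let ?M = "to_mat m m Y"
  have "upper_triangular ?M" using Y(2) by (auto simp: upper_triangular_def)
  then have "det ?M = prod_list (diag_mat ?M)" by (rule det_upper_triangular) (rule to_mat_carrier)
  also have "\<dots> = 0" using j by (auto simp: diag_mat_def prod_list_zero_iff image_iff intro!: bexI[of _ j])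
  finally obtain v where v: "v \<in> carrier_vec m" "v \<noteq> 0\<^sub>v m" "?M *\<^sub>v v = 0\<^sub>v m"
    using det_0_iff_vec_prod_zero_field[of ?M m] by auto
  have "to_mat n m Y *\<^sub>v v = 0\<^sub>v n"
  proof (rule eq_vecI)
    fix i assume "i < dim_vec (0\<^sub>v n)"
    then have i: "i < n" by simp
    show "(to_mat n m Y *\<^sub>v v) $ i = 0\<^sub>v n $ i"
    proof (cases "i < m")
      case True
      have "(to_mat n m Y *\<^sub>v v) $ i = (?M *\<^sub>v v) $ i" using i True v(1) by (simp add: scalar_prod_def)
      then show ?thesis using v(3) i True by simp
    next
      case False
      then have "\<And>k. k < m \<Longrightarrow> entry Y i k = 0" using Y(2) by simp
      then show ?thesis using i v(1) by (simp add: scalar_prod_def)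
    qed
  qed simp
  then show ?thesis using v by blast
qed

lemma not_invertible_kernel:
  fixes M :: "real mat"
  assumes "M \<in> carrier_mat n n" "v \<in> carrier_vec n" "v \<noteq> 0\<^sub>v n" "M *\<^sub>v v = 0\<^sub>v n"
  shows "\<not> invertible_mat M"
proof
  assume "invertible_mat M"
  then obtain B where B: "inverts_mat B M" "inverts_mat M B" by (auto simp: invertible_mat_def)
  have BM: "B * M = 1\<^sub>m (dim_row B)" "M * B = 1\<^sub>m n" using B assms(1) by (auto simp: inverts_mat_def)
  have "dim_col B = n" using arg_cong[OF BM(2), of dim_col] by simp
  moreover have "dim_row B = n" using arg_cong[OF BM(1), of dim_col] assms(1) by simp
  ultimately have Bc: "B \<in> carrier_mat n n" by auto
  have "v = (B * M) *\<^sub>v v" using BM(1) Bc assms(2) by simp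
  also have "\<dots> = B *\<^sub>v (M *\<^sub>v v)" by (rule assoc_mult_mat_vec[OF Bc assms(1,2)])
  also have "\<dots> = 0\<^sub>v n" using assms(4) Bc by (auto intro!: eq_vecI simp: scalar_prod_def)
  finally show False using assms(3) by simp
qed

lemma ls_rel_mono:
  assumes "ls_rel n m \<beta> x z" "\<beta> \<le> \<beta>'" shows "ls_rel n m \<beta>' x z"
proof -
  let ?A = "mk n m (\<lambda>a. x (False, a))" and ?b = "mk n 1 (\<lambda>a. x (True, a))"
  have le: "r \<le> \<beta>' * norm F" if "r \<le> \<beta> * norm F" for r and F :: fm
    using that mult_right_mono[OF assms(2) norm_ge_zero[of F]] by linarith
  obtain Q Y where Q: "orth n Q" "dims n m Y" "\<forall>i j. j < i \<longrightarrow> entry Y i j = 0" "norm (?A - Q * Y) \<le> \<beta> * norm ?A"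
      "\<forall>j<m. z (True, j) = entry Y j j"
    and sol: "(\<forall>j<m. z (True, j) \<noteq> 0) \<longrightarrow> (\<exists>Y' y. dims n m Y' \<and> dims n 1 y \<and> (\<forall>i j. j < i \<longrightarrow> entry Y' i j = 0) \<and>
          norm (?A - Q * Y') \<le> \<beta> * norm ?A \<and> norm (?b - Q * y) \<le> \<beta> * norm ?b \<and>
          (\<forall>i<m. entry (Y' * mk m 1 (\<lambda>(j, _). z (False, j))) i 0 = entry y i 0))"
    using assms(1) unfolding ls_rel_def Let_def by (elim exE conjE) (rule that)
  have "(\<forall>j<m. z (True, j) \<noteq> 0) \<longrightarrow> (\<exists>Y' y. dims n m Y' \<and> dims n 1 y \<and> (\<forall>i j. j < i \<longrightarrow> entry Y' i j = 0) \<and>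
          norm (?A - Q * Y') \<le> \<beta>' * norm ?A \<and> norm (?b - Q * y) \<le> \<beta>' * norm ?b \<and>
          (\<forall>i<m. entry (Y' * mk m 1 (\<lambda>(j, _). z (False, j))) i 0 = entry y i 0))"
    using sol le by meson
  then show ?thesis unfolding ls_rel_def Let_def
    using Q(1-3,5) le[OF Q(4)] by - (rule exI[of _ Q], rule exI[of _ Y], intro conjI)
qed

lemma ls_program:
  assumes ls: "computable C (\<lambda>\<epsilon> x z. K * \<epsilon> \<le> 1 \<longrightarrow> ls_rel n m (K * \<epsilon>) x z)" and nm: "1 \<le> m" "m \<le> n"
  shows "\<exists>p. real (cost p) \<le> C + real m \<and> (\<forall>\<epsilon>. 0 \<le> \<epsilon> \<longrightarrow> \<epsilon> \<le> 1 / 2 \<longrightarrow> K * \<epsilon> \<le> 1 \<longrightarrow>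
    stable_least_squares n m \<epsilon> (K * \<epsilon>) p \<and> (m = n \<longrightarrow> stable_solver n \<epsilon> (K * \<epsilon>) p))"
proof -
  define X where "X = (\<lambda>(b, i, j). if b then (if i < n then n * m + i else n * m + n)
    else if i < n \<and> j < m then i * m + j else n * m + n)"
  have X: "X a < n * m + n + 1" for a
    using index_less by (cases a) (auto simp: X_def less_Suc_eq trans_less_add1)
  obtain c and Z :: "bool \<times> nat \<Rightarrow> nat" and k' where Z: "\<And>j. Z j < k'" and c: "real (ccost c) \<le> C"
    "\<And>\<epsilon> s p res. 0 \<le> \<epsilon> \<Longrightarrow> \<epsilon> \<le> 1 / 2 \<Longrightarrow> res \<in> outcomes \<epsilon> (compile c p) s \<Longrightarrow>
      (\<exists>s'. (K * \<epsilon> \<le> 1 \<longrightarrow> ls_rel n m (K * \<epsilon>) (\<lambda>a. s (X a)) (\<lambda>j. s' (Z j))) \<and> res \<in> outcomes \<epsilon> p s')"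
    by (rule computable_program[where X = X, OF ls X]) (rule that)
  define tl where "tl = Return (map (\<lambda>j. Z (False, j)) [0..<m])"
  define zs where "zs = map (\<lambda>j. Z (True, j)) [0..<m]"
  define p where "p = compile c (test_nonzero k' zs tl)"
  have core: "\<exists>Q Y. orth n Q \<and> dims n m Y \<and> (\<forall>i j. j < i \<longrightarrow> entry Y i j = 0) \<and>
      norm (mk n m (\<lambda>p. A $$ p) - Q * Y) \<le> K * \<epsilon> * norm (mk n m (\<lambda>p. A $$ p)) \<and>
      ((res = None \<and> (\<exists>j<m. entry Y j j = 0)) \<or>
       (\<exists>w Y' y. res = Some (map w [0..<m]) \<and> dims n m Y' \<and> dims n 1 y \<and> (\<forall>i j. j < i \<longrightarrow> entry Y' i j = 0) \<and>
          norm (mk n m (\<lambda>p. A $$ p) - Q * Y') \<le> K * \<epsilon> * norm (mk n m (\<lambda>p. A $$ p)) \<and>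
          norm (mk n 1 (\<lambda>(i, _). b $ i) - Q * y) \<le> K * \<epsilon> * norm (mk n 1 (\<lambda>(i, _). b $ i)) \<and>
          (\<forall>i<m. entry (Y' * mk m 1 (\<lambda>(j, _). w j)) i 0 = entry y i 0)))"
    if e: "0 \<le> \<epsilon>" "\<epsilon> \<le> 1 / 2" "K * \<epsilon> \<le> 1" and A: "A \<in> carrier_mat n m" and b: "b \<in> carrier_vec n"
      and res: "res \<in> outcomes \<epsilon> p (load (entries A @ list_of_vec b))" for \<epsilon> A b res
  proof -
    define s where "s = load (entries A @ list_of_vec b)"
    obtain s' where s': "ls_rel n m (K * \<epsilon>) (\<lambda>a. s (X a)) (\<lambda>j. s' (Z j))"
      and r: "res \<in> outcomes \<epsilon> (test_nonzero k' zs tl) s'"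
      using c(2)[OF e(1,2) res[unfolded p_def]] e(3) unfolding s_def by blast
    have len: "length (list_of_vec b) = n" using b by simp
    have A': "mk n m (\<lambda>a. s (X (False, a))) = mk n m (\<lambda>p. A $$ p)"
    proof (rule mk_cong)
      fix i j assume ij: "i < n" "j < m"
      then show "s (X (False, i, j)) = A $$ (i, j)"
        using index_less[OF ij] by (simp add: s_def X_def load_def length_entries[OF A] nth_entries[OF A] nth_append)
    qed
    have b': "mk n 1 (\<lambda>a. s (X (True, a))) = mk n 1 (\<lambda>(i, _). b $ i)"
    proof (rule mk_cong)
      fix i j :: nat assume ij: "i < n" "j < 1"
      then show "s (X (True, i, j)) = (case (i, j) of (i, _) \<Rightarrow> b $ i)"
        using len b by (simp add: s_def X_def load_def length_entries[OF A] nth_append list_of_vec_index)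
    qed
    from s' obtain Q Y where Q: "orth n Q" "dims n m Y" "\<forall>i j. j < i \<longrightarrow> entry Y i j = 0"
        "norm (mk n m (\<lambda>p. A $$ p) - Q * Y) \<le> K * \<epsilon> * norm (mk n m (\<lambda>p. A $$ p))"
      and zT: "\<forall>j<m. s' (Z (True, j)) = entry Y j j"
      and sol: "(\<forall>j<m. s' (Z (True, j)) \<noteq> 0) \<longrightarrow> (\<exists>Y' y. dims n m Y' \<and> dims n 1 y \<and> (\<forall>i j. j < i \<longrightarrow> entry Y' i j = 0) \<and>
          norm (mk n m (\<lambda>p. A $$ p) - Q * Y') \<le> K * \<epsilon> * norm (mk n m (\<lambda>p. A $$ p)) \<and>
          norm (mk n 1 (\<lambda>(i, _). b $ i) - Q * y) \<le> K * \<epsilon> * norm (mk n 1 (\<lambda>(i, _). b $ i)) \<and>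
          (\<forall>i<m. entry (Y' * mk m 1 (\<lambda>(j, _). s' (Z (False, j)))) i 0 = entry y i 0))"
      unfolding ls_rel_def Let_def A' b' by blast
    have "\<forall>z\<in>set zs. z < k'" using Z by (auto simp: zs_def)
    from outcomes_test_nonzero[OF r this] show ?thesis
    proof
      assume h: "res = None \<and> (\<exists>z\<in>set zs. s' z = 0)"
      then have "\<exists>j<m. entry Y j j = 0" using zT by (auto simp: zs_def)
      then show ?thesis using Q h by blast
    next
      assume h: "(\<forall>z\<in>set zs. s' z \<noteq> 0) \<and> (\<exists>s''. (\<forall>r<k'. s'' r = s' r) \<and> res \<in> outcomes \<epsilon> tl s'')"
      then obtain s'' where s'': "\<forall>r<k'. s'' r = s' r" "res \<in> outcomes \<epsilon> tl s''" by blast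
      have "res = Some (map (\<lambda>j. s'' (Z (False, j))) [0..<m])" using s''(2) by (simp add: tl_def o_def)
      then have r: "res = Some (map (\<lambda>j. s' (Z (False, j))) [0..<m])" using s''(1) Z by simp
      have "\<forall>j<m. s' (Z (True, j)) \<noteq> 0" using h by (auto simp: zs_def)
      then obtain Y' y where Y': "dims n m Y' \<and> dims n 1 y \<and> (\<forall>i j. j < i \<longrightarrow> entry Y' i j = 0) \<and>
          norm (mk n m (\<lambda>p. A $$ p) - Q * Y') \<le> K * \<epsilon> * norm (mk n m (\<lambda>p. A $$ p)) \<and>
          norm (mk n 1 (\<lambda>(i, _). b $ i) - Q * y) \<le> K * \<epsilon> * norm (mk n 1 (\<lambda>(i, _). b $ i)) \<and>
          (\<forall>i<m. entry (Y' * mk m 1 (\<lambda>(j, _). s' (Z (False, j)))) i 0 = entry y i 0)" using sol by blast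
      show ?thesis
        by (rule exI[of _ Q], rule exI[of _ Y], intro conjI Q disjI2,
            rule exI[of _ "\<lambda>j. s' (Z (False, j))"], rule exI[of _ Y'], rule exI[of _ y], rule conjI[OF r Y'])
    qed
  qed
  have singular: "\<exists>E\<in>carrier_mat n m. fnorm E \<le> \<beta> * fnorm A \<and>
      (\<exists>v\<in>carrier_vec m. v \<noteq> 0\<^sub>v m \<and> (A + E) *\<^sub>v v = 0\<^sub>v n)"
    if A: "A \<in> carrier_mat n m" and Q: "orth n Q" "dims n m Y" "\<forall>i j. j < i \<longrightarrow> entry Y i j = 0"
        "norm (mk n m (\<lambda>p. A $$ p) - Q * Y) \<le> \<beta> * norm (mk n m (\<lambda>p. A $$ p))"
      and sing: "\<exists>j<m. entry Y j j = 0" for A Q Y \<beta>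
  proof -
    let ?F = "mk n m (\<lambda>p. A $$ p)"
    have dQ: "dims n n Q" using Q(1) by (simp add: orth_def)
    obtain v where v: "v \<in> carrier_vec m" "v \<noteq> 0\<^sub>v m" "to_mat n m Y *\<^sub>v v = 0\<^sub>v n"
      using upper_triangular_kernel[OF Q(2)] Q(3) sing by blast
    have AF: "A = to_mat n m ?F" by (simp add: to_mat_mk[OF A])
    have "A + to_mat n m (Q * Y - ?F) = to_mat n n Q * to_mat n m Y"
      by (subst AF) (simp add: to_mat_add to_mat_mult[OF dQ])
    then have "(A + to_mat n m (Q * Y - ?F)) *\<^sub>v v = to_mat n n Q *\<^sub>v (to_mat n m Y *\<^sub>v v)"
      using v(1) by (simp add: assoc_mult_mat_vec[of _ n n _ m])
    also have "\<dots> = 0\<^sub>v n" unfolding v(3) by (rule eq_vecI) (simp_all add: scalar_prod_def)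
    finally have "(A + to_mat n m (Q * Y - ?F)) *\<^sub>v v = 0\<^sub>v n" .
    moreover have "fnorm (to_mat n m (Q * Y - ?F)) \<le> \<beta> * fnorm A"
      using Q(4) by (simp add: fnorm_mk[OF A] fnorm_to_mat dims_diff dims_mult[OF dQ Q(2)] norm_minus_commute)
    ultimately show ?thesis using v by (intro bexI[of _ "to_mat n m (Q * Y - ?F)"]) auto
  qed
  have "stable_least_squares n m \<epsilon> (K * \<epsilon>) p \<and> (m = n \<longrightarrow> stable_solver n \<epsilon> (K * \<epsilon>) p)"
    if e: "0 \<le> \<epsilon>" "\<epsilon> \<le> 1 / 2" "K * \<epsilon> \<le> 1" for \<epsilon>
  proof -
    have some: "\<exists>x\<in>carrier_vec m. map w [0..<m] = list_of_vec x \<and>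
        (\<exists>\<delta>A\<in>carrier_mat n m. \<exists>\<delta>b\<in>carrier_vec n.
           fnorm \<delta>A \<le> K * \<epsilon> * fnorm A \<and> vnorm \<delta>b \<le> K * \<epsilon> * vnorm b \<and>
           least_squares_solution (A + \<delta>A) (b + \<delta>b) x \<and> (m = n \<longrightarrow> (A + \<delta>A) *\<^sub>v x = b + \<delta>b))"
      if A: "A \<in> carrier_mat n m" and b: "b \<in> carrier_vec n" and Q: "orth n Q"
        and Y: "dims n m Y" "dims n 1 y" "\<forall>i j. j < i \<longrightarrow> entry Y i j = 0"
        and nA: "norm (mk n m (\<lambda>p. A $$ p) - Q * Y) \<le> K * \<epsilon> * norm (mk n m (\<lambda>p. A $$ p))"
        and nb: "norm (mk n 1 (\<lambda>(i, _). b $ i) - Q * y) \<le> K * \<epsilon> * norm (mk n 1 (\<lambda>(i, _). b $ i))"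
        and sol: "\<forall>i<m. entry (Y * mk m 1 (\<lambda>(j, _). w j)) i 0 = entry y i 0" for A b Q Y y w
    proof -
      let ?F = "mk n m (\<lambda>p. A $$ p)" and ?b = "mk n 1 (\<lambda>(i, _). b $ i)"
      define W where "W = mk m 1 (\<lambda>(j, _). w j)"
      have dQ: "dims n n Q" using Q(1) by (simp add: orth_def)
      have dQY: "dims n m (Q * Y)" "dims n 1 (Q * y)" by (rule dims_mult[OF dQ Y(1)], rule dims_mult[OF dQ Y(2)])
      have AF: "A + to_mat n m (Q * Y - ?F) = to_mat n m (Q * Y)"
        using to_mat_add[of n m ?F "Q * Y - ?F"] by (simp add: to_mat_mk[OF A])
      have bF: "b + to_vec n (Q * y - ?b) = to_vec n (Q * y)"
        using to_vec_add[of n ?b "Q * y - ?b"] unfolding to_vec_mk[OF b] by simp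
      have low: "entry (Y * V) i 0 = 0" if "m \<le> i" for i V
        unfolding entry_mult[OF Y(1)] using Y(3) that by (intro sum.neutral) auto
      have resid: "vnorm (to_mat n m (Q * Y) *\<^sub>v v - to_vec n (Q * y)) = norm (Y * mk m 1 (\<lambda>(i, _). v $ i) - y)"
        if v: "v \<in> carrier_vec m" for v
      proof -
        let ?v = "mk m 1 (\<lambda>(i, _). v $ i)"
        have dYv: "dims n 1 (Y * ?v - y)" by (rule dims_diff[OF dims_mult[OF Y(1) dims_mk] Y(2)])
        have "to_mat n m (Q * Y) *\<^sub>v v = to_vec n (Q * Y * ?v)"
          using to_mat_mult_vec[OF dQY(1), of ?v] unfolding to_vec_mk[OF v] .
        then have "to_mat n m (Q * Y) *\<^sub>v v - to_vec n (Q * y) = to_vec n (Q * (Y * ?v - y))"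
          by (simp add: to_vec_diff right_diff_distrib mult.assoc)
        then show ?thesis
          using vnorm_to_vec[OF dims_mult[OF dQ dYv]] norm_orth_mult[OF Q dYv] by simp
      qed
      have x: "to_vec m W \<in> carrier_vec m" by simp
      have WW: "mk m 1 (\<lambda>(i, _). to_vec m W $ i) = W" by (rule fm_eqI) (auto simp: W_def)
      have "least_squares_solution (to_mat n m (Q * Y)) (to_vec n (Q * y)) (to_vec m W)"
        unfolding least_squares_solution_def
      proof (intro conjI ballI)
        fix v :: "real vec" assume "v \<in> carrier_vec (dim_col (to_mat n m (Q * Y)))"
        then have v: "v \<in> carrier_vec m" by simp
        have "norm (Y * W - y) \<le> norm (Y * mk m 1 (\<lambda>(i, _). v $ i) - y)"
        proof (rule norm_le_entries)
          fix i j
          have d1: "entry (Y * W - y) i j = 0" if "j \<noteq> 0"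
            using that dims_entry0[OF dims_diff[OF dims_mult[OF Y(1) dims_mk] Y(2)], of i j] by (simp add: W_def)
          have d2: "entry (Y * W - y) i 0 = 0" if "i < m" using sol that by (simp add: W_def)
          show "\<bar>entry (Y * W - y) i j\<bar> \<le> \<bar>entry (Y * mk m 1 (\<lambda>(i, _). v $ i) - y) i j\<bar>"
            using d1 d2 low by (cases "j = 0"; cases "i < m") auto
        qed
        then show "vnorm (to_mat n m (Q * Y) *\<^sub>v to_vec m W - to_vec n (Q * y)) \<le> vnorm (to_mat n m (Q * Y) *\<^sub>v v - to_vec n (Q * y))"
          unfolding resid[OF x] resid[OF v] WW .
      qed simp
      moreover have "to_mat n m (Q * Y) *\<^sub>v to_vec m W = to_vec n (Q * y)" if mn: "m = n"
      proof -
        have "Y * W = y"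
        proof (rule fm_eqI)
          fix i j
          have dYW: "dims n 1 (Y * W)" unfolding W_def by (rule dims_mult[OF Y(1) dims_mk])
          show "entry (Y * W) i j = entry y i j"
            using sol mn dims_entry0[OF dYW, of i j] dims_entry0[OF Y(2), of i j]
            by (cases "i < n \<and> j = 0") (auto simp: W_def)
        qed
        then show ?thesis using to_mat_mult_vec[OF dQY(1), of W] by (simp add: mult.assoc)
      qed
      moreover have "fnorm (to_mat n m (Q * Y - ?F)) \<le> K * \<epsilon> * fnorm A"
        using nA by (simp add: fnorm_mk[OF A] fnorm_to_mat dims_diff dQY norm_minus_commute)
      moreover have "vnorm (to_vec n (Q * y - ?b)) \<le> K * \<epsilon> * vnorm b"
        using nb unfolding vnorm_mk[OF b] vnorm_to_vec[OF dims_diff[OF dQY(2) dims_mk]] by (simp add: norm_minus_commute)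
      moreover have "map w [0..<m] = list_of_vec (to_vec m W)"
        by (rule nth_equalityI) (auto simp: W_def list_of_vec_index)
      ultimately show ?thesis
        unfolding AF[symmetric] bF[symmetric]
        by - (rule bexI[of _ "to_vec m W"], rule conjI, assumption, rule bexI[of _ "to_mat n m (Q * Y - ?F)"],
          rule bexI[of _ "to_vec n (Q * y - ?b)"], intro conjI impI, simp_all)
    qed
    have LS: "stable_least_squares n m \<epsilon> (K * \<epsilon>) p"
      unfolding stable_least_squares_def
    proof (intro ballI)
      fix A b res
      assume A: "A \<in> carrier_mat n m" and b: "b \<in> carrier_vec n" and res: "res \<in> outcomes \<epsilon> p (load (entries A @ list_of_vec b))"
      obtain Q Y where Q: "orth n Q" "dims n m Y" "\<forall>i j. j < i \<longrightarrow> entry Y i j = 0"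
          "norm (mk n m (\<lambda>p. A $$ p) - Q * Y) \<le> K * \<epsilon> * norm (mk n m (\<lambda>p. A $$ p))"
        and alt: "(res = None \<and> (\<exists>j<m. entry Y j j = 0)) \<or>
       (\<exists>w Y' y. res = Some (map w [0..<m]) \<and> dims n m Y' \<and> dims n 1 y \<and> (\<forall>i j. j < i \<longrightarrow> entry Y' i j = 0) \<and>
          norm (mk n m (\<lambda>p. A $$ p) - Q * Y') \<le> K * \<epsilon> * norm (mk n m (\<lambda>p. A $$ p)) \<and>
          norm (mk n 1 (\<lambda>(i, _). b $ i) - Q * y) \<le> K * \<epsilon> * norm (mk n 1 (\<lambda>(i, _). b $ i)) \<and>
          (\<forall>i<m. entry (Y' * mk m 1 (\<lambda>(j, _). w j)) i 0 = entry y i 0))"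
        using core[OF e A b res] by blast
      from alt show "case res of
             None \<Rightarrow> (\<exists>E\<in>carrier_mat n m. fnorm E \<le> K * \<epsilon> * fnorm A \<and> \<not> full_column_rank (A + E))
           | Some xs \<Rightarrow> (\<exists>x\<in>carrier_vec m. xs = list_of_vec x \<and>
                 (\<exists>\<delta>A\<in>carrier_mat n m. \<exists>\<delta>b\<in>carrier_vec n.
                    fnorm \<delta>A \<le> K * \<epsilon> * fnorm A \<and> vnorm \<delta>b \<le> K * \<epsilon> * vnorm b \<and>
                    least_squares_solution (A + \<delta>A) (b + \<delta>b) x))"
      proof
        assume h: "res = None \<and> (\<exists>j<m. entry Y j j = 0)"
        obtain E v where E: "E \<in> carrier_mat n m" "fnorm E \<le> K * \<epsilon> * fnorm A" "v \<in> carrier_vec m" "v \<noteq> 0\<^sub>v m" "(A + E) *\<^sub>v v = 0\<^sub>v n"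
          using singular[OF A Q] h by blast
        have "A + E \<in> carrier_mat n m" using E(1) by simp
        then have "v \<in> mat_kernel (A + E)" using E by (simp add: mat_kernel_def)
        then have "\<not> full_column_rank (A + E)" using E(1,4) by (auto simp: full_column_rank_def)
        then show ?thesis using h E by auto
      next
        assume "\<exists>w Y' y. res = Some (map w [0..<m]) \<and> dims n m Y' \<and> dims n 1 y \<and> (\<forall>i j. j < i \<longrightarrow> entry Y' i j = 0) \<and>
          norm (mk n m (\<lambda>p. A $$ p) - Q * Y') \<le> K * \<epsilon> * norm (mk n m (\<lambda>p. A $$ p)) \<and>
          norm (mk n 1 (\<lambda>(i, _). b $ i) - Q * y) \<le> K * \<epsilon> * norm (mk n 1 (\<lambda>(i, _). b $ i)) \<and>
          (\<forall>i<m. entry (Y' * mk m 1 (\<lambda>(j, _). w j)) i 0 = entry y i 0)"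
        then obtain w Y' y where w: "res = Some (map w [0..<m])" "dims n m Y'" "dims n 1 y" "\<forall>i j. j < i \<longrightarrow> entry Y' i j = 0"
          "norm (mk n m (\<lambda>p. A $$ p) - Q * Y') \<le> K * \<epsilon> * norm (mk n m (\<lambda>p. A $$ p))"
          "norm (mk n 1 (\<lambda>(i, _). b $ i) - Q * y) \<le> K * \<epsilon> * norm (mk n 1 (\<lambda>(i, _). b $ i))"
          "\<forall>i<m. entry (Y' * mk m 1 (\<lambda>(j, _). w j)) i 0 = entry y i 0" by (elim exE conjE) (rule that)
        show ?thesis unfolding w(1) option.case using some[OF A b Q(1) w(2-7)] by blast
      qed
    qed
    have SV: "stable_solver n \<epsilon> (K * \<epsilon>) p" if mn: "m = n"
      unfolding stable_solver_def
    proof (intro ballI)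
      fix A b res
      assume A': "A \<in> carrier_mat n n" and b: "b \<in> carrier_vec n" and res: "res \<in> outcomes \<epsilon> p (load (entries A @ list_of_vec b))"
      have A: "A \<in> carrier_mat n m" using A' mn by simp
      obtain Q Y where Q: "orth n Q" "dims n m Y" "\<forall>i j. j < i \<longrightarrow> entry Y i j = 0"
          "norm (mk n m (\<lambda>p. A $$ p) - Q * Y) \<le> K * \<epsilon> * norm (mk n m (\<lambda>p. A $$ p))"
        and alt: "(res = None \<and> (\<exists>j<m. entry Y j j = 0)) \<or>
       (\<exists>w Y' y. res = Some (map w [0..<m]) \<and> dims n m Y' \<and> dims n 1 y \<and> (\<forall>i j. j < i \<longrightarrow> entry Y' i j = 0) \<and>
          norm (mk n m (\<lambda>p. A $$ p) - Q * Y') \<le> K * \<epsilon> * norm (mk n m (\<lambda>p. A $$ p)) \<and>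
          norm (mk n 1 (\<lambda>(i, _). b $ i) - Q * y) \<le> K * \<epsilon> * norm (mk n 1 (\<lambda>(i, _). b $ i)) \<and>
          (\<forall>i<m. entry (Y' * mk m 1 (\<lambda>(j, _). w j)) i 0 = entry y i 0))"
        using core[OF e A b res] by blast
      from alt show "case res of
             None \<Rightarrow> (\<exists>E\<in>carrier_mat n n. fnorm E \<le> K * \<epsilon> * fnorm A \<and> \<not> invertible_mat (A + E))
           | Some xs \<Rightarrow> (\<exists>x\<in>carrier_vec n. xs = list_of_vec x \<and>
                 (\<exists>\<delta>A\<in>carrier_mat n n. \<exists>\<delta>b\<in>carrier_vec n.
                    fnorm \<delta>A \<le> K * \<epsilon> * fnorm A \<and> vnorm \<delta>b \<le> K * \<epsilon> * vnorm b \<and>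
                    (A + \<delta>A) *\<^sub>v x = b + \<delta>b))"
      proof
        assume h: "res = None \<and> (\<exists>j<m. entry Y j j = 0)"
        obtain E v where E: "E \<in> carrier_mat n m" "fnorm E \<le> K * \<epsilon> * fnorm A" "v \<in> carrier_vec m" "v \<noteq> 0\<^sub>v m" "(A + E) *\<^sub>v v = 0\<^sub>v n"
          using singular[OF A Q] h by blast
        have "A + E \<in> carrier_mat n n" using E(1) mn by simp
        then have "\<not> invertible_mat (A + E)" using not_invertible_kernel[of "A + E" n v] E mn by simp
        then show ?thesis using h E mn by auto
      next
        assume "\<exists>w Y' y. res = Some (map w [0..<m]) \<and> dims n m Y' \<and> dims n 1 y \<and> (\<forall>i j. j < i \<longrightarrow> entry Y' i j = 0) \<and>
          norm (mk n m (\<lambda>p. A $$ p) - Q * Y') \<le> K * \<epsilon> * norm (mk n m (\<lambda>p. A $$ p)) \<and>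
          norm (mk n 1 (\<lambda>(i, _). b $ i) - Q * y) \<le> K * \<epsilon> * norm (mk n 1 (\<lambda>(i, _). b $ i)) \<and>
          (\<forall>i<m. entry (Y' * mk m 1 (\<lambda>(j, _). w j)) i 0 = entry y i 0)"
        then obtain w Y' y where w: "res = Some (map w [0..<m])" "dims n m Y'" "dims n 1 y" "\<forall>i j. j < i \<longrightarrow> entry Y' i j = 0"
          "norm (mk n m (\<lambda>p. A $$ p) - Q * Y') \<le> K * \<epsilon> * norm (mk n m (\<lambda>p. A $$ p))"
          "norm (mk n 1 (\<lambda>(i, _). b $ i) - Q * y) \<le> K * \<epsilon> * norm (mk n 1 (\<lambda>(i, _). b $ i))"
          "\<forall>i<m. entry (Y' * mk m 1 (\<lambda>(j, _). w j)) i 0 = entry y i 0" by (elim exE conjE) (rule that)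
        show ?thesis unfolding w(1) option.case using some[OF A b Q(1) w(2-7)] mn by blast
      qed
    qed
    show ?thesis using LS SV by blast
  qed
  moreover have "real (cost p) \<le> C + real m"
  proof -
    have "cost p \<le> ccost c + (m + 0)"
      using cost_compile[of c "test_nonzero k' zs tl"] by (simp add: p_def cost_test_nonzero zs_def tl_def)
    then show ?thesis using c(1) by linarith
  qed
  ultimately show ?thesis by blast
qed

lemma small_epsD:
  assumes "K * real n ^ c * \<epsilon> \<le> 1" "2 \<le> K" "1 \<le> n" "0 < \<epsilon>" shows "\<epsilon> \<le> 1 / 2"
proof -
  have "1 \<le> real n ^ c" using assms(3) by (intro one_le_power) simp
  then have "2 * 1 \<le> K * real n ^ c" using assms(2) by (intro mult_mono) auto
  then have "2 * \<epsilon> \<le> K * real n ^ c * \<epsilon>" using assms(4) by (intro mult_right_mono) auto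
  then show ?thesis using assms(1) by linarith
qed

theorem mainTheorem2:
  fixes \<omega> :: real
  assumes fast_multiplication:
    "\<forall>\<eta>>0. \<exists>P C. \<forall>n\<ge>1. multiplies n (P n) \<and> real (cost (P n)) \<le> C * real n powr (\<omega> + \<eta>)"
  shows
    "\<forall>\<eta>>0.
       (\<exists>P C c. \<exists>K>0. \<forall>n\<ge>1.
          real (cost (P n)) \<le> C * real n powr (\<omega> + \<eta>) \<and>
          stable_for_small_eps K c n (stable_qr n) (P n)) \<and>
       (\<exists>P C c. \<exists>K>0. \<forall>n\<ge>1.
          real (cost (P n)) \<le> C * real n powr (\<omega> + \<eta>) \<and>
          stable_for_small_eps K c n (stable_solver n) (P n)) \<and>
       (\<exists>P C c. \<exists>K>0. \<forall>n\<ge>1. \<forall>m\<in>{1..n}.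
          real (cost (P n m)) \<le> C * real n powr (\<omega> + \<eta>) \<and>
          stable_for_small_eps K c n (stable_least_squares n m) (P n m))"
proof (rule allI, rule impI)
  fix \<eta> :: real assume \<eta>: "\<eta> > 0"
  define \<tau> where "\<tau> = \<omega> + \<eta>"
  have \<tau>: "2 < \<tau>" unfolding \<tau>_def by (rule mm_kernel_fast(1)[OF fast_multiplication \<eta>])
  obtain C K c where C: "0 \<le> C" "1 \<le> K" and
    qr: "\<And>n. n \<ge> 1 \<Longrightarrow> qr_kernel n n 0 (C * real n powr \<tau>) (K * real n ^ c)" and
    mm: "\<And>n. n \<ge> 1 \<Longrightarrow> mm_kernel n (C * real n powr \<tau>) (K * real n ^ c)"
    using fast_kernels[OF fast_multiplication \<eta>] unfolding \<tau>_def by blast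
  define Q where "Q n p \<longleftrightarrow> real (cost p) \<le> C * real n powr \<tau> \<and> stable_for_small_eps (K + 1) c n (stable_qr n) p" for n p
  have ex1: "\<exists>p. Q n p" if n: "n \<ge> 1" for n
  proof -
    have "K * real n ^ c \<le> (K + 1) * real n ^ c" by (intro mult_right_mono) auto
    from qr_program[OF qr_kernel_mono[OF qr[OF n] order_refl this]] obtain p where p: "real (cost p) \<le> C * real n powr \<tau>"
      "\<And>\<epsilon>. 0 \<le> \<epsilon> \<Longrightarrow> \<epsilon> \<le> 1 / 2 \<Longrightarrow> (K + 1) * real n ^ c * \<epsilon> \<le> 1 \<Longrightarrow> stable_qr n \<epsilon> ((K + 1) * real n ^ c * \<epsilon>) p" by blast
    have "stable_for_small_eps (K + 1) c n (stable_qr n) p"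
      unfolding stable_for_small_eps_def
    proof (intro allI impI)
      fix \<epsilon> :: real assume e: "0 < \<epsilon>" "(K + 1) * real n ^ c * \<epsilon> \<le> 1"
      have "\<epsilon> \<le> 1 / 2" by (rule small_epsD[OF e(2) _ n e(1)]) (use C in simp)
      then show "stable_qr n \<epsilon> ((K + 1) * real n ^ c * \<epsilon>) p" using p(2) e by simp
    qed
    then show ?thesis using p(1) unfolding Q_def by blast
  qed
  define K' where "K' = 13 * K + 20"
  define C' where "C' = 2 * C + 9"
  define L where "L n m p \<longleftrightarrow> real (cost p) \<le> C' * real n powr \<tau> \<and>
    stable_for_small_eps K' (c + 1) n (stable_least_squares n m) p \<and>
    (m = n \<longrightarrow> stable_for_small_eps K' (c + 1) n (stable_solver n) p)" for n m p
  have ex2: "\<exists>p. L n m p" if m: "1 \<le> m" "m \<le> n" for n m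
  proof -
    have n: "1 \<le> n" using m by simp
    have K0: "0 \<le> K * real n ^ c" using C by simp
    define k where "k = 3 * (K * real n ^ c) + 10 * real n * (K * real n ^ c) + 20 * real n"
    have kK: "k \<le> K' * real n ^ (c + 1)"
    proof -
      have "1 \<le> real n ^ c" using n by (intro one_le_power) simp
      then have "real n \<le> real n ^ (c + 1)" using n by simp
      moreover have "K * real n ^ c \<le> K * real n ^ (c + 1)" using n C by (intro mult_left_mono power_increasing) auto
      moreover have "real n * (K * real n ^ c) = K * real n ^ (c + 1)" by simp
      ultimately show ?thesis unfolding k_def K'_def distrib_right mult.assoc by linarith
    qed
    define cst where "cst = C * real n powr \<tau> + (C * real n powr \<tau> + 1) + real m * (2 * real m + 4) + 1"
    have "computable cst (\<lambda>\<epsilon> x z. k * \<epsilon> \<le> 1 \<longrightarrow> ls_rel n m (k * \<epsilon>) x z)"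
      unfolding k_def cst_def by (rule computable_ls[OF qr[OF n] mm[OF n] m K0 K0])
    then have "computable cst (\<lambda>\<epsilon> x z. K' * real n ^ (c + 1) * \<epsilon> \<le> 1 \<longrightarrow> ls_rel n m (K' * real n ^ (c + 1) * \<epsilon>) x z)"
    proof (rule computable_mono[OF _ order_refl])
      fix \<epsilon> :: real and x z
      assume e: "0 \<le> \<epsilon>" and h: "k * \<epsilon> \<le> 1 \<longrightarrow> ls_rel n m (k * \<epsilon>) x z"
      have "k * \<epsilon> \<le> K' * real n ^ (c + 1) * \<epsilon>" using kK e by (rule mult_right_mono)
      then show "K' * real n ^ (c + 1) * \<epsilon> \<le> 1 \<longrightarrow> ls_rel n m (K' * real n ^ (c + 1) * \<epsilon>) x z"
        using h ls_rel_mono by (meson order_trans)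
    qed
    from ls_program[OF this m] obtain p where p: "real (cost p) \<le> cst + real m"
      "\<And>\<epsilon>. 0 \<le> \<epsilon> \<Longrightarrow> \<epsilon> \<le> 1 / 2 \<Longrightarrow> K' * real n ^ (c + 1) * \<epsilon> \<le> 1 \<Longrightarrow>
        stable_least_squares n m \<epsilon> (K' * real n ^ (c + 1) * \<epsilon>) p \<and> (m = n \<longrightarrow> stable_solver n \<epsilon> (K' * real n ^ (c + 1) * \<epsilon>) p)"
      by blast
    have small: "\<epsilon> \<le> 1 / 2" if "0 < \<epsilon>" "K' * real n ^ (c + 1) * \<epsilon> \<le> 1" for \<epsilon>
      by (rule small_epsD[OF that(2) _ n that(1)]) (use C in \<open>simp add: K'_def\<close>)
    have "stable_for_small_eps K' (c + 1) n (stable_least_squares n m) p"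
      "m = n \<longrightarrow> stable_for_small_eps K' (c + 1) n (stable_solver n) p"
      unfolding stable_for_small_eps_def using p(2) small by auto
    moreover have "real (cost p) \<le> C' * real n powr \<tau>"
    proof -
      have "real n powr 2 \<le> real n powr \<tau>" using n \<tau> by (intro powr_mono) auto
      then have n2: "real n * real n \<le> real n powr \<tau>" using n by (simp add: powr_numeral power2_eq_square)
      have "1 * real n \<le> real n * real n" using n by (intro mult_right_mono) auto
      then have n1: "1 \<le> real n powr \<tau>" "real n \<le> real n powr \<tau>" using n2 n by linarith+
      have "real m * real m \<le> real n * real n" using m by (intro mult_mono) auto
      moreover have "real m \<le> real n" using m by simp
      ultimately have "cst + real m \<le> 2 * (C * real n powr \<tau>) + 9 * real n powr \<tau>"
        using n1 n2 unfolding cst_def distrib_left by linarith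
      then show ?thesis using p(1) by (simp add: C'_def distrib_right)
    qed
    ultimately show ?thesis unfolding L_def by blast
  qed
  have K: "0 < K + 1" "0 < K'" using C by (simp_all add: K'_def)
  have L: "L n m (SOME p. L n m p)" if "1 \<le> m" "m \<le> n" for n m by (rule someI_ex[OF ex2[OF that]])
  have Q: "Q n (SOME p. Q n p)" if "1 \<le> n" for n by (rule someI_ex[OF ex1[OF that]])
  have "\<forall>n\<ge>1. real (cost (SOME p. Q n p)) \<le> C * real n powr (\<omega> + \<eta>) \<and>
      stable_for_small_eps (K + 1) c n (stable_qr n) (SOME p. Q n p)"
  proof (intro allI impI)
    fix n :: nat assume "1 \<le> n"
    from Q[OF this, unfolded Q_def[of n "SOME p. Q n p"]]
    show "real (cost (SOME p. Q n p)) \<le> C * real n powr (\<omega> + \<eta>) \<and>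
      stable_for_small_eps (K + 1) c n (stable_qr n) (SOME p. Q n p)" unfolding \<tau>_def .
  qed
  then have 1: "\<exists>P C c. \<exists>K>0. \<forall>n\<ge>1. real (cost (P n)) \<le> C * real n powr (\<omega> + \<eta>) \<and>
      stable_for_small_eps K c n (stable_qr n) (P n)"
    using K(1) by - (rule exI[of _ "\<lambda>n. SOME p. Q n p"], rule exI[of _ C], rule exI[of _ c], rule exI[of _ "K + 1"], rule conjI)
  have Ln: "real (cost (SOME p. L n m p)) \<le> C' * real n powr (\<omega> + \<eta>) \<and>
    stable_for_small_eps K' (c + 1) n (stable_least_squares n m) (SOME p. L n m p) \<and>
    (m = n \<longrightarrow> stable_for_small_eps K' (c + 1) n (stable_solver n) (SOME p. L n m p))" if "1 \<le> m" "m \<le> n" for n m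
    using L[OF that, unfolded L_def[of n m "SOME p. L n m p"]] unfolding \<tau>_def .
  have "\<forall>n\<ge>1. real (cost (SOME p. L n n p)) \<le> C' * real n powr (\<omega> + \<eta>) \<and>
      stable_for_small_eps K' (c + 1) n (stable_solver n) (SOME p. L n n p)" using Ln by blast
  then have 2: "\<exists>P C c. \<exists>K>0. \<forall>n\<ge>1. real (cost (P n)) \<le> C * real n powr (\<omega> + \<eta>) \<and>
      stable_for_small_eps K c n (stable_solver n) (P n)"
    using K(2) by - (rule exI[of _ "\<lambda>n. SOME p. L n n p"], rule exI[of _ C'], rule exI[of _ "c + 1"], rule exI[of _ K'], rule conjI)
  have "\<forall>n\<ge>1. \<forall>m\<in>{1..n}. real (cost (SOME p. L n m p)) \<le> C' * real n powr (\<omega> + \<eta>) \<and>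
      stable_for_small_eps K' (c + 1) n (stable_least_squares n m) (SOME p. L n m p)" using Ln by auto
  then have 3: "\<exists>P C c. \<exists>K>0. \<forall>n\<ge>1. \<forall>m\<in>{1..n}. real (cost (P n m)) \<le> C * real n powr (\<omega> + \<eta>) \<and>
      stable_for_small_eps K c n (stable_least_squares n m) (P n m)"
    using K(2) by - (rule exI[of _ "\<lambda>n m. SOME p. L n m p"], rule exI[of _ C'], rule exI[of _ "c + 1"], rule exI[of _ K'], rule conjI)
  show "(\<exists>P C c. \<exists>K>0. \<forall>n\<ge>1. real (cost (P n)) \<le> C * real n powr (\<omega> + \<eta>) \<and>
          stable_for_small_eps K c n (stable_qr n) (P n)) \<and>
       (\<exists>P C c. \<exists>K>0. \<forall>n\<ge>1. real (cost (P n)) \<le> C * real n powr (\<omega> + \<eta>) \<and>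
          stable_for_small_eps K c n (stable_solver n) (P n)) \<and>
       (\<exists>P C c. \<exists>K>0. \<forall>n\<ge>1. \<forall>m\<in>{1..n}. real (cost (P n m)) \<le> C * real n powr (\<omega> + \<eta>) \<and>
          stable_for_small_eps K c n (stable_least_squares n m) (P n m))"
    using 1 2 3 by blast
qed

end
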